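(* Let $b$ satisfy the standing assumptions below and, in addition: (a) there is $x_0\in\mathbb{R}$ such that $b^{(p)}(x)\neq 0$ for all $p\in\mathbb{N}$ and all $x\ge x_0$; (b) $b'(x)=o(b_+-b(x))$ and, for every $p\in\mathbb{N}$, $b^{(p+1)}(x)=o(b^{(p)}(x))$ as $x\to+\infty$; (c) $(b')^2(x)=o(b''(x))$ as $x\to+\infty$. Then for every $n\in\mathbb{N}$ there exist $\sigma>0$ and $\tau>0$ such that, with $\epsilon=\epsilon_{\sigma,\tau}$, as $k\to+\infty$, $$E_n(k)=b_k\Lambda_n+\gamma_n b_k^{-1}b_k''+O(\epsilon(k)),$$ $$E_n'(k)=b_k^{-1}\Lambda_n b_k'+O(\epsilon(k)),\qquad E_n''(k)=b_k^{-2}\Lambda_n b_k''+O(\epsilon(k)),$$ where $\Lambda_n=2n-1$, $\gamma_n=\tfrac14(2n^2-2n+1)$, and the remainders depend on $n$.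
   Context: Standing assumptions: $b\in C^\infty(\mathbb{R})$ is increasing, $\lim_{x\to-\infty}b(x)=b_-$, $\lim_{x\to+\infty}b(x)=b_+$ with $b_+>b_->0$; $a(x)=\int_0^x b(t)\,dt$. For $k\in\mathbb{R}$, $h(k)=-\frac{d^2}{dx^2}+(a(x)-k)^2$ is self-adjoint in $L^2(\mathbb{R})$ with compact resolvent and simple spectrum; its eigenvalues in increasing order are $E_1(k)<E_2(k)<\dots$ (the band functions). Notation: $x_k:=a^{-1}(k)$, $b_k:=b(x_k)$, $b_k^{(p)}:=b^{(p)}(x_k)$ for $p\ge1$ (so $b_k'=b'(x_k)$, $b_k''=b''(x_k)$). For $\sigma,\tau>0$, $$\epsilon_{\sigma,\tau}(k):=(b_k')^2+\sup_{x\in(\sigma k,+\infty)}\{|b'(x)b''(x)|+|b^{(3)}(x)|\}+e^{-\tau k^2}.$$ *)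

theory Defs
  imports "HOL-Analysis.Analysis" "HOL-Library.Landau_Symbols"
begin

definition a_of :: "(real \<Rightarrow> real) \<Rightarrow> real \<Rightarrow> real" where
  "a_of b x = (if 0 \<le> x then integral {0..x} b else - integral {x..0} b)"

text \<open>Eigenvalues of h(k) = -d^2/dx^2 + (a(x)-k)^2 on L^2(R): the E for which
  the eigenvalue equation -u'' + (a-k)^2 u = E u has a nonzero square-integrable
  solution (limit-point case at both ends, so these are exactly the eigenvalues
  of the self-adjoint realisation).\<close>
definition hspec :: "(real \<Rightarrow> real) \<Rightarrow> real \<Rightarrow> real set" where
  "hspec b k = {E. \<exists>u u'.
      (\<forall>x. (u has_real_derivative u' x) (at x) \<and>
           (u' has_real_derivative (((a_of b x - k)^2 - E) * u x)) (at x)) \<and>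
      integrable lborel (\<lambda>x. (u x)^2) \<and> (\<exists>x. u x \<noteq> 0)}"

definition band :: "(real \<Rightarrow> real) \<Rightarrow> nat \<Rightarrow> real \<Rightarrow> real" where
  "band b n k = (THE E. E \<in> hspec b k \<and> card {E' \<in> hspec b k. E' < E} = n - 1)"

definition xk :: "(real \<Rightarrow> real) \<Rightarrow> real \<Rightarrow> real" where
  "xk b k = inv (a_of b) k"

definition eps :: "(real \<Rightarrow> real) \<Rightarrow> real \<Rightarrow> real \<Rightarrow> real \<Rightarrow> real" where
  "eps b \<sigma> \<tau> k = (deriv b (xk b k))^2
     + Sup ((\<lambda>x. \<bar>deriv b x * (deriv ^^ 2) b x\<bar> + \<bar>(deriv ^^ 3) b x\<bar>) ` {\<sigma> * k<..})
     + exp (- \<tau> * k^2)"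

end

theory Submission
  imports Defs
begin

text \<open>In the coordinate \<open>y = x - x\<^sub>k\<close> an eigenfunction solves \<open>u'' = ((a(x\<^sub>k + y) - k)\<^sup>2 - E) u\<close>, with a potential
  squeezed between multiples of \<open>y\<^sup>2\<close> uniformly in \<open>k\<close>. A maximum principle makes all square-integrable solutions decay
  faster than any fixed exponential with constants depending only on this squeeze, and the Wronskian at 0 turns this into a uniform
  Fredholm estimate: a decaying solution of the inhomogeneous equation whose Cauchy data at 0 are orthogonal to those of the bound
  state is bounded by its source. Shooting from both sides then shows that the \<open>n\<close>-th eigenvalue stays near \<open>(2 n - 1) b\<^sub>+\<close>, and
  difference quotients of eigenfunctions converge, so that \<open>E'\<close> and \<open>E''\<close> are explicit integrals of \<open>u\<close> and its derivative \<open>D\<close> in \<open>k\<close>.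
  Since \<open>b'\<close>, \<open>b''\<close>, \<open>b'''\<close> vary slowly, Taylor expansion at \<open>x\<^sub>k\<close> costs only \<open>O(b'\<^sup>2 + \<bar>b'''\<bar>)\<close> against decaying functions. The energy comes from
  pairing \<open>u\<close> with the oscillator state; \<open>E'\<close> from the virial identity \<open>\<integral> (a - k) b u\<^sup>2 = 0\<close>; \<open>E''\<close> from \<open>D\<close> being \<open>- u'/b\<close> up to \<open>O(b')\<close>
  modulo \<open>u\<close>.\<close>

section \<open>Exponentially weighted functions\<close>

text \<open>The spectrum is given only as the set of energies with a square-integrable solution, and
  \<open>band\<close> only by counting, so existence, labelling and regularity of eigenvalues all
  have to come from differential equations. This is why states are normalised by their Cauchy data
  at 0: such data lie on a compact circle, and the sine of the angle between two of them is a
  Wronskian, hence an integral. The errors must be quadratic in b', although state and energy differ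
  from those of the oscillator by O(b'). The gain comes from vanishing odd moments of the oscillator
  density: the cubic term b b' y^3 of the potential meets only moments that are themselves O(b').
  The constant \<gamma>_n is (1 + \<Lambda>_n^2)/8, from the quartic term (b b''/3) y^4 and the
  fourth moment 3 (1 + \<Lambda>_n^2)/(8 b^2). Taylor errors must be proportional to derivatives at
  x_k on the whole line, also far to the left where b' is not controlled. There slow variation
  bounds |b'(x_k)| and |b'''(x_k)| below by a multiple of e^{-|y|/4}, so that a crude error is
  absorbed by the weight.\<close>

definition wt :: "real \<Rightarrow> real \<Rightarrow> real" where
  "wt l y = exp (- (l * \<bar>y\<bar>))"

text \<open>The rate \<open>l\<close> may be negative, so one predicate covers decaying states and
  growing coefficients; rates add and constants multiply under products.\<close>

definition dec :: "real \<Rightarrow> real \<Rightarrow> (real \<Rightarrow> real) \<Rightarrow> bool" where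
  "dec l C g \<longleftrightarrow> (\<forall>y. \<bar>g y\<bar> \<le> C * wt l y)"

lemma wt_pos [simp]: "0 < wt l y" "0 \<le> wt l y"
  by (simp_all add: wt_def)

lemma wt_mult: "wt a y * wt b y = wt (a + b) y"
  by (simp add: wt_def exp_add[symmetric] algebra_simps)

lemma wt_mono: "a \<le> b \<Longrightarrow> wt b y \<le> wt a y"
  by (simp add: wt_def mult_right_mono)

lemma wt_zero [simp]: "wt 0 y = 1" "wt l 0 = 1"
  by (simp_all add: wt_def)

lemma wt_uminus [simp]: "wt l (- y) = wt l y"
  by (simp add: wt_def)

lemma decD: "dec l C g \<Longrightarrow> \<bar>g y\<bar> \<le> C * wt l y"
  by (simp add: dec_def)

lemma dec_nonneg: "dec l C g \<Longrightarrow> 0 \<le> C"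
  using decD[of l C g 0] by simp

lemma dec_mono:
  assumes "dec l C g" "l' \<le> l" "C \<le> C'"
  shows "dec l' C' g"
  unfolding dec_def
proof
  fix y
  have "\<bar>g y\<bar> \<le> C * wt l y" using assms(1) by (rule decD)
  also have "\<dots> \<le> C' * wt l' y"
    using assms dec_nonneg[OF assms(1)] wt_mono[OF assms(2)] by (intro mult_mono) auto
  finally show "\<bar>g y\<bar> \<le> C' * wt l' y" .
qed

lemma dec_add:
  assumes "dec l C g" "dec l C' g'"
  shows "dec l (C + C') (\<lambda>y. g y + g' y)"
  unfolding dec_def
proof
  fix y
  have "\<bar>g y + g' y\<bar> \<le> \<bar>g y\<bar> + \<bar>g' y\<bar>" by simp
  also have "\<dots> \<le> C * wt l y + C' * wt l y"
    using assms by (intro add_mono decD)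
  finally show "\<bar>g y + g' y\<bar> \<le> (C + C') * wt l y" by (simp add: algebra_simps)
qed

lemma dec_uminus: "dec l C g \<Longrightarrow> dec l C (\<lambda>y. - g y)"
  by (simp add: dec_def)

lemma dec_diff:
  assumes "dec l C g" "dec l C' g'"
  shows "dec l (C + C') (\<lambda>y. g y - g' y)"
  using dec_add[OF assms(1) dec_uminus[OF assms(2)]] by simp

lemma dec_mult:
  assumes "dec l C g" "dec l' C' g'"
  shows "dec (l + l') (C * C') (\<lambda>y. g y * g' y)"
  unfolding dec_def
proof
  fix y
  have "\<bar>g y * g' y\<bar> \<le> (C * wt l y) * (C' * wt l' y)"
    unfolding abs_mult using assms by (intro mult_mono decD) (auto dest: dec_nonneg)
  thus "\<bar>g y * g' y\<bar> \<le> (C * C') * wt (l + l') y"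
    by (simp add: wt_mult[symmetric] algebra_simps)
qed

lemma dec_const: "dec 0 \<bar>c\<bar> (\<lambda>_. c)"
  by (simp add: dec_def)

lemma dec_cmult: "dec l C g \<Longrightarrow> dec l (\<bar>c\<bar> * C) (\<lambda>y. c * g y)"
  using dec_mult[OF dec_const] by fastforce

lemma dec_reflect: "dec l C g \<Longrightarrow> dec l C (\<lambda>y. g (- y))"
  by (auto simp: dec_def) (metis wt_uminus)

text \<open>The exchange rate between polynomials and weights: a quadratic factor costs one unit of
  decay.\<close>

lemma exp_abs_ge: "1 + y\<^sup>2 \<le> 2 * wt (-1) y"
proof -
  have "1 + \<bar>y\<bar> + \<bar>y\<bar>\<^sup>2 / 2 \<le> exp \<bar>y\<bar>"
    by (rule exp_lower_Taylor_quadratic) simp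
  moreover have "0 \<le> \<bar>y\<bar>" by simp
  ultimately have "1 + y\<^sup>2 / 2 \<le> exp \<bar>y\<bar>" unfolding power2_abs by linarith
  thus ?thesis by (simp add: wt_def)
qed

lemma dec_y: "dec (-1) 1 (\<lambda>y. y)"
  unfolding dec_def
proof
  fix y :: real
  have "\<bar>y\<bar> \<le> exp \<bar>y\<bar>" using exp_ge_add_one_self[of "\<bar>y\<bar>"] by linarith
  thus "\<bar>y\<bar> \<le> 1 * wt (-1) y" by (simp add: wt_def)
qed

lemma dec_tendsto:
  assumes "dec l C g" "0 < l"
  shows "(g \<longlongrightarrow> 0) at_top" "(g \<longlongrightarrow> 0) at_bot"
proof -
  have "((\<lambda>y. exp (- (l * y))) \<longlongrightarrow> 0) at_top"
    using assms(2) by (intro filterlim_compose[OF exp_at_bot])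
      (auto simp: filterlim_uminus_at_bot intro!: filterlim_tendsto_pos_mult_at_top filterlim_ident tendsto_const)
  hence "((\<lambda>y. C * exp (- (l * y))) \<longlongrightarrow> 0) at_top" by (rule tendsto_mult_right_zero)
  hence 1: "((\<lambda>y. C * wt l y) \<longlongrightarrow> 0) at_top"
    by (rule Lim_transform_eventually)
      (auto simp: eventually_at_top_linorder wt_def intro!: exI[of _ 0])
  show "(g \<longlongrightarrow> 0) at_top"
    by (rule Lim_null_comparison[OF _ 1]) (use decD[OF assms(1)] in auto)
  have 2: "((\<lambda>y. C * wt l y) \<longlongrightarrow> 0) at_bot"
    using filterlim_compose[OF 1 filterlim_uminus_at_top_at_bot] by simp
  show "(g \<longlongrightarrow> 0) at_bot"
    by (rule Lim_null_comparison[OF _ 2]) (use decD[OF assms(1)] in auto)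
qed

text \<open>The Cauchy density is the dominating function for every weighted integral below; its
  primitive is \<open>arctan\<close>.\<close>

lemma integrable_cauchy_density: "integrable lborel (\<lambda>y::real. 1 / (1 + y\<^sup>2))"
  and integral_cauchy_density: "(LBINT y. 1 / (1 + y\<^sup>2)) = pi"
proof -
  have F: "DERIV arctan x :> 1 / (1 + x\<^sup>2)" for x :: real
    using DERIV_arctan[of x] by (simp add: inverse_eq_divide)
  have c: "isCont (\<lambda>y::real. 1 / (1 + y\<^sup>2)) x" for x
    by (intro continuous_intros) (smt (verit) zero_le_power2)
  have A: "((arctan \<circ> real_of_ereal) \<longlongrightarrow> - (pi / 2)) (at_right (-\<infinity>))"
    and B: "((arctan \<circ> real_of_ereal) \<longlongrightarrow> pi / 2) (at_left \<infinity>)"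
    using tendsto_arctan_at_top tendsto_arctan_at_bot
    by (simp_all add: ereal_tendsto_simps)
  note FTC = interval_integral_FTC_nonneg[of "-\<infinity>" \<infinity> arctan "\<lambda>y. 1 / (1 + y\<^sup>2)", OF _ F c _ A B]
  from FTC(1) show "integrable lborel (\<lambda>y::real. 1 / (1 + y\<^sup>2))"
    by (simp add: set_integrable_def einterval_def)
  from FTC(2) show "(LBINT y. 1 / (1 + y\<^sup>2)) = pi"
    by (simp add: interval_lebesgue_integral_def einterval_def set_lebesgue_integral_def)
qed

text \<open>Rate 1 suffices because (1 + y^2) e^{-|y|} is at most 2, which puts \<open>g\<close>
  below \<open>2 * C\<close> times the Cauchy density; 7 is a round bound for 2 pi.\<close>

lemma
  assumes "continuous_on UNIV g" "dec l C g" "1 \<le> l"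
  shows integrable_dec: "integrable lborel g"
    and integral_dec_le: "\<bar>LBINT y. g y\<bar> \<le> 7 * C"
proof -
  have C: "0 \<le> C" using assms(2) by (rule dec_nonneg)
  have bd: "\<bar>g y\<bar> \<le> 2 * C * (1 / (1 + y\<^sup>2))" for y
  proof -
    have "(1 + y\<^sup>2) * wt 1 y \<le> 2 * (wt (-1) y * wt 1 y)"
      using mult_right_mono[OF exp_abs_ge[of y], of "wt 1 y"] by simp
    hence *: "wt 1 y \<le> 2 * (1 / (1 + y\<^sup>2))"
      by (simp add: wt_mult field_simps add_pos_nonneg)
    have "\<bar>g y\<bar> \<le> C * wt 1 y"
      using decD[OF dec_mono[OF assms(2) assms(3) order_refl]] .
    also have "\<dots> \<le> C * (2 * (1 / (1 + y\<^sup>2)))" using * C by (intro mult_left_mono)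
    finally show ?thesis by (simp add: algebra_simps)
  qed
  have meas: "g \<in> borel_measurable lborel"
    using borel_measurable_continuous_onI[OF assms(1)] by simp
  have i: "integrable lborel (\<lambda>y::real. 2 * C * (1 / (1 + y\<^sup>2)))"
    using integrable_cauchy_density by (intro integrable_mult_right) auto
  show g: "integrable lborel g"
    by (rule Bochner_Integration.integrable_bound[OF i meas]) (use bd C in auto)
  have "\<bar>LBINT y. g y\<bar> \<le> (LBINT y. \<bar>g y\<bar>)"
    using integral_norm_bound[of lborel g] by simp
  also have "\<dots> \<le> (LBINT y. 2 * C * (1 / (1 + y\<^sup>2)))"
    by (rule integral_mono[OF integrable_abs[OF g] i]) (rule bd)
  also have "\<dots> = 2 * C * pi"
    using integral_cauchy_density by (simp only: Bochner_Integration.integral_mult_right_zero)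
  also have "\<dots> \<le> 2 * C * (7 / 2)" 
    using pi_less_4 pi_approx C by (intro mult_left_mono) auto
  finally show "\<bar>LBINT y. g y\<bar> \<le> 7 * C" by simp
qed

text \<open>The form of integration by parts used throughout: each integral identity over the line
  is obtained by exhibiting a decaying primitive \<open>F\<close>. Any positive rate makes
  \<open>F\<close> vanish at both ends, while \<open>f\<close> needs rate 1 to be
  integrable.\<close>

lemma integral_deriv_zero:
  assumes "\<And>y. (F has_real_derivative f y) (at y)" "continuous_on UNIV f"
    and "dec l C F" "0 < l" "dec l' C' f" "1 \<le> l'"
  shows "(LBINT y. f y) = 0"
proof -
  have "(LBINT y=-\<infinity>..\<infinity>. f y) = 0 - 0"
  proof (rule interval_integral_FTC_integrable)
    show "(F has_vector_derivative f x) (at x)" for x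
      using assms(1) by (simp add: has_real_derivative_iff_has_vector_derivative)
    show "isCont f x" for x using assms(2) by (simp add: continuous_on_eq_continuous_at)
    show "set_integrable lborel (einterval (-\<infinity>) \<infinity>) f"
      using integrable_dec[OF assms(2,5,6)] by (simp add: set_integrable_def einterval_def)
    show "((F \<circ> real_of_ereal) \<longlongrightarrow> 0) (at_right (-\<infinity>))" "((F \<circ> real_of_ereal) \<longlongrightarrow> 0) (at_left \<infinity>)"
      using dec_tendsto[OF assms(3,4)] by (simp_all add: ereal_tendsto_simps)
  qed simp
  thus ?thesis
    by (simp add: interval_lebesgue_integral_def einterval_def set_lebesgue_integral_def)
qed

text \<open>Subtracting the primitive (B/K) e^{Ky} of the bound makes both G and -G nonincreasing.
  The factor 1/K gained at each integration drives the Picard series and the Taylor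
  estimates.\<close>

lemma deriv_bound_exp:
  fixes G g :: "real \<Rightarrow> real"
  assumes "\<And>y. 0 \<le> y \<Longrightarrow> y \<le> T \<Longrightarrow> (G has_real_derivative g y) (at y)"
    and "\<And>y. 0 \<le> y \<Longrightarrow> y \<le> T \<Longrightarrow> \<bar>g y\<bar> \<le> B * exp (K * y)"
    and "G 0 = 0" "0 < K" "0 \<le> y" "y \<le> T"
  shows "\<bar>G y\<bar> \<le> B / K * exp (K * y)"
proof -
  have B: "0 \<le> B" using assms(2)[of 0] assms(5,6) by simp
  have *: "s * G y - B / K * exp (K * y) \<le> s * G 0 - B / K * exp (K * 0)" if s: "s \<in> {1, -1}" for s
  proof (rule DERIV_nonpos_imp_nonincreasing[of 0 y "\<lambda>y. s * G y - B / K * exp (K * y)"])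
    fix x assume x: "0 \<le> x" "x \<le> y"
    have "((\<lambda>y. s * G y - B / K * exp (K * y)) has_real_derivative s * g x - B * exp (K * x)) (at x)"
      using assms(4) x assms(6) by (auto intro!: derivative_eq_intros assms(1))
    moreover have "s * g x - B * exp (K * x) \<le> 0"
      using s assms(2)[of x] x assms(6) by auto
    ultimately show "\<exists>y. ((\<lambda>y. s * G y - B / K * exp (K * y)) has_real_derivative y) (at x) \<and> y \<le> 0"
      by blast
  qed (use assms in simp)
  have "0 \<le> B / K" using B assms(4) by simp
  with *[of 1] *[of "-1"] assms(3) show ?thesis by auto
qed

lemma deriv_bound_exp_abs:
  fixes G g :: "real \<Rightarrow> real"
  assumes "\<And>y. \<bar>y\<bar> \<le> T \<Longrightarrow> (G has_real_derivative g y) (at y)"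
    and "\<And>y. \<bar>y\<bar> \<le> T \<Longrightarrow> \<bar>g y\<bar> \<le> B * exp (K * \<bar>y\<bar>)"
    and "G 0 = 0" "0 < K" "\<bar>y\<bar> \<le> T"
  shows "\<bar>G y\<bar> \<le> B / K * exp (K * \<bar>y\<bar>)"
proof (cases "0 \<le> y")
  case True
  have "\<bar>G y\<bar> \<le> B / K * exp (K * y)"
  proof (rule deriv_bound_exp[of T G g B K y])
    show "(G has_real_derivative g z) (at z)" if "0 \<le> z" "z \<le> T" for z
      using assms(1)[of z] that by simp
    show "\<bar>g z\<bar> \<le> B * exp (K * z)" if "0 \<le> z" "z \<le> T" for z
      using assms(2)[of z] that by simp
  qed (use assms True in simp_all)
  thus ?thesis using True by simp
next
  case False
  have "\<bar>G (- (- y))\<bar> \<le> B / K * exp (K * (- y))"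
  proof (rule deriv_bound_exp[of T "\<lambda>y. G (- y)" "\<lambda>y. - g (- y)" B K "- y"])
    show "((\<lambda>y. G (- y)) has_real_derivative - g (- z)) (at z)" if "0 \<le> z" "z \<le> T" for z
      using assms(1)[of "-z"] that by (simp add: DERIV_mirror)
    show "\<bar>- g (- z)\<bar> \<le> B * exp (K * z)" if "0 \<le> z" "z \<le> T" for z
      using assms(2)[of "-z"] that by simp
  qed (use assms False in simp_all)
  thus ?thesis using False by simp
qed

section \<open>Primitives of continuous functions\<close>

lemma a_of_deriv:
  assumes "continuous_on UNIV g"
  shows "(a_of g has_real_derivative g x) (at x)"
proof -
  \<comment> \<open>A base point to the left of both 0 and \<open>x\<close> replaces the two cases
    of \<open>a_of\<close> by one integral, up to the constant \<open>F 0\<close>.\<close>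
  define L where "L = - \<bar>x\<bar> - 1"
  define F where "F = (\<lambda>y. integral {L..y} g)"
  have int: "g integrable_on {c..d}" for c d
    by (rule integrable_continuous_real) (rule continuous_on_subset[OF assms], simp)
  have "(F has_real_derivative g x) (at x within {L..\<bar>x\<bar>+1})"
    unfolding F_def
    by (rule integral_has_real_derivative[OF continuous_on_subset[OF assms]]) (auto simp: L_def)
  moreover have "x \<in> interior {L..\<bar>x\<bar>+1}" by (auto simp: L_def)
  ultimately have "(F has_real_derivative g x) (at x)"
    using at_within_interior by metis
  hence 1: "((\<lambda>y. F y - F 0) has_real_derivative g x) (at x)"
    by (auto intro!: derivative_eq_intros)
  have 2: "F y - F 0 = a_of g y" if "y \<in> {L<..}" for y
  proof (cases "0 \<le> y")
    case True
    have "integral {L..0} g + integral {0..y} g = integral {L..y} g"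
      by (rule Henstock_Kurzweil_Integration.integral_combine[OF _ True int]) (simp add: L_def)
    thus ?thesis using True by (simp add: a_of_def F_def)
  next
    case False
    have "integral {L..y} g + integral {y..0} g = integral {L..0} g"
      by (rule Henstock_Kurzweil_Integration.integral_combine[OF _ _ int]) (use False that in auto)
    thus ?thesis using False by (simp add: a_of_def F_def)
  qed
  show ?thesis
  proof (rule has_field_derivative_transform_within_open[OF 1 open_greaterThan[of L]])
    show "x \<in> {L<..}" by (simp add: L_def)
  qed (rule 2)
qed

lemma a_of_0 [simp]: "a_of g 0 = 0"
  by (simp add: a_of_def)

lemma a_of_cont:
  assumes "continuous_on UNIV g"
  shows "continuous_on UNIV (a_of g)"
  using a_of_deriv[OF assms] by (meson DERIV_isCont continuous_at_imp_continuous_on)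

section \<open>Linear second-order equations\<close>

text \<open>The equation -u'' + p u = f as a first-order system. The derivative is carried along
  because Wronskians, shooting and uniqueness all work with pairs of Cauchy data.\<close>

definition sol :: "(real \<Rightarrow> real) \<Rightarrow> (real \<Rightarrow> real) \<Rightarrow> (real \<Rightarrow> real) \<Rightarrow> (real \<Rightarrow> real) \<Rightarrow> bool" where
  "sol p f u v \<longleftrightarrow> (\<forall>y. (u has_real_derivative v y) (at y) \<and>
     (v has_real_derivative p y * u y - f y) (at y))"

lemma solD:
  assumes "sol p f u v"
  shows "(u has_real_derivative v y) (at y)" "(v has_real_derivative p y * u y - f y) (at y)"
  using assms by (auto simp: sol_def)

lemma sol_cont:
  assumes "sol p f u v"
  shows "continuous_on UNIV u" "continuous_on UNIV v"
  using solD[OF assms] by (meson DERIV_isCont continuous_at_imp_continuous_on)+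

lemma sol_reflect:
  assumes "sol p f u v"
  shows "sol (\<lambda>y. p (- y)) (\<lambda>y. f (- y)) (\<lambda>y. u (- y)) (\<lambda>y. - v (- y))"
  unfolding sol_def
proof (intro allI conjI)
  fix y
  show "((\<lambda>y. u (- y)) has_real_derivative - v (- y)) (at y)"
    using solD(1)[OF assms, of "-y"] by (simp add: DERIV_mirror)
  have "((\<lambda>y. v (- y)) has_real_derivative - (p (- y) * u (- y) - f (- y))) (at y)"
    using solD(2)[OF assms, of "-y"] by (simp add: DERIV_mirror)
  from DERIV_minus[OF this]
  show "((\<lambda>y. - v (- y)) has_real_derivative p (- y) * u (- y) - f (- y)) (at y)" by simp
qed

lemma sol_lincomb:
  assumes "sol p f u v" "sol p g u' v'"
  shows "sol p (\<lambda>y. c * f y + d * g y) (\<lambda>y. c * u y + d * u' y) (\<lambda>y. c * v y + d * v' y)"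
  unfolding sol_def
  by (auto intro!: derivative_eq_intros solD[OF assms(1)] solD[OF assms(2)] simp: algebra_simps)

text \<open>The difference of the potentials, applied to the second solution, becomes a source.
  Every comparison of two eigenfunctions thereby reduces to an estimate for one inhomogeneous
  equation.\<close>

lemma sol_diff:
  assumes "sol p f u v" "sol p' (\<lambda>_. 0) u' v'"
  shows "sol p (\<lambda>y. f y + c * ((p' y - p y) * u' y)) (\<lambda>y. u y - c * u' y) (\<lambda>y. v y - c * v' y)"
  unfolding sol_def
  by (auto intro!: derivative_eq_intros solD[OF assms(1)] solD[OF assms(2)] simp: algebra_simps)

text \<open>With zero sources only the difference of the potentials remains, and integration gives
  orthogonality relations; with equal potentials only the sources remain, and integration gives the
  solvability condition.\<close>

lemma wronskian_deriv:
  assumes "sol p f u v" "sol p' f' u' v'"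
  shows "((\<lambda>y. u y * v' y - v y * u' y) has_real_derivative
    ((p' y - p y) * (u y * u' y) + f y * u' y - u y * f' y)) (at y)"
  by (auto intro!: derivative_eq_intros solD[OF assms(1)] solD[OF assms(2)] simp: algebra_simps)

text \<open>Square root of the growth factor in \<open>gronwall_sq\<close>: for data bounded by S,
  the quantity u(0)^2 + v(0)^2 + T B^2 is at most (2 + T)(S + B)^2.\<close>

definition gron :: "real \<Rightarrow> real \<Rightarrow> real" where
  "gron L T = sqrt (exp ((L + 2) * T) * (2 + T))"

text \<open>The weighted energy e^{-Ky}(u^2 + v^2) - B^2 y decreases for K = L + 2: the term 2uv(1 +
  p) costs 1 + L times the energy, and the source term -2vf costs one further v^2 and the f^2 that
  B^2 absorbs.\<close>

lemma gronwall_sq: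
  assumes s: "sol p f u v"
    and pL: "\<And>y. 0 \<le> y \<Longrightarrow> y \<le> T \<Longrightarrow> \<bar>p y\<bar> \<le> L"
    and fB: "\<And>y. 0 \<le> y \<Longrightarrow> y \<le> T \<Longrightarrow> \<bar>f y\<bar> \<le> B"
    and y: "0 \<le> y" "y \<le> T"
  shows "(u y)\<^sup>2 + (v y)\<^sup>2 \<le> exp ((L + 2) * T) * ((u 0)\<^sup>2 + (v 0)\<^sup>2 + T * B\<^sup>2)"
proof -
  define K where "K = L + 2"
  have L: "0 \<le> L" using pL[of 0] y by simp
  have B: "0 \<le> B" using fB[of 0] y by simp
  define H where "H = (\<lambda>y. exp (- K * y) * ((u y)\<^sup>2 + (v y)\<^sup>2) - B\<^sup>2 * y)"
  have "H y \<le> H 0"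
  proof (rule DERIV_nonpos_imp_nonincreasing[OF y(1)])
    fix x assume x: "0 \<le> x" "x \<le> y"
    define D where "D = exp (- K * x) * (2 * u x * v x * (1 + p x) - 2 * v x * f x - K * ((u x)\<^sup>2 + (v x)\<^sup>2)) - B\<^sup>2"
    have "(H has_real_derivative D) (at x)"
      unfolding H_def D_def
      by (auto intro!: derivative_eq_intros solD[OF s] simp: algebra_simps power2_eq_square)
    moreover have "D \<le> 0"
    proof -
      have p: "\<bar>p x\<bar> \<le> L" and f: "\<bar>f x\<bar> \<le> B" using pL fB x y by auto
      have uv: "2 * \<bar>u x * v x\<bar> \<le> (u x)\<^sup>2 + (v x)\<^sup>2"
        using sum_squares_bound[of "\<bar>u x\<bar>" "\<bar>v x\<bar>"] by (simp add: abs_mult)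
      have "2 * u x * v x * (1 + p x) \<le> 2 * \<bar>u x * v x\<bar> * \<bar>1 + p x\<bar>"
        by (metis abs_ge_self abs_mult abs_numeral mult.assoc)
      also have "\<dots> \<le> ((u x)\<^sup>2 + (v x)\<^sup>2) * (1 + L)"
        using uv p by (intro mult_mono) auto
      finally have 1: "2 * u x * v x * (1 + p x) \<le> ((u x)\<^sup>2 + (v x)\<^sup>2) * (1 + L)" .
      have 2: "- (2 * v x * f x) \<le> (v x)\<^sup>2 + (f x)\<^sup>2"
        using zero_le_power2[of "v x + f x"] by (simp add: power2_sum)
      have 3: "(f x)\<^sup>2 \<le> B\<^sup>2" using f B by (simp add: abs_le_square_iff[symmetric])
      have "2 * u x * v x * (1 + p x) - 2 * v x * f x - K * ((u x)\<^sup>2 + (v x)\<^sup>2) \<le> B\<^sup>2"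
      proof -
        have "K * ((u x)\<^sup>2 + (v x)\<^sup>2) = ((u x)\<^sup>2 + (v x)\<^sup>2) * (1 + L) + ((u x)\<^sup>2 + (v x)\<^sup>2)"
          by (simp add: K_def algebra_simps)
        thus ?thesis using 1 2 3 zero_le_power2[of "u x"] by linarith
      qed
      hence 4: "exp (- K * x) * (2 * u x * v x * (1 + p x) - 2 * v x * f x - K * ((u x)\<^sup>2 + (v x)\<^sup>2)) \<le> exp (- K * x) * B\<^sup>2"
        by (intro mult_left_mono) auto
      have "0 \<le> K * x" using L x by (simp add: K_def)
      hence "exp (- K * x) * B\<^sup>2 \<le> 1 * B\<^sup>2" by (intro mult_right_mono) auto
      with 4 have "exp (- K * x) * (2 * u x * v x * (1 + p x) - 2 * v x * f x - K * ((u x)\<^sup>2 + (v x)\<^sup>2)) \<le> 1 * B\<^sup>2"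
        by (rule order_trans)
      thus ?thesis by (simp add: D_def)
    qed
    ultimately show "\<exists>y. (H has_real_derivative y) (at x) \<and> y \<le> 0" by blast
  qed
  hence "exp (- K * y) * ((u y)\<^sup>2 + (v y)\<^sup>2) \<le> (u 0)\<^sup>2 + (v 0)\<^sup>2 + B\<^sup>2 * y"
    by (simp add: H_def)
  also have "\<dots> \<le> (u 0)\<^sup>2 + (v 0)\<^sup>2 + T * B\<^sup>2"
    using y by (simp add: mult.commute mult_right_mono)
  finally have "exp (K * y) * (exp (- K * y) * ((u y)\<^sup>2 + (v y)\<^sup>2)) \<le> exp (K * y) * ((u 0)\<^sup>2 + (v 0)\<^sup>2 + T * B\<^sup>2)"
    by (intro mult_left_mono) auto
  moreover have "exp (K * y) * (exp (- K * y) * ((u y)\<^sup>2 + (v y)\<^sup>2)) = (u y)\<^sup>2 + (v y)\<^sup>2"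
    by (simp add: mult.assoc[symmetric] exp_add[symmetric])
  ultimately have "(u y)\<^sup>2 + (v y)\<^sup>2 \<le> exp (K * y) * ((u 0)\<^sup>2 + (v 0)\<^sup>2 + T * B\<^sup>2)" by (simp only:)
  also have "\<dots> \<le> exp (K * T) * ((u 0)\<^sup>2 + (v 0)\<^sup>2 + T * B\<^sup>2)"
    using y L by (intro mult_right_mono) (auto simp: K_def intro!: mult_left_mono)
  finally show ?thesis by (simp add: K_def)
qed

lemma gron_nonneg [simp]: "0 \<le> T \<Longrightarrow> 0 \<le> gron L T"
  by (simp add: gron_def)

lemma gronwall:
  assumes s: "sol p f u v"
    and pL: "\<And>y. 0 \<le> y \<Longrightarrow> y \<le> T \<Longrightarrow> \<bar>p y\<bar> \<le> L"
    and fB: "\<And>y. 0 \<le> y \<Longrightarrow> y \<le> T \<Longrightarrow> \<bar>f y\<bar> \<le> B"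
    and S: "\<bar>u 0\<bar> \<le> S" "\<bar>v 0\<bar> \<le> S"
    and y: "0 \<le> y" "y \<le> T"
  shows "\<bar>u y\<bar> \<le> gron L T * (S + B)" "\<bar>v y\<bar> \<le> gron L T * (S + B)"
proof -
  have B: "0 \<le> B" using fB[of 0] y by simp
  have S0: "0 \<le> S" using S by simp
  have T: "0 \<le> T" using y by simp
  have "(u 0)\<^sup>2 \<le> S\<^sup>2" "(v 0)\<^sup>2 \<le> S\<^sup>2" using S S0 by (simp_all add: abs_le_square_iff[symmetric])
  hence "(u 0)\<^sup>2 + (v 0)\<^sup>2 + T * B\<^sup>2 \<le> 2 * S\<^sup>2 + T * B\<^sup>2" by simp
  also have "\<dots> \<le> (2 + T) * S\<^sup>2 + (2 + T) * B\<^sup>2"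
    using T by (intro add_mono mult_right_mono) auto
  also have "\<dots> \<le> (2 + T) * (S + B)\<^sup>2"
    unfolding distrib_left[symmetric] using T S0 B by (intro mult_left_mono) (auto simp: power2_sum)
  finally have "exp ((L + 2) * T) * ((u 0)\<^sup>2 + (v 0)\<^sup>2 + T * B\<^sup>2) \<le> exp ((L + 2) * T) * ((2 + T) * (S + B)\<^sup>2)"
    by (intro mult_left_mono) auto
  also have "\<dots> = (gron L T * (S + B))\<^sup>2" using T by (simp add: gron_def power_mult_distrib)
  finally have "(u y)\<^sup>2 + (v y)\<^sup>2 \<le> (gron L T * (S + B))\<^sup>2"
    using gronwall_sq[OF s pL fB y] by simp
  moreover have "0 \<le> (u y)\<^sup>2" "0 \<le> (v y)\<^sup>2" by auto
  ultimately have "(u y)\<^sup>2 \<le> (gron L T * (S + B))\<^sup>2" "(v y)\<^sup>2 \<le> (gron L T * (S + B))\<^sup>2" by linarith+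
  moreover have "0 \<le> gron L T * (S + B)" using T S0 B by simp
  ultimately show "\<bar>u y\<bar> \<le> gron L T * (S + B)" "\<bar>v y\<bar> \<le> gron L T * (S + B)"
    by (simp_all add: abs_le_square_iff[symmetric])
qed

lemma gronwall_abs:
  assumes s: "sol p f u v"
    and pL: "\<And>y. \<bar>y\<bar> \<le> T \<Longrightarrow> \<bar>p y\<bar> \<le> L"
    and fB: "\<And>y. \<bar>y\<bar> \<le> T \<Longrightarrow> \<bar>f y\<bar> \<le> B"
    and S: "\<bar>u 0\<bar> \<le> S" "\<bar>v 0\<bar> \<le> S"
    and y: "\<bar>y\<bar> \<le> T"
  shows "\<bar>u y\<bar> \<le> gron L T * (S + B)" "\<bar>v y\<bar> \<le> gron L T * (S + B)"
proof -
  have "\<bar>u y\<bar> \<le> gron L T * (S + B) \<and> \<bar>v y\<bar> \<le> gron L T * (S + B)"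
  proof (cases "0 \<le> y")
    case True
    have p: "0 \<le> z \<Longrightarrow> z \<le> T \<Longrightarrow> \<bar>p z\<bar> \<le> L" "0 \<le> z \<Longrightarrow> z \<le> T \<Longrightarrow> \<bar>f z\<bar> \<le> B" for z
      using pL[of z] fB[of z] by auto
    show ?thesis using gronwall[of p f u v T L B S y, OF s p S] y True by auto
  next
    case False
    have p: "0 \<le> z \<Longrightarrow> z \<le> T \<Longrightarrow> \<bar>p (-z)\<bar> \<le> L" "0 \<le> z \<Longrightarrow> z \<le> T \<Longrightarrow> \<bar>f (-z)\<bar> \<le> B" for z
      using pL[of "-z"] fB[of "-z"] by auto
    show ?thesis using gronwall[of _ _ _ _ T L B S "-y", OF sol_reflect[OF s] p] S y False by auto
  qed
  thus "\<bar>u y\<bar> \<le> gron L T * (S + B)" "\<bar>v y\<bar> \<le> gron L T * (S + B)" by auto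
qed

lemma cont_bounded_on:
  fixes g :: "real \<Rightarrow> real"
  assumes "continuous_on UNIV g"
  obtains C where "1 \<le> C" "\<And>y. \<bar>y\<bar> \<le> T \<Longrightarrow> \<bar>g y\<bar> \<le> C"
proof -
  have "compact (g ` {-T..T})"
    by (rule compact_continuous_image[OF continuous_on_subset[OF assms]]) auto
  then obtain C where C: "\<forall>x\<in>g ` {-T..T}. norm x \<le> C"
    using compact_imp_bounded bounded_iff by metis
  show thesis
    by (rule that[of "max 1 C"]) (use C in \<open>force simp: le_max_iff_disj\<close>)+
qed

text \<open>Picard iteration written as a series: the zeroth term solves the equation with p = 0,
  and each later term is the double primitive of p times its predecessor. Locally uniform
  convergence of the first two derived series justifies differentiating term by term.\<close>

lemma ivp_exists:
  assumes cp: "continuous_on UNIV p" and cf: "continuous_on UNIV f"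
  obtains u v where "sol p f u v" "u 0 = \<alpha>" "v 0 = \<beta>"
proof -
  define w where "w = rec_nat (\<lambda>y. \<alpha> + \<beta> * y - a_of (a_of f) y) (\<lambda>_ w. a_of (a_of (\<lambda>y. p y * w y)))"
  \<comment> \<open>First and second derivatives of the terms, in closed form. The derivatives of
    term \<open>Suc j\<close> involve \<open>w j\<close>, hence the shift made by
    \<open>case_nat\<close>.\<close>
  define w1 where "w1 = case_nat (\<lambda>y. \<beta> - a_of f y) (\<lambda>j. a_of (\<lambda>y. p y * w j y))"
  define w2 where "w2 = case_nat (\<lambda>y. - f y) (\<lambda>j y. p y * w j y)"
  have w_0: "w 0 = (\<lambda>y. \<alpha> + \<beta> * y - a_of (a_of f) y)"
    and w_S: "\<And>j. w (Suc j) = a_of (a_of (\<lambda>y. p y * w j y))" by (simp_all add: w_def)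
  have cw: "continuous_on UNIV (w j)" for j
  proof (induction j)
    case 0 show ?case unfolding w_0 using cf by (intro continuous_intros a_of_cont)
  next
    case (Suc j) show ?case unfolding w_S using cp Suc by (intro a_of_cont continuous_intros)
  qed
  have cpw: "continuous_on UNIV (\<lambda>y. p y * w j y)" for j using cp cw by (intro continuous_intros)
  have d1: "(w j has_real_derivative w1 j y) (at y)" for j y
  proof (cases j)
    case 0 thus ?thesis using cf
      by (auto simp: w_0 w1_def intro!: derivative_eq_intros a_of_deriv a_of_cont)
  next
    case (Suc i) thus ?thesis using cpw
      by (auto simp: w_S w1_def intro!: derivative_eq_intros a_of_deriv a_of_cont)
  qed
  have d2: "(w1 j has_real_derivative w2 j y) (at y)" for j y
  proof (cases j)
    case 0 thus ?thesis using cf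
      by (auto simp: w1_def w2_def intro!: derivative_eq_intros a_of_deriv a_of_cont)
  next
    case (Suc i) thus ?thesis using cpw
      by (auto simp: w1_def w2_def intro!: derivative_eq_intros a_of_deriv a_of_cont)
  qed
  define U where "U = (\<lambda>y. \<Sum>j. w j y)"
  define V where "V = (\<lambda>y. \<Sum>j. w1 j y)"
  have main: "(U has_real_derivative V x) (at x) \<and> (V has_real_derivative p x * U x - f x) (at x)" for x
  proof -
    define T where "T = \<bar>x\<bar> + 1"
    obtain L where L: "1 \<le> L" "\<And>y. \<bar>y\<bar> \<le> T \<Longrightarrow> \<bar>p y\<bar> \<le> L" using cont_bounded_on[OF cp] by blast
    obtain C where C: "1 \<le> C" "\<And>y. \<bar>y\<bar> \<le> T \<Longrightarrow> \<bar>w 0 y\<bar> \<le> C" using cont_bounded_on[OF cw] by blast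
    have "continuous_on UNIV (w1 0)" "continuous_on UNIV (w2 0)"
      using cf by (auto simp: w1_def w2_def intro!: continuous_intros a_of_cont)
    then obtain C1 C2 where C1: "\<And>y. \<bar>y\<bar> \<le> T \<Longrightarrow> \<bar>w1 0 y\<bar> \<le> C1" and C2: "\<And>y. \<bar>y\<bar> \<le> T \<Longrightarrow> \<bar>w2 0 y\<bar> \<le> C2"
      using cont_bounded_on by metis
    \<comment> \<open>In the weight e^{K|y|} a double integration against p gains L/K^2 = 1/(4L), at
      most 1/4, so the series is dominated by a geometric one.\<close>
    define K where "K = 2 * L"
    have K: "0 < K" using L by (simp add: K_def)
    have pw: "\<bar>p y * w j y\<bar> \<le> L * C * (1/4)^j * exp (K * \<bar>y\<bar>)"
      if "\<bar>y\<bar> \<le> T" "\<bar>w j y\<bar> \<le> C * (1/4)^j * exp (K * \<bar>y\<bar>)" for j y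
    proof -
      have "\<bar>p y * w j y\<bar> \<le> L * (C * (1/4)^j * exp (K * \<bar>y\<bar>))"
        unfolding abs_mult using that L by (intro mult_mono) auto
      thus ?thesis by (simp add: algebra_simps)
    qed
    have w1b: "\<bar>a_of (\<lambda>y. p y * w j y) y\<bar> \<le> L * C * (1/4)^j / K * exp (K * \<bar>y\<bar>)"
      if *: "\<And>y. \<bar>y\<bar> \<le> T \<Longrightarrow> \<bar>w j y\<bar> \<le> C * (1/4)^j * exp (K * \<bar>y\<bar>)" and y: "\<bar>y\<bar> \<le> T" for j y
      by (rule deriv_bound_exp_abs[OF a_of_deriv[OF cpw] pw _ K y]) (use * in auto)
    have wb: "\<bar>w j y\<bar> \<le> C * (1/4)^j * exp (K * \<bar>y\<bar>)" if "\<bar>y\<bar> \<le> T" for j y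
      using that
    proof (induction j arbitrary: y)
      case 0
      have "C * 1 \<le> C * exp (K * \<bar>y\<bar>)" using C K by (intro mult_left_mono) auto
      thus ?case using C(2)[OF 0] by simp
    next
      case (Suc j)
      have "\<bar>a_of (a_of (\<lambda>y. p y * w j y)) y\<bar> \<le> L * C * (1/4)^j / K / K * exp (K * \<bar>y\<bar>)"
        by (rule deriv_bound_exp_abs[OF a_of_deriv[OF a_of_cont[OF cpw]] w1b[OF Suc.IH] _ K Suc.prems]) auto
      also have "L * C * (1/4)^j / K / K = C * (1/4)^j / (4 * L)" using L by (simp add: K_def)
      also have "\<dots> \<le> C * (1/4)^j / 4" using L C by (intro divide_left_mono) auto
      finally show ?case by (simp add: w_S mult_right_mono)
    qed
    have eT: "exp (K * \<bar>y\<bar>) \<le> exp (K * T)" if "\<bar>y\<bar> \<le> T" for y using that K by simp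
    have w1b': "\<bar>w1 j y\<bar> \<le> \<bar>C1\<bar> * (1/4)^j + 4 * (L * C / K * exp (K * T)) * (1/4)^j" if y: "\<bar>y\<bar> \<le> T" for j y
    proof (cases j)
      case 0
      have "0 \<le> 4 * (L * C / K * exp (K * T))" using L C K by simp
      thus ?thesis using 0 C1[OF y] by simp
    next
      case (Suc i)
      have "\<bar>w1 j y\<bar> \<le> L * C * (1/4)^i / K * exp (K * \<bar>y\<bar>)"
        using w1b[OF wb y] Suc by (simp add: w1_def)
      also have "\<dots> \<le> L * C * (1/4)^i / K * exp (K * T)"
        using L C K eT[OF y] by (intro mult_left_mono) auto
      also have "\<dots> = 4 * (L * C / K * exp (K * T)) * (1/4)^j" using Suc by simp
      also have "\<dots> \<le> \<bar>C1\<bar> * (1/4)^j + \<dots>" by simp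
      finally show ?thesis .
    qed
    have w2b': "\<bar>w2 j y\<bar> \<le> \<bar>C2\<bar> * (1/4)^j + 4 * (L * C * exp (K * T)) * (1/4)^j" if y: "\<bar>y\<bar> \<le> T" for j y
    proof (cases j)
      case 0
      have "0 \<le> 4 * (L * C * exp (K * T))" using L C K by simp
      hence "\<bar>w2 j y\<bar> \<le> \<bar>C2\<bar> + 4 * (L * C * exp (K * T))" using C2[OF y] unfolding 0 by linarith
      thus ?thesis using 0 by simp
    next
      case (Suc i)
      have "\<bar>w2 j y\<bar> \<le> L * C * (1/4)^i * exp (K * \<bar>y\<bar>)"
        using pw[OF y wb[OF y]] Suc by (simp add: w2_def)
      also have "\<dots> \<le> L * C * (1/4)^i * exp (K * T)"
        using L C K eT[OF y] by (intro mult_left_mono) auto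
      also have "\<dots> = 4 * (L * C * exp (K * T)) * (1/4)^j" using Suc by simp
      also have "\<dots> \<le> \<bar>C2\<bar> * (1/4)^j + \<dots>" by simp
      finally show ?thesis .
    qed
    have geo: "summable (\<lambda>j. a * (1/4)^j)" for a :: real by (intro summable_mult summable_geometric) simp
    have sw: "summable (\<lambda>j. w j y)" if "\<bar>y\<bar> \<le> T" for y
      by (rule summable_comparison_test'[OF geo[of "C * exp (K * \<bar>y\<bar>)"], of 0])
        (use wb[OF that] in \<open>simp add: algebra_simps\<close>)
    have sw1: "summable (\<lambda>j. w1 j y)" if "\<bar>y\<bar> \<le> T" for y
      by (rule summable_comparison_test'[OF summable_add[OF geo[of "\<bar>C1\<bar>"] geo[of "4 * (L * C / K * exp (K * T))"]], of 0])
        (use w1b'[OF that] in simp)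
    have u1: "uniformly_convergent_on {-T..T} (\<lambda>n x. \<Sum>i<n. w1 i x)"
      by (rule Weierstrass_m_test'[OF _ summable_add[OF geo[of "\<bar>C1\<bar>"] geo[of "4 * (L * C / K * exp (K * T))"]]])
        (use w1b' in auto)
    have u2: "uniformly_convergent_on {-T..T} (\<lambda>n x. \<Sum>i<n. w2 i x)"
      by (rule Weierstrass_m_test'[OF _ summable_add[OF geo[of "\<bar>C2\<bar>"] geo[of "4 * (L * C * exp (K * T))"]]])
        (use w2b' in auto)
    have xi: "x \<in> interior {-T..T}" by (auto simp: T_def)
    have T0: "0 \<in> {-T..T}" "\<bar>0\<bar> \<le> T" "\<bar>x\<bar> \<le> T" by (auto simp: T_def)
    have 1: "(U has_real_derivative V x) (at x)"
      unfolding U_def V_def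
    proof (rule has_field_derivative_series'(2)[where S = "{-T..T}" and ?x0.0 = 0])
      show "(w n has_real_derivative w1 n x) (at x within {-T..T})" for n x
        by (rule has_field_derivative_at_within[OF d1])
    qed (use u1 T0 sw xi in auto)
    have 2: "(V has_real_derivative (\<Sum>j. w2 j x)) (at x)"
      unfolding V_def
    proof (rule has_field_derivative_series'(2)[where S = "{-T..T}" and ?x0.0 = 0])
      show "(w1 n has_real_derivative w2 n x) (at x within {-T..T})" for n x
        by (rule has_field_derivative_at_within[OF d2])
    qed (use u2 T0 sw1 xi in auto)
    have "summable (\<lambda>j. w2 j x)"
      by (rule summable_comparison_test'[OF summable_add[OF geo[of "\<bar>C2\<bar>"] geo[of "4 * (L * C * exp (K * T))"]], of 0])
        (use w2b'[OF T0(3)] in simp)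
    \<comment> \<open>Splitting off the zeroth term undoes the shift: it equals -f, and the
      remaining terms sum to p times U.\<close>
    hence "(\<Sum>j. w2 j x) = (\<Sum>j. w2 (Suc j) x) + w2 0 x"
      using suminf_split_head[of "\<lambda>j. w2 j x"] by simp
    also have "\<dots> = p x * U x - f x"
      using suminf_mult[OF sw[OF T0(3)], of "p x"] by (simp add: w2_def U_def)
    finally show ?thesis using 1 2 by simp
  qed
  have "w j 0 = (if j = 0 then \<alpha> else 0)" for j by (cases j) (auto simp: w_0 w_S)
  hence "U 0 = \<alpha>" using suminf_finite[of "{0}" "\<lambda>j. w j 0"] by (simp add: U_def)
  moreover have "w1 j 0 = (if j = 0 then \<beta> else 0)" for j by (cases j) (auto simp: w1_def)
  hence "V 0 = \<beta>" using suminf_finite[of "{0}" "\<lambda>j. w1 j 0"] by (simp add: V_def)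
  moreover have "sol p f U V" using main by (simp add: sol_def)
  ultimately show thesis using that by blast
qed

section \<open>Decay of bound states\<close>

text \<open>One pair of constants \<mu>, M serves all translated potentials, their oscillator models
  and the reflections of both; constants that depend only on \<mu> and M are therefore uniform in
  k.\<close>

definition adm :: "real \<Rightarrow> real \<Rightarrow> (real \<Rightarrow> real) \<Rightarrow> bool" where
  "adm \<mu> M p \<longleftrightarrow> continuous_on UNIV p \<and> (\<forall>y. \<mu> * y\<^sup>2 - M \<le> p y \<and> p y \<le> M * (1 + y\<^sup>2))"

lemma admD:
  assumes "adm \<mu> M p"
  shows "continuous_on UNIV p" "\<mu> * y\<^sup>2 - M \<le> p y" "p y \<le> M * (1 + y\<^sup>2)"
  using assms by (auto simp: adm_def)

lemma adm_nonneg: "adm \<mu> M p \<Longrightarrow> 0 \<le> M"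
  using admD(2)[of \<mu> M p 0] admD(3)[of \<mu> M p 0] by simp

lemma adm_abs:
  assumes "adm \<mu> M p" "0 < \<mu>"
  shows "\<bar>p y\<bar> \<le> M * (1 + y\<^sup>2)"
proof -
  have "0 \<le> M * y\<^sup>2" "0 \<le> \<mu> * y\<^sup>2" using adm_nonneg[OF assms(1)] assms(2) by auto
  thus ?thesis using admD(2,3)[OF assms(1), of y] by (simp add: abs_le_iff algebra_simps)
qed

lemma adm_abs_le:
  assumes "adm \<mu> M p" "0 < \<mu>" "\<bar>y\<bar> \<le> T"
  shows "\<bar>p y\<bar> \<le> M * (1 + T\<^sup>2)"
proof -
  have "y\<^sup>2 \<le> T\<^sup>2" using assms(3) by (simp add: abs_le_square_iff[symmetric])
  hence "M * (1 + y\<^sup>2) \<le> M * (1 + T\<^sup>2)" using adm_nonneg[OF assms(1)] by (intro mult_left_mono) auto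
  thus ?thesis using adm_abs[OF assms(1,2), of y] by linarith
qed

lemma adm_reflect: "adm \<mu> M p \<Longrightarrow> adm \<mu> M (\<lambda>y. p (- y))"
  unfolding adm_def by (auto intro!: continuous_on_compose2[of UNIV p] continuous_intros)
    (metis power2_minus)+

text \<open>At a negative interior minimum the first derivative vanishes and the second is negative,
  so the first derivative is negative just to the right and z drops below its minimum. The second
  derivative need not be continuous for this.\<close>

lemma max_principle:
  fixes z zd zdd :: "real \<Rightarrow> real"
  assumes d1: "\<And>y. (z has_real_derivative zd y) (at y)" and d2: "\<And>y. (zd has_real_derivative zdd y) (at y)"
    and neg: "\<And>y. a < y \<Longrightarrow> y < b \<Longrightarrow> z y < 0 \<Longrightarrow> zdd y < 0"
    and ends: "0 \<le> z a" "0 \<le> z b" and y: "a \<le> y" "y \<le> b"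
  shows "0 \<le> z y"
proof (rule ccontr)
  assume "\<not> 0 \<le> z y"
  have "continuous_on {a..b} z" using d1 by (meson DERIV_isCont continuous_at_imp_continuous_on)
  then obtain x where x: "x \<in> {a..b}" "\<And>t. t \<in> {a..b} \<Longrightarrow> z x \<le> z t"
    using continuous_attains_inf[of "{a..b}" z] y by auto
  have zx: "z x < 0" using x(2)[of y] y \<open>\<not> 0 \<le> z y\<close> by auto
  with ends have ab: "a < x" "x < b" using x(1) by (auto simp: less_le)
  define d where "d = min (x - a) (b - x)"
  have "zd x = 0"
    by (rule DERIV_local_min[OF d1, of d]) (use ab x(2) in \<open>auto simp: d_def abs_if split: if_splits\<close>)
  obtain e where e: "0 < e" "\<And>h. 0 < h \<Longrightarrow> h < e \<Longrightarrow> zd (x + h) < zd x"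
    using DERIV_neg_dec_right[OF d2 neg[OF ab zx]] by auto
  define h where "h = min (e / 2) (b - x)"
  have h: "0 < h" "h < e" "x + h \<le> b" using e ab by (auto simp: h_def min_def)
  have "z (x + h) < z x"
  proof (rule DERIV_neg_imp_decreasing_open[of x "x + h" z])
    fix t assume t: "x < t" "t < x + h"
    have "zd t < 0" using e(2)[of "t - x"] t h \<open>zd x = 0\<close> by simp
    thus "\<exists>y. (z has_real_derivative y) (at t) \<and> y < 0" using d1 by blast
  next
    show "continuous_on {x..x+h} z" using d1 by (meson DERIV_isCont continuous_at_imp_continuous_on)
  qed (use h in simp)
  with x(2)[of "x + h"] h ab show False by simp
qed

text \<open>The barrier (B + S) e^{-ly} + \<epsilon> is tested against u and -u. Where u violates
  it, p contributes at least l^2 + 1 times the barrier: l^2 matches the barrier's own second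
  derivative and the extra 1 beats the source. The constant \<epsilon> allows for a right end where
  u is only known to be small.\<close>

lemma comparison:
  assumes s: "sol p f u v"
    and p: "\<And>y. R \<le> y \<Longrightarrow> y \<le> N \<Longrightarrow> l\<^sup>2 + 1 \<le> p y"
    and f: "\<And>y. R \<le> y \<Longrightarrow> y \<le> N \<Longrightarrow> \<bar>f y\<bar> \<le> B * exp (- (l * y))"
    and uR: "\<bar>u R\<bar> \<le> S * exp (- (l * R))" and uN: "\<bar>u N\<bar> \<le> \<epsilon>"
    and y: "R \<le> y" "y \<le> N"
  shows "\<bar>u y\<bar> \<le> (B + S) * exp (- (l * y)) + \<epsilon>"
proof -
  have "0 \<le> B * exp (- (l * R))" using f[of R] y by (smt (verit) abs_ge_zero)
  hence B: "0 \<le> B" by (simp add: zero_le_mult_iff)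
  have "0 \<le> S * exp (- (l * R))" using uR by (smt (verit) abs_ge_zero)
  hence S: "0 \<le> S" by (simp add: zero_le_mult_iff)
  have e: "0 \<le> \<epsilon>" using uN by simp
  define K where "K = B + S"
  have K: "0 \<le> K" "B \<le> K" "S \<le> K" using B S by (auto simp: K_def)
  have "0 \<le> K * exp (- (l * y)) + \<epsilon> + c * u y" if c: "c \<in> {1, -1}" for c
  proof (rule max_principle[where a = R and b = N and z = "\<lambda>y. K * exp (- (l * y)) + \<epsilon> + c * u y"
        and zd = "\<lambda>y. - (l * K * exp (- (l * y))) + c * v y"
        and zdd = "\<lambda>y. l\<^sup>2 * K * exp (- (l * y)) + c * (p y * u y - f y)"])
    show "((\<lambda>y. K * exp (- (l * y)) + \<epsilon> + c * u y) has_real_derivative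
       - (l * K * exp (- (l * y))) + c * v y) (at y)" for y
      by (auto intro!: derivative_eq_intros solD(1)[OF s])
    show "((\<lambda>y. - (l * K * exp (- (l * y))) + c * v y) has_real_derivative
       (l\<^sup>2 * K * exp (- (l * y)) + c * (p y * u y - f y))) (at y)" for y
      by (auto intro!: derivative_eq_intros solD(2)[OF s] simp: power2_eq_square)
    fix y assume y: "R < y" "y < N" and neg: "K * exp (- (l * y)) + \<epsilon> + c * u y < 0"
    have py: "l\<^sup>2 + 1 \<le> p y" using p y by simp
    have py0: "0 < p y" using py zero_le_power2[of l] by linarith
    have "p y * (c * u y) < p y * - (K * exp (- (l * y)))"
      using neg e py0 by (intro mult_strict_left_mono) auto
    also have "\<dots> \<le> - ((l\<^sup>2 + 1) * (K * exp (- (l * y))))"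
      using py K by (simp add: mult_right_mono)
    finally have 1: "p y * (c * u y) < - ((l\<^sup>2 + 1) * (K * exp (- (l * y))))" .
    have "- (c * f y) \<le> \<bar>f y\<bar>" using c by auto
    also have "\<dots> \<le> B * exp (- (l * y))" using f y by simp
    also have "\<dots> \<le> K * exp (- (l * y))" using K by (intro mult_right_mono) auto
    finally have 2: "- (c * f y) \<le> K * exp (- (l * y))" .
    show "l\<^sup>2 * K * exp (- (l * y)) + c * (p y * u y - f y) < 0"
      using 1 2 by (simp add: algebra_simps)
  next
    have "S * exp (- (l * R)) \<le> K * exp (- (l * R))" using K by (intro mult_right_mono) auto
    with uR e have "\<bar>u R\<bar> \<le> K * exp (- (l * R)) + \<epsilon>" by linarith
    thus "0 \<le> K * exp (- (l * R)) + \<epsilon> + c * u R" using c by auto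
    have "0 \<le> K * exp (- (l * N))" using K by simp
    thus "0 \<le> K * exp (- (l * N)) + \<epsilon> + c * u N" using uN c by auto
  qed (use y in auto)
  from this[of 1] this[of "-1"] show ?thesis by (auto simp: K_def abs_le_iff)
qed

lemma adm_large:
  assumes "0 < \<mu>"
  obtains R where "0 \<le> R" "\<And>p y. adm \<mu> M p \<Longrightarrow> R \<le> \<bar>y\<bar> \<Longrightarrow> a \<le> p y"
proof -
  define R where "R = sqrt (max 0 ((M + a) / \<mu>))"
  have R0: "0 \<le> R" by (simp add: R_def)
  have "a \<le> p y" if "adm \<mu> M p" "R \<le> \<bar>y\<bar>" for p y
  proof -
    have "(M + a) / \<mu> \<le> R\<^sup>2" by (simp add: R_def)
    also have "\<dots> \<le> y\<^sup>2" using that(2) R0 by (simp add: abs_le_square_iff[symmetric])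
    finally have "M + a \<le> \<mu> * y\<^sup>2" using assms by (simp add: field_simps)
    thus ?thesis using admD(2)[OF that(1), of y] by simp
  qed
  thus thesis using that R0 by blast
qed

text \<open>The energy estimate covers [0, R], beyond which p is at least l^2 + 1 and the barrier
  takes over. The constant is independent of the right end N, so the bound serves Dirichlet
  solutions on long intervals as well as decaying solutions.\<close>

lemma half_line:
  assumes "0 < \<mu>" "0 \<le> M" "0 \<le> l"
  obtains C N0 where "1 \<le> C" "0 \<le> N0"
    "\<And>p f u v S B N \<epsilon> y. adm \<mu> M p \<Longrightarrow> sol p f u v \<Longrightarrow> N0 \<le> N \<Longrightarrow>
       (\<And>y. 0 \<le> y \<Longrightarrow> y \<le> N \<Longrightarrow> \<bar>f y\<bar> \<le> B * exp (- (l * y))) \<Longrightarrow>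
       \<bar>u 0\<bar> \<le> S \<Longrightarrow> \<bar>v 0\<bar> \<le> S \<Longrightarrow> \<bar>u N\<bar> \<le> \<epsilon> \<Longrightarrow> 0 \<le> y \<Longrightarrow> y \<le> N \<Longrightarrow>
       \<bar>u y\<bar> \<le> C * (S + B) * exp (- (l * y)) + \<epsilon>"
proof -
  obtain R where R: "0 \<le> R" "\<And>p y. adm \<mu> M p \<Longrightarrow> R \<le> \<bar>y\<bar> \<Longrightarrow> l\<^sup>2 + 1 \<le> p y"
    using adm_large[OF assms(1)] by metis
  \<comment> \<open>The factor e^{lR} converts the unweighted bound on [0, R] into a weighted
    one.\<close>
  define g where "g = gron (M * (1 + R\<^sup>2)) R * exp (l * R)"
  have g0: "0 \<le> g" using R by (simp add: g_def)
  show thesis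
  proof (rule that[of "1 + g" R])
    fix p f u v S B N \<epsilon> y
    assume a: "adm \<mu> M p" and s: "sol p f u v" and N: "R \<le> N"
      and f: "\<And>y. 0 \<le> y \<Longrightarrow> y \<le> N \<Longrightarrow> \<bar>f y\<bar> \<le> B * exp (- (l * y))"
      and S: "\<bar>u 0\<bar> \<le> S" "\<bar>v 0\<bar> \<le> S" and e: "\<bar>u N\<bar> \<le> \<epsilon>" and y: "0 \<le> y" "y \<le> N"
    have "\<bar>f 0\<bar> \<le> B" using f[of 0] R(1) N by simp
    hence B: "0 \<le> B" by linarith
    have S0: "0 \<le> S" using S by simp
    have pL: "\<bar>p y\<bar> \<le> M * (1 + R\<^sup>2)" if "0 \<le> y" "y \<le> R" for y
      using adm_abs_le[OF a assms(1), of y R] that by simp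
    have fB: "\<bar>f y\<bar> \<le> B" if "0 \<le> y" "y \<le> R" for y
    proof -
      have "0 \<le> l * y" using that assms(3) by simp
      hence "B * exp (- (l * y)) \<le> B * 1" using B by (intro mult_left_mono) auto
      thus ?thesis using f[of y] that N by simp
    qed
    have small: "\<bar>u y\<bar> \<le> g * (S + B) * exp (- (l * y))" if y: "0 \<le> y" "y \<le> R" for y
    proof -
      have "\<bar>u y\<bar> \<le> gron (M * (1 + R\<^sup>2)) R * (S + B)"
        by (rule gronwall(1)[OF s pL fB S y])
      also have "\<dots> = g * (S + B) * exp (- (l * R))"
        by (simp add: g_def exp_minus)
      also have "\<dots> \<le> g * (S + B) * exp (- (l * y))"
        using g0 S0 B y assms(3) by (intro mult_left_mono) (auto intro: mult_left_mono)
      finally show ?thesis .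
    qed
    show "\<bar>u y\<bar> \<le> (1 + g) * (S + B) * exp (- (l * y)) + \<epsilon>"
    proof (cases "y \<le> R")
      case True
      have "g * (S + B) * exp (- (l * y)) \<le> (1 + g) * (S + B) * exp (- (l * y))"
        using S0 B by (intro mult_right_mono) auto
      thus ?thesis using small[OF y(1) True] e by linarith
    next
      case False
      have "\<bar>u y\<bar> \<le> (B + g * (S + B)) * exp (- (l * y)) + \<epsilon>"
      proof (rule comparison[OF s _ _ small[OF R(1) order_refl] e])
        show "l\<^sup>2 + 1 \<le> p y" if "R \<le> y" for y using R a that by simp
        show "\<bar>f y\<bar> \<le> B * exp (- (l * y))" if "R \<le> y" "y \<le> N" for y using f R that by simp
      qed (use False y in auto)
      also have "\<dots> \<le> ((1 + g) * (S + B)) * exp (- (l * y)) + \<epsilon>"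
        using S0 by (intro add_right_mono mult_right_mono) (auto simp: algebra_simps)
      finally show ?thesis .
    qed
  qed (use g0 R in auto)
qed

text \<open>Decay to 0, without any rate, lets the right end of \<open>half_line\<close> move out
  until its boundary term is below any given error; the left half follows by reflection.\<close>

lemma full_line:
  assumes "0 < \<mu>" "0 \<le> M" "0 \<le> l"
  obtains C where "1 \<le> C"
    "\<And>p f u v S B. adm \<mu> M p \<Longrightarrow> sol p f u v \<Longrightarrow> dec l B f \<Longrightarrow> \<bar>u 0\<bar> \<le> S \<Longrightarrow> \<bar>v 0\<bar> \<le> S \<Longrightarrow>
       (u \<longlongrightarrow> 0) at_top \<Longrightarrow> (u \<longlongrightarrow> 0) at_bot \<Longrightarrow> dec l (C * (S + B)) u"
proof -
  obtain C N0 where C: "1 \<le> C" "0 \<le> N0" and H: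
    "\<And>p f u v S B N \<epsilon> y. adm \<mu> M p \<Longrightarrow> sol p f u v \<Longrightarrow> N0 \<le> N \<Longrightarrow>
       (\<And>y. 0 \<le> y \<Longrightarrow> y \<le> N \<Longrightarrow> \<bar>f y\<bar> \<le> B * exp (- (l * y))) \<Longrightarrow>
       \<bar>u 0\<bar> \<le> S \<Longrightarrow> \<bar>v 0\<bar> \<le> S \<Longrightarrow> \<bar>u N\<bar> \<le> \<epsilon> \<Longrightarrow> 0 \<le> y \<Longrightarrow> y \<le> N \<Longrightarrow>
       \<bar>u y\<bar> \<le> C * (S + B) * exp (- (l * y)) + \<epsilon>"
    using half_line[OF assms] by metis
  have half: "\<bar>u y\<bar> \<le> C * (S + B) * exp (- (l * y))"
    if "adm \<mu> M p" "sol p f u v" "dec l B f" "\<bar>u 0\<bar> \<le> S" "\<bar>v 0\<bar> \<le> S" "(u \<longlongrightarrow> 0) at_top" "0 \<le> y"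
    for p f u v S B y
  proof (rule field_le_epsilon)
    fix e :: real assume "0 < e"
    with that(6) have "eventually (\<lambda>N. \<bar>u N\<bar> < e) at_top" by (simp add: tendsto_iff dist_real_def)
    then obtain N1 where N1: "\<And>N. N1 \<le> N \<Longrightarrow> \<bar>u N\<bar> < e" by (auto simp: eventually_at_top_linorder)
    show "\<bar>u y\<bar> \<le> C * (S + B) * exp (- (l * y)) + e"
    proof (rule H[OF that(1,2)])
      show "N0 \<le> max N0 (max y N1)" "y \<le> max N0 (max y N1)" by simp_all
      show "\<bar>u (max N0 (max y N1))\<bar> \<le> e" using N1[of "max N0 (max y N1)"] by (simp add: less_imp_le)
      show "\<bar>f y\<bar> \<le> B * exp (- (l * y))" if "0 \<le> y" for y
        using decD[OF \<open>dec l B f\<close>, of y] that by (simp add: wt_def)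
    qed (use that in auto)
  qed
  show thesis
  proof (rule that[OF C(1)])
    fix p f u v S B
    assume *: "adm \<mu> M p" "sol p f u v" "dec l B f" "\<bar>u 0\<bar> \<le> S" "\<bar>v 0\<bar> \<le> S"
      "(u \<longlongrightarrow> 0) at_top" "(u \<longlongrightarrow> 0) at_bot"
    have "\<bar>u y\<bar> \<le> C * (S + B) * wt l y" for y
    proof (cases "0 \<le> y")
      case True thus ?thesis using half[OF *(1-6), of y] by (simp add: wt_def)
    next
      case False
      have "((\<lambda>y. u (- y)) \<longlongrightarrow> 0) at_top"
        by (rule filterlim_compose[OF *(7) filterlim_uminus_at_bot_at_top])
      from half[OF adm_reflect[OF *(1)] sol_reflect[OF *(2)] dec_reflect[OF *(3)] _ _ this, of S "-y"]
      show ?thesis using *(4,5) False by (simp add: wt_def)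
    qed
    thus "dec l (C * (S + B)) u" by (simp add: dec_def)
  qed
qed

text \<open>The mean value theorem on an interval of length 1 yields a point where |v| is at most
  2U, and W bounds the change of v from there.\<close>

lemma deriv_local:
  fixes u v w :: "real \<Rightarrow> real"
  assumes d1: "\<And>y. a \<le> y \<Longrightarrow> y \<le> a + 1 \<Longrightarrow> (u has_real_derivative v y) (at y)"
    and d2: "\<And>y. a \<le> y \<Longrightarrow> y \<le> a + 1 \<Longrightarrow> (v has_real_derivative w y) (at y)"
    and U: "\<And>y. a \<le> y \<Longrightarrow> y \<le> a + 1 \<Longrightarrow> \<bar>u y\<bar> \<le> U"
    and W: "\<And>y. a \<le> y \<Longrightarrow> y \<le> a + 1 \<Longrightarrow> \<bar>w y\<bar> \<le> W"
    and y: "a \<le> y" "y \<le> a + 1"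
  shows "\<bar>v y\<bar> \<le> 2 * U + W"
proof -
  obtain z where z: "a < z" "z < a + 1" "u (a + 1) - u a = (a + 1 - a) * v z"
    using MVT2[of a "a + 1" u v] d1 by auto
  have vz: "\<bar>v z\<bar> \<le> 2 * U" using z(3) U[of a] U[of "a+1"] by simp
  have "norm (v y - v z) \<le> W * norm (y - z)"
    by (rule field_differentiable_bound[where S = "{a..a+1}" and f' = w])
      (use y z d2 W in \<open>auto intro: has_field_derivative_at_within\<close>)
  moreover have "\<bar>y - z\<bar> \<le> 1" using y z by auto
  moreover have "0 \<le> W" using W[of a] by simp
  ultimately have "\<bar>v y - v z\<bar> \<le> W * 1" unfolding real_norm_def
    by (blast intro: order_trans mult_left_mono)
  thus ?thesis using vz by linarith
qed

text \<open>The unit of rate is lost to the quadratic growth of p. The comparison interval points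
  away from the origin, so that the weight at its near end dominates.\<close>

lemma dec_deriv:
  assumes a: "adm \<mu> M p" "0 < \<mu>" and s: "sol p f u v" and u: "dec l A u" and f: "dec l B f" and l: "1 \<le> l"
  shows "dec (l - 1) ((2 + 2 * M) * A + B) v"
proof -
  have half: "\<bar>v y\<bar> \<le> ((2 + 2 * M) * A + B) * wt (l - 1) y"
    if a: "adm \<mu> M p" and s: "sol p f u v" and u: "dec l A u" and f: "dec l B f" and y: "0 \<le> y"
    for p f u v y
  proof -
    have A: "0 \<le> A" and B: "0 \<le> B" using u f by (auto dest: dec_nonneg)
    have M: "0 \<le> M" using a by (rule adm_nonneg)
    have mono: "wt k z \<le> wt k y" if "y \<le> z" "0 \<le> k" for z k
      using that y by (auto simp: wt_def mult_left_mono)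
    have "\<bar>v y\<bar> \<le> 2 * (A * wt l y) + (2 * M * A + B) * wt (l - 1) y"
    proof (rule deriv_local[of y u v "\<lambda>y. p y * u y - f y"])
      fix z assume z: "y \<le> z" "z \<le> y + 1"
      show "\<bar>u z\<bar> \<le> A * wt l y"
        using decD[OF u, of z] mult_left_mono[OF mono[OF z(1), of l] A] l by linarith
      have "\<bar>p z\<bar> \<le> 2 * M * wt (-1) z"
        using adm_abs[OF a assms(2), of z] mult_left_mono[OF exp_abs_ge M, of z] by simp
      hence "\<bar>p z * u z\<bar> \<le> (2 * M * wt (-1) z) * (A * wt l z)"
        unfolding abs_mult using decD[OF u] by (intro mult_mono) auto
      also have "\<dots> = 2 * M * A * wt (l - 1) z" using wt_mult[of "-1" z l] by simp
      finally have 1: "\<bar>p z * u z\<bar> \<le> 2 * M * A * wt (l - 1) z" .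
      have "\<bar>f z\<bar> \<le> B * wt l z" by (rule decD[OF f])
      also have "\<dots> \<le> B * wt (l - 1) z" using B by (intro mult_left_mono wt_mono) auto
      finally have "\<bar>p z * u z - f z\<bar> \<le> (2 * M * A + B) * wt (l - 1) z" using 1 by (simp add: algebra_simps)
      also have "\<dots> \<le> (2 * M * A + B) * wt (l - 1) y"
        using A B M l by (intro mult_left_mono mono z) auto
      finally show "\<bar>p z * u z - f z\<bar> \<le> (2 * M * A + B) * wt (l - 1) y" .
    qed (use solD[OF s] in auto)
    also have "\<dots> \<le> 2 * (A * wt (l - 1) y) + (2 * M * A + B) * wt (l - 1) y"
      using A by (intro add_right_mono mult_left_mono wt_mono) auto
    finally show ?thesis by (simp add: algebra_simps)
  qed
  have "\<bar>v y\<bar> \<le> ((2 + 2 * M) * A + B) * wt (l - 1) y" for y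
  proof (cases "0 \<le> y")
    case True thus ?thesis by (rule half[OF a(1) s u f])
  next
    case False
    thus ?thesis
      using half[OF adm_reflect[OF a(1)] sol_reflect[OF s] dec_reflect[OF u] dec_reflect[OF f], of "-y"] by simp
  qed
  thus ?thesis by (simp add: dec_def)
qed

lemma integral_lower_bound:
  assumes g: "integrable lborel g" and pos: "\<And>y::real. 0 \<le> g y" and c: "\<And>y. a \<le> y \<Longrightarrow> y \<le> b \<Longrightarrow> c \<le> g y"
    and "a \<le> b"
  shows "c * (b - a) \<le> (LBINT y. g y)"
proof -
  have "(LBINT y. c * indicator {a..b} y) \<le> (LBINT y. g y)"
  proof (rule integral_mono[OF _ g])
    show "integrable lborel (\<lambda>y. c * indicator {a..b} y)"
      by (intro integrable_mult_right integrable_real_indicator) (use assms(4) in auto)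
    show "c * indicator {a..b} y \<le> g y" for y using pos c by (auto simp: indicator_def)
  qed
  thus ?thesis using assms(4) by simp
qed

text \<open>Where p is nonnegative, u v is nondecreasing, having derivative v^2 + p u^2. If it were
  ever positive, u^2 would increase from there on and not be integrable; hence u^2 is nonincreasing,
  and integrability forces it to 0 at the rate 1/y.\<close>

lemma square_integrable_tendsto:
  assumes a: "adm \<mu> M p" "0 < \<mu>" and s: "sol p (\<lambda>_. 0) u v" and i: "integrable lborel (\<lambda>y. (u y)\<^sup>2)"
  shows "(u \<longlongrightarrow> 0) at_top"
proof -
  obtain R where R: "\<And>p y. adm \<mu> M p \<Longrightarrow> R \<le> \<bar>y\<bar> \<Longrightarrow> 0 \<le> p y" "0 \<le> R"
    using adm_large[OF a(2)] by metis
  define I where "I = (LBINT y. (u y)\<^sup>2)"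
  have g_mono: "u y * v y \<le> u z * v z" if "R \<le> y" "y \<le> z" for y z
  proof (rule DERIV_nonneg_imp_nondecreasing[OF that(2), of "\<lambda>y. u y * v y"])
    fix x assume x: "y \<le> x" "x \<le> z"
    have "((\<lambda>y. u y * v y) has_real_derivative v x * v x + p x * (u x * u x)) (at x)"
      by (auto intro!: derivative_eq_intros solD(1)[OF s] solD(2)[OF s] simp: algebra_simps)
    moreover have "0 \<le> p x" using R(1)[OF a(1), of x] x that(1) by linarith
    hence "0 \<le> v x * v x + p x * (u x * u x)" by simp
    ultimately show "\<exists>y. ((\<lambda>y. u y * v y) has_real_derivative y) (at x) \<and> 0 \<le> y" by blast
  qed
  have dsq: "((\<lambda>y. (u y)\<^sup>2) has_real_derivative 2 * (u x * v x)) (at x)" for x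
    by (auto intro!: derivative_eq_intros solD(1)[OF s])
  have g_nonpos: "u y * v y \<le> 0" if "R \<le> y" for y
  proof (rule ccontr)
    assume "\<not> u y * v y \<le> 0"
    hence pos: "0 < u y * v y" by simp
    have inc: "(u y)\<^sup>2 \<le> (u z)\<^sup>2" if "y \<le> z" for z
    proof (rule DERIV_nonneg_imp_nondecreasing[OF that])
      fix x assume "y \<le> x" "x \<le> z"
      hence "0 \<le> 2 * (u x * v x)" using g_mono[OF \<open>R \<le> y\<close>, of x] pos by simp
      thus "\<exists>d. ((\<lambda>y. (u y)\<^sup>2) has_real_derivative d) (at x) \<and> 0 \<le> d" using dsq by blast
    qed
    have uy: "0 < (u y)\<^sup>2" using pos by auto
    have "(u y)\<^sup>2 * ((y + (I / (u y)\<^sup>2 + 1)) - y) \<le> I"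
      unfolding I_def
    proof (rule integral_lower_bound[OF i])
      have "0 \<le> (LBINT y. (u y)\<^sup>2) / (u y)\<^sup>2" by simp
      thus "y \<le> y + ((LBINT y. (u y)\<^sup>2) / (u y)\<^sup>2 + 1)" by linarith
    qed (use inc in auto)
    thus False using uy by (simp add: field_simps)
  qed
  have dec: "(u z)\<^sup>2 \<le> (u y)\<^sup>2" if "R \<le> y" "y \<le> z" for y z
  proof (rule DERIV_nonpos_imp_nonincreasing[OF that(2)])
    fix x assume "y \<le> x" "x \<le> z"
    hence "2 * (u x * v x) \<le> 0" using g_nonpos[of x] that by simp
    thus "\<exists>d. ((\<lambda>y. (u y)\<^sup>2) has_real_derivative d) (at x) \<and> d \<le> 0" using dsq by blast
  qed
  have bd: "(u y)\<^sup>2 \<le> I / (y - R)" if "R < y" for y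
  proof -
    have "(u y)\<^sup>2 * (y - R) \<le> I"
      unfolding I_def by (rule integral_lower_bound[OF i]) (use dec that in auto)
    thus ?thesis using that by (simp add: field_simps)
  qed
  have "((\<lambda>y. I / (y - R)) \<longlongrightarrow> 0) at_top"
    by (rule tendsto_divide_0[OF tendsto_const])
      (auto intro!: filterlim_at_top_imp_at_infinity simp: filterlim_at_top eventually_at_top_linorder,
       metis le_diff_eq)
  hence "((\<lambda>y. (u y)\<^sup>2) \<longlongrightarrow> 0) at_top"
    by (rule Lim_null_comparison[rotated])
      (auto intro!: bd exI[of _ "R + 1"] simp: eventually_at_top_linorder)
  from tendsto_real_sqrt[OF this] have "((\<lambda>y. \<bar>u y\<bar>) \<longlongrightarrow> 0) at_top" by simp
  thus ?thesis by (simp add: tendsto_rabs_zero_iff)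
qed

text \<open>The normalisation uses the Cauchy data at 0 instead of the L2 norm: the data lie on a
  circle and determine the solution. \<open>bound_norm_lower\<close> recovers a lower bound for the
  norm.\<close>

definition bound :: "(real \<Rightarrow> real) \<Rightarrow> (real \<Rightarrow> real) \<Rightarrow> (real \<Rightarrow> real) \<Rightarrow> bool" where
  "bound p u v \<longleftrightarrow> sol p (\<lambda>_. 0) u v \<and> (u 0)\<^sup>2 + (v 0)\<^sup>2 = 1 \<and> integrable lborel (\<lambda>y. (u y)\<^sup>2)"

lemma boundD:
  assumes "bound p u v"
  shows "sol p (\<lambda>_. 0) u v" "(u 0)\<^sup>2 + (v 0)\<^sup>2 = 1" "\<bar>u 0\<bar> \<le> 1" "\<bar>v 0\<bar> \<le> 1"
    "integrable lborel (\<lambda>y. (u y)\<^sup>2)"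
proof -
  show "sol p (\<lambda>_. 0) u v" "(u 0)\<^sup>2 + (v 0)\<^sup>2 = 1" "integrable lborel (\<lambda>y. (u y)\<^sup>2)"
    using assms by (auto simp: bound_def)
  hence "(u 0)\<^sup>2 \<le> 1\<^sup>2" "(v 0)\<^sup>2 \<le> 1\<^sup>2" using zero_le_power2[of "u 0"] zero_le_power2[of "v 0"]
    unfolding one_power2 by linarith+
  thus "\<bar>u 0\<bar> \<le> 1" "\<bar>v 0\<bar> \<le> 1" by (simp_all add: abs_square_le_1)
qed

lemma bound_reflect:
  assumes "bound p u v"
  shows "bound (\<lambda>y. p (- y)) (\<lambda>y. u (- y)) (\<lambda>y. - v (- y))"
  unfolding bound_def
proof (intro conjI)
  show "sol (\<lambda>y. p (- y)) (\<lambda>_. 0) (\<lambda>y. u (- y)) (\<lambda>y. - v (- y))"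
    by (rule sol_reflect[OF boundD(1)[OF assms]])
  show "(u (- 0))\<^sup>2 + (- v (- 0))\<^sup>2 = 1" using boundD(2)[OF assms] by simp
  show "integrable lborel (\<lambda>y. (u (- y))\<^sup>2)"
    using lborel_integrable_real_affine[OF boundD(5)[OF assms], of "-1" 0] by simp
qed

text \<open>Square integrability gives convergence to 0, which \<open>full_line\<close> upgrades to
  any rate; rate l + 1 is requested for u because its derivative loses one unit.\<close>

lemma sol_zero_dec:
  assumes "0 < \<mu>" "0 \<le> M" "0 \<le> l"
  obtains C where "1 \<le> C"
    "\<And>p u v S. adm \<mu> M p \<Longrightarrow> sol p (\<lambda>_. 0) u v \<Longrightarrow> integrable lborel (\<lambda>y. (u y)\<^sup>2) \<Longrightarrow>
        \<bar>u 0\<bar> \<le> S \<Longrightarrow> \<bar>v 0\<bar> \<le> S \<Longrightarrow> dec l (C * S) u \<and> dec l (C * S) v"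
proof -
  obtain C where C: "1 \<le> C"
    "\<And>p f u v S B. adm \<mu> M p \<Longrightarrow> sol p f u v \<Longrightarrow> dec (l + 1) B f \<Longrightarrow> \<bar>u 0\<bar> \<le> S \<Longrightarrow> \<bar>v 0\<bar> \<le> S \<Longrightarrow>
       (u \<longlongrightarrow> 0) at_top \<Longrightarrow> (u \<longlongrightarrow> 0) at_bot \<Longrightarrow> dec (l + 1) (C * (S + B)) u"
    using full_line[of \<mu> M "l + 1"] assms by auto
  show thesis
  proof (rule that[of "(2 + 2 * M) * C"])
    have "1 * 1 \<le> (2 + 2 * M) * C" using C(1) assms by (intro mult_mono) auto
    thus "1 \<le> (2 + 2 * M) * C" by simp
    fix p u v S
    assume *: "adm \<mu> M p" "sol p (\<lambda>_. 0) u v" "integrable lborel (\<lambda>y. (u y)\<^sup>2)" "\<bar>u 0\<bar> \<le> S" "\<bar>v 0\<bar> \<le> S"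
    have S: "0 \<le> S" using *(4) by simp
    have t: "(u \<longlongrightarrow> 0) at_top" by (rule square_integrable_tendsto[OF *(1) assms(1) *(2,3)])
    have "((\<lambda>y. u (- y)) \<longlongrightarrow> 0) at_top"
      using square_integrable_tendsto[OF adm_reflect[OF *(1)] assms(1) sol_reflect[OF *(2)]]
        lborel_integrable_real_affine[OF *(3), of "-1" 0] by simp
    hence b: "(u \<longlongrightarrow> 0) at_bot" by (simp add: at_bot_mirror filterlim_filtermap)
    have z: "dec (l + 1) 0 (\<lambda>_. 0)" by (simp add: dec_def)
    have u: "dec (l + 1) (C * S) u" using C(2)[OF *(1,2) z *(4,5) t b] by simp
    have v: "dec (l + 1 - 1) ((2 + 2 * M) * (C * S) + 0) v"
      by (rule dec_deriv[OF *(1) assms(1) *(2) u z]) (use assms in simp)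
    have "1 * (C * S) \<le> (2 + 2 * M) * (C * S)" using C(1) S assms by (intro mult_right_mono) auto
    hence "dec l ((2 + 2 * M) * C * S) u" by (intro dec_mono[OF u]) (auto simp: algebra_simps)
    thus "dec l ((2 + 2 * M) * C * S) u \<and> dec l ((2 + 2 * M) * C * S) v"
      using v by (simp add: mult.assoc)
  qed
qed

lemma bound_dec:
  assumes "0 < \<mu>" "0 \<le> M" "0 \<le> l"
  obtains C where "1 \<le> C"
    "\<And>p u v. adm \<mu> M p \<Longrightarrow> bound p u v \<Longrightarrow> dec l C u \<and> dec l C v"
proof -
  obtain C where C: "1 \<le> C"
    "\<And>p u v S. adm \<mu> M p \<Longrightarrow> sol p (\<lambda>_. 0) u v \<Longrightarrow> integrable lborel (\<lambda>y. (u y)\<^sup>2) \<Longrightarrow>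
        \<bar>u 0\<bar> \<le> S \<Longrightarrow> \<bar>v 0\<bar> \<le> S \<Longrightarrow> dec l (C * S) u \<and> dec l (C * S) v"
    using sol_zero_dec[OF assms] by metis
  show thesis
  proof (rule that[OF C(1)])
    fix p u v assume "adm \<mu> M p" "bound p u v"
    thus "dec l C u \<and> dec l C v" using C(2)[of p u v 1] boundD[of p u v] by simp
  qed
qed

text \<open>\<open>G 0\<close> is minus the integral of g over the positive half-line; with a
  Wronskian for G this bounds the Wronskian at 0. Adding the primitive of the bound to G and to -G
  makes both monotone.\<close>

lemma tail_estimate:
  fixes G g :: "real \<Rightarrow> real"
  assumes d: "\<And>y. (G has_real_derivative g y) (at y)" and g: "dec k K g" and k: "0 < k"
    and lim: "(G \<longlongrightarrow> 0) at_top"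
  shows "\<bar>G 0\<bar> \<le> K / k"
proof -
  have *: "- (K / k) \<le> c * G 0" if c: "c \<in> {1, -1}" for c
  proof -
    define H where "H = (\<lambda>y. c * G y + K / k * exp (- (k * y)))"
    have "H y \<le> H 0" if y: "0 \<le> y" for y
    proof (rule DERIV_nonpos_imp_nonincreasing[OF y])
      fix x assume x: "0 \<le> x" "x \<le> y"
      have "(H has_real_derivative c * g x - K * exp (- (k * x))) (at x)"
        unfolding H_def using k by (auto intro!: derivative_eq_intros d)
      moreover have "c * g x - K * exp (- (k * x)) \<le> 0"
        using decD[OF g, of x] c x by (auto simp: wt_def)
      ultimately show "\<exists>d. (H has_real_derivative d) (at x) \<and> d \<le> 0" by blast
    qed
    moreover have "((\<lambda>y. exp (- (k * y))) \<longlongrightarrow> 0) at_top"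
      using k by (intro filterlim_compose[OF exp_at_bot])
        (auto simp: filterlim_uminus_at_bot intro!: filterlim_tendsto_pos_mult_at_top filterlim_ident tendsto_const)
    hence "(H \<longlongrightarrow> c * 0 + K / k * 0) at_top" unfolding H_def by (intro tendsto_intros lim)
    ultimately have "0 \<le> H 0"
      by (intro tendsto_upperbound[of H 0 at_top]) (auto simp: eventually_at_top_linorder)
    thus ?thesis by (simp add: H_def)
  qed
  from *[of 1] *[of "-1"] show ?thesis by (auto simp: abs_le_iff)
qed

lemma wronskian_tendsto:
  assumes "dec a A u" "0 < a" "dec b B v" "0 \<le> b" "dec c C u'" "0 < c" "dec d D v'" "0 \<le> d"
  shows "((\<lambda>y. u y * v' y - v y * u' y) \<longlongrightarrow> 0) at_top"
proof -
  have "dec (min a c) (A * D + B * C) (\<lambda>y. u y * v' y - v y * u' y)"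
  proof (rule dec_diff)
    show "dec (min a c) (A * D) (\<lambda>y. u y * v' y)"
      using assms by (intro dec_mono[OF dec_mult[OF assms(1,7)]]) auto
    show "dec (min a c) (B * C) (\<lambda>y. v y * u' y)"
      using assms by (intro dec_mono[OF dec_mult[OF assms(3,5)]]) auto
  qed
  thus ?thesis using assms by (intro dec_tendsto(1)[of "min a c"]) auto
qed

text \<open>The vectors (u, v) and (v, -u) form an orthonormal basis; (D, E) has coordinate 0 along
  the first and w along the second.\<close>

lemma perp_data:
  fixes D E u v w :: real
  assumes "D * u + E * v = 0" "D * v - E * u = w" "u\<^sup>2 + v\<^sup>2 = 1"
  shows "\<bar>D\<bar> \<le> \<bar>w\<bar>" "\<bar>E\<bar> \<le> \<bar>w\<bar>"
proof -
  have "D\<^sup>2 + E\<^sup>2 = (D\<^sup>2 + E\<^sup>2) * (u\<^sup>2 + v\<^sup>2)" using assms(3) by simp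
  also have "\<dots> = (D * u + E * v)\<^sup>2 + (D * v - E * u)\<^sup>2" by algebra
  also have "\<dots> = w\<^sup>2" using assms by simp
  finally have "D\<^sup>2 + E\<^sup>2 = w\<^sup>2" .
  hence "D\<^sup>2 \<le> w\<^sup>2" "E\<^sup>2 \<le> w\<^sup>2" using zero_le_power2[of D] zero_le_power2[of E] by linarith+
  thus "\<bar>D\<bar> \<le> \<bar>w\<bar>" "\<bar>E\<bar> \<le> \<bar>w\<bar>" by (simp_all add: abs_le_square_iff)
qed

text \<open>The condition at 0 removes the multiple of u left free by the equation, so only the
  component of the data measured by the Wronskian remains. The bounds with \<open>C0\<close> are
  qualitative: they make the Wronskian vanish at infinity and do not enter the final
  constant.\<close>

lemma fredholm_estimate:
  assumes "0 < \<mu>" "0 \<le> M" "1 \<le> l"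
  obtains C where "1 \<le> C"
    "\<And>p u v f D E B C0. adm \<mu> M p \<Longrightarrow> bound p u v \<Longrightarrow> sol p f D E \<Longrightarrow> dec l B f \<Longrightarrow> dec 1 C0 D \<Longrightarrow> dec 0 C0 E
       \<Longrightarrow> D 0 * u 0 + E 0 * v 0 = 0 \<Longrightarrow> dec l (C * B) D"
proof -
  have l0: "0 \<le> l" using assms by simp
  obtain C where C: "1 \<le> C" and F: "\<And>p f u v S B. adm \<mu> M p \<Longrightarrow> sol p f u v \<Longrightarrow> dec l B f \<Longrightarrow> \<bar>u 0\<bar> \<le> S \<Longrightarrow> \<bar>v 0\<bar> \<le> S \<Longrightarrow>
       (u \<longlongrightarrow> 0) at_top \<Longrightarrow> (u \<longlongrightarrow> 0) at_bot \<Longrightarrow> dec l (C * (S + B)) u"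
    using full_line[OF assms(1,2) l0] by metis
  obtain C1 where C1: "1 \<le> C1" "\<And>p u v. adm \<mu> M p \<Longrightarrow> bound p u v \<Longrightarrow> dec l C1 u \<and> dec l C1 v"
    using bound_dec[OF assms(1,2) l0] by metis
  show thesis
  proof (rule that[of "C * (C1 + 1)"])
    have "1 * 1 \<le> C * (C1 + 1)" using C C1 by (intro mult_mono) auto
    thus "1 \<le> C * (C1 + 1)" by simp
    fix p u v f D E B C0
    assume a: "adm \<mu> M p" and b: "bound p u v" and s: "sol p f D E" and f: "dec l B f"
      and D: "dec 1 C0 D" and E: "dec 0 C0 E" and perp: "D 0 * u 0 + E 0 * v 0 = 0"
    have B: "0 \<le> B" using f by (rule dec_nonneg)
    have u: "dec l C1 u" "dec l C1 v" using C1(2)[OF a b] by auto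
    define W where "W = (\<lambda>y. D y * v y - E y * u y)"
    have "\<bar>W 0\<bar> \<le> B * C1 / (l + l)"
    proof (rule tail_estimate)
      show "(W has_real_derivative f y * u y) (at y)" for y
        using wronskian_deriv[OF s boundD(1)[OF b], of y] by (simp add: W_def)
      show "dec (l + l) (B * C1) (\<lambda>y. f y * u y)" by (rule dec_mult[OF f u(1)])
      show "(W \<longlongrightarrow> 0) at_top"
        unfolding W_def using assms by (intro wronskian_tendsto[OF D _ E _ u(1) _ u(2)]) auto
    qed (use assms in simp)
    also have "\<dots> \<le> B * C1 / 1" using assms B C1 by (intro divide_left_mono) auto
    finally have W: "\<bar>W 0\<bar> \<le> B * C1" by simp
    have "\<bar>D 0\<bar> \<le> B * C1" "\<bar>E 0\<bar> \<le> B * C1"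
      using perp_data[OF perp, of "W 0"] boundD(2)[OF b] W by (auto simp: W_def)
    from F[OF a s f this dec_tendsto[OF D]] have "dec l (C * (B * C1 + B)) D" by simp
    thus "dec l (C * (C1 + 1) * B) D" by (simp add: algebra_simps)
  qed
qed

text \<open>The mere existence of bound states for two nearby potentials forces them to agree up to
  sign: the Wronskian of the pair has derivative (p2 - p1) u1 u2 and vanishes at infinity, so the
  angle between the data at 0 has a sine of order d.\<close>

lemma bound_close:
  assumes "0 < \<mu>" "0 \<le> M" "0 \<le> l"
  obtains C where "1 \<le> C"
    "\<And>p1 u1 v1 p2 u2 v2 d. adm \<mu> M p1 \<Longrightarrow> adm \<mu> M p2 \<Longrightarrow> bound p1 u1 v1 \<Longrightarrow> bound p2 u2 v2 \<Longrightarrow>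
      dec (-1) d (\<lambda>y. p1 y - p2 y) \<Longrightarrow>
      \<exists>s\<in>{1, -1}. dec l (C * d) (\<lambda>y. u1 y - s * u2 y) \<and> \<bar>v1 0 - s * v2 0\<bar> \<le> C * d"
proof -
  obtain C where C: "1 \<le> C" and F: "\<And>p f u v S B. adm \<mu> M p \<Longrightarrow> sol p f u v \<Longrightarrow> dec l B f \<Longrightarrow> \<bar>u 0\<bar> \<le> S \<Longrightarrow> \<bar>v 0\<bar> \<le> S \<Longrightarrow>
       (u \<longlongrightarrow> 0) at_top \<Longrightarrow> (u \<longlongrightarrow> 0) at_bot \<Longrightarrow> dec l (C * (S + B)) u"
    using full_line[OF assms] by metis
  obtain K where K: "1 \<le> K" "\<And>p u v. adm \<mu> M p \<Longrightarrow> bound p u v \<Longrightarrow> dec (l + 1) K u \<and> dec (l + 1) K v"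
    using bound_dec[of \<mu> M "l + 1"] assms by auto
  define C' where "C' = C * (2 * K\<^sup>2 + K) + 2 * K\<^sup>2"
  have KK: "1 \<le> K\<^sup>2" using K(1) by (simp add: one_le_power)
  show thesis
  proof (rule that[of C'])
    have "1 \<le> 2 * K\<^sup>2 + K" using K(1) KK by linarith
    hence "1 * 1 \<le> C * (2 * K\<^sup>2 + K)" using C by (intro mult_mono) auto
    thus "1 \<le> C'" unfolding C'_def using KK by linarith
    fix p1 u1 v1 p2 u2 v2 d
    assume a: "adm \<mu> M p1" "adm \<mu> M p2" and b: "bound p1 u1 v1" "bound p2 u2 v2"
      and d: "dec (-1) d (\<lambda>y. p1 y - p2 y)"
    have d0: "0 \<le> d" using d by (rule dec_nonneg)
    have d': "dec (-1) d (\<lambda>y. p2 y - p1 y)" using dec_uminus[OF d] by simp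
    have u: "dec (l + 1) K u1" "dec (l + 1) K v1" "dec (l + 1) K u2" "dec (l + 1) K v2"
      using K(2)[OF a(1) b(1)] K(2)[OF a(2) b(2)] by auto
    define W where "W = (\<lambda>y. u1 y * v2 y - v1 y * u2 y)"
    have "\<bar>W 0\<bar> \<le> d * (K * K) / (-1 + (l + 1 + (l + 1)))"
    proof (rule tail_estimate)
      show "(W has_real_derivative (p2 y - p1 y) * (u1 y * u2 y)) (at y)" for y
        using wronskian_deriv[OF boundD(1)[OF b(1)] boundD(1)[OF b(2)], of y] by (simp add: W_def)
      show "dec (-1 + (l + 1 + (l + 1))) (d * (K * K)) (\<lambda>y. (p2 y - p1 y) * (u1 y * u2 y))"
        by (intro dec_mult d' u)
      show "(W \<longlongrightarrow> 0) at_top"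
        unfolding W_def using assms by (intro wronskian_tendsto[OF u(1) _ u(2) _ u(3) _ u(4)]) auto
    qed (use assms in simp)
    also have "\<dots> \<le> d * (K * K) / 1" using assms d0 K by (intro divide_left_mono) auto
    finally have W: "\<bar>W 0\<bar> \<le> d * K\<^sup>2" by (simp add: power2_eq_square)
    \<comment> \<open>\<open>t\<close> and \<open>W 0\<close> are the cosine and sine of the angle
      between the two unit data vectors; the sign \<open>s\<close> makes the angle acute.\<close>
    define t where "t = u1 0 * u2 0 + v1 0 * v2 0"
    define s :: real where "s = (if 0 \<le> t then 1 else -1)"
    have s: "s \<in> {1, -1}" "s\<^sup>2 = 1" "s * t = \<bar>t\<bar>" by (auto simp: s_def)
    have "t\<^sup>2 + (W 0)\<^sup>2 = ((u1 0)\<^sup>2 + (v1 0)\<^sup>2) * ((u2 0)\<^sup>2 + (v2 0)\<^sup>2)"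
      unfolding t_def W_def by algebra
    hence tW: "t\<^sup>2 + (W 0)\<^sup>2 = 1" using boundD(2)[OF b(1)] boundD(2)[OF b(2)] by simp
    hence "t\<^sup>2 \<le> 1" using zero_le_power2[of "W 0"] by linarith
    hence "\<bar>t\<bar> \<le> 1" by (simp add: abs_square_le_1)
    hence "\<bar>t\<bar> * \<bar>t\<bar> \<le> 1 * \<bar>t\<bar>" by (intro mult_right_mono) auto
    hence "t\<^sup>2 \<le> \<bar>t\<bar>" by (simp add: power2_eq_square)
    hence tW': "1 - \<bar>t\<bar> \<le> (W 0)\<^sup>2" using tW by linarith
    \<comment> \<open>The squared distance of unit vectors is 2 - 2|t|, and 1 - |t| is at most the
      squared sine, so the distance is linear in d.\<close>
    have "(u1 0 - s * u2 0)\<^sup>2 + (v1 0 - s * v2 0)\<^sup>2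
      = ((u1 0)\<^sup>2 + (v1 0)\<^sup>2) + s\<^sup>2 * ((u2 0)\<^sup>2 + (v2 0)\<^sup>2) - 2 * (s * t)"
      unfolding t_def by algebra
    also have "\<dots> = 2 - 2 * \<bar>t\<bar>" using boundD(2)[OF b(1)] boundD(2)[OF b(2)] s by simp
    also have "\<dots> \<le> 2 * (W 0)\<^sup>2" using tW' by simp
    also have "\<dots> \<le> (2 * \<bar>W 0\<bar>)\<^sup>2" by (simp add: power_mult_distrib)
    also have "\<dots> \<le> (2 * (d * K\<^sup>2))\<^sup>2" using W by (intro power_mono) auto
    finally have "(u1 0 - s * u2 0)\<^sup>2 + (v1 0 - s * v2 0)\<^sup>2 \<le> (2 * (d * K\<^sup>2))\<^sup>2" .
    hence "(u1 0 - s * u2 0)\<^sup>2 \<le> (2 * (d * K\<^sup>2))\<^sup>2" "(v1 0 - s * v2 0)\<^sup>2 \<le> (2 * (d * K\<^sup>2))\<^sup>2"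
      using zero_le_power2[of "u1 0 - s * u2 0"] zero_le_power2[of "v1 0 - s * v2 0"] by linarith+
    moreover have "0 \<le> 2 * (d * K\<^sup>2)" using d0 by simp
    ultimately have dat: "\<bar>u1 0 - s * u2 0\<bar> \<le> 2 * (d * K\<^sup>2)" "\<bar>v1 0 - s * v2 0\<bar> \<le> 2 * (d * K\<^sup>2)"
      by (metis abs_le_square_iff abs_of_nonneg)+
    have so: "sol p1 (\<lambda>y. 0 + s * ((p2 y - p1 y) * u2 y)) (\<lambda>y. u1 y - s * u2 y) (\<lambda>y. v1 y - s * v2 y)"
      by (rule sol_diff[OF boundD(1)[OF b(1)] boundD(1)[OF b(2)]])
    have "dec (-1 + (l + 1)) (\<bar>s\<bar> * (d * K)) (\<lambda>y. s * ((p2 y - p1 y) * u2 y))"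
      by (intro dec_cmult dec_mult d' u)
    hence f: "dec l (d * K) (\<lambda>y. 0 + s * ((p2 y - p1 y) * u2 y))" using s by auto
    have su: "dec (l + 1) (K + \<bar>s\<bar> * K) (\<lambda>y. u1 y - s * u2 y)" by (intro dec_diff dec_cmult u)
    have "dec l (C * (2 * (d * K\<^sup>2) + d * K)) (\<lambda>y. u1 y - s * u2 y)"
      using assms by (intro F[OF a(1) so f dat dec_tendsto[OF su]]) auto
    moreover have "C * (2 * (d * K\<^sup>2) + d * K) \<le> C' * d" using d0 unfolding C'_def by (simp add: algebra_simps)
    ultimately have 1: "dec l (C' * d) (\<lambda>y. u1 y - s * u2 y)" by (blast intro: dec_mono)
    have "0 \<le> C * (2 * K\<^sup>2 + K) * d" using C K d0 by simp
    hence "2 * (d * K\<^sup>2) \<le> C' * d" unfolding C'_def by (simp add: algebra_simps)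
    with dat(2) have 2: "\<bar>v1 0 - s * v2 0\<bar> \<le> C' * d" by linarith
    show "\<exists>s\<in>{1, -1}. dec l (C' * d) (\<lambda>y. u1 y - s * u2 y) \<and> \<bar>v1 0 - s * v2 0\<bar> \<le> C' * d"
      using 1 2 s(1) by blast
  qed
qed

text \<open>The integrated Wronskian identity. For potentials differing by a constant it is
  orthogonality of eigenfunctions; in general it expresses an energy difference through overlap
  integrals.\<close>

lemma bound_orthogonal:
  assumes a: "adm \<mu> M p1" "adm \<mu> M p2" "0 < \<mu>" and b: "bound p1 u1 v1" "bound p2 u2 v2"
  shows "(LBINT y. (p2 y - p1 y) * (u1 y * u2 y)) = 0"
proof -
  have M: "0 \<le> M" using a(1) by (rule adm_nonneg)
  obtain K where K: "1 \<le> K" "\<And>p u v. adm \<mu> M p \<Longrightarrow> bound p u v \<Longrightarrow> dec 2 K u \<and> dec 2 K v"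
    using bound_dec[of \<mu> M 2] a M by auto
  have u: "dec 2 K u1" "dec 2 K v1" "dec 2 K u2" "dec 2 K v2"
    using K(2)[OF a(1) b(1)] K(2)[OF a(2) b(2)] by auto
  have pp: "dec (-1) (2 * M + 2 * M) (\<lambda>y. p2 y - p1 y)"
  proof (rule dec_diff)
    have "\<bar>p y\<bar> \<le> 2 * M * wt (-1) y" if "adm \<mu> M p" for p y
      using adm_abs[OF that a(3), of y] mult_left_mono[OF exp_abs_ge M, of y] by simp
    thus "dec (-1) (2 * M) p2" "dec (-1) (2 * M) p1" using a by (auto simp: dec_def)
  qed
  show ?thesis
  proof (rule integral_deriv_zero)
    show "((\<lambda>y. u1 y * v2 y - v1 y * u2 y) has_real_derivative (p2 y - p1 y) * (u1 y * u2 y)) (at y)" for y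
      using wronskian_deriv[OF boundD(1)[OF b(1)] boundD(1)[OF b(2)], of y] by simp
    show "continuous_on UNIV (\<lambda>y. (p2 y - p1 y) * (u1 y * u2 y))"
      by (intro continuous_intros admD(1)[OF a(1)] admD(1)[OF a(2)] sol_cont[OF boundD(1)[OF b(1)]] sol_cont[OF boundD(1)[OF b(2)]])
    show "dec (2 + 2) (K * K + K * K) (\<lambda>y. u1 y * v2 y - v1 y * u2 y)"
      by (intro dec_diff dec_mult u)
    show "dec (-1 + (2 + 2)) ((2 * M + 2 * M) * (K * K)) (\<lambda>y. (p2 y - p1 y) * (u1 y * u2 y))"
      by (intro dec_mult u pp)
  qed auto
qed

text \<open>Near 0 the solution is u(0) + v(0) y up to a quadratic error. Either |u(0)| dominates
  close to 0, or |v(0)| is at least 1/2 and the linear term dominates near the end of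
  [0, h].\<close>

lemma unit_lower:
  assumes "0 < \<mu>" "0 \<le> M"
  obtains \<kappa> h where "0 < \<kappa>" "0 < h"
    "\<And>p u v. adm \<mu> M p \<Longrightarrow> sol p (\<lambda>_. 0) u v \<Longrightarrow> (u 0)\<^sup>2 + (v 0)\<^sup>2 = 1 \<Longrightarrow>
      \<exists>a. 0 \<le> a \<and> a + h \<le> 1 \<and> (\<forall>y. a \<le> y \<longrightarrow> y \<le> a + h \<longrightarrow> \<kappa> \<le> (u y)\<^sup>2)"
proof -
  define L where "L = M * (1 + 1\<^sup>2) * gron (M * (1 + 1\<^sup>2)) 1 + 1"
  have L: "1 \<le> L" using assms by (simp add: L_def)
  \<comment> \<open>This makes the quadratic error L h^2 equal to h/16, so a linear part of size h/8
    leaves |u| at least h/16.\<close>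
  define h where "h = 1 / (16 * L)"
  have h: "0 < h" "h \<le> 1 / 16" "L * h\<^sup>2 = h / 16"
    using L by (auto simp: h_def power2_eq_square divide_simps)
  show thesis
  proof (rule that[of "(h/16)\<^sup>2" "h/8"])
    fix p u v assume a: "adm \<mu> M p" and s: "sol p (\<lambda>_. 0) u v" and unit: "(u 0)\<^sup>2 + (v 0)\<^sup>2 = 1"
    have "(u 0)\<^sup>2 \<le> 1\<^sup>2" "(v 0)\<^sup>2 \<le> 1\<^sup>2" using unit zero_le_power2[of "u 0"] zero_le_power2[of "v 0"]
      unfolding one_power2 by linarith+
    hence uv1: "\<bar>u 0\<bar> \<le> 1" "\<bar>v 0\<bar> \<le> 1" by (simp_all add: abs_square_le_1)
    have pL: "\<bar>p y\<bar> \<le> M * (1 + 1\<^sup>2)" if "0 \<le> y" "y \<le> 1" for y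
      using adm_abs_le[OF a assms(1), of y 1] that by simp
    have w: "\<bar>p y * u y\<bar> \<le> L" if y: "0 \<le> y" "y \<le> 1" for y
    proof -
      have "\<bar>u y\<bar> \<le> gron (M * (1 + 1\<^sup>2)) 1 * (1 + 0)"
        by (rule gronwall(1)[OF s pL _ uv1 y]) auto
      hence "\<bar>p y * u y\<bar> \<le> M * (1 + 1\<^sup>2) * gron (M * (1 + 1\<^sup>2)) 1"
        unfolding abs_mult using pL[OF y] assms by (intro mult_mono) auto
      thus ?thesis by (simp add: L_def)
    qed
    have v: "\<bar>v y - v 0\<bar> \<le> L * y" if y: "0 \<le> y" "y \<le> 1" for y
    proof -
      have "norm (v y - v 0) \<le> L * norm (y - 0)"
        by (rule field_differentiable_bound[where S = "{0..1}" and f' = "\<lambda>y. p y * u y"])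
          (use y w solD(2)[OF s] in \<open>auto intro: has_field_derivative_at_within\<close>)
      thus ?thesis using y by simp
    qed
    have u: "\<bar>u y - u 0 - v 0 * y\<bar> \<le> L * h * y" if y: "0 \<le> y" "y \<le> h" for y
    proof -
      have "norm ((u y - v 0 * y) - (u 0 - v 0 * 0)) \<le> L * h * norm (y - 0)"
      proof (rule field_differentiable_bound[where S = "{0..h}" and f' = "\<lambda>y. v y - v 0"])
        show "((\<lambda>y. u y - v 0 * y) has_real_derivative v z - v 0) (at z within {0..h})" for z
          by (auto intro!: derivative_eq_intros has_field_derivative_at_within[OF solD(1)[OF s]])
        fix z assume z: "z \<in> {0..h}"
        hence "L * z \<le> L * h" using L by simp
        thus "norm (v z - v 0) \<le> L * h" using v[of z] z h by simp
      qed (use y in auto)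
      thus ?thesis using y by (simp add: algebra_simps)
    qed
    have lin: "\<bar>u 0 + v 0 * y\<bar> - h / 16 \<le> \<bar>u y\<bar>" if y: "0 \<le> y" "y \<le> h" for y
    proof -
      have "L * h * y \<le> L * h * h" using y L h by (intro mult_left_mono) auto
      also have "\<dots> = h / 16" using h(3) by (simp add: power2_eq_square mult.assoc)
      finally show ?thesis using u[OF y] by linarith
    qed
    have fin: "(h/16)\<^sup>2 \<le> (u y)\<^sup>2" if "0 \<le> y" "y \<le> h" "h / 8 \<le> \<bar>u 0 + v 0 * y\<bar>" for y
    proof -
      have "h / 16 \<le> \<bar>u y\<bar>" using lin[OF that(1,2)] that(3) by linarith
      thus ?thesis using h by (metis abs_le_square_iff abs_of_pos divide_pos_pos zero_less_numeral)
    qed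
    show "\<exists>a. 0 \<le> a \<and> a + h / 8 \<le> 1 \<and> (\<forall>y. a \<le> y \<longrightarrow> y \<le> a + h/8 \<longrightarrow> (h/16)\<^sup>2 \<le> (u y)\<^sup>2)"
    proof (cases "h / 4 \<le> \<bar>u 0\<bar>")
      case True
      have "(h/16)\<^sup>2 \<le> (u y)\<^sup>2" if y: "0 \<le> y" "y \<le> 0 + h / 8" for y
      proof (rule fin)
        have "\<bar>v 0 * y\<bar> \<le> 1 * (h / 8)" unfolding abs_mult using uv1 y by (intro mult_mono) auto
        thus "h / 8 \<le> \<bar>u 0 + v 0 * y\<bar>" using True by linarith
      qed (use y h in auto)
      thus ?thesis using h by (intro exI[of _ 0]) auto
    next
      case False
      have "\<bar>u 0\<bar> \<le> 1 / 4" using False h by linarith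
      hence "\<bar>u 0\<bar>\<^sup>2 \<le> (1 / 4)\<^sup>2" by (intro power_mono) auto
      hence "(1/2)\<^sup>2 \<le> (v 0)\<^sup>2" using unit by (simp add: power2_eq_square)
      hence v0: "1 / 2 \<le> \<bar>v 0\<bar>" using abs_le_square_iff[of "1/2" "v 0"] by simp
      \<comment> \<open>Here the linear term is at least 7h/16 and the constant term below h/4,
        which leaves more than h/8.\<close>
      have "(h/16)\<^sup>2 \<le> (u y)\<^sup>2" if y: "7 / 8 * h \<le> y" "y \<le> 7 / 8 * h + h / 8" for y
      proof (rule fin)
        have "1 / 2 * (7 / 8 * h) \<le> \<bar>v 0 * y\<bar>" unfolding abs_mult using v0 y h by (intro mult_mono) auto
        thus "h / 8 \<le> \<bar>u 0 + v 0 * y\<bar>" using False h by linarith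
      qed (use y h in auto)
      thus ?thesis using h by (intro exI[of _ "7 / 8 * h"]) auto
    qed
  qed (use h in auto)
qed

lemma bound_norm_lower:
  assumes "0 < \<mu>" "0 \<le> M"
  obtains \<kappa> where "0 < \<kappa>" "\<And>p u v. adm \<mu> M p \<Longrightarrow> bound p u v \<Longrightarrow> \<kappa> \<le> (LBINT y. (u y)\<^sup>2)"
proof -
  obtain \<kappa> h where k: "0 < \<kappa>" "0 < h"
    "\<And>p u v. adm \<mu> M p \<Longrightarrow> sol p (\<lambda>_. 0) u v \<Longrightarrow> (u 0)\<^sup>2 + (v 0)\<^sup>2 = 1 \<Longrightarrow>
      \<exists>a. 0 \<le> a \<and> a + h \<le> 1 \<and> (\<forall>y. a \<le> y \<longrightarrow> y \<le> a + h \<longrightarrow> \<kappa> \<le> (u y)\<^sup>2)"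
    using unit_lower[OF assms] by metis
  show thesis
  proof (rule that[of "\<kappa> * h"])
    fix p u v assume *: "adm \<mu> M p" "bound p u v"
    obtain a where "\<forall>y. a \<le> y \<longrightarrow> y \<le> a + h \<longrightarrow> \<kappa> \<le> (u y)\<^sup>2"
      using k(3)[OF *(1) boundD(1,2)[OF *(2)]] by blast
    hence "\<kappa> * ((a + h) - a) \<le> (LBINT y. (u y)\<^sup>2)"
      using k by (intro integral_lower_bound[OF boundD(5)[OF *(2)]]) auto
    thus "\<kappa> * h \<le> (LBINT y. (u y)\<^sup>2)" by simp
  qed (use k in simp)
qed

section \<open>Stability of eigenvalues\<close>

text \<open>Subtracting K e^{-y} from G absorbs the error in its derivative, so the total loss is at
  most K and the gain \<open>m\<close> on an interval of length \<open>h\<close> survives.\<close>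

lemma growth_lower:
  fixes G g :: "real \<Rightarrow> real"
  assumes d: "\<And>y. (G has_real_derivative g y) (at y)"
    and g: "\<And>y. 0 \<le> y \<Longrightarrow> y \<le> N \<Longrightarrow> - K * exp (- y) \<le> g y"
    and gm: "\<And>y. a \<le> y \<Longrightarrow> y \<le> a + h \<Longrightarrow> m - K * exp (- y) \<le> g y"
    and "0 \<le> a" "0 \<le> h" "a + h \<le> N" "0 \<le> K"
  shows "m * h - K \<le> G N - G 0"
proof -
  define H where "H = (\<lambda>y. G y - K * exp (- y))"
  have dH: "(H has_real_derivative g y + K * exp (- y)) (at y)" for y
    unfolding H_def by (auto intro!: derivative_eq_intros d)
  have inc: "H x \<le> H z" if "0 \<le> x" "x \<le> z" "z \<le> N" for x z
  proof (rule DERIV_nonneg_imp_nondecreasing[OF that(2)])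
    fix y assume "x \<le> y" "y \<le> z"
    hence "0 \<le> g y + K * exp (- y)" using g[of y] that by simp
    thus "\<exists>d. (H has_real_derivative d) (at y) \<and> 0 \<le> d" using dH by blast
  qed
  have "H a - m * a \<le> H (a + h) - m * (a + h)"
  proof (rule DERIV_nonneg_imp_nondecreasing[of a "a + h" "\<lambda>y. H y - m * y"])
    fix y assume "a \<le> y" "y \<le> a + h"
    hence "0 \<le> g y + K * exp (- y) - m" using gm[of y] by simp
    moreover have "((\<lambda>y. H y - m * y) has_real_derivative g y + K * exp (- y) - m) (at y)"
      by (auto intro!: derivative_eq_intros dH)
    ultimately show "\<exists>d. ((\<lambda>y. H y - m * y) has_real_derivative d) (at y) \<and> 0 \<le> d" by blast
  qed (use assms in simp)
  hence "m * h \<le> H (a + h) - H a" by (simp add: algebra_simps)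
  also have "\<dots> \<le> H N - H 0" using inc[of 0 a] inc[of "a + h" N] assms by simp
  also have "\<dots> \<le> G N - G 0 + K" using assms by (simp add: H_def)
  finally show ?thesis by simp
qed

lemma adm_shift:
  assumes "adm \<mu> M p" "\<bar>e\<bar> \<le> 1"
  shows "adm \<mu> (M + 1) (\<lambda>y. p y - e)"
  unfolding adm_def
proof (intro conjI allI)
  show "continuous_on UNIV (\<lambda>y. p y - e)" using admD(1)[OF assms(1)] by (intro continuous_intros)
  fix y
  show "\<mu> * y\<^sup>2 - (M + 1) \<le> p y - e" using admD(2)[OF assms(1), of y] assms(2) by simp
  have "p y - e \<le> M * (1 + y\<^sup>2) + 1" using admD(3)[OF assms(1), of y] assms(2) by simp
  also have "\<dots> \<le> (M + 1) * (1 + y\<^sup>2)" by (simp add: algebra_simps)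
  finally show "p y - e \<le> (M + 1) * (1 + y\<^sup>2)" .
qed

text \<open>The sine of the angle between the data of u and \<psi> is the Wronskian at 0, hence
  minus the integral of (p0 - p + e) u \<psi> up to a boundary term at N. All contributions are
  small, which is the first bound. When e = c \<eta> and the angle is acute, u is close to t \<psi>,
  so the integral contains e t times that of \<psi>^2, and this term of size \<eta> \<kappa> fixes
  the sign of the sine.\<close>

lemma shoot_core:
  assumes "0 < \<mu>" "0 \<le> M"
  obtains K \<kappa> N0 where "1 \<le> K" "0 < \<kappa>" "0 \<le> N0"
    "\<And>p0 p \<psi> \<psi>' e \<eta> \<delta> u v N. adm \<mu> M p0 \<Longrightarrow> adm \<mu> M p \<Longrightarrow> bound p0 \<psi> \<psi>' \<Longrightarrow>
      dec (-1) \<delta> (\<lambda>y. p y - p0 y) \<Longrightarrow> \<bar>e\<bar> \<le> \<eta> \<Longrightarrow> \<eta> \<le> 1 \<Longrightarrow> N0 \<le> N \<Longrightarrow>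
      sol (\<lambda>y. p y - e) (\<lambda>_. 0) u v \<Longrightarrow> (u 0)\<^sup>2 + (v 0)\<^sup>2 = 1 \<Longrightarrow> u N = 0 \<Longrightarrow>
      \<bar>u 0 * \<psi>' 0 - v 0 * \<psi> 0\<bar> \<le> K * (\<eta> + \<delta> + exp (- N)) \<and>
      (\<forall>c\<in>{1,-1}. 1 / 2 \<le> u 0 * \<psi> 0 + v 0 * \<psi>' 0 \<longrightarrow> e = c * \<eta> \<longrightarrow>
         c * (u 0 * \<psi>' 0 - v 0 * \<psi> 0) \<le> K * (\<eta>\<^sup>2 + \<delta> + exp (- N)) - \<eta> * \<kappa>)"
proof -
  have M1: "0 \<le> M + 1" using assms by simp
  obtain C3 N3 where C3: "1 \<le> C3" "0 \<le> N3" and H3: "\<And>p f u v S B N \<epsilon> y. adm \<mu> (M+1) p \<Longrightarrow> sol p f u v \<Longrightarrow> N3 \<le> N \<Longrightarrow>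
       (\<And>y. 0 \<le> y \<Longrightarrow> y \<le> N \<Longrightarrow> \<bar>f y\<bar> \<le> B * exp (- (3 * y))) \<Longrightarrow>
       \<bar>u 0\<bar> \<le> S \<Longrightarrow> \<bar>v 0\<bar> \<le> S \<Longrightarrow> \<bar>u N\<bar> \<le> \<epsilon> \<Longrightarrow> 0 \<le> y \<Longrightarrow> y \<le> N \<Longrightarrow>
       \<bar>u y\<bar> \<le> C3 * (S + B) * exp (- (3 * y)) + \<epsilon>"
    using half_line[of \<mu> "M + 1" 3, OF assms(1) M1] by (metis zero_le_numeral)
  obtain C2 N2 where C2: "1 \<le> C2" "0 \<le> N2" and H2: "\<And>p f u v S B N \<epsilon> y. adm \<mu> (M+1) p \<Longrightarrow> sol p f u v \<Longrightarrow> N2 \<le> N \<Longrightarrow>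
       (\<And>y. 0 \<le> y \<Longrightarrow> y \<le> N \<Longrightarrow> \<bar>f y\<bar> \<le> B * exp (- (2 * y))) \<Longrightarrow>
       \<bar>u 0\<bar> \<le> S \<Longrightarrow> \<bar>v 0\<bar> \<le> S \<Longrightarrow> \<bar>u N\<bar> \<le> \<epsilon> \<Longrightarrow> 0 \<le> y \<Longrightarrow> y \<le> N \<Longrightarrow>
       \<bar>u y\<bar> \<le> C2 * (S + B) * exp (- (2 * y)) + \<epsilon>"
    using half_line[of \<mu> "M + 1" 2, OF assms(1) M1] by (metis zero_le_numeral)
  obtain CC where CC: "1 \<le> CC" "\<And>p u v. adm \<mu> M p \<Longrightarrow> bound p u v \<Longrightarrow> dec 3 CC u \<and> dec 3 CC v"
    using bound_dec[of \<mu> M 3] assms by auto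
  obtain \<kappa>0 h where kh: "0 < \<kappa>0" "0 < h"
    "\<And>p u v. adm \<mu> M p \<Longrightarrow> sol p (\<lambda>_. 0) u v \<Longrightarrow> (u 0)\<^sup>2 + (v 0)\<^sup>2 = 1 \<Longrightarrow>
      \<exists>a. 0 \<le> a \<and> a + h \<le> 1 \<and> (\<forall>y. a \<le> y \<longrightarrow> y \<le> a + h \<longrightarrow> \<kappa>0 \<le> (u y)\<^sup>2)"
    using unit_lower[OF assms] by metis
  define A where "A = max C3 CC"
  have A: "1 \<le> A" "C3 \<le> A" "CC \<le> A" using C3 by (auto simp: A_def)
  define Cv where "Cv = 2 * A + 2 * (M + 1) * A"
  have Cv: "0 \<le> Cv" using A assms by (simp add: Cv_def)
  define Ka where "Ka = Cv * A + A * A"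
  have Ka: "0 \<le> Ka" using A Cv by (simp add: Ka_def)
  define K4 where "K4 = C2 * (Ka + A) + A"
  have K4: "1 \<le> K4" using A Ka C2 by (simp add: K4_def add_increasing)
  define K where "K = K4 * A + A * A + Cv * A"
  have AA: "1 \<le> A * A" using A mult_mono[of 1 A 1 A] by simp
  have K4A: "0 \<le> K4 * A" using K4 A by simp
  have "0 \<le> Cv * A" using Cv A by simp
  hence K: "1 \<le> K" "Ka \<le> K" unfolding K_def Ka_def using AA K4A by linarith+
  show thesis
  proof (rule that[of K "\<kappa>0 * h / 2" "max 1 (max N2 N3)"])
    fix p0 p \<psi> \<psi>' e \<eta> \<delta> u v N
    assume a: "adm \<mu> M p0" "adm \<mu> M p" and b: "bound p0 \<psi> \<psi>'" and dl: "dec (-1) \<delta> (\<lambda>y. p y - p0 y)"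
      and e: "\<bar>e\<bar> \<le> \<eta>" "\<eta> \<le> 1" and N: "max 1 (max N2 N3) \<le> N"
      and s: "sol (\<lambda>y. p y - e) (\<lambda>_. 0) u v" and unit: "(u 0)\<^sup>2 + (v 0)\<^sup>2 = 1" and uN: "u N = 0"
    have N1: "1 \<le> N" "N2 \<le> N" "N3 \<le> N" using N by auto
    have \<eta>: "0 \<le> \<eta>" using e by simp
    have \<delta>: "0 \<le> \<delta>" using dl by (rule dec_nonneg)
    have ae: "adm \<mu> (M + 1) (\<lambda>y. p y - e)" using adm_shift[OF a(2)] e by simp
    have "(u 0)\<^sup>2 \<le> 1\<^sup>2" "(v 0)\<^sup>2 \<le> 1\<^sup>2" using unit zero_le_power2[of "u 0"] zero_le_power2[of "v 0"]
      unfolding one_power2 by linarith+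
    hence uv1: "\<bar>u 0\<bar> \<le> 1" "\<bar>v 0\<bar> \<le> 1" by (simp_all add: abs_square_le_1)
    have \<psi>b: "\<bar>\<psi> y\<bar> \<le> A * exp (- (3 * y))" if "0 \<le> y" for y
    proof -
      have "\<bar>\<psi> y\<bar> \<le> CC * wt 3 y" using CC(2)[OF a(1) b] by (blast intro: decD)
      also have "\<dots> \<le> A * wt 3 y" using A by (intro mult_right_mono) auto
      finally show ?thesis using that by (simp add: wt_def)
    qed
    have ub: "\<bar>u y\<bar> \<le> A * exp (- (3 * y))" if "0 \<le> y" "y \<le> N" for y
    proof -
      have "\<bar>u y\<bar> \<le> C3 * (1 + 0) * exp (- (3 * y)) + 0"
        by (rule H3[OF ae s N1(3) _ uv1 _ that]) (use uN in auto)
      also have "\<dots> \<le> A * exp (- (3 * y))" using A by simp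
      finally show ?thesis .
    qed
    have \<delta>b: "\<bar>p0 y - p y\<bar> \<le> \<delta> * exp y" if "0 \<le> y" for y
      using decD[OF dl, of y] that by (simp add: wt_def abs_minus_commute)
    have eb: "exp (- (k * y)) \<le> 1" if "0 \<le> y" "0 \<le> k" for k y :: real using that by simp
    have emono: "exp (- (k * y)) \<le> exp (- (j * y))" if "0 \<le> y" "j \<le> k" for j k y :: real
      using that by (simp add: mult_right_mono)
    \<comment> \<open>Boundedness is enough here: since u vanishes at N, the Wronskian there is -v
      \<psi>, and \<psi> supplies the factor e^{-N}.\<close>
    have vN: "\<bar>v N\<bar> \<le> Cv"
      unfolding Cv_def
    proof (rule deriv_local[of "N - 1" u v "\<lambda>y. (p y - e) * u y"])
      fix y assume y: "N - 1 \<le> y" "y \<le> N - 1 + 1"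
      hence y0: "0 \<le> y" "y \<le> N" using N1 by auto
      have "A * exp (- (3 * y)) \<le> A * 1" using A y0 by (intro mult_left_mono) auto
      thus "\<bar>u y\<bar> \<le> A" using ub[OF y0] by linarith
      have "\<bar>p y - e\<bar> \<le> (M + 1) * (1 + y\<^sup>2)" by (rule adm_abs[OF ae assms(1)])
      also have "\<dots> \<le> (M + 1) * (2 * wt (-1) y)" using exp_abs_ge M1 by (intro mult_left_mono)
      finally have "\<bar>(p y - e) * u y\<bar> \<le> ((M + 1) * (2 * wt (-1) y)) * (A * exp (- (3 * y)))"
        unfolding abs_mult using ub[OF y0] by (intro mult_mono) auto
      also have "\<dots> = 2 * (M + 1) * A * (wt (-1) y * wt 3 y)" using y0 by (simp add: wt_def)
      also have "\<dots> \<le> 2 * (M + 1) * A * 1" unfolding wt_mult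
        using A M1 by (intro mult_left_mono) (auto simp: wt_def)
      finally show "\<bar>(p y - e) * u y\<bar> \<le> 2 * (M + 1) * A" by simp
    qed (use solD[OF s] in auto)
    define W where "W = (\<lambda>y. u y * \<psi>' y - v y * \<psi> y)"
    define W' where "W' = (\<lambda>y. (p0 y - (p y - e)) * (u y * \<psi> y))"
    have dW: "(W has_real_derivative W' y) (at y)" for y
      using wronskian_deriv[OF s boundD(1)[OF b], of y] by (simp add: W_def W'_def)
    have WN: "\<bar>W N\<bar> \<le> Cv * A * exp (- N)"
    proof -
      have "\<bar>W N\<bar> = \<bar>v N\<bar> * \<bar>\<psi> N\<bar>" by (simp add: W_def uN abs_mult)
      also have "A * exp (- (3 * N)) \<le> A * exp (- N)" using A N1 by (intro mult_left_mono) auto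
      hence "\<bar>v N\<bar> * \<bar>\<psi> N\<bar> \<le> Cv * (A * exp (- N))"
        using vN \<psi>b[of N] N1 Cv by (intro mult_mono) auto
      finally show ?thesis by simp
    qed
    have ex: "exp y * exp (- (6 * y)) \<le> exp (- y)" "exp (- (6 * y)) \<le> exp (- y)" "exp y * exp (- (3 * y)) = exp (- (2 * y))"
      "exp (- (3 * y)) \<le> exp (- (2 * y))" "exp (- (2 * y)) * exp (- (3 * y)) \<le> exp (- y)" if "0 \<le> y" for y :: real
      using that by (auto simp: exp_add[symmetric])
    have u\<psi>: "\<bar>u y * \<psi> y\<bar> \<le> A * A * exp (- (6 * y))" if y: "0 \<le> y" "y \<le> N" for y
    proof -
      have "\<bar>u y * \<psi> y\<bar> \<le> (A * exp (- (3 * y))) * (A * exp (- (3 * y)))"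
        unfolding abs_mult using ub[OF y] \<psi>b[OF y(1)] A by (intro mult_mono) auto
      also have "\<dots> = A * A * exp (- (3 * y) + - (3 * y))" unfolding exp_add by simp
      finally show ?thesis by (simp add: algebra_simps)
    qed
    have p0u: "\<bar>(p0 y - p y) * (u y * \<psi> y)\<bar> \<le> \<delta> * (A * A) * exp (- y)" if y: "0 \<le> y" "y \<le> N" for y
    proof -
      have "\<bar>(p0 y - p y) * (u y * \<psi> y)\<bar> \<le> (\<delta> * exp y) * (A * A * exp (- (6 * y)))"
        using \<delta>b[OF y(1)] u\<psi>[OF y] \<delta> unfolding abs_mult[of "p0 y - p y"] by (intro mult_mono) auto
      also have "\<dots> = \<delta> * (A * A) * (exp y * exp (- (6 * y)))" by simp
      also have "\<dots> \<le> \<delta> * (A * A) * exp (- y)" using ex(1)[OF y(1)] \<delta> A by (intro mult_left_mono) auto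
      finally show ?thesis .
    qed
    have W'b: "\<bar>W' y\<bar> \<le> (\<delta> + \<eta>) * (A * A) * exp (- y)" if y: "0 \<le> y" "y \<le> N" for y
    proof -
      have "\<bar>e * (u y * \<psi> y)\<bar> \<le> \<eta> * (A * A * exp (- (6 * y)))"
        unfolding abs_mult[of e] using u\<psi>[OF y] e \<eta> by (intro mult_mono) auto
      also have "\<dots> \<le> \<eta> * (A * A * exp (- y))" using ex(2)[OF y(1)] \<eta> A by (intro mult_left_mono) auto
      finally have "\<bar>e * (u y * \<psi> y)\<bar> \<le> \<eta> * (A * A * exp (- y))" .
      moreover have "W' y = (p0 y - p y) * (u y * \<psi> y) + e * (u y * \<psi> y)" by (simp add: W'_def algebra_simps)
      ultimately show ?thesis using p0u[OF y] by (simp add: algebra_simps)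
    qed
    have W0c: "c * W 0 \<le> (\<delta> + \<eta>) * (A * A) + c * W N" if c: "c \<in> {1, -1}" for c
    proof -
      have "0 * 0 - (\<delta> + \<eta>) * (A * A) \<le> c * W N - c * W 0"
      proof (rule growth_lower[where a = 0 and g = "\<lambda>y. c * W' y"])
        show "((\<lambda>y. c * W y) has_real_derivative c * W' y) (at y)" for y
          by (auto intro!: derivative_eq_intros dW)
        show "- ((\<delta> + \<eta>) * (A * A)) * exp (- y) \<le> c * W' y" if "0 \<le> y" "y \<le> N" for y
          using W'b[OF that] c by auto
        show "0 - ((\<delta> + \<eta>) * (A * A)) * exp (- y) \<le> c * W' y" if "0 \<le> y" "y \<le> 0 + 0" for y
        proof -
          have "0 \<le> y" "y \<le> N" using that N1 by auto
          from W'b[OF this] c show ?thesis by auto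
        qed
      qed (use \<delta> \<eta> A N1 in auto)
      thus ?thesis by simp
    qed
    define \<omega> where "\<omega> = W 0"
    define t where "t = u 0 * \<psi> 0 + v 0 * \<psi>' 0"
    have e1: "exp (- N) \<le> 1" using N1 by simp
    have Q: "0 \<le> \<eta> + \<delta> + exp (- N)" using \<eta> \<delta> by (simp add: add_nonneg_nonneg)
    have \<omega>: "\<bar>\<omega>\<bar> \<le> Ka * (\<eta> + \<delta> + exp (- N))"
    proof -
      have "\<bar>\<omega>\<bar> \<le> (\<delta> + \<eta>) * (A * A) + Cv * A * exp (- N)"
        using W0c[of 1] W0c[of "-1"] WN unfolding \<omega>_def by auto
      also have "\<dots> \<le> (\<delta> + \<eta>) * Ka + Ka * exp (- N)"
        using \<delta> \<eta> A Cv unfolding Ka_def by (intro add_mono mult_left_mono mult_right_mono) auto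
      finally show ?thesis by (simp add: algebra_simps)
    qed
    have "t\<^sup>2 + \<omega>\<^sup>2 = ((u 0)\<^sup>2 + (v 0)\<^sup>2) * ((\<psi> 0)\<^sup>2 + (\<psi>' 0)\<^sup>2)"
      unfolding t_def \<omega>_def W_def by algebra
    hence "t\<^sup>2 + \<omega>\<^sup>2 = 1" using unit boundD(2)[OF b] by simp
    hence "t\<^sup>2 \<le> 1" using zero_le_power2[of \<omega>] by linarith
    hence t1: "\<bar>t\<bar> \<le> 1" by (simp add: abs_square_le_1)
    \<comment> \<open>What remains of u after removing its component along \<psi>. It has size
      \<eta> + \<delta> + e^{-N}, and it enters below multiplied by \<eta>, hence at second
      order.\<close>
    define D where "D = (\<lambda>y. u y - t * \<psi> y)"
    define E where "E = (\<lambda>y. v y - t * \<psi>' y)"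
    have sD: "sol (\<lambda>y. p y - e) (\<lambda>y. 0 + t * ((p0 y - (p y - e)) * \<psi> y)) D E"
      unfolding D_def E_def by (rule sol_diff[OF s boundD(1)[OF b]])
    \<comment> \<open>The data of \<psi> form a unit vector, so removing the component t leaves
      \<omega> times the rotated vector.\<close>
    have D0: "D 0 = \<psi>' 0 * \<omega>" "E 0 = - (\<psi> 0 * \<omega>)"
    proof -
      have "D 0 = u 0 * ((\<psi> 0)\<^sup>2 + (\<psi>' 0)\<^sup>2) - t * \<psi> 0" "E 0 = v 0 * ((\<psi> 0)\<^sup>2 + (\<psi>' 0)\<^sup>2) - t * \<psi>' 0"
        using boundD(2)[OF b] by (auto simp: D_def E_def)
      thus "D 0 = \<psi>' 0 * \<omega>" "E 0 = - (\<psi> 0 * \<omega>)" unfolding t_def \<omega>_def W_def by algebra+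
    qed
    have D0b: "\<bar>D 0\<bar> \<le> \<bar>\<omega>\<bar>" "\<bar>E 0\<bar> \<le> \<bar>\<omega>\<bar>"
      using boundD(3,4)[OF b] mult_right_mono[of "\<bar>\<psi>' 0\<bar>" 1 "\<bar>\<omega>\<bar>"] mult_right_mono[of "\<bar>\<psi> 0\<bar>" 1 "\<bar>\<omega>\<bar>"]
      unfolding D0 by (auto simp: abs_mult)
    have fD: "\<bar>0 + t * ((p0 y - (p y - e)) * \<psi> y)\<bar> \<le> (\<delta> + \<eta>) * A * exp (- (2 * y))" if y: "0 \<le> y" for y
    proof -
      have "\<bar>p0 y - (p y - e)\<bar> \<le> \<delta> * exp y + \<eta> * exp y"
      proof -
        have "\<eta> * 1 \<le> \<eta> * exp y" using \<eta> y by (intro mult_left_mono) auto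
        thus ?thesis using \<delta>b[OF y] e by linarith
      qed
      hence "\<bar>(p0 y - (p y - e)) * \<psi> y\<bar> \<le> (\<delta> * exp y + \<eta> * exp y) * (A * exp (- (3 * y)))"
        unfolding abs_mult using \<psi>b[OF y] \<delta> \<eta> by (intro mult_mono) auto
      also have "\<dots> = (\<delta> + \<eta>) * A * (exp y * exp (- (3 * y)))" by (simp add: algebra_simps)
      finally have *: "\<bar>(p0 y - (p y - e)) * \<psi> y\<bar> \<le> (\<delta> + \<eta>) * A * exp (- (2 * y))" unfolding ex(3)[OF y] .
      have "\<bar>t * ((p0 y - (p y - e)) * \<psi> y)\<bar> \<le> 1 * \<bar>(p0 y - (p y - e)) * \<psi> y\<bar>"
        unfolding abs_mult[of t] using t1 by (intro mult_right_mono) auto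
      thus ?thesis using * by simp
    qed
    have Db: "\<bar>D y\<bar> \<le> K4 * (\<eta> + \<delta> + exp (- N)) * exp (- (2 * y))" if y: "0 \<le> y" "y \<le> N" for y
    proof -
      have DN: "\<bar>D N\<bar> \<le> A * exp (- (3 * N))"
      proof -
        have "\<bar>D N\<bar> = \<bar>t\<bar> * \<bar>\<psi> N\<bar>" by (simp add: D_def uN abs_mult)
        also have "\<dots> \<le> 1 * (A * exp (- (3 * N)))" using t1 \<psi>b[of N] N1 by (intro mult_mono) auto
        finally show ?thesis by simp
      qed
      have "\<bar>D y\<bar> \<le> C2 * (\<bar>\<omega>\<bar> + (\<delta> + \<eta>) * A) * exp (- (2 * y)) + A * exp (- (3 * N))"
        by (rule H2[OF ae sD N1(2) fD D0b DN y]) auto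
      also have "C2 * (\<bar>\<omega>\<bar> + (\<delta> + \<eta>) * A) * exp (- (2 * y)) \<le> C2 * ((Ka + A) * (\<eta> + \<delta> + exp (- N))) * exp (- (2 * y))"
      proof (intro mult_right_mono mult_left_mono)
        have "(\<delta> + \<eta>) * A \<le> (\<eta> + \<delta> + exp (- N)) * A" using A by (intro mult_right_mono) auto
        thus "\<bar>\<omega>\<bar> + (\<delta> + \<eta>) * A \<le> (Ka + A) * (\<eta> + \<delta> + exp (- N))" using \<omega> by (simp add: algebra_simps)
      qed (use C2 in auto)
      also have "A * exp (- (3 * N)) \<le> A * ((\<eta> + \<delta> + exp (- N)) * exp (- (2 * y)))"
      proof (rule mult_left_mono)
        have "exp (- (3 * N)) = exp (- N) * exp (- (2 * N))" by (simp add: exp_add[symmetric])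
        also have "\<dots> \<le> (\<eta> + \<delta> + exp (- N)) * exp (- (2 * y))" using y \<eta> \<delta> by (intro mult_mono) auto
        finally show "exp (- (3 * N)) \<le> (\<eta> + \<delta> + exp (- N)) * exp (- (2 * y))" .
      qed (use A in simp)
      finally show ?thesis by (simp add: K4_def algebra_simps)
    qed
    obtain a where a0: "0 \<le> a" "a + h \<le> 1" "\<And>y. a \<le> y \<Longrightarrow> y \<le> a + h \<Longrightarrow> \<kappa>0 \<le> (\<psi> y)\<^sup>2"
      using kh(3)[OF a(1) boundD(1,2)[OF b]] by blast
    \<comment> \<open>Total mass of the errors in the lower bound for \<open>c * W'\<close>: \<eta>
      times the deviation \<open>D\<close>, and the difference of the potentials.\<close>
    define K5 where "K5 = \<eta> * (K4 * (\<eta> + \<delta> + exp (- N))) * A + \<delta> * (A * A)"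
    have K5: "0 \<le> K5" using \<eta> \<delta> K4 A Q by (simp add: K5_def)
    have second: "c * \<omega> \<le> K * (\<eta>\<^sup>2 + \<delta> + exp (- N)) - \<eta> * (\<kappa>0 * h / 2)"
      if c: "c \<in> {1, -1}" and t: "1 / 2 \<le> t" and ec: "e = c * \<eta>" for c
    proof -
      have W'l: "\<eta> * (t * (\<psi> y)\<^sup>2) - K5 * exp (- y) \<le> c * W' y" if y: "0 \<le> y" "y \<le> N" for y
      proof -
        have cc: "c * e = \<eta>" using c ec by auto
        have "c * W' y = c * ((p0 y - p y) * (u y * \<psi> y)) + (c * e) * (u y * \<psi> y)" by (simp add: W'_def algebra_simps)
        also have "(c * e) * (u y * \<psi> y) = \<eta> * (t * (\<psi> y)\<^sup>2) + \<eta> * (D y * \<psi> y)"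
          unfolding cc D_def by (simp add: algebra_simps power2_eq_square)
        finally have eq: "c * W' y = c * ((p0 y - p y) * (u y * \<psi> y)) + (\<eta> * (t * (\<psi> y)\<^sup>2) + \<eta> * (D y * \<psi> y))" .
        have 1: "- (\<delta> * (A * A) * exp (- y)) \<le> c * ((p0 y - p y) * (u y * \<psi> y))" using p0u[OF y] c by auto
        have "\<bar>D y * \<psi> y\<bar> \<le> (K4 * (\<eta> + \<delta> + exp (- N)) * exp (- (2 * y))) * (A * exp (- (3 * y)))"
          unfolding abs_mult using Db[OF y] \<psi>b[OF y(1)] K4 Q by (intro mult_mono) auto
        also have "\<dots> = K4 * (\<eta> + \<delta> + exp (- N)) * A * (exp (- (2 * y)) * exp (- (3 * y)))" by simp
        also have "\<dots> \<le> K4 * (\<eta> + \<delta> + exp (- N)) * A * exp (- y)"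
          using ex(5)[OF y(1)] K4 Q A by (intro mult_left_mono) auto
        finally have "\<bar>\<eta> * (D y * \<psi> y)\<bar> \<le> \<eta> * (K4 * (\<eta> + \<delta> + exp (- N)) * A * exp (- y))"
          unfolding abs_mult[of \<eta>] using \<eta> by (simp add: mult_left_mono)
        thus ?thesis using 1 unfolding eq K5_def by (simp add: algebra_simps)
      qed
      have "(\<eta> * (\<kappa>0 / 2)) * h - K5 \<le> c * W N - c * W 0"
      proof (rule growth_lower[where a = a and g = "\<lambda>y. c * W' y"])
        show "((\<lambda>y. c * W y) has_real_derivative c * W' y) (at y)" for y
          by (auto intro!: derivative_eq_intros dW)
        show "- K5 * exp (- y) \<le> c * W' y" if y: "0 \<le> y" "y \<le> N" for y
        proof -
          have "0 \<le> \<eta> * (t * (\<psi> y)\<^sup>2)" using \<eta> t by simp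
          thus ?thesis using W'l[OF y] by linarith
        qed
        show "\<eta> * (\<kappa>0 / 2) - K5 * exp (- y) \<le> c * W' y" if y: "a \<le> y" "y \<le> a + h" for y
        proof -
          have "1 / 2 * \<kappa>0 \<le> t * (\<psi> y)\<^sup>2" using t a0(3)[OF y] kh by (intro mult_mono) auto
          hence "\<eta> * (\<kappa>0 / 2) \<le> \<eta> * (t * (\<psi> y)\<^sup>2)" using \<eta> by (intro mult_left_mono) auto
          thus ?thesis using W'l[of y] y a0 N1 by linarith
        qed
      qed (use a0 kh N1 K5 in auto)
      moreover have "c * W N \<le> Cv * A * exp (- N)" using WN c by auto
      moreover have "K5 + Cv * A * exp (- N) \<le> K * (\<eta>\<^sup>2 + \<delta> + exp (- N))"
      proof -
        have "\<eta> * (\<eta> + \<delta> + exp (- N)) \<le> \<eta>\<^sup>2 + \<delta> + exp (- N)"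
        proof -
          have "\<eta> * \<delta> \<le> 1 * \<delta>" "\<eta> * exp (- N) \<le> 1 * exp (- N)"
            using e(2) \<delta> by (intro mult_right_mono; simp)+
          thus ?thesis by (simp only: power2_eq_square distrib_left mult_1)
        qed
        hence "K4 * A * (\<eta> * (\<eta> + \<delta> + exp (- N))) \<le> K4 * A * (\<eta>\<^sup>2 + \<delta> + exp (- N))"
          using K4A by (rule mult_left_mono)
        moreover have "\<delta> \<le> \<eta>\<^sup>2 + \<delta> + exp (- N)" by (simp add: add_nonneg_nonneg)
        hence "A * A * \<delta> \<le> A * A * (\<eta>\<^sup>2 + \<delta> + exp (- N))" by (rule mult_left_mono) simp
        moreover have "exp (- N) \<le> \<eta>\<^sup>2 + \<delta> + exp (- N)" using \<delta> by simp
        hence "Cv * A * exp (- N) \<le> Cv * A * (\<eta>\<^sup>2 + \<delta> + exp (- N))" using Cv A by (intro mult_left_mono) auto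
        ultimately show ?thesis unfolding K5_def K_def by (simp add: algebra_simps)
      qed
      ultimately show ?thesis unfolding \<omega>_def by (simp add: algebra_simps)
    qed
    have "Ka * (\<eta> + \<delta> + exp (- N)) \<le> K * (\<eta> + \<delta> + exp (- N))" using K Q by (intro mult_right_mono)
    with \<omega> have "\<bar>\<omega>\<bar> \<le> K * (\<eta> + \<delta> + exp (- N))" by linarith
    thus "\<bar>u 0 * \<psi>' 0 - v 0 * \<psi> 0\<bar> \<le> K * (\<eta> + \<delta> + exp (- N)) \<and>
      (\<forall>c\<in>{1,-1}. 1 / 2 \<le> u 0 * \<psi> 0 + v 0 * \<psi>' 0 \<longrightarrow> e = c * \<eta> \<longrightarrow>
         c * (u 0 * \<psi>' 0 - v 0 * \<psi> 0) \<le> K * (\<eta>\<^sup>2 + \<delta> + exp (- N)) - \<eta> * (\<kappa>0 * h / 2))"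
      using second unfolding t_def \<omega>_def W_def by blast
  qed (use K kh in auto)
qed

section \<open>Dirichlet eigenvalues on finite intervals and their limits\<close>

lemma param_cont:
  assumes cp: "continuous_on UNIV p"
    and s: "\<And>e. sol (\<lambda>y. p y - e) (\<lambda>_. 0) (\<phi> e) (\<phi>' e)"
    and d: "\<And>e. \<phi> e 0 = a" "\<And>e. \<phi>' e 0 = b"
  shows "continuous_on UNIV (\<lambda>e. \<phi> e y)"
proof -
  have "isCont (\<lambda>e. \<phi> e y) e0" for e0
  proof -
    define T where "T = \<bar>y\<bar>"
    obtain Lp where Lp: "1 \<le> Lp" "\<And>y. \<bar>y\<bar> \<le> T \<Longrightarrow> \<bar>p y\<bar> \<le> Lp" using cont_bounded_on[OF cp] by blast
    obtain G where G: "1 \<le> G" "\<And>y. \<bar>y\<bar> \<le> T \<Longrightarrow> \<bar>\<phi> e0 y\<bar> \<le> G" using cont_bounded_on[OF sol_cont(1)[OF s]] by blast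
    define L where "L = Lp + \<bar>e0\<bar> + 1"
    have bd: "\<bar>\<phi> e y - \<phi> e0 y\<bar> \<le> gron L T * (0 + \<bar>e - e0\<bar> * G)" if e: "\<bar>e - e0\<bar> < 1" for e
    proof -
      have so: "sol (\<lambda>y. p y - e) (\<lambda>y. 0 + 1 * (((p y - e0) - (p y - e)) * \<phi> e0 y))
          (\<lambda>y. \<phi> e y - 1 * \<phi> e0 y) (\<lambda>y. \<phi>' e y - 1 * \<phi>' e0 y)"
        by (rule sol_diff[OF s s])
      have "\<bar>\<phi> e y - 1 * \<phi> e0 y\<bar> \<le> gron L T * (0 + \<bar>e - e0\<bar> * G)"
      proof (rule gronwall_abs(1)[OF so])
        fix z :: real assume z: "\<bar>z\<bar> \<le> T"
        show "\<bar>p z - e\<bar> \<le> L" using Lp(2)[OF z] e unfolding L_def by linarith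
        show "\<bar>0 + 1 * (((p z - e0) - (p z - e)) * \<phi> e0 z)\<bar> \<le> \<bar>e - e0\<bar> * G"
          using G(2)[OF z] by (simp add: abs_mult mult_left_mono)
      qed (simp_all add: d T_def)
      thus ?thesis by simp
    qed
    have "((\<lambda>e. gron L T * (0 + \<bar>e - e0\<bar> * G)) \<longlongrightarrow> gron L T * (0 + \<bar>e0 - e0\<bar> * G)) (at e0)"
      by (intro tendsto_intros)
    hence "((\<lambda>e. gron L T * (0 + \<bar>e - e0\<bar> * G)) \<longlongrightarrow> 0) (at e0)" by simp
    moreover have "\<forall>\<^sub>F e in at e0. norm (\<phi> e y - \<phi> e0 y) \<le> gron L T * (0 + \<bar>e - e0\<bar> * G)"
      using bd by (auto simp: eventually_at dist_real_def intro!: exI[of _ 1])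
    ultimately have "((\<lambda>e. \<phi> e y - \<phi> e0 y) \<longlongrightarrow> 0) (at e0)" by (rule Lim_null_comparison[rotated])
    thus ?thesis by (simp add: isCont_def LIM_zero_iff)
  qed
  thus ?thesis by (simp add: continuous_on_eq_continuous_at)
qed

lemma sol_unique_zero:
  assumes cp: "continuous_on UNIV p" and s: "sol p (\<lambda>_. 0) u v" and z: "u 0 = 0" "v 0 = 0"
  shows "u y = 0" "v y = 0"
proof -
  obtain L where L: "1 \<le> L" "\<And>z. \<bar>z\<bar> \<le> \<bar>y\<bar> \<Longrightarrow> \<bar>p z\<bar> \<le> L" using cont_bounded_on[OF cp] by blast
  have "\<bar>u y\<bar> \<le> gron L \<bar>y\<bar> * (0 + 0)" "\<bar>v y\<bar> \<le> gron L \<bar>y\<bar> * (0 + 0)"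
    by (rule gronwall_abs[OF s L(2)]; simp add: z)+
  thus "u y = 0" "v y = 0" by auto
qed

text \<open>The two Dirichlet solutions at \<open>N\<close> and \<open>-N\<close> have Cauchy data at 0 whose angles to the data
  of \<open>\<psi>\<close> move in opposite directions as \<open>e\<close> increases, so they meet for some \<open>e\<close>.\<close>

lemma dirichlet_eigenvalue:
  assumes cp: "continuous_on UNIV p" and \<eta>: "0 < \<eta>" and c01: "c0\<^sup>2 + s0\<^sup>2 = 1"
    and R: "\<And>e u v. \<bar>e\<bar> \<le> \<eta> \<Longrightarrow> sol (\<lambda>y. p y - e) (\<lambda>_. 0) u v \<Longrightarrow> (u 0)\<^sup>2 + (v 0)\<^sup>2 = 1 \<Longrightarrow> u N = 0 \<Longrightarrow>
        \<bar>u 0 * s0 - v 0 * c0\<bar> \<le> 1 / 2 \<and> (0 < u 0 * c0 + v 0 * s0 \<longrightarrow>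
          (e = \<eta> \<longrightarrow> u 0 * s0 - v 0 * c0 < 0) \<and> (e = - \<eta> \<longrightarrow> 0 < u 0 * s0 - v 0 * c0))"
    and L: "\<And>e u v. \<bar>e\<bar> \<le> \<eta> \<Longrightarrow> sol (\<lambda>y. p y - e) (\<lambda>_. 0) u v \<Longrightarrow> (u 0)\<^sup>2 + (v 0)\<^sup>2 = 1 \<Longrightarrow> u (- N) = 0 \<Longrightarrow>
        \<bar>u 0 * s0 - v 0 * c0\<bar> \<le> 1 / 2 \<and> (0 < u 0 * c0 + v 0 * s0 \<longrightarrow>
          (e = \<eta> \<longrightarrow> 0 < u 0 * s0 - v 0 * c0) \<and> (e = - \<eta> \<longrightarrow> u 0 * s0 - v 0 * c0 < 0))"
  obtains e u v where "\<bar>e\<bar> \<le> \<eta>" "sol (\<lambda>y. p y - e) (\<lambda>_. 0) u v" "(u 0)\<^sup>2 + (v 0)\<^sup>2 = 1" "u N = 0" "u (- N) = 0"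
proof -
  have cpe: "continuous_on UNIV (\<lambda>y. p y - e)" for e using cp by (intro continuous_intros)
  have c0: "continuous_on UNIV (\<lambda>_::real. 0::real)" by simp
  have "\<forall>e. \<exists>f g. sol (\<lambda>y. p y - e) (\<lambda>_. 0) f g \<and> f 0 = 1 \<and> g 0 = 0"
    using ivp_exists[OF cpe c0] by metis
  then obtain F F' where F: "\<And>e. sol (\<lambda>y. p y - e) (\<lambda>_. 0) (F e) (F' e)" "\<And>e. F e 0 = 1" "\<And>e. F' e 0 = 0" by metis
  have "\<forall>e. \<exists>f g. sol (\<lambda>y. p y - e) (\<lambda>_. 0) f g \<and> f 0 = 0 \<and> g 0 = 1"
    using ivp_exists[OF cpe c0] by metis
  then obtain G G' where G: "\<And>e. sol (\<lambda>y. p y - e) (\<lambda>_. 0) (G e) (G' e)" "\<And>e. G e 0 = 0" "\<And>e. G' e 0 = 1" by metis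
  have sFG: "sol (\<lambda>y. p y - e) (\<lambda>_. 0) (\<lambda>y. a * F e y + b * G e y) (\<lambda>y. a * F' e y + b * G' e y)" for e a b
    using sol_lincomb[OF F(1) G(1)] by simp
  have wr: "F e y * G' e y - F' e y * G e y = 1" for e y
  proof -
    have "((\<lambda>y. F e y * G' e y - F' e y * G e y) has_real_derivative 0) (at z)" for z
      using wronskian_deriv[OF F(1)[of e] G(1)[of e], of z] by simp
    hence "F e y * G' e y - F' e y * G e y = F e 0 * G' e 0 - F' e 0 * G e 0"
      using DERIV_isconst_all[of "\<lambda>y. F e y * G' e y - F' e y * G e y" y 0] by blast
    thus ?thesis using F G by simp
  qed
  \<comment> \<open>The solution vanishing at z is G(z) F - F(z) G, with data (G(z), -F(z)) at 0.
    \<open>I\<close> and \<open>\<omega>\<close> are the unnormalised cosine and sine of its angle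
    to (c0, s0).\<close>
  define I where "I = (\<lambda>e z. G e z * c0 - F e z * s0)"
  define \<omega> where "\<omega> = (\<lambda>e z. G e z * s0 + F e z * c0)"
  have unit_sol: "\<exists>r u v. 0 < r \<and> sol (\<lambda>y. p y - e) (\<lambda>_. 0) u v \<and> (u 0)\<^sup>2 + (v 0)\<^sup>2 = 1 \<and> u z = 0 \<and>
      u = (\<lambda>y. k * r * (G e z * F e y - F e z * G e y)) \<and>
      u 0 * s0 - v 0 * c0 = k * r * \<omega> e z \<and> u 0 * c0 + v 0 * s0 = k * r * I e z" if k: "k \<in> {1, -1}" for e z k
  proof -
    define m where "m = (G e z)\<^sup>2 + (F e z)\<^sup>2"
    have "m \<noteq> 0"
    proof
      assume "m = 0"
      hence "G e z = 0" "F e z = 0" by (simp_all add: m_def)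
      thus False using wr[of e z] by simp
    qed
    hence m: "0 < m" by (simp add: m_def less_le)
    define r where "r = 1 / sqrt m"
    have r: "0 < r" "r\<^sup>2 * m = 1" using m by (simp_all add: r_def power_divide)
    define u where "u = (\<lambda>y. (k * r * G e z) * F e y + (- (k * r * F e z)) * G e y)"
    define v where "v = (\<lambda>y. (k * r * G e z) * F' e y + (- (k * r * F e z)) * G' e y)"
    have kk: "k\<^sup>2 = 1" using k by auto
    have "sol (\<lambda>y. p y - e) (\<lambda>_. 0) u v" unfolding u_def v_def by (rule sFG)
    moreover have "(u 0)\<^sup>2 + (v 0)\<^sup>2 = k\<^sup>2 * (r\<^sup>2 * m)"
      by (simp add: u_def v_def F G m_def power_mult_distrib algebra_simps)
    hence "(u 0)\<^sup>2 + (v 0)\<^sup>2 = 1" using kk r by simp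
    ultimately show ?thesis
      using r(1) by (intro exI[of _ r] exI[of _ u] exI[of _ v])
        (auto simp: u_def v_def F G I_def \<omega>_def algebra_simps)
  qed
  have half: "1 / 2 < \<bar>t\<bar>" if "t\<^sup>2 + w\<^sup>2 = 1" "\<bar>w\<bar> \<le> 1 / 2" for t w :: real
  proof -
    have "w\<^sup>2 \<le> (1/2)\<^sup>2" using that(2) by (metis abs_le_square_iff abs_of_nonneg zero_le_divide_1_iff zero_le_numeral)
    hence "(1/2)\<^sup>2 < t\<^sup>2" using that(1) by (simp add: power2_eq_square)
    thus ?thesis by (metis abs_less_iff abs_of_nonneg abs_square_le_1 abs_le_square_iff linorder_not_le zero_le_divide_1_iff zero_le_numeral)
  qed
  have pyth: "(a * c0 + b * s0)\<^sup>2 + (a * s0 - b * c0)\<^sup>2 = 1" if "a\<^sup>2 + b\<^sup>2 = 1" for a b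
  proof -
    have "(a * c0 + b * s0)\<^sup>2 + (a * s0 - b * c0)\<^sup>2 = (a\<^sup>2 + b\<^sup>2) * (c0\<^sup>2 + s0\<^sup>2)" by algebra
    thus ?thesis using that c01 by simp
  qed
  \<comment> \<open>The sine is at most 1/2 in absolute value, so the cosine cannot vanish and the
    quotients in \<open>H\<close> below are defined.\<close>
  have I0: "I e z \<noteq> 0" if e: "\<bar>e\<bar> \<le> \<eta>" and z: "z \<in> {N, - N}" for e z
  proof -
    obtain r u v where u: "0 < r" "sol (\<lambda>y. p y - e) (\<lambda>_. 0) u v" "(u 0)\<^sup>2 + (v 0)\<^sup>2 = 1" "u z = 0"
      "u 0 * c0 + v 0 * s0 = 1 * r * I e z"
      using unit_sol[of 1 e z] by auto
    have "\<bar>u 0 * s0 - v 0 * c0\<bar> \<le> 1 / 2" using R[OF e u(2,3)] L[OF e u(2,3)] u(4) z by auto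
    from half[OF pyth[OF u(3)] this] show ?thesis unfolding u(5) by auto
  qed
  \<comment> \<open>The sign \<open>k\<close> is chosen to make the cosine positive, since the
    hypotheses fix the sign of the sine only in that case.\<close>
  have sgn: "\<exists>k r. k \<in> {1, -1} \<and> 0 < r \<and> 0 < k * r * I e z \<and>
      (z = N \<longrightarrow> (e = \<eta> \<longrightarrow> k * r * \<omega> e z < 0) \<and> (e = - \<eta> \<longrightarrow> 0 < k * r * \<omega> e z)) \<and>
      (z = - N \<longrightarrow> (e = \<eta> \<longrightarrow> 0 < k * r * \<omega> e z) \<and> (e = - \<eta> \<longrightarrow> k * r * \<omega> e z < 0))"
    if e: "\<bar>e\<bar> \<le> \<eta>" and z: "z \<in> {N, - N}" for e z
  proof -
    define k :: real where "k = sgn (I e z)"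
    have k: "k \<in> {1, -1}" "0 < k * I e z" using I0[OF e z] by (auto simp: k_def sgn_if)
    obtain r u v where u: "0 < r" "sol (\<lambda>y. p y - e) (\<lambda>_. 0) u v" "(u 0)\<^sup>2 + (v 0)\<^sup>2 = 1" "u z = 0"
      "u 0 * s0 - v 0 * c0 = k * r * \<omega> e z" "u 0 * c0 + v 0 * s0 = k * r * I e z"
      using unit_sol[OF k(1), of e z] by auto
    have pos: "0 < k * r * I e z" using k(2) u(1) by (metis mult.assoc mult.commute mult_pos_pos)
    have "z = N \<Longrightarrow> (e = \<eta> \<longrightarrow> k * r * \<omega> e z < 0) \<and> (e = - \<eta> \<longrightarrow> 0 < k * r * \<omega> e z)"
      using R[OF e u(2,3)] u(4) pos unfolding u(5,6)[symmetric] by blast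
    moreover have "z = - N \<Longrightarrow> (e = \<eta> \<longrightarrow> 0 < k * r * \<omega> e z) \<and> (e = - \<eta> \<longrightarrow> k * r * \<omega> e z < 0)"
      using L[OF e u(2,3)] u(4) pos unfolding u(5,6)[symmetric] by blast
    ultimately show ?thesis using k u(1) pos by (intro exI[of _ k] exI[of _ r]) blast
  qed
  \<comment> \<open>Difference of the tangents of the two angles. The normalising factors k and r
    cancel in each quotient, so the sign of H at both end values of e can be read off, while H
    itself is continuous in e.\<close>
  define H where "H = (\<lambda>e. \<omega> e N / I e N - \<omega> e (- N) / I e (- N))"
  have quot: "w / i = (k * r * w) / (k * r * i)" if "k \<in> {1, -1}" "0 < r" for w i k r :: real using that by auto
  have Hp: "H \<eta> \<le> 0"
  proof -
    obtain k r k' r' where "k \<in> {1, -1}" "0 < r" "0 < k * r * I \<eta> N" "k * r * \<omega> \<eta> N < 0"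
      "k' \<in> {1, -1}" "0 < r'" "0 < k' * r' * I \<eta> (-N)" "0 < k' * r' * \<omega> \<eta> (-N)"
      using sgn[of \<eta> N] sgn[of \<eta> "-N"] \<eta> by (auto simp del: insert_iff)
    thus ?thesis unfolding H_def
      by (subst quot[of k r], simp, simp, subst (2) quot[of k' r'], simp, simp)
        (smt (verit) divide_neg_pos divide_pos_pos)
  qed
  have Hm: "0 \<le> H (- \<eta>)"
  proof -
    obtain k r k' r' where "k \<in> {1, -1}" "0 < r" "0 < k * r * I (-\<eta>) N" "0 < k * r * \<omega> (-\<eta>) N"
      "k' \<in> {1, -1}" "0 < r'" "0 < k' * r' * I (-\<eta>) (-N)" "k' * r' * \<omega> (-\<eta>) (-N) < 0"
      using sgn[of "-\<eta>" N] sgn[of "-\<eta>" "-N"] \<eta> by (auto simp del: insert_iff)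
    thus ?thesis unfolding H_def
      by (subst quot[of k r], simp, simp, subst (2) quot[of k' r'], simp, simp)
        (smt (verit) divide_neg_pos divide_pos_pos)
  qed
  have cF: "continuous_on S (\<lambda>e. F e z)" and cG: "continuous_on S (\<lambda>e. G e z)" for z S
    using param_cont[OF cp F] param_cont[OF cp G] continuous_on_subset by blast+
  have "continuous_on {-\<eta>..\<eta>} H"
    unfolding H_def \<omega>_def I_def using I0 unfolding I_def
    by (intro continuous_intros cF cG) auto
  then obtain e where e: "- \<eta> \<le> e" "e \<le> \<eta>" "H e = 0"
    using IVT2'[of H \<eta> 0 "-\<eta>"] Hp Hm \<eta> by auto
  have e': "\<bar>e\<bar> \<le> \<eta>" using e by auto
  \<comment> \<open>Equal tangents mean parallel data, so the determinant vanishes; it is the value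
    at -N of the solution vanishing at N.\<close>
  have "\<omega> e N * I e (- N) = \<omega> e (- N) * I e N"
    using e(3) I0[OF e', of N] I0[OF e', of "-N"] by (simp add: H_def frac_eq_eq)
  moreover have "\<omega> e N * I e (- N) - \<omega> e (- N) * I e N = (F e N * G e (- N) - G e N * F e (- N)) * (c0\<^sup>2 + s0\<^sup>2)"
    unfolding \<omega>_def I_def by algebra
  ultimately have det: "G e N * F e (- N) - F e N * G e (- N) = 0" using c01 by simp
  obtain r u v where u: "0 < r" "sol (\<lambda>y. p y - e) (\<lambda>_. 0) u v" "(u 0)\<^sup>2 + (v 0)\<^sup>2 = 1" "u N = 0"
      "u = (\<lambda>y. 1 * r * (G e N * F e y - F e N * G e y))"
      using unit_sol[of 1 e N] by auto
  have "u (- N) = 0" using det by (simp add: u(5))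
  thus thesis using that[OF e' u(2,3,4)] by blast
qed

lemma sol_converge:
  assumes cp: "continuous_on UNIV p"
    and U: "\<And>n::nat. sol (\<lambda>y. p y - E n) (\<lambda>_. 0) (U n) (V n)" and u: "sol (\<lambda>y. p y - e) (\<lambda>_. 0) u v"
    and lim: "E \<longlonglongrightarrow> e" "(\<lambda>n. U n 0) \<longlonglongrightarrow> u 0" "(\<lambda>n. V n 0) \<longlonglongrightarrow> v 0"
  shows "(\<lambda>n. U n y) \<longlonglongrightarrow> u y"
proof -
  obtain Lp where Lp: "1 \<le> Lp" "\<And>z. \<bar>z\<bar> \<le> \<bar>y\<bar> \<Longrightarrow> \<bar>p z\<bar> \<le> Lp" using cont_bounded_on[OF cp] by blast
  obtain G where G: "1 \<le> G" "\<And>z. \<bar>z\<bar> \<le> \<bar>y\<bar> \<Longrightarrow> \<bar>u z\<bar> \<le> G" using cont_bounded_on[OF sol_cont(1)[OF u]] by blast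
  obtain B where B: "\<And>n. \<bar>E n\<bar> \<le> B"
    using convergent_imp_Bseq[OF convergentI[OF lim(1)]] unfolding Bseq_def by auto
  define R where "R = (\<lambda>n. gron (Lp + B) \<bar>y\<bar> * ((\<bar>U n 0 - u 0\<bar> + \<bar>V n 0 - v 0\<bar>) + \<bar>E n - e\<bar> * G))"
  have bd: "\<bar>U n y - u y\<bar> \<le> R n" for n
  proof -
    have so: "sol (\<lambda>y. p y - E n) (\<lambda>y. 0 + 1 * ((p y - e - (p y - E n)) * u y)) (\<lambda>y. U n y - 1 * u y) (\<lambda>y. V n y - 1 * v y)"
      by (rule sol_diff[OF U u])
    have "\<bar>U n y - 1 * u y\<bar> \<le> gron (Lp + B) \<bar>y\<bar> * ((\<bar>U n 0 - u 0\<bar> + \<bar>V n 0 - v 0\<bar>) + \<bar>E n - e\<bar> * G)"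
    proof (rule gronwall_abs(1)[OF so])
      fix z :: real assume z: "\<bar>z\<bar> \<le> \<bar>y\<bar>"
      show "\<bar>p z - E n\<bar> \<le> Lp + B" using Lp(2)[OF z] B[of n] by linarith
      show "\<bar>0 + 1 * ((p z - e - (p z - E n)) * u z)\<bar> \<le> \<bar>E n - e\<bar> * G"
        using G(2)[OF z] by (simp add: abs_mult mult_left_mono)
    qed auto
    thus ?thesis by (simp add: R_def)
  qed
  have "R \<longlonglongrightarrow> gron (Lp + B) \<bar>y\<bar> * ((\<bar>u 0 - u 0\<bar> + \<bar>v 0 - v 0\<bar>) + \<bar>e - e\<bar> * G)"
    unfolding R_def by (intro tendsto_intros lim)
  hence "R \<longlonglongrightarrow> 0" by simp
  hence "(\<lambda>n. U n y - u y) \<longlonglongrightarrow> 0"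
    by (rule Lim_null_comparison[rotated]) (simp add: bd)
  thus ?thesis by (simp add: LIM_zero_iff)
qed

text \<open>Energies and unit data lie in a compact set, so a subsequence of the Dirichlet states
  converges pointwise, and the uniform weighted bound passes to the limit. This takes the place of
  compactness of the resolvent.\<close>

lemma bound_limit:
  assumes cp: "continuous_on UNIV p" and E: "\<And>n::nat. \<bar>E n\<bar> \<le> \<eta>"
    and U: "\<And>n. sol (\<lambda>y. p y - E n) (\<lambda>_. 0) (U n) (V n)" and unit: "\<And>n. (U n 0)\<^sup>2 + (V n 0)\<^sup>2 = 1"
    and Ub: "\<And>n y. \<bar>y\<bar> \<le> N + real n \<Longrightarrow> \<bar>U n y\<bar> \<le> C * exp (- \<bar>y\<bar>)"
  obtains e u v where "\<bar>e\<bar> \<le> \<eta>" "bound (\<lambda>y. p y - e) u v"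
proof -
  have uv1: "\<bar>U n 0\<bar> \<le> 1" "\<bar>V n 0\<bar> \<le> 1" for n
  proof -
    have "(U n 0)\<^sup>2 \<le> 1\<^sup>2" "(V n 0)\<^sup>2 \<le> 1\<^sup>2" using unit[of n] zero_le_power2[of "U n 0"] zero_le_power2[of "V n 0"]
      unfolding one_power2 by linarith+
    thus "\<bar>U n 0\<bar> \<le> 1" "\<bar>V n 0\<bar> \<le> 1" by (simp_all add: abs_square_le_1)
  qed
  define X where "X = (\<lambda>n. (E n, U n 0, V n 0))"
  have "compact ({-\<eta>..\<eta>} \<times> {-1..1::real} \<times> {-1..1::real})" by (intro compact_Times compact_Icc)
  moreover have "X n \<in> {-\<eta>..\<eta>} \<times> {-1..1} \<times> {-1..1}" for n
    using E[of n] uv1[of n] by (simp add: X_def abs_le_iff)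
  ultimately obtain l r where l: "l \<in> {-\<eta>..\<eta>} \<times> {-1..1} \<times> {-1..1}" "strict_mono r" "(X \<circ> r) \<longlonglongrightarrow> l"
    unfolding compact_def by metis
  obtain e \<alpha> \<beta> where lab: "l = (e, \<alpha>, \<beta>)" by (cases l) auto
  have lim: "(\<lambda>n. E (r n)) \<longlonglongrightarrow> e" "(\<lambda>n. U (r n) 0) \<longlonglongrightarrow> \<alpha>" "(\<lambda>n. V (r n) 0) \<longlonglongrightarrow> \<beta>"
    using tendsto_fst[OF l(3)] tendsto_fst[OF tendsto_snd[OF l(3)]] tendsto_snd[OF tendsto_snd[OF l(3)]]
    by (simp_all add: X_def lab comp_def)
  have e: "\<bar>e\<bar> \<le> \<eta>" using l(1) by (auto simp: lab)
  have c0: "continuous_on UNIV (\<lambda>_::real. 0::real)" by simp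
  have cpe: "continuous_on UNIV (\<lambda>y. p y - e)" using cp by (intro continuous_intros)
  obtain u v where u: "sol (\<lambda>y. p y - e) (\<lambda>_. 0) u v" "u 0 = \<alpha>" "v 0 = \<beta>"
    using ivp_exists[OF cpe c0] by metis
  have conv: "(\<lambda>n. U (r n) y) \<longlonglongrightarrow> u y" for y
    by (rule sol_converge[OF cp U u(1)]) (use lim u in auto)
  have "dec 1 C u"
    unfolding dec_def
  proof
    fix y
    obtain m :: nat where m: "\<bar>y\<bar> - N \<le> real m" using real_arch_simple by blast
    have "\<bar>U (r n) y\<bar> \<le> C * wt 1 y" if "m \<le> n" for n
    proof -
      have "m \<le> r n" using that seq_suble[OF l(2), of n] by simp
      hence "real m \<le> real (r n)" by simp
      hence "\<bar>y\<bar> \<le> N + real (r n)" using m by linarith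
      thus ?thesis using Ub[of y "r n"] by (simp add: wt_def)
    qed
    hence "eventually (\<lambda>n. \<bar>U (r n) y\<bar> \<le> C * wt 1 y) sequentially"
      by (auto simp: eventually_sequentially)
    thus "\<bar>u y\<bar> \<le> C * wt 1 y" by (rule tendsto_upperbound[OF tendsto_rabs[OF conv]]) simp
  qed
  from integrable_dec[OF _ dec_mult[OF this this]] have "integrable lborel (\<lambda>y. (u y)\<^sup>2)"
    using sol_cont[OF u(1)] by (auto simp: power2_eq_square intro!: continuous_intros)
  moreover have "(\<lambda>n. (U (r n) 0)\<^sup>2 + (V (r n) 0)\<^sup>2) \<longlonglongrightarrow> \<alpha>\<^sup>2 + \<beta>\<^sup>2" by (intro tendsto_intros lim)
  hence "(u 0)\<^sup>2 + (v 0)\<^sup>2 = 1" unfolding unit u(2,3) using LIMSEQ_unique tendsto_const by blast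
  ultimately have "bound (\<lambda>y. p y - e) u v" using u(1) by (simp add: bound_def)
  thus thesis using that e by blast
qed

text \<open>The shift \<eta> is fixed first, so small that K \<eta>^2 loses against \<eta> \<kappa>;
  then \<delta> and e^{-N} are taken small relative to \<eta>. As \<open>p0\<close> and
  \<open>p\<close> range over the same class, the result transports eigenvalues from the oscillator
  to the fibre operator and back.\<close>

lemma eigenvalue_stability:
  assumes "0 < \<mu>" "0 \<le> M"
  obtains \<eta>0 where "0 < \<eta>0" "\<And>\<eta>. 0 < \<eta> \<Longrightarrow> \<eta> \<le> \<eta>0 \<Longrightarrow> \<exists>\<delta>>0. \<forall>p0 p \<psi> \<psi>'. adm \<mu> M p0 \<longrightarrow> adm \<mu> M p \<longrightarrow>
     bound p0 \<psi> \<psi>' \<longrightarrow> dec (-1) \<delta> (\<lambda>y. p y - p0 y) \<longrightarrow> (\<exists>e u v. \<bar>e\<bar> \<le> \<eta> \<and> bound (\<lambda>y. p y - e) u v)"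
proof -
  obtain K \<kappa> N0 where K: "1 \<le> K" "0 < \<kappa>" "0 \<le> N0" and core:
    "\<And>p0 p \<psi> \<psi>' e \<eta> \<delta> u v N. adm \<mu> M p0 \<Longrightarrow> adm \<mu> M p \<Longrightarrow> bound p0 \<psi> \<psi>' \<Longrightarrow>
      dec (-1) \<delta> (\<lambda>y. p y - p0 y) \<Longrightarrow> \<bar>e\<bar> \<le> \<eta> \<Longrightarrow> \<eta> \<le> 1 \<Longrightarrow> N0 \<le> N \<Longrightarrow>
      sol (\<lambda>y. p y - e) (\<lambda>_. 0) u v \<Longrightarrow> (u 0)\<^sup>2 + (v 0)\<^sup>2 = 1 \<Longrightarrow> u N = 0 \<Longrightarrow>
      \<bar>u 0 * \<psi>' 0 - v 0 * \<psi> 0\<bar> \<le> K * (\<eta> + \<delta> + exp (- N)) \<and>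
      (\<forall>c\<in>{1,-1}. 1 / 2 \<le> u 0 * \<psi> 0 + v 0 * \<psi>' 0 \<longrightarrow> e = c * \<eta> \<longrightarrow>
         c * (u 0 * \<psi>' 0 - v 0 * \<psi> 0) \<le> K * (\<eta>\<^sup>2 + \<delta> + exp (- N)) - \<eta> * \<kappa>)"
    using shoot_core[OF assms] by (auto simp del: insert_iff)
  obtain C1 N1 where C1: "1 \<le> C1" "0 \<le> N1" and H1: "\<And>p f u v S B N \<epsilon> y. adm \<mu> (M+1) p \<Longrightarrow> sol p f u v \<Longrightarrow> N1 \<le> N \<Longrightarrow>
       (\<And>y. 0 \<le> y \<Longrightarrow> y \<le> N \<Longrightarrow> \<bar>f y\<bar> \<le> B * exp (- (1 * y))) \<Longrightarrow>
       \<bar>u 0\<bar> \<le> S \<Longrightarrow> \<bar>v 0\<bar> \<le> S \<Longrightarrow> \<bar>u N\<bar> \<le> \<epsilon> \<Longrightarrow> 0 \<le> y \<Longrightarrow> y \<le> N \<Longrightarrow>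
       \<bar>u y\<bar> \<le> C1 * (S + B) * exp (- (1 * y)) + \<epsilon>"
    using half_line[of \<mu> "M + 1" 1] assms by (metis add_increasing2 zero_le_one)
  \<comment> \<open>\<kappa>/(4K) keeps K \<eta>^2 below \<eta> \<kappa>/4; 1/(6K) is a third of the
    admissible sine 1/2, shared by three error terms.\<close>
  define \<eta>0 where "\<eta>0 = min 1 (min (\<kappa> / (4 * K)) (1 / (6 * K)))"
  show thesis
  proof (rule that[of \<eta>0])
    show "0 < \<eta>0" using K by (simp add: \<eta>0_def)
    fix \<eta> assume \<eta>: "0 < \<eta>" "\<eta> \<le> \<eta>0"
    have \<eta>1: "\<eta> \<le> 1" "K * \<eta> \<le> \<kappa> / 4" "K * \<eta> \<le> 1 / 6"
      using \<eta> K by (auto simp: \<eta>0_def field_simps)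
    \<comment> \<open>With this choice K \<delta> and K e^{-N} are each at most \<eta> \<kappa>/8,
      so the errors sum to \<eta> \<kappa>/2 and the term -\<eta> \<kappa> decides the sign.\<close>
    define \<delta> where "\<delta> = min (\<eta> * \<kappa> / (8 * K)) (1 / (6 * K))"
    have \<delta>: "0 < \<delta>" "K * \<delta> \<le> \<eta> * \<kappa> / 8" "K * \<delta> \<le> 1 / 6"
      using \<eta> K by (auto simp: \<delta>_def min_def field_simps)
    define N2 where "N2 = max (max N0 N1) (- ln \<delta>)"
    have eN: "exp (- N) \<le> \<delta>" if "N2 \<le> N" for N
    proof -
      have "exp (- N) \<le> exp (ln \<delta>)" using that by (simp add: N2_def)
      thus ?thesis using \<delta> by simp
    qed
    have half: "\<bar>u 0 * \<psi>' 0 - v 0 * \<psi> 0\<bar> \<le> 1 / 2 \<and> (0 < u 0 * \<psi> 0 + v 0 * \<psi>' 0 \<longrightarrow>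
          (e = \<eta> \<longrightarrow> u 0 * \<psi>' 0 - v 0 * \<psi> 0 < 0) \<and> (e = - \<eta> \<longrightarrow> 0 < u 0 * \<psi>' 0 - v 0 * \<psi> 0))"
      if a: "adm \<mu> M p0" "adm \<mu> M p" "bound p0 \<psi> \<psi>'" "dec (-1) \<delta> (\<lambda>y. p y - p0 y)" and N: "N2 \<le> N"
        and s: "\<bar>e\<bar> \<le> \<eta>" "sol (\<lambda>y. p y - e) (\<lambda>_. 0) u v" "(u 0)\<^sup>2 + (v 0)\<^sup>2 = 1" "u N = 0"
      for p0 p \<psi> \<psi>' e u v N
    proof -
      define w where "w = u 0 * \<psi>' 0 - v 0 * \<psi> 0"
      define t where "t = u 0 * \<psi> 0 + v 0 * \<psi>' 0"
      have "N0 \<le> N" using N by (simp add: N2_def)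
      note co = core[OF a s(1) \<eta>1(1) this s(2-4)]
      have "K * exp (- N) \<le> K * \<delta>" using eN[OF N] K by (intro mult_left_mono) auto
      hence KE: "K * exp (- N) \<le> \<eta> * \<kappa> / 8" "K * exp (- N) \<le> 1 / 6" using \<delta> by linarith+
      have "\<bar>w\<bar> \<le> K * (\<eta> + \<delta> + exp (- N))" using co by (simp add: w_def)
      also have "\<dots> = K * \<eta> + K * \<delta> + K * exp (- N)" by (simp add: algebra_simps)
      also have "\<dots> \<le> 1 / 2" using KE \<eta>1 \<delta> by linarith
      finally have w: "\<bar>w\<bar> \<le> 1 / 2" .
      have "t\<^sup>2 + w\<^sup>2 = ((u 0)\<^sup>2 + (v 0)\<^sup>2) * ((\<psi> 0)\<^sup>2 + (\<psi>' 0)\<^sup>2)" unfolding t_def w_def by algebra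
      hence tw: "t\<^sup>2 + w\<^sup>2 = 1" using s(3) boundD(2)[OF a(3)] by simp
      have "\<bar>w\<bar>\<^sup>2 \<le> (1/2)\<^sup>2" using w by (intro power_mono) auto
      hence "(1/2)\<^sup>2 \<le> t\<^sup>2" using tw by (simp add: power2_eq_square)
      hence t: "1 / 2 \<le> \<bar>t\<bar>" using abs_le_square_iff[of "1/2" t] by simp
      have "c * w < 0" if "c \<in> {1, -1}" "0 < t" "e = c * \<eta>" for c
      proof -
        have "c * w \<le> K * (\<eta>\<^sup>2 + \<delta> + exp (- N)) - \<eta> * \<kappa>" using co that t by (auto simp: w_def t_def)
        also have "K * (\<eta>\<^sup>2 + \<delta> + exp (- N)) = \<eta> * (K * \<eta>) + K * \<delta> + K * exp (- N)"
          by (simp add: algebra_simps power2_eq_square)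
        also have "\<eta> * (K * \<eta>) \<le> \<eta> * (\<kappa> / 4)" using \<eta>1 \<eta> by (intro mult_left_mono) auto
        finally have "c * w \<le> \<eta> * (\<kappa> / 4) + K * \<delta> + K * exp (- N) - \<eta> * \<kappa>" by simp
        moreover have "0 < \<eta> * \<kappa>" using \<eta> K by simp
        ultimately show ?thesis using KE \<delta> by linarith
      qed
      from this[of 1] this[of "-1"] show ?thesis using w unfolding w_def t_def by auto
    qed
    show "\<exists>\<delta>>0. \<forall>p0 p \<psi> \<psi>'. adm \<mu> M p0 \<longrightarrow> adm \<mu> M p \<longrightarrow> bound p0 \<psi> \<psi>' \<longrightarrow>
       dec (-1) \<delta> (\<lambda>y. p y - p0 y) \<longrightarrow> (\<exists>e u v. \<bar>e\<bar> \<le> \<eta> \<and> bound (\<lambda>y. p y - e) u v)"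
    proof (rule exI[of _ \<delta>], intro conjI allI impI)
      fix p0 p \<psi> \<psi>' assume a: "adm \<mu> M p0" "adm \<mu> M p" "bound p0 \<psi> \<psi>'" "dec (-1) \<delta> (\<lambda>y. p y - p0 y)"
      have cp: "continuous_on UNIV p" by (rule admD(1)[OF a(2)])
      have dir: "\<exists>e u v. \<bar>e\<bar> \<le> \<eta> \<and> sol (\<lambda>y. p y - e) (\<lambda>_. 0) u v \<and> (u 0)\<^sup>2 + (v 0)\<^sup>2 = 1 \<and> u N = 0 \<and> u (- N) = 0"
        if N: "N2 \<le> N" for N
      proof (rule dirichlet_eigenvalue[OF cp \<eta>(1) boundD(2)[OF a(3)], where N = N])
        \<comment> \<open>The left end is the right end of the reflected problem; reflection negates
          the derivatives and hence the sine, which exchanges the two sign conditions.\<close>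
        fix e u v assume s: "\<bar>e\<bar> \<le> \<eta>" "sol (\<lambda>y. p y - e) (\<lambda>_. 0) u v" "(u 0)\<^sup>2 + (v 0)\<^sup>2 = 1" "u (- N) = 0"
        have s': "((\<lambda>y. u (- y)) 0)\<^sup>2 + ((\<lambda>y. - v (- y)) 0)\<^sup>2 = 1" using s(3) by simp
        show "\<bar>u 0 * \<psi>' 0 - v 0 * \<psi> 0\<bar> \<le> 1 / 2 \<and> (0 < u 0 * \<psi> 0 + v 0 * \<psi>' 0 \<longrightarrow>
          (e = \<eta> \<longrightarrow> 0 < u 0 * \<psi>' 0 - v 0 * \<psi> 0) \<and> (e = - \<eta> \<longrightarrow> u 0 * \<psi>' 0 - v 0 * \<psi> 0 < 0))"
          using half[OF adm_reflect[OF a(1)] adm_reflect[OF a(2)] bound_reflect[OF a(3)] dec_reflect[OF a(4)] N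
              s(1) sol_reflect[OF s(2)] s' s(4)] by (auto simp: abs_minus_commute)
      qed (use half[OF a N] in blast)+
      have "\<forall>n::nat. \<exists>e u v. \<bar>e\<bar> \<le> \<eta> \<and> sol (\<lambda>y. p y - e) (\<lambda>_. 0) u v \<and> (u 0)\<^sup>2 + (v 0)\<^sup>2 = 1 \<and> u (N2 + real n) = 0 \<and> u (- (N2 + real n)) = 0"
        by (intro allI dir) simp
      then obtain E U V where E: "\<And>n::nat. \<bar>E n\<bar> \<le> \<eta>" and U: "\<And>n. sol (\<lambda>y. p y - E n) (\<lambda>_. 0) (U n) (V n)"
        and unit: "\<And>n. (U n 0)\<^sup>2 + (V n 0)\<^sup>2 = 1" and UN: "\<And>n. U n (N2 + real n) = 0" "\<And>n. U n (- (N2 + real n)) = 0"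
        by metis
      have uv1: "\<bar>U n 0\<bar> \<le> 1" "\<bar>V n 0\<bar> \<le> 1" for n
      proof -
        have "(U n 0)\<^sup>2 \<le> 1\<^sup>2" "(V n 0)\<^sup>2 \<le> 1\<^sup>2" using unit[of n] zero_le_power2[of "U n 0"] zero_le_power2[of "V n 0"]
          unfolding one_power2 by linarith+
        thus "\<bar>U n 0\<bar> \<le> 1" "\<bar>V n 0\<bar> \<le> 1" by (simp_all add: abs_square_le_1)
      qed
      have Ub: "\<bar>U n y\<bar> \<le> C1 * exp (- \<bar>y\<bar>)" if "\<bar>y\<bar> \<le> N2 + real n" for n y
      proof -
        have e1: "\<bar>E n\<bar> \<le> 1" using E[of n] \<eta>1 by linarith
        have N1: "N1 \<le> N2 + real n" by (simp add: N2_def)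
        have f0: "\<bar>0::real\<bar> \<le> 0 * exp (- (1 * z))" for z :: real by simp
        show ?thesis
        proof (cases "0 \<le> y")
          case True
          have "y \<le> N2 + real n" using that by simp
          moreover have "\<bar>U n (N2 + real n)\<bar> \<le> 0" using UN by simp
          ultimately have "\<bar>U n y\<bar> \<le> C1 * (1 + 0) * exp (- (1 * y)) + 0"
            using H1[OF adm_shift[OF a(2) e1] U N1 f0 uv1 _ True] by blast
          thus ?thesis using True by simp
        next
          case False
          have "0 \<le> - y" "- y \<le> N2 + real n" using that False by auto
          moreover have "\<bar>U n (- (N2 + real n))\<bar> \<le> 0" using UN(2)[of n] by simp
          moreover have "\<bar>U n (- 0)\<bar> \<le> 1" "\<bar>- V n (- 0)\<bar> \<le> 1" using uv1[of n] by simp_all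
          ultimately have "\<bar>U n (- (- y))\<bar> \<le> C1 * (1 + 0) * exp (- (1 * (- y))) + 0"
            using H1[OF adm_reflect[OF adm_shift[OF a(2) e1]] sol_reflect[OF U] N1 f0] by blast
          thus ?thesis using False by simp
        qed
      qed
      show "\<exists>e u v. \<bar>e\<bar> \<le> \<eta> \<and> bound (\<lambda>y. p y - e) u v"
      proof (rule bound_limit[where N = N2 and C = C1, OF cp E U unit])
        show "\<bar>U n y\<bar> \<le> C1 * exp (- \<bar>y\<bar>)" if "\<bar>y\<bar> \<le> N2 + real n" for n y using that by (rule Ub)
      qed blast
    qed (rule \<delta>(1))
  qed
qed

section \<open>The harmonic oscillator\<close>

text \<open>u v has the nonnegative derivative v^2 + p u^2 and vanishes at both ends, so it is
  identically 0; then v = 0 and u is a decaying constant, against the normalisation.\<close>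

lemma bound_nonneg_potential:
  assumes a: "adm \<mu> M p" "0 < \<mu>" and b: "bound p u v" and p: "\<And>y. 0 \<le> p y"
  shows False
proof -
  obtain K where "dec 1 K u \<and> dec 1 K v" using bound_dec[of \<mu> M 1] a b adm_nonneg[OF a(1)] by (metis zero_le_one)
  hence u: "dec 1 K u" "dec 1 K v" by auto
  note s = boundD(1)[OF b]
  define g where "g = (\<lambda>y. u y * v y)"
  have dg: "(g has_real_derivative (v y)\<^sup>2 + p y * (u y)\<^sup>2) (at y)" for y
    unfolding g_def by (auto intro!: derivative_eq_intros solD(1)[OF s] solD(2)[OF s] simp: power2_eq_square)
  have mono: "g x \<le> g z" if "x \<le> z" for x z
  proof (rule DERIV_nonneg_imp_nondecreasing[OF that])
    fix y
    have "0 \<le> (v y)\<^sup>2 + p y * (u y)\<^sup>2" using p[of y] by simp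
    thus "\<exists>d. (g has_real_derivative d) (at y) \<and> 0 \<le> d" using dg[of y] by blast
  qed
  have g: "dec (1 + 1) (K * K) g" unfolding g_def by (rule dec_mult[OF u])
  have "g y = 0" for y
  proof (rule antisym)
    show "g y \<le> 0"
      by (rule tendsto_lowerbound[OF dec_tendsto(1)[OF g]])
        (auto intro!: mono exI[of _ y] simp: eventually_at_top_linorder)
    show "0 \<le> g y"
      by (rule tendsto_upperbound[OF dec_tendsto(2)[OF g]])
        (auto intro!: mono exI[of _ y] simp: eventually_at_bot_linorder)
  qed
  hence "g = (\<lambda>_. 0)" by auto
  hence "(v y)\<^sup>2 + p y * (u y)\<^sup>2 = 0" for y
    using DERIV_unique[OF dg[of y], of 0] by simp
  hence v: "v y = 0" for y using p[of y] by (metis add_nonneg_eq_0_iff mult_nonneg_nonneg zero_eq_power2 zero_le_power2)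
  have "u y = u 0" for y
    using DERIV_isconst_all[of u y 0] solD(1)[OF s] v by metis
  hence "u = (\<lambda>_. u 0)" by blast
  hence "((\<lambda>_::real. u 0) \<longlongrightarrow> 0) at_top" using dec_tendsto(1)[OF u(1)] by simp
  hence "u 0 = 0" by (simp add: tendsto_const_iff)
  thus False using boundD(2)[OF b] v by simp
qed

lemma bound_of_sol:
  assumes s: "sol p (\<lambda>_. 0) u v" and i: "integrable lborel (\<lambda>y. (u y)\<^sup>2)" and nz: "u 0 \<noteq> 0 \<or> v 0 \<noteq> 0"
  shows "\<exists>u v. bound p u v"
proof -
  define m where "m = (u 0)\<^sup>2 + (v 0)\<^sup>2"
  have m: "0 < m" using nz by (simp add: m_def sum_power2_gt_zero_iff)
  define c where "c = 1 / sqrt m"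
  have c: "c\<^sup>2 * m = 1" using m by (simp add: c_def power_divide)
  have "sol p (\<lambda>_. 0) (\<lambda>y. c * u y) (\<lambda>y. c * v y)"
    using sol_lincomb[OF s s, of c 0] by simp
  moreover have "(c * u 0)\<^sup>2 + (c * v 0)\<^sup>2 = 1" using c by (simp add: m_def power_mult_distrib algebra_simps)
  moreover have "integrable lborel (\<lambda>y. (c * u y)\<^sup>2)" using i by (simp add: power_mult_distrib)
  ultimately have "bound p (\<lambda>y. c * u y) (\<lambda>y. c * v y)" by (simp add: bound_def)
  thus ?thesis by blast
qed

definition ho :: "real \<Rightarrow> real \<Rightarrow> real \<Rightarrow> real" where
  "ho \<beta> E y = \<beta>\<^sup>2 * y\<^sup>2 - E"

lemma ho_adm: "0 < \<mu> \<Longrightarrow> \<mu> \<le> \<beta>\<^sup>2 \<Longrightarrow> \<beta>\<^sup>2 \<le> M \<Longrightarrow> \<bar>E\<bar> \<le> M \<Longrightarrow> adm \<mu> M (ho \<beta> E)"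
  unfolding adm_def ho_def
proof (intro conjI allI)
  assume *: "0 < \<mu>" "\<mu> \<le> \<beta>\<^sup>2" "\<beta>\<^sup>2 \<le> M" "\<bar>E\<bar> \<le> M"
  show "continuous_on UNIV (\<lambda>y. \<beta>\<^sup>2 * y\<^sup>2 - E)" by (intro continuous_intros)
  fix y
  have "\<mu> * y\<^sup>2 \<le> \<beta>\<^sup>2 * y\<^sup>2" "\<beta>\<^sup>2 * y\<^sup>2 \<le> M * y\<^sup>2" using * by (auto intro!: mult_right_mono)
  thus "\<mu> * y\<^sup>2 - M \<le> \<beta>\<^sup>2 * y\<^sup>2 - E" "\<beta>\<^sup>2 * y\<^sup>2 - E \<le> M * (1 + y\<^sup>2)" using * by (auto simp: algebra_simps)
qed

lemma ho_dec:
  assumes "0 < \<beta>" "bound (ho \<beta> E) u v"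
  obtains K where "dec 4 K u" "dec 4 K v"
proof -
  have a: "adm (\<beta>\<^sup>2) (\<beta>\<^sup>2 + \<bar>E\<bar>) (ho \<beta> E)" using assms by (intro ho_adm) auto
  have "0 < \<beta>\<^sup>2" "0 \<le> \<beta>\<^sup>2 + \<bar>E\<bar>" "0 \<le> (4::real)" using assms by auto
  from bound_dec[OF this] obtain K where
    "\<And>p u v. adm (\<beta>\<^sup>2) (\<beta>\<^sup>2 + \<bar>E\<bar>) p \<Longrightarrow> bound p u v \<Longrightarrow> dec 4 K u \<and> dec 4 K v" by metis
  from this[OF a assms(2)] show thesis using that by blast
qed

lemma ho_integrable:
  assumes u: "dec 4 K u" "dec 4 K v" "continuous_on UNIV u" "continuous_on UNIV v"
  shows "integrable lborel (\<lambda>y. (c * v y + \<beta> * y * u y)\<^sup>2)"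
proof -
  have 1: "dec 3 (\<bar>c\<bar> * K) (\<lambda>y. c * v y)" by (intro dec_mono[OF dec_cmult[OF u(2)]]) auto
  have 2: "dec 3 (\<bar>\<beta>\<bar> * 1 * K) (\<lambda>y. \<beta> * y * u y)"
    by (intro dec_mono[OF dec_mult[OF dec_cmult[OF dec_y] u(1)]]) auto
  from dec_add[OF 1 2] show ?thesis
    unfolding power2_eq_square
    by (intro integrable_dec[OF _ dec_mult] continuous_intros u) auto
qed

text \<open>The annihilation operator u' + \<beta> y u lowers the energy by 2 \<beta>. Its image has
  data (v(0), (\<beta> - E) u(0)) at 0, which vanish only in the ground state.\<close>

lemma ho_lower:
  assumes "0 < \<beta>" and b: "bound (ho \<beta> E) u v" and "E \<noteq> \<beta>"
  shows "\<exists>u v. bound (ho \<beta> (E - 2 * \<beta>)) u v"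
proof -
  note s = boundD(1)[OF b]
  obtain K where K: "dec 4 K u" "dec 4 K v" using ho_dec[OF assms(1) b] by blast
  show ?thesis
  proof (rule bound_of_sol)
    show "sol (ho \<beta> (E - 2 * \<beta>)) (\<lambda>_. 0) (\<lambda>y. 1 * v y + \<beta> * y * u y)
      (\<lambda>y. (\<beta>\<^sup>2 * y\<^sup>2 - E + \<beta>) * u y + \<beta> * y * v y)"
      unfolding sol_def
    proof (intro allI conjI)
      fix y
      show "((\<lambda>y. 1 * v y + \<beta> * y * u y) has_real_derivative (\<beta>\<^sup>2 * y\<^sup>2 - E + \<beta>) * u y + \<beta> * y * v y) (at y)"
        by (auto intro!: derivative_eq_intros solD(1)[OF s] solD(2)[OF s] simp: ho_def algebra_simps)
      show "((\<lambda>y. (\<beta>\<^sup>2 * y\<^sup>2 - E + \<beta>) * u y + \<beta> * y * v y) has_real_derivative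
         ho \<beta> (E - 2 * \<beta>) y * (1 * v y + \<beta> * y * u y) - 0) (at y)"
        by (auto intro!: derivative_eq_intros solD(1)[OF s] solD(2)[OF s] simp: ho_def algebra_simps power2_eq_square)
    qed
    show "integrable lborel (\<lambda>y. (1 * v y + \<beta> * y * u y)\<^sup>2)"
      by (rule ho_integrable[OF K sol_cont[OF s]])
    show "1 * v 0 + \<beta> * 0 * u 0 \<noteq> 0 \<or> (\<beta>\<^sup>2 * 0\<^sup>2 - E + \<beta>) * u 0 + \<beta> * 0 * v 0 \<noteq> 0"
      using boundD(2)[OF b] assms(3) by auto
  qed
qed

text \<open>The creation operator -u' + \<beta> y u; its image has data (-v(0), (\<beta> + E) u(0))
  at 0.\<close>

lemma ho_raise:
  assumes "0 < \<beta>" and b: "bound (ho \<beta> E) u v" and "E \<noteq> - \<beta>"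
  shows "\<exists>u v. bound (ho \<beta> (E + 2 * \<beta>)) u v"
proof -
  note s = boundD(1)[OF b]
  obtain K where K: "dec 4 K u" "dec 4 K v" using ho_dec[OF assms(1) b] by blast
  show ?thesis
  proof (rule bound_of_sol)
    show "sol (ho \<beta> (E + 2 * \<beta>)) (\<lambda>_. 0) (\<lambda>y. (-1) * v y + \<beta> * y * u y)
      (\<lambda>y. (\<beta> + E - \<beta>\<^sup>2 * y\<^sup>2) * u y + \<beta> * y * v y)"
      unfolding sol_def
    proof (intro allI conjI)
      fix y
      show "((\<lambda>y. (-1) * v y + \<beta> * y * u y) has_real_derivative (\<beta> + E - \<beta>\<^sup>2 * y\<^sup>2) * u y + \<beta> * y * v y) (at y)"
        by (auto intro!: derivative_eq_intros solD(1)[OF s] solD(2)[OF s] simp: ho_def algebra_simps)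
      show "((\<lambda>y. (\<beta> + E - \<beta>\<^sup>2 * y\<^sup>2) * u y + \<beta> * y * v y) has_real_derivative
         ho \<beta> (E + 2 * \<beta>) y * ((-1) * v y + \<beta> * y * u y) - 0) (at y)"
        by (auto intro!: derivative_eq_intros solD(1)[OF s] solD(2)[OF s] simp: ho_def algebra_simps power2_eq_square)
    qed
    show "integrable lborel (\<lambda>y. ((-1) * v y + \<beta> * y * u y)\<^sup>2)"
      by (rule ho_integrable[OF K sol_cont[OF s]])
    show "(-1) * v 0 + \<beta> * 0 * u 0 \<noteq> 0 \<or> (\<beta> + E - \<beta>\<^sup>2 * 0\<^sup>2) * u 0 + \<beta> * 0 * v 0 \<noteq> 0"
      using boundD(2)[OF b] assms(3) by auto
  qed
qed

lemma ho_ground: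
  assumes "0 < \<beta>"
  shows "\<exists>u v. bound (ho \<beta> \<beta>) u v"
proof -
  define u where "u = (\<lambda>y. exp (- (\<beta> * y\<^sup>2 / 2)))"
  have "bound (ho \<beta> \<beta>) u (\<lambda>y. - (\<beta> * y * u y))"
    unfolding bound_def
  proof (intro conjI)
    have du: "(u has_real_derivative - (\<beta> * y * u y)) (at y)" for y
      unfolding u_def by (auto intro!: derivative_eq_intros)
    show s: "sol (ho \<beta> \<beta>) (\<lambda>_. 0) u (\<lambda>y. - (\<beta> * y * u y))"
      unfolding sol_def
    proof (intro allI conjI du)
      fix y
      show "((\<lambda>y. - (\<beta> * y * u y)) has_real_derivative ho \<beta> \<beta> y * u y - 0) (at y)"
        by (auto intro!: derivative_eq_intros du simp: ho_def algebra_simps power2_eq_square)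
    qed
    show "(u 0)\<^sup>2 + (- (\<beta> * 0 * u 0))\<^sup>2 = 1" by (simp add: u_def)
    have "dec 1 (exp (1 / (2 * \<beta>))) u"
      unfolding dec_def
    proof
      fix y :: real
      have "0 \<le> (\<beta> * \<bar>y\<bar> - 1)\<^sup>2 / (2 * \<beta>)" using assms by simp
      also have "\<dots> = \<beta> * y\<^sup>2 / 2 - \<bar>y\<bar> + 1 / (2 * \<beta>)"
        using assms by (simp add: power2_diff power_mult_distrib field_simps power2_eq_square)
      finally have "- (\<beta> * y\<^sup>2 / 2) \<le> 1 / (2 * \<beta>) + - (1 * \<bar>y\<bar>)" by simp
      hence "exp (- (\<beta> * y\<^sup>2 / 2)) \<le> exp (1 / (2 * \<beta>) + - (1 * \<bar>y\<bar>))" by (simp only: exp_le_cancel_iff)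
      thus "\<bar>u y\<bar> \<le> exp (1 / (2 * \<beta>)) * wt 1 y" unfolding exp_add wt_def u_def by simp
    qed
    from integrable_dec[OF _ dec_mult[OF this this]] show "integrable lborel (\<lambda>y. (u y)\<^sup>2)"
      using sol_cont(1)[OF s] by (auto simp: power2_eq_square intro!: continuous_intros)
  qed
  thus ?thesis by blast
qed

text \<open>Lowering repeatedly must stop at E = \<beta>, since a negative energy makes the
  potential nonnegative; raising the Gaussian state produces every level. Levels are counted from
  1.\<close>

lemma ho_spec:
  assumes "0 < \<beta>"
  shows "(\<exists>u v. bound (ho \<beta> E) u v) \<longleftrightarrow> (\<exists>j::nat. 1 \<le> j \<and> E = (2 * real j - 1) * \<beta>)"
proof
  have "\<exists>j::nat. 1 \<le> j \<and> E = (2 * real j - 1) * \<beta>" if "bound (ho \<beta> E) u v" "E < 2 * real n * \<beta>" for n E u v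
    using that
  proof (induction n arbitrary: E u v)
    case 0
    have "adm (\<beta>\<^sup>2) (\<beta>\<^sup>2 + \<bar>E\<bar>) (ho \<beta> E)" using assms by (intro ho_adm) auto
    moreover have "0 \<le> ho \<beta> E y" for y using 0 by (simp add: ho_def order_trans[of E 0])
    ultimately show ?case using bound_nonneg_potential[of "\<beta>\<^sup>2"] 0 assms by (metis zero_less_power)
  next
    case (Suc n)
    show ?case
    proof (cases "E = \<beta>")
      case True thus ?thesis by (intro exI[of _ 1]) auto
    next
      case False
      obtain u' v' where "bound (ho \<beta> (E - 2 * \<beta>)) u' v'" using ho_lower[OF assms Suc.prems(1) False] by blast
      moreover have "E - 2 * \<beta> < 2 * real n * \<beta>" using Suc.prems(2) by (simp add: algebra_simps)
      ultimately obtain j :: nat where "1 \<le> j" "E - 2 * \<beta> = (2 * real j - 1) * \<beta>" using Suc.IH by blast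
      thus ?thesis by (intro exI[of _ "Suc j"]) (auto simp: algebra_simps)
    qed
  qed
  moreover obtain n :: nat where "E / (2 * \<beta>) < real n" using reals_Archimedean2 by blast
  hence "E < 2 * real n * \<beta>" using assms by (simp add: field_simps)
  ultimately show "\<exists>u v. bound (ho \<beta> E) u v \<Longrightarrow> \<exists>j::nat. 1 \<le> j \<and> E = (2 * real j - 1) * \<beta>" by blast
next
  have "\<exists>u v. bound (ho \<beta> ((2 * real (Suc i) - 1) * \<beta>)) u v" for i
  proof (induction i)
    case 0 show ?case using ho_ground[OF assms] by simp
  next
    case (Suc i)
    then obtain u v where b: "bound (ho \<beta> ((2 * real (Suc i) - 1) * \<beta>)) u v" by blast
    have "0 < (2 * real (Suc i) - 1) * \<beta>" using assms by (intro mult_pos_pos) auto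
    hence "(2 * real (Suc i) - 1) * \<beta> \<noteq> - \<beta>" using assms by linarith
    from ho_raise[OF assms b this] show ?case by (simp add: algebra_simps)
  qed
  thus "\<exists>j::nat. 1 \<le> j \<and> E = (2 * real j - 1) * \<beta> \<Longrightarrow> \<exists>u v. bound (ho \<beta> E) u v"
    by (metis One_nat_def Suc_le_D)
qed

section \<open>Moments of the oscillator states\<close>

lemma dec_poly:
  assumes "dec l C g" "0 \<le> C"
  shows "dec (l - real n) C (\<lambda>y. y ^ n * g y)"
proof (induction n)
  case (Suc n)
  have "dec (-1 + (l - real n)) (1 * C) (\<lambda>y. y * (y ^ n * g y))" by (rule dec_mult[OF dec_y Suc])
  thus ?case by (simp add: algebra_simps)
qed (use assms in simp)

text \<open>Integrates the third-order equation satisfied by \<open>u\<^sup>2\<close> against a weight \<open>P\<close>.\<close>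

lemma virial:
  assumes b: "bound p u v" and u: "dec 8 K u" "dec 8 K v"
    and p: "\<And>y. (p has_real_derivative p' y) (at y)" "continuous_on UNIV p'" "dec (-4) C p" "dec (-4) C p'"
    and P: "\<And>y. (P has_real_derivative P1 y) (at y)" "\<And>y. (P1 has_real_derivative P2 y) (at y)"
      "\<And>y. (P2 has_real_derivative P3 y) (at y)" "continuous_on UNIV P3"
      "dec (-4) C P" "dec (-4) C P1" "dec (-4) C P2" "dec (-4) C P3"
  shows "(LBINT y. (P3 y - 4 * P1 y * p y - 2 * P y * p' y) * (u y)\<^sup>2) = 0"
proof -
  note s = boundD(1)[OF b]
  have K: "0 \<le> K" using u(1) by (rule dec_nonneg)
  have C: "0 \<le> C" using p(3) by (rule dec_nonneg)
  \<comment> \<open>With w = u^2 this is P w'' - P' w' + P'' w - 4 P p w. The equation w''' = 4 p w'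
    + 2 p' w cancels every derivative of w when it is differentiated.\<close>
  define F where "F = (\<lambda>y. 2 * (P y * (v y * v y)) - 2 * ((P y * p y) * (u y * u y)) - 2 * (P1 y * (u y * v y)) + P2 y * (u y * u y))"
  have cu: "continuous_on UNIV u" "continuous_on UNIV v" using sol_cont[OF s] by auto
  have cont: "continuous_on UNIV f" if "\<And>y. (f has_real_derivative f' y) (at y)" for f f'
    using that by (meson DERIV_isCont continuous_at_imp_continuous_on)
  have cp: "continuous_on UNIV p" "continuous_on UNIV P" "continuous_on UNIV P1"
    using cont p(1) P(1,2) by metis+
  show ?thesis
  proof (rule integral_deriv_zero)
    show "(F has_real_derivative (P3 y - 4 * P1 y * p y - 2 * P y * p' y) * (u y)\<^sup>2) (at y)" for y
      unfolding F_def
      by (auto intro!: derivative_eq_intros solD(1)[OF s] solD(2)[OF s] p(1) P(1-3) simp: algebra_simps power2_eq_square)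
    show "continuous_on UNIV (\<lambda>y. (P3 y - 4 * P1 y * p y - 2 * P y * p' y) * (u y)\<^sup>2)"
      by (intro continuous_intros cu cp p P)
    have "dec 8 (\<bar>2\<bar> * (C * (K * K)) + \<bar>2\<bar> * (C * C * (K * K)) + \<bar>2\<bar> * (C * (K * K)) + C * (K * K)) F"
      unfolding F_def
      by (intro dec_add dec_diff dec_cmult; rule dec_mono, (rule dec_mult P p u)+; simp)
    thus "dec 8 (\<bar>2\<bar> * (C * (K * K)) + \<bar>2\<bar> * (C * C * (K * K)) + \<bar>2\<bar> * (C * (K * K)) + C * (K * K)) F" .
    have P3: "dec (-8) C P3" using C by (intro dec_mono[OF P(8)]) auto
    have 4: "dec (-8) (\<bar>4\<bar> * C * C) (\<lambda>y. 4 * P1 y * p y)"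
      by (rule dec_mono[OF dec_mult[OF dec_cmult[OF P(6)] p(3)]]) auto
    have 2: "dec (-8) (\<bar>2\<bar> * C * C) (\<lambda>y. 2 * P y * p' y)"
      by (rule dec_mono[OF dec_mult[OF dec_cmult[OF P(5)] p(4)]]) auto
    have "dec (-8 + (8 + 8)) ((C + \<bar>4\<bar> * C * C + \<bar>2\<bar> * C * C) * (K * K)) (\<lambda>y. (P3 y - 4 * P1 y * p y - 2 * P y * p' y) * (u y * u y))"
      by (intro dec_mult dec_diff P3 4 2 u)
    thus "dec (-8 + (8 + 8)) ((C + \<bar>4\<bar> * C * C + \<bar>2\<bar> * C * C) * (K * K)) (\<lambda>y. (P3 y - 4 * P1 y * p y - 2 * P y * p' y) * (u y)\<^sup>2)"
      unfolding power2_eq_square .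
  qed auto
qed

lemma integrable_moment:
  assumes "continuous_on UNIV u" "dec 8 K u" and that: "j \<le> 8"
  shows "integrable lborel (\<lambda>y. y ^ j * (u y)\<^sup>2)"
proof -
  have K: "0 \<le> K" using assms(2) by (rule dec_nonneg)
  have "dec (8 + 8 - real j) (K * K) (\<lambda>y. y ^ j * (u y * u y))"
    by (rule dec_poly[OF dec_mult]) (use assms K in auto)
  thus ?thesis unfolding power2_eq_square
    by (rule integrable_dec[rotated]) (use that assms in \<open>auto intro!: continuous_intros\<close>)
qed

text \<open>The weights 1, y, y^2, y^3 in \<open>virial\<close> give one relation each, expressing
  the moment of order 1, 2, 3, 4 through lower ones.\<close>

lemma ho_moments:
  assumes "0 < \<beta>" and b: "bound (ho \<beta> E) u v"
  defines "m \<equiv> \<lambda>j. LBINT y. y ^ j * (u y)\<^sup>2"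
  shows "m 1 = 0" "m 2 = E / (2 * \<beta>\<^sup>2) * m 0" "m 3 = 0"
    "m 4 = 3 / (8 * \<beta>\<^sup>2) * (1 + (E / \<beta>)\<^sup>2) * m 0"
proof -
  have a: "adm (\<beta>\<^sup>2) (\<beta>\<^sup>2 + \<bar>E\<bar>) (ho \<beta> E)" using assms by (intro ho_adm) auto
  have "0 < \<beta>\<^sup>2" "0 \<le> \<beta>\<^sup>2 + \<bar>E\<bar>" "0 \<le> (8::real)" using assms by auto
  from bound_dec[OF this] obtain K where
    "\<And>p u v. adm (\<beta>\<^sup>2) (\<beta>\<^sup>2 + \<bar>E\<bar>) p \<Longrightarrow> bound p u v \<Longrightarrow> dec 8 K u \<and> dec 8 K v" by metis
  from this[OF a b] have K: "dec 8 K u" "dec 8 K v" by auto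
  have cu: "continuous_on UNIV u" using sol_cont[OF boundD(1)[OF b]] by auto
  note im = integrable_moment[OF cu K(1)]
  have I: "integrable lborel (\<lambda>y. c * (y ^ j * (u y)\<^sup>2))" if "j \<le> 8" for j c
    using im[OF that] by simp
  have lin2: "(LBINT y. c * (y ^ i * (u y)\<^sup>2) + d * (y ^ j * (u y)\<^sup>2)) = c * m i + d * m j"
    if "i \<le> 8" "j \<le> 8" for c d i j
    unfolding m_def Bochner_Integration.integral_add[OF I[OF that(1)] I[OF that(2)]] by simp
  have lin3: "(LBINT y. c * (y ^ i * (u y)\<^sup>2) + (d * (y ^ j * (u y)\<^sup>2) + e * (y ^ l * (u y)\<^sup>2))) = c * m i + (d * m j + e * m l)"
    if "i \<le> 8" "j \<le> 8" "l \<le> 8" for c d e i j l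
    unfolding Bochner_Integration.integral_add[OF I[OF that(1)] Bochner_Integration.integrable_add[OF I[OF that(2)] I[OF that(3)]]]
      lin2[OF that(2,3)] by (simp add: m_def)
  have one: "dec (-4) 1 (\<lambda>_. 1::real)" using dec_mono[OF dec_const[of 1], of "-4" 1] by simp
  have pw: "dec (-4) 1 (\<lambda>y. y ^ n)" if "n \<le> 4" for n
    using dec_poly[OF dec_const[of 1], of n] that
    by (intro dec_mono[of "0 - real n" 1 _ "-4" 1]) auto
  \<comment> \<open>6 is the largest coefficient among the weights and their derivatives, attained
    by the third derivative of y^3.\<close>
  define C where "C = 6 * (1 + \<beta>\<^sup>2 + \<bar>E\<bar>)"
  have C: "c \<le> C" if "c \<le> 6" for c using that by (simp add: C_def algebra_simps add_increasing2)
  have cpw: "dec (-4) C (\<lambda>y. c * y ^ n)" if "n \<le> 4" "\<bar>c\<bar> \<le> 6" for n c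
    using dec_cmult[OF pw[OF that(1)], of c] by (rule dec_mono) (use C[OF that(2)] in auto)
  have pC: "dec (-4) C (ho \<beta> E)"
  proof -
    have "dec (-4) (\<bar>\<beta>\<^sup>2\<bar> * 1 + \<bar>E\<bar> * 1) (\<lambda>y. \<beta>\<^sup>2 * y ^ 2 - E * 1)"
      by (intro dec_diff dec_cmult pw one) simp
    thus ?thesis unfolding ho_def by (auto intro: dec_mono simp: C_def)
  qed
  have p'C: "dec (-4) C (\<lambda>y. 2 * \<beta>\<^sup>2 * y)"
    using dec_cmult[OF pw[of 1], of "2 * \<beta>\<^sup>2"] by (auto intro: dec_mono simp: C_def)
  have dp: "(ho \<beta> E has_real_derivative 2 * \<beta>\<^sup>2 * y) (at y)" for y
    unfolding ho_def by (auto intro!: derivative_eq_intros)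
  have cp': "continuous_on UNIV (\<lambda>y. 2 * \<beta>\<^sup>2 * y)" by (intro continuous_intros)
  note vir = virial[OF b K dp cp' pC p'C]
  have z: "dec (-4) C (\<lambda>_. 0)" "dec (-4) C (\<lambda>_. 1)" "dec (-4) C (\<lambda>_. 2)" "dec (-4) C (\<lambda>_. 6)"
    using cpw[of 0 0] cpw[of 0 1] cpw[of 0 2] cpw[of 0 6] by auto
  have z1: "dec (-4) C (\<lambda>y. y)" "dec (-4) C (\<lambda>y. 2 * y)" "dec (-4) C (\<lambda>y. 6 * y)" "dec (-4) C (\<lambda>y. y\<^sup>2)"
    "dec (-4) C (\<lambda>y. 3 * y\<^sup>2)" "dec (-4) C (\<lambda>y. y ^ 3)"
    using cpw[of 1 1] cpw[of 1 2] cpw[of 1 6] cpw[of 2 1] cpw[of 2 3] cpw[of 3 1] by auto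
  have b2: "\<beta>\<^sup>2 \<noteq> 0" using assms(1) by simp
  have "(LBINT y. (0 - 4 * 0 * ho \<beta> E y - 2 * 1 * (2 * \<beta>\<^sup>2 * y)) * (u y)\<^sup>2) = 0"
    by (rule vir) (auto intro!: derivative_eq_intros z)
  also have "(\<lambda>y. (0 - 4 * 0 * ho \<beta> E y - 2 * 1 * (2 * \<beta>\<^sup>2 * y)) * (u y)\<^sup>2) = (\<lambda>y. (- (4 * \<beta>\<^sup>2)) * (y ^ 1 * (u y)\<^sup>2))"
    by auto
  finally have m1: "m 1 = 0" using b2 by (simp only: m_def Bochner_Integration.integral_mult_right_zero) simp
  thus "m 1 = 0" .
  have "(LBINT y. (0 - 4 * 1 * ho \<beta> E y - 2 * y * (2 * \<beta>\<^sup>2 * y)) * (u y)\<^sup>2) = 0"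
    by (rule vir[where ?P2.0 = "\<lambda>_. 0"]) (auto intro!: derivative_eq_intros z z1)
  also have "(\<lambda>y. (0 - 4 * 1 * ho \<beta> E y - 2 * y * (2 * \<beta>\<^sup>2 * y)) * (u y)\<^sup>2)
     = (\<lambda>y. (- (8 * \<beta>\<^sup>2)) * (y ^ 2 * (u y)\<^sup>2) + (4 * E) * (y ^ 0 * (u y)\<^sup>2))"
    by (auto simp: ho_def algebra_simps power2_eq_square)
  finally have "- (8 * \<beta>\<^sup>2) * m 2 + 4 * E * m 0 = 0" by (subst (asm) lin2) simp_all
  thus m2: "m 2 = E / (2 * \<beta>\<^sup>2) * m 0" using b2 by (simp add: field_simps)
  have "(LBINT y. (0 - 4 * (2 * y) * ho \<beta> E y - 2 * y\<^sup>2 * (2 * \<beta>\<^sup>2 * y)) * (u y)\<^sup>2) = 0"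
    by (rule vir[where ?P2.0 = "\<lambda>_. 2"]) (auto intro!: derivative_eq_intros z z1)
  also have "(\<lambda>y. (0 - 4 * (2 * y) * ho \<beta> E y - 2 * y\<^sup>2 * (2 * \<beta>\<^sup>2 * y)) * (u y)\<^sup>2)
     = (\<lambda>y. (- (12 * \<beta>\<^sup>2)) * (y ^ 3 * (u y)\<^sup>2) + (8 * E) * (y ^ 1 * (u y)\<^sup>2))"
    by (auto simp: ho_def algebra_simps power2_eq_square power3_eq_cube)
  finally have "- (12 * \<beta>\<^sup>2) * m 3 + 8 * E * m 1 = 0" by (subst (asm) lin2) simp_all
  thus "m 3 = 0" using b2 m1 by simp
  have "(LBINT y. (6 - 4 * (3 * y\<^sup>2) * ho \<beta> E y - 2 * y ^ 3 * (2 * \<beta>\<^sup>2 * y)) * (u y)\<^sup>2) = 0"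
    by (rule vir[where ?P2.0 = "\<lambda>y. 6 * y"]) (auto intro!: derivative_eq_intros z z1)
  also have "(\<lambda>y. (6 - 4 * (3 * y\<^sup>2) * ho \<beta> E y - 2 * y ^ 3 * (2 * \<beta>\<^sup>2 * y)) * (u y)\<^sup>2)
     = (\<lambda>y. (- (16 * \<beta>\<^sup>2)) * (y ^ 4 * (u y)\<^sup>2) + ((12 * E) * (y ^ 2 * (u y)\<^sup>2) + 6 * (y ^ 0 * (u y)\<^sup>2)))"
    by (auto simp: ho_def algebra_simps power2_eq_square power3_eq_cube power4_eq_xxxx)
  finally have "- (16 * \<beta>\<^sup>2) * m 4 + (12 * E * m 2 + 6 * m 0) = 0" by (subst (asm) lin3) simp_all
  hence "m 4 = (12 * E * m 2 + 6 * m 0) / (16 * \<beta>\<^sup>2)" using b2 by (simp add: field_simps)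
  also have "\<dots> = 3 / (8 * \<beta>\<^sup>2) * (1 + (E / \<beta>)\<^sup>2) * m 0"
    unfolding m2 using b2 by (simp add: field_simps power2_eq_square)
  finally show "m 4 = 3 / (8 * \<beta>\<^sup>2) * (1 + (E / \<beta>)\<^sup>2) * m 0" .
qed

section \<open>The spectrum of the fibre operators\<close>

text \<open>Two nearby eigenvalues would have nearby eigenfunctions by \<open>bound_close\<close>,
  yet these are orthogonal: the squared norm of u equals the integral of u (u - s u') and is thus
  O(e), while it is bounded below.\<close>

lemma eigenvalue_separation:
  assumes "0 < \<mu>" "0 \<le> M"
  obtains d0 where "0 < d0"
    "\<And>p u v u' v' e. adm \<mu> M p \<Longrightarrow> adm \<mu> M (\<lambda>y. p y - e) \<Longrightarrow> bound p u v \<Longrightarrow> bound (\<lambda>y. p y - e) u' v' \<Longrightarrow>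
      e \<noteq> 0 \<Longrightarrow> d0 \<le> \<bar>e\<bar>"
proof -
  have one: "(0::real) \<le> 1" by simp
  obtain C where C: "1 \<le> C" and close:
    "\<And>p1 u1 v1 p2 u2 v2 d. adm \<mu> M p1 \<Longrightarrow> adm \<mu> M p2 \<Longrightarrow> bound p1 u1 v1 \<Longrightarrow> bound p2 u2 v2 \<Longrightarrow>
      dec (-1) d (\<lambda>y. p1 y - p2 y) \<Longrightarrow>
      \<exists>s\<in>{1, -1}. dec 1 (C * d) (\<lambda>y. u1 y - s * u2 y) \<and> \<bar>v1 0 - s * v2 0\<bar> \<le> C * d"
    by (rule bound_close[OF assms one], erule that, assumption)
  obtain K where K: "1 \<le> K" "\<And>p u v. adm \<mu> M p \<Longrightarrow> bound p u v \<Longrightarrow> dec 1 K u \<and> dec 1 K v"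
    using bound_dec[OF assms one] by metis
  obtain \<kappa> where \<kappa>: "0 < \<kappa>" "\<And>p u v. adm \<mu> M p \<Longrightarrow> bound p u v \<Longrightarrow> \<kappa> \<le> (LBINT y. (u y)\<^sup>2)"
    using bound_norm_lower[OF assms] by metis
  show thesis
  proof (rule that[of "\<kappa> / (7 * (K * C))"])
    show "0 < \<kappa> / (7 * (K * C))" using \<kappa> K C by simp
    fix p u v u' v' e
    assume a: "adm \<mu> M p" "adm \<mu> M (\<lambda>y. p y - e)" and b: "bound p u v" "bound (\<lambda>y. p y - e) u' v'" and e: "e \<noteq> 0"
    have "dec (-1) \<bar>e\<bar> (\<lambda>y. p y - (p y - e))"
      using dec_mono[OF dec_const[of e], of "-1"] by simp
    then obtain s where s: "s \<in> {1, -1}" "dec 1 (C * \<bar>e\<bar>) (\<lambda>y. u y - s * u' y)"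
      using close[OF a b] by blast
    have du: "dec 1 K u" "dec 1 K u'" using K(2)[OF a(1) b(1)] K(2)[OF a(2) b(2)] by auto
    have cu: "continuous_on UNIV u" "continuous_on UNIV u'"
      using sol_cont(1)[OF boundD(1)[OF b(1)]] sol_cont(1)[OF boundD(1)[OF b(2)]] .
    have "(LBINT y. ((p y - e) - p y) * (u y * u' y)) = 0" by (rule bound_orthogonal[OF a assms(1) b])
    hence orth: "(LBINT y. u y * u' y) = 0" using e by simp
    have i: "integrable lborel (\<lambda>y. u y * u' y)"
      by (rule integrable_dec[OF _ dec_mult[OF du]]) (auto intro!: continuous_intros cu)
    have i2: "integrable lborel (\<lambda>y. u y * (u y - s * u' y))"
      by (rule integrable_dec[OF _ dec_mult[OF du(1) s(2)]]) (auto intro!: continuous_intros cu)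
    have "(LBINT y. (u y)\<^sup>2) = (LBINT y. u y * (u y - s * u' y) + s * (u y * u' y))"
      by (rule Bochner_Integration.integral_cong) (auto simp: algebra_simps power2_eq_square)
    also have "\<dots> = (LBINT y. u y * (u y - s * u' y)) + s * (LBINT y. u y * u' y)"
      using i i2 by (subst Bochner_Integration.integral_add) auto
    also have "\<dots> = (LBINT y. u y * (u y - s * u' y))" using orth by simp
    also have "\<dots> \<le> 7 * (K * (C * \<bar>e\<bar>))"
    proof -
      have "\<bar>LBINT y. u y * (u y - s * u' y)\<bar> \<le> 7 * (K * (C * \<bar>e\<bar>))"
        by (rule integral_dec_le[OF _ dec_mult[OF du(1) s(2)]]) (auto intro!: continuous_intros cu)
      thus ?thesis by linarith
    qed
    finally have "\<kappa> \<le> 7 * (K * C) * \<bar>e\<bar>" using \<kappa>(2)[OF a(1) b(1)] by (simp add: algebra_simps)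
    thus "\<kappa> / (7 * (K * C)) \<le> \<bar>e\<bar>" using K C by (simp add: divide_le_eq algebra_simps)
  qed
qed

lemma finite_separated:
  fixes S :: "real set"
  assumes "0 < d" "\<And>x. x \<in> S \<Longrightarrow> a \<le> x \<and> x \<le> b" "\<And>x y. x \<in> S \<Longrightarrow> y \<in> S \<Longrightarrow> x \<noteq> y \<Longrightarrow> d \<le> \<bar>x - y\<bar>"
  shows "finite S"
proof (rule inj_on_finite)
  show "inj_on (\<lambda>x. \<lfloor>x / d\<rfloor>) S"
  proof (rule inj_onI, rule ccontr)
    fix x y assume *: "x \<in> S" "y \<in> S" "\<lfloor>x / d\<rfloor> = \<lfloor>y / d\<rfloor>" "x \<noteq> y"
    have "\<bar>x / d - y / d\<bar> < 1" using *(3) by linarith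
    hence "\<bar>x - y\<bar> < d" using assms(1) by (simp add: diff_divide_distrib[symmetric] abs_divide)
    thus False using assms(3)[OF *(1,2,4)] by simp
  qed
  show "(\<lambda>x. \<lfloor>x / d\<rfloor>) ` S \<subseteq> {\<lfloor>a / d\<rfloor>..\<lfloor>b / d\<rfloor>}"
    using assms(1,2) by (auto intro!: floor_mono divide_right_mono)
qed auto

section \<open>The potential seen from x_k, and its spectrum\<close>

locale field_profile =
  fixes b :: "real \<Rightarrow> real" and bm bp :: real
  assumes b_cont: "continuous_on UNIV b" and b_lower: "\<And>x. bm \<le> b x" and b_upper: "\<And>x. b x \<le> bp" and bm_pos: "0 < bm"
begin

definition A :: "real \<Rightarrow> real \<Rightarrow> real" where "A s y = a_of b (s + y) - a_of b s"

text \<open>The potential at momentum a(s) + \<kappa> in the coordinate centred at s. Keeping the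
  centre fixed while \<kappa> varies makes the dependence on the momentum polynomial, as
  differentiation in k requires.\<close>

definition pot :: "real \<Rightarrow> real \<Rightarrow> real \<Rightarrow> real" where "pot s \<kappa> y = (A s y - \<kappa>)\<^sup>2"

lemma bp_pos: "0 < bp" and bm_le_bp: "bm \<le> bp"
  using b_lower[of 0] b_upper[of 0] bm_pos by linarith+

lemma A_deriv: "(A s has_real_derivative b (s + y)) (at y)"
  unfolding A_def using DERIV_shift[of "a_of b" "b (s + y)" y s] a_of_deriv[OF b_cont, of "s + y"]
  by (auto intro!: derivative_eq_intros simp: add.commute)

lemma A_cont: "continuous_on UNIV (A s)"
  using A_deriv by (meson DERIV_isCont continuous_at_imp_continuous_on)

lemma A_0 [simp]: "A s 0 = 0" by (simp add: A_def)

lemma A_mvt: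
  obtains z where "A s y = b z * y" "\<bar>z - s\<bar> \<le> \<bar>y\<bar>"
proof (cases "y = 0")
  case True thus thesis using that[of s] by simp
next
  case False
  have "\<exists>z. \<bar>z\<bar> \<le> \<bar>y\<bar> \<and> A s y = b (s + z) * y"
  proof (cases "0 < y")
    case True
    obtain z where "0 < z" "z < y" "A s y - A s 0 = (y - 0) * b (s + z)" using MVT2[OF True, of "A s" "\<lambda>z. b (s + z)", OF A_deriv] by blast
    thus ?thesis by (intro exI[of _ z]) (auto simp: algebra_simps)
  next
    case False
    hence "y < 0" using \<open>y \<noteq> 0\<close> by simp
    then obtain z where "y < z" "z < 0" "A s 0 - A s y = (0 - y) * b (s + z)" using MVT2[of y 0 "A s" "\<lambda>z. b (s + z)", OF _ A_deriv] by blast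
    thus ?thesis by (intro exI[of _ z]) (auto simp: algebra_simps)
  qed
  then obtain z where "\<bar>z\<bar> \<le> \<bar>y\<bar>" "A s y = b (s + z) * y" by blast
  thus thesis by (intro that[of "s + z"]) auto
qed

lemma A_upper: "\<bar>A s y\<bar> \<le> bp * \<bar>y\<bar>" and A_lower: "bm * \<bar>y\<bar> \<le> \<bar>A s y\<bar>"
proof -
  obtain z where z: "A s y = b z * y" using A_mvt by blast
  have "\<bar>A s y\<bar> = b z * \<bar>y\<bar>" using b_lower[of z] bm_pos by (simp add: z abs_mult)
  thus "\<bar>A s y\<bar> \<le> bp * \<bar>y\<bar>" "bm * \<bar>y\<bar> \<le> \<bar>A s y\<bar>"
    using b_lower[of z] b_upper[of z] by (auto intro!: mult_right_mono)
qed

lemma A_dec: "dec (-1) bp (A s)"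
  unfolding dec_def
proof
  fix y
  have "bp * \<bar>y\<bar> \<le> bp * (1 * wt (-1) y)" using decD[OF dec_y, of y] bp_pos by (intro mult_left_mono) auto
  thus "\<bar>A s y\<bar> \<le> bp * wt (-1) y" using A_upper[of s y] by simp
qed

lemma a_mono: "x < y \<Longrightarrow> a_of b x < a_of b y"
proof (rule DERIV_pos_imp_increasing[of x y "a_of b"])
  fix z show "\<exists>d. (a_of b has_real_derivative d) (at z) \<and> 0 < d"
    using a_of_deriv[OF b_cont, of z] b_lower[of z] bm_pos by (intro exI[of _ "b z"]) auto
qed

lemma a_surj: "\<exists>x. a_of b x = k"
proof -
  define R where "R = \<bar>k\<bar> / bm"
  have R: "0 \<le> R" "bm * R = \<bar>k\<bar>" using bm_pos by (auto simp: R_def)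
  have "a_of b 0 \<le> a_of b R" "a_of b (- R) \<le> a_of b 0" using a_mono[of 0 R] a_mono[of "-R" 0] R by (cases "R = 0"; simp add: less_imp_le)+
  moreover have "bm * R \<le> \<bar>a_of b R\<bar>" "bm * R \<le> \<bar>a_of b (- R)\<bar>" using A_lower[of R 0] A_lower[of "-R" 0] R by (auto simp: A_def)
  ultimately have "a_of b (- R) \<le> k" "k \<le> a_of b R" unfolding R(2) by auto
  moreover have "continuous_on {- R..R} (a_of b)" using a_of_cont[OF b_cont] continuous_on_subset by blast
  ultimately show ?thesis using IVT'[of "a_of b" "-R" k R] R by auto
qed

lemma a_xk [simp]: "a_of b (xk b k) = k"
  unfolding xk_def inv_def using someI_ex[OF a_surj] .

text \<open>From A^2/2 - \<kappa>^2 \<le> (A - \<kappa>)^2 \<le> 2 A^2 + 2 \<kappa>^2 and the linear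
  bounds on A; the constants involve only the bounds on b and the energy cutoff.\<close>

lemma pot_adm:
  assumes "\<bar>\<kappa>\<bar> \<le> 1" "\<bar>E\<bar> \<le> M0"
  shows "adm (bm\<^sup>2 / 2) (2 * bp\<^sup>2 + 2 + M0) (\<lambda>y. pot s \<kappa> y - E)"
  unfolding adm_def
proof (intro conjI allI)
  show "continuous_on UNIV (\<lambda>y. pot s \<kappa> y - E)" unfolding pot_def by (intro continuous_intros A_cont)
  fix y
  have \<kappa>: "\<kappa>\<^sup>2 \<le> 1" using assms(1) by (simp add: abs_square_le_1)
  have "(bm * \<bar>y\<bar>)\<^sup>2 \<le> \<bar>A s y\<bar>\<^sup>2" using A_lower bm_pos by (intro power_mono) auto
  hence l: "bm\<^sup>2 * y\<^sup>2 \<le> (A s y)\<^sup>2" by (simp add: power_mult_distrib)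
  have "\<bar>A s y\<bar>\<^sup>2 \<le> (bp * \<bar>y\<bar>)\<^sup>2" using A_upper bp_pos by (intro power_mono) auto
  hence u: "(A s y)\<^sup>2 \<le> bp\<^sup>2 * y\<^sup>2" by (simp add: power_mult_distrib)
  have "0 \<le> (A s y - 2 * \<kappa>)\<^sup>2" by simp
  hence "(A s y)\<^sup>2 / 2 - \<kappa>\<^sup>2 \<le> pot s \<kappa> y" by (simp add: pot_def power2_diff power2_eq_square algebra_simps)
  moreover have "0 \<le> bp\<^sup>2" by simp
  ultimately show "bm\<^sup>2 / 2 * y\<^sup>2 - (2 * bp\<^sup>2 + 2 + M0) \<le> pot s \<kappa> y - E"
    using l \<kappa> assms(2) unfolding abs_le_iff by linarith
  have "0 \<le> (A s y + \<kappa>)\<^sup>2" by simp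
  hence "pot s \<kappa> y \<le> 2 * (A s y)\<^sup>2 + 2 * \<kappa>\<^sup>2" by (simp add: pot_def power2_diff power2_sum)
  moreover have "0 \<le> y\<^sup>2 * (2 + M0)" using assms(2) by (intro mult_nonneg_nonneg) auto
  ultimately show "pot s \<kappa> y - E \<le> (2 * bp\<^sup>2 + 2 + M0) * (1 + y\<^sup>2)"
    using u \<kappa> assms(2) \<open>0 \<le> bp\<^sup>2\<close> unfolding abs_le_iff distrib_left distrib_right mult_1_right
    by (simp only: mult.commute[of "y\<^sup>2"] distrib_right) linarith
qed

text \<open>Translation by s, followed by normalisation of the data: by uniqueness a nonzero
  solution has nonzero data at 0.\<close>

lemma hspec_iff: "E \<in> hspec b (a_of b s + \<kappa>) \<longleftrightarrow> (\<exists>u v. bound (\<lambda>y. pot s \<kappa> y - E) u v)"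
proof
  assume "E \<in> hspec b (a_of b s + \<kappa>)"
  then obtain u u' where d: "\<And>x. (u has_real_derivative u' x) (at x)"
      "\<And>x. (u' has_real_derivative (((a_of b x - (a_of b s + \<kappa>))\<^sup>2 - E) * u x)) (at x)"
    and i: "integrable lborel (\<lambda>x. (u x)\<^sup>2)" and nz: "\<exists>x. u x \<noteq> 0"
    unfolding hspec_def by blast
  have s: "sol (\<lambda>y. pot s \<kappa> y - E) (\<lambda>_. 0) (\<lambda>y. u (s + y)) (\<lambda>y. u' (s + y))"
    unfolding sol_def
  proof (intro allI conjI)
    fix y
    show "((\<lambda>y. u (s + y)) has_real_derivative u' (s + y)) (at y)"
      using DERIV_shift[of u "u' (s + y)" y s] d(1)[of "s + y"] by (simp add: add.commute)
    have "((\<lambda>y. u' (s + y)) has_real_derivative ((a_of b (s + y) - (a_of b s + \<kappa>))\<^sup>2 - E) * u (s + y)) (at y)"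
      using DERIV_shift[of u' "((a_of b (s + y) - (a_of b s + \<kappa>))\<^sup>2 - E) * u (s + y)" y s] d(2)[of "s + y"] by (simp add: add.commute)
    thus "((\<lambda>y. u' (s + y)) has_real_derivative (pot s \<kappa> y - E) * u (s + y) - 0) (at y)"
      by (simp add: pot_def A_def algebra_simps)
  qed
  have cp: "continuous_on UNIV (\<lambda>y. pot s \<kappa> y - E)" unfolding pot_def by (intro continuous_intros A_cont)
  show "\<exists>u v. bound (\<lambda>y. pot s \<kappa> y - E) u v"
  proof (rule bound_of_sol[OF s])
    show "integrable lborel (\<lambda>y. (u (s + y))\<^sup>2)"
      using lborel_integrable_real_affine[OF i, of 1 s] by simp
    show "u (s + 0) \<noteq> 0 \<or> u' (s + 0) \<noteq> 0"
    proof (rule ccontr)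
      assume *: "\<not> (u (s + 0) \<noteq> 0 \<or> u' (s + 0) \<noteq> 0)"
      have "u (s + y) = 0" for y using sol_unique_zero(1)[OF cp s] * by auto
      from this[of "x - s" for x] show False using nz by auto
    qed
  qed
next
  assume "\<exists>u v. bound (\<lambda>y. pot s \<kappa> y - E) u v"
  then obtain u v where b: "bound (\<lambda>y. pot s \<kappa> y - E) u v" by blast
  note d = solD[OF boundD(1)[OF b]]
  show "E \<in> hspec b (a_of b s + \<kappa>)"
    unfolding hspec_def
  proof (intro CollectI exI conjI allI)
    fix x
    show "((\<lambda>x. u (x - s)) has_real_derivative v (x - s)) (at x)"
      using DERIV_shift[of u "v (x - s)" x "- s"] d(1)[of "x - s"] by simp
    have "((\<lambda>x. v (x - s)) has_real_derivative (pot s \<kappa> (x - s) - E) * u (x - s)) (at x)"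
      using DERIV_shift[of v "(pot s \<kappa> (x - s) - E) * u (x - s)" x "- s"] d(2)[of "x - s"] by simp
    thus "((\<lambda>x. v (x - s)) has_real_derivative ((a_of b x - (a_of b s + \<kappa>))\<^sup>2 - E) * u (x - s)) (at x)"
      by (simp add: pot_def A_def algebra_simps)
  next
    show "integrable lborel (\<lambda>x. (u (x - s))\<^sup>2)"
      using lborel_integrable_real_affine[OF boundD(5)[OF b], of 1 "- s"] by simp
    have cp: "continuous_on UNIV (\<lambda>y. pot s \<kappa> y - E)" unfolding pot_def by (intro continuous_intros A_cont)
    \<comment> \<open>The state may vanish at the centre, though not identically; the witness is s
      unless that happens.\<close>
    show "u ((if u 0 = 0 then (SOME y. u y \<noteq> 0) + s else s) - s) \<noteq> 0"
    proof (cases "u 0 = 0")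
      case True
      have "\<exists>y. u y \<noteq> 0"
      proof (rule ccontr)
        assume "\<nexists>y. u y \<noteq> 0"
        hence "u = (\<lambda>_. 0)" by auto
        hence "v 0 = 0" using DERIV_unique[OF d(1)[of 0], of 0] by simp
        thus False using True boundD(2)[OF b] by simp
      qed
      from someI_ex[OF this] show ?thesis using True by simp
    qed simp
  qed
qed

lemma hspec_pos: "E \<in> hspec b k \<Longrightarrow> 0 < E"
proof (rule ccontr)
  assume E: "E \<in> hspec b k" "\<not> 0 < E"
  obtain u v where b: "bound (\<lambda>y. pot (xk b k) 0 y - E) u v"
    using E(1) hspec_iff[of E "xk b k" 0] by auto
  have "0 \<le> pot (xk b k) 0 y - E" for y
  proof -
    have "0 \<le> pot (xk b k) 0 y" by (simp add: pot_def)
    thus ?thesis using E(2) by linarith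
  qed
  thus False using bound_nonneg_potential[OF pot_adm[of 0 E "\<bar>E\<bar>"] _ b] bm_pos by simp
qed

lemma hspec_separated:
  obtains d where "0 < d" "\<And>s \<kappa> E E'. \<bar>\<kappa>\<bar> \<le> 1 \<Longrightarrow> E \<in> hspec b (a_of b s + \<kappa>) \<Longrightarrow> E' \<in> hspec b (a_of b s + \<kappa>) \<Longrightarrow>
    E \<le> M0 \<Longrightarrow> E' \<le> M0 \<Longrightarrow> E \<noteq> E' \<Longrightarrow> d \<le> \<bar>E - E'\<bar>"
proof -
  have "0 < bm\<^sup>2 / 2" "0 \<le> 2 * bp\<^sup>2 + 2 + \<bar>M0\<bar>" using bm_pos by (auto simp: add_nonneg_nonneg)
  from eigenvalue_separation[OF this] obtain d where d: "0 < d"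
    "\<And>p u v u' v' e. adm (bm\<^sup>2 / 2) (2 * bp\<^sup>2 + 2 + \<bar>M0\<bar>) p \<Longrightarrow> adm (bm\<^sup>2 / 2) (2 * bp\<^sup>2 + 2 + \<bar>M0\<bar>) (\<lambda>y. p y - e) \<Longrightarrow>
      bound p u v \<Longrightarrow> bound (\<lambda>y. p y - e) u' v' \<Longrightarrow> e \<noteq> 0 \<Longrightarrow> d \<le> \<bar>e\<bar>" by metis
  show thesis
  proof (rule that[OF d(1)])
    fix s \<kappa> E E' assume *: "\<bar>\<kappa>\<bar> \<le> 1" "E \<in> hspec b (a_of b s + \<kappa>)" "E' \<in> hspec b (a_of b s + \<kappa>)" "E \<le> M0" "E' \<le> M0" "E \<noteq> E'"
    obtain u v u' v' where b: "bound (\<lambda>y. pot s \<kappa> y - E) u v" "bound (\<lambda>y. pot s \<kappa> y - E') u' v'"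
      using *(2,3) unfolding hspec_iff by blast
    have eq: "(\<lambda>y. pot s \<kappa> y - E') = (\<lambda>y. (pot s \<kappa> y - E) - (E' - E))" by auto
    have "\<bar>E\<bar> \<le> \<bar>M0\<bar>" "\<bar>E'\<bar> \<le> \<bar>M0\<bar>" using * hspec_pos by force+
    from d(2)[OF pot_adm[OF *(1) this(1)] pot_adm[OF *(1) this(2), of s, unfolded eq] b(1) b(2)[unfolded eq]]
    show "d \<le> \<bar>E - E'\<bar>" using *(6) by (simp add: abs_minus_commute)
  qed
qed

lemma hspec_finite: "finite {E \<in> hspec b k. E < M0}"
proof -
  obtain d where d: "0 < d" "\<And>s \<kappa> E E'. \<bar>\<kappa>\<bar> \<le> 1 \<Longrightarrow> E \<in> hspec b (a_of b s + \<kappa>) \<Longrightarrow> E' \<in> hspec b (a_of b s + \<kappa>) \<Longrightarrow>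
    E \<le> M0 \<Longrightarrow> E' \<le> M0 \<Longrightarrow> E \<noteq> E' \<Longrightarrow> d \<le> \<bar>E - E'\<bar>" using hspec_separated[of M0] by metis
  show ?thesis
  proof (rule finite_separated[OF d(1)])
    show "0 \<le> x \<and> x \<le> M0" if "x \<in> {E \<in> hspec b k. E < M0}" for x using that hspec_pos[of x k] by auto
    show "d \<le> \<bar>x - y\<bar>" if "x \<in> {E \<in> hspec b k. E < M0}" "y \<in> {E \<in> hspec b k. E < M0}" "x \<noteq> y" for x y
      using d(2)[of 0 x "xk b k" y] that by auto
  qed
qed

text \<open>Since only finitely many eigenvalues lie below any level, the counting function is
  strictly increasing on the spectrum, which makes the description in \<open>band\<close> unique.
  Finiteness matters because \<open>card\<close> of an infinite set is 0.\<close>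

lemma band_eqI:
  assumes E: "E \<in> hspec b k" and card: "card {E' \<in> hspec b k. E' < E} = n - 1" and n: "1 \<le> n"
  shows "band b n k = E"
  unfolding band_def
proof (rule the_equality)
  show "E \<in> hspec b k \<and> card {E' \<in> hspec b k. E' < E} = n - 1" using E card by simp
  have strict: "card {z \<in> hspec b k. z < x} < card {z \<in> hspec b k. z < y}" if "x \<in> hspec b k" "x < y" for x y
    by (rule psubset_card_mono[OF hspec_finite]) (use that in auto)
  fix F assume F: "F \<in> hspec b k \<and> card {E' \<in> hspec b k. E' < F} = n - 1"
  show "F = E"
    using strict[of F E] strict[of E F] E F card by (cases F E rule: linorder_cases) auto
qed

end

section \<open>Convergence to the limiting oscillator and labelling of the bands\<close>

locale field_limit = field_profile +
  assumes b_mono: "mono b" and b_lim: "(b \<longlongrightarrow> bp) at_top"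
begin

text \<open>On |y| \<le> T the field is within \<rho> of its limit once s is large; beyond T the
  deviation is only bounded by a multiple of y^2, which e^{|y|} beats. The convergence is uniform in
  the weighted sense only.\<close>

lemma pot_limit:
  assumes "0 < \<delta>"
  shows "\<exists>S. \<forall>s\<ge>S. dec (-1) \<delta> (\<lambda>y. pot s 0 y - bp\<^sup>2 * y\<^sup>2)"
proof -
  \<comment> \<open>Chosen so that 16 bp^2 e^{-T/2} is at most \<delta>, where y^2 \<le> 8 e^{|y|/2}
    supplies the half exponent.\<close>
  define T where "T = max 0 (- 2 * ln (\<delta> / (16 * bp\<^sup>2)))"
  have bp: "0 < 16 * bp\<^sup>2" using bp_pos by simp
  have T: "16 * bp\<^sup>2 * exp (- (T / 2)) \<le> \<delta>"
  proof -
    have "exp (- (T / 2)) \<le> exp (ln (\<delta> / (16 * bp\<^sup>2)))" by (simp add: T_def)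
    also have "\<dots> = \<delta> / (16 * bp\<^sup>2)" using assms bp by simp
    finally show ?thesis using bp by (simp add: field_simps)
  qed
  define \<rho> where "\<rho> = \<delta> / (4 * bp)"
  have \<rho>: "0 < \<rho>" using assms bp_pos by (simp add: \<rho>_def)
  have "eventually (\<lambda>x. dist (b x) bp < \<rho>) at_top" using b_lim \<rho> by (simp add: tendsto_iff)
  then obtain X where X: "\<And>x. X \<le> x \<Longrightarrow> bp - b x < \<rho>"
    by (auto simp: eventually_at_top_linorder dist_real_def abs_less_iff)
  have "dec (-1) \<delta> (\<lambda>y. pot s 0 y - bp\<^sup>2 * y\<^sup>2)" if s: "X + T \<le> s" for s
    unfolding dec_def
  proof
    fix y
    obtain z where z: "A s y = b z * y" "\<bar>z - s\<bar> \<le> \<bar>y\<bar>" using A_mvt by blast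
    have eq: "pot s 0 y - bp\<^sup>2 * y\<^sup>2 = - ((bp - b z) * (bp + b z) * y\<^sup>2)"
      by (simp add: pot_def z(1) power_mult_distrib algebra_simps power2_eq_square)
    have bz: "0 \<le> bp - b z" "0 < b z" "b z \<le> bp" using b_lower[of z] b_upper[of z] bm_pos by auto
    have abs: "\<bar>pot s 0 y - bp\<^sup>2 * y\<^sup>2\<bar> = (bp - b z) * (bp + b z) * y\<^sup>2"
      unfolding eq using bz by (simp add: abs_mult)
    show "\<bar>pot s 0 y - bp\<^sup>2 * y\<^sup>2\<bar> \<le> \<delta> * wt (-1) y"
    proof (cases "\<bar>y\<bar> \<le> T")
      case True
      hence "X \<le> z" using z(2) s by linarith
      hence "(bp - b z) * (bp + b z) \<le> \<rho> * (2 * bp)" using X[of z] bz by (intro mult_mono) auto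
      hence "(bp - b z) * (bp + b z) * y\<^sup>2 \<le> \<rho> * (2 * bp) * y\<^sup>2" by (rule mult_right_mono) simp
      also have "\<dots> \<le> \<rho> * (2 * bp) * (2 * wt (-1) y)" using exp_abs_ge[of y] \<rho> bp_pos by (intro mult_left_mono) auto
      also have "\<dots> = \<delta> * wt (-1) y" using bp_pos by (simp add: \<rho>_def)
      finally show ?thesis using abs by simp
    next
      case False
      have "1 + (y / 2)\<^sup>2 \<le> 2 * wt (-1) (y / 2)" by (rule exp_abs_ge)
      hence y2: "y\<^sup>2 \<le> 8 * exp (\<bar>y\<bar> / 2)" by (simp add: power_divide wt_def)
      have "(bp - b z) * (bp + b z) \<le> bp * (2 * bp)" using bz by (intro mult_mono) auto
      hence "(bp - b z) * (bp + b z) * y\<^sup>2 \<le> bp * (2 * bp) * (8 * exp (\<bar>y\<bar> / 2))"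
        using y2 bp_pos bz by (intro mult_mono) auto
      also have "\<dots> = 16 * bp\<^sup>2 * exp (- (\<bar>y\<bar> / 2)) * exp \<bar>y\<bar>" 
        by (simp add: exp_add[symmetric] power2_eq_square)
      also have "\<dots> \<le> 16 * bp\<^sup>2 * exp (- (T / 2)) * exp \<bar>y\<bar>"
        using False bp by (intro mult_right_mono mult_left_mono) auto
      also have "\<dots> \<le> \<delta> * exp \<bar>y\<bar>" using T by (intro mult_right_mono) auto
      finally show ?thesis using abs by (simp add: wt_def)
    qed
  qed
  thus ?thesis by blast
qed

text \<open>Stability from the oscillator to h(k) produces an eigenvalue near each of the first n
  levels; the reverse direction shows that nothing else lies below 2 n bp, which is halfway to level
  n + 1. The window \<eta>1 stays fixed while the accuracy \<eta> may shrink, so the band is the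
  only eigenvalue in a window of fixed size.\<close>

lemma band_char:
  assumes n: "1 \<le> n"
  obtains \<eta>1 where "0 < \<eta>1" "\<And>\<eta>. 0 < \<eta> \<Longrightarrow> \<eta> \<le> \<eta>1 \<Longrightarrow> \<exists>S. \<forall>s\<ge>S.
     band b n (a_of b s) \<in> hspec b (a_of b s) \<and> \<bar>band b n (a_of b s) - (2 * real n - 1) * bp\<bar> \<le> \<eta> \<and>
     (\<forall>E\<in>hspec b (a_of b s). \<bar>E - (2 * real n - 1) * bp\<bar> \<le> \<eta>1 \<longrightarrow> E = band b n (a_of b s))"
proof -
  define M0 where "M0 = (2 * real n + 1) * bp + 1"
  define \<mu> where "\<mu> = bm\<^sup>2 / 2"
  define M where "M = 2 * bp\<^sup>2 + 2 + M0"
  have \<mu>: "0 < \<mu>" using bm_pos by (simp add: \<mu>_def)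
  have M0: "1 \<le> M0" using bp_pos by (simp add: M0_def)
  have M: "0 \<le> M" "M0 \<le> M" using M0 by (auto simp: M_def add_nonneg_nonneg)
  obtain \<eta>X where \<eta>X: "0 < \<eta>X" "\<And>\<eta>. 0 < \<eta> \<Longrightarrow> \<eta> \<le> \<eta>X \<Longrightarrow> \<exists>\<delta>>0. \<forall>p0 p \<psi> \<psi>'. adm \<mu> M p0 \<longrightarrow> adm \<mu> M p \<longrightarrow>
     bound p0 \<psi> \<psi>' \<longrightarrow> dec (-1) \<delta> (\<lambda>y. p y - p0 y) \<longrightarrow> (\<exists>e u v. \<bar>e\<bar> \<le> \<eta> \<and> bound (\<lambda>y. p y - e) u v)"
    by (rule eigenvalue_stability[OF \<mu> M(1)], erule that, assumption)
  obtain d where d: "0 < d" "\<And>s \<kappa> E E'. \<bar>\<kappa>\<bar> \<le> 1 \<Longrightarrow> E \<in> hspec b (a_of b s + \<kappa>) \<Longrightarrow> E' \<in> hspec b (a_of b s + \<kappa>) \<Longrightarrow>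
    E \<le> M0 \<Longrightarrow> E' \<le> M0 \<Longrightarrow> E \<noteq> E' \<Longrightarrow> d \<le> \<bar>E - E'\<bar>" by (rule hspec_separated, erule that, assumption)
  \<comment> \<open>bp/4 keeps the windows of neighbouring levels, 2 bp apart, disjoint; d/4 admits
    a single eigenvalue to each; 1/2 keeps all energies below the cutoff M0.\<close>
  define \<eta>1 where "\<eta>1 = min (min \<eta>X (1/2)) (min (bp / 4) (d / 4))"
  have \<eta>1: "0 < \<eta>1" "\<eta>1 \<le> \<eta>X" "\<eta>1 \<le> 1 / 2" "\<eta>1 \<le> bp / 4" "\<eta>1 \<le> d / 4"
    using \<eta>X(1) bp_pos d(1) by (auto simp: \<eta>1_def)
  have Lam_le: "(2 * real j - 1) * bp + 1 \<le> M0" if "j \<le> n" for j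
    unfolding M0_def using that bp_pos by (intro add_right_mono mult_right_mono) auto
  have ha: "adm \<mu> M (ho bp E)" if "\<bar>E\<bar> \<le> M0" for E
  proof (rule ho_adm[OF \<mu>])
    have "bm\<^sup>2 \<le> bp\<^sup>2" using bm_pos bm_le_bp by (intro power_mono) auto
    thus "\<mu> \<le> bp\<^sup>2" unfolding \<mu>_def using zero_le_power2[of bm] by linarith
    show "bp\<^sup>2 \<le> M" unfolding M_def using M0 zero_le_power2[of bp] by linarith
    show "\<bar>E\<bar> \<le> M" using that M by linarith
  qed
  show thesis
  proof (rule that[OF \<eta>1(1)])
    fix \<eta> assume \<eta>: "0 < \<eta>" "\<eta> \<le> \<eta>1"
    obtain \<delta> where \<delta>: "0 < \<delta>" and X: "\<And>p0 p \<psi> \<psi>'. adm \<mu> M p0 \<Longrightarrow> adm \<mu> M p \<Longrightarrow>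
     bound p0 \<psi> \<psi>' \<Longrightarrow> dec (-1) \<delta> (\<lambda>y. p y - p0 y) \<Longrightarrow> \<exists>e u v. \<bar>e\<bar> \<le> \<eta> \<and> bound (\<lambda>y. p y - e) u v"
      using \<eta>X(2)[of \<eta>] \<eta> \<eta>1 by (meson order_trans)
    obtain S where S: "\<And>s. S \<le> s \<Longrightarrow> dec (-1) \<delta> (\<lambda>y. pot s 0 y - bp\<^sup>2 * y\<^sup>2)" using pot_limit[OF \<delta>] by blast
    show "\<exists>S. \<forall>s\<ge>S.
     band b n (a_of b s) \<in> hspec b (a_of b s) \<and> \<bar>band b n (a_of b s) - (2 * real n - 1) * bp\<bar> \<le> \<eta> \<and>
     (\<forall>E\<in>hspec b (a_of b s). \<bar>E - (2 * real n - 1) * bp\<bar> \<le> \<eta>1 \<longrightarrow> E = band b n (a_of b s))"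
    proof (intro exI[of _ S] allI impI)
      fix s assume s: "S \<le> s"
      have hs: "E \<in> hspec b (a_of b s) \<longleftrightarrow> (\<exists>u v. bound (\<lambda>y. pot s 0 y - E) u v)" for E
        using hspec_iff[of E s 0] by simp
      have pa: "adm \<mu> M (\<lambda>y. pot s 0 y - E)" if "\<bar>E\<bar> \<le> M0" for E
        unfolding \<mu>_def M_def by (rule pot_adm) (use that in auto)
      have ex: "\<exists>E. E \<in> hspec b (a_of b s) \<and> \<bar>E - (2 * real j - 1) * bp\<bar> \<le> \<eta>" if j: "1 \<le> j" "j \<le> n" for j
      proof -
        define L where "L = (2 * real j - 1) * bp"
        have "0 \<le> L" using j bp_pos by (simp add: L_def)
        hence L: "\<bar>L\<bar> \<le> M0" using Lam_le[OF j(2)] by (simp add: L_def)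
        obtain u v where "bound (ho bp L) u v" using ho_spec[OF bp_pos, of L] j unfolding L_def by blast
        moreover have "dec (-1) \<delta> (\<lambda>y. (pot s 0 y - L) - ho bp L y)" using S[OF s] by (simp add: ho_def)
        ultimately obtain e u v where e: "\<bar>e\<bar> \<le> \<eta>" "bound (\<lambda>y. (pot s 0 y - L) - e) u v"
          using X[OF ha[OF L] pa[OF L]] by blast
        have "(\<lambda>y. (pot s 0 y - L) - e) = (\<lambda>y. pot s 0 y - (L + e))" by auto
        hence "L + e \<in> hspec b (a_of b s)" using e(2) hs[of "L + e"] by auto
        thus ?thesis using e(1) by (intro exI[of _ "L + e"]) (simp add: L_def)
      qed
      \<comment> \<open>Stability is applied backwards here: the fibre operator is the reference and
        the oscillator the perturbation.\<close>
      have near: "\<exists>j. 1 \<le> j \<and> j \<le> n \<and> \<bar>E - (2 * real j - 1) * bp\<bar> \<le> \<eta>"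
        if E: "E \<in> hspec b (a_of b s)" "E < 2 * real n * bp" for E
      proof -
        have "0 < E" by (rule hspec_pos[OF E(1)])
        moreover have "2 * real n * bp \<le> M0" using bp_pos by (simp add: M0_def algebra_simps)
        ultimately have EM: "\<bar>E\<bar> \<le> M0" using E(2) by simp
        obtain u v where "bound (\<lambda>y. pot s 0 y - E) u v" using E(1) hs by blast
        moreover have "dec (-1) \<delta> (\<lambda>y. ho bp E y - (pot s 0 y - E))"
          using dec_uminus[OF S[OF s]] by (simp add: ho_def algebra_simps)
        ultimately obtain e u v where e: "\<bar>e\<bar> \<le> \<eta>" "bound (\<lambda>y. ho bp E y - e) u v"
          using X[OF pa[OF EM] ha[OF EM]] by blast
        have "(\<lambda>y. ho bp E y - e) = ho bp (E + e)" by (auto simp: ho_def)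
        then obtain j :: nat where j: "1 \<le> j" "E + e = (2 * real j - 1) * bp"
          using e(2) ho_spec[OF bp_pos, of "E + e"] by auto
        have "(2 * real j - 1) * bp < (2 * real n + 1) * bp"
          using j(2) e(1) E(2) \<eta> \<eta>1 bp_pos by (simp add: algebra_simps)
        hence "2 * real j - 1 < 2 * real n + 1" using bp_pos by (simp add: mult_less_cancel_right)
        hence "j \<le> n" by linarith
        thus ?thesis using j e(1) by (intro exI[of _ j]) auto
      qed
      have uniq: "E = E'" if "E \<in> hspec b (a_of b s)" "E' \<in> hspec b (a_of b s)" "j \<le> n"
        "\<bar>E - (2 * real j - 1) * bp\<bar> \<le> \<eta>1" "\<bar>E' - (2 * real j - 1) * bp\<bar> \<le> \<eta>1" for E E' j
      proof (rule ccontr)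
        assume "E \<noteq> E'"
        moreover have "E \<le> M0" "E' \<le> M0" using that(4,5) Lam_le[OF that(3)] \<eta>1 by auto
        ultimately have "d \<le> \<bar>E - E'\<bar>" using d(2)[of 0 E s E'] that(1,2) by simp
        moreover have "\<bar>E - E'\<bar> \<le> 2 * \<eta>1" using that(4,5) by linarith
        ultimately show False using \<eta>1 d(1) by linarith
      qed
      obtain f where f: "\<And>j. 1 \<le> j \<Longrightarrow> j \<le> n \<Longrightarrow> f j \<in> hspec b (a_of b s) \<and> \<bar>f j - (2 * real j - 1) * bp\<bar> \<le> \<eta>"
        using ex by metis
      have f_mono: "f i < f j" if "1 \<le> i" "i < j" "j \<le> n" for i j
      proof -
        have "real i + 1 \<le> real j" using that(2) by linarith
        hence "(real i + 1) * (2 * bp) \<le> real j * (2 * bp)" using bp_pos by (intro mult_right_mono) auto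
        hence "(2 * real i - 1) * bp + 2 * bp \<le> (2 * real j - 1) * bp" by (simp add: algebra_simps)
        thus ?thesis using f[of i] f[of j] that \<eta> \<eta>1 bp_pos by (simp add: abs_le_iff)
      qed
      have "f n < 2 * real n * bp" using f[of n] n \<eta> \<eta>1 bp_pos by (simp add: abs_le_iff algebra_simps)
      have "{E' \<in> hspec b (a_of b s). E' < f n} = f ` {1..<n}"
      proof (intro equalityI subsetI)
        fix E assume "E \<in> {E' \<in> hspec b (a_of b s). E' < f n}"
        hence E: "E \<in> hspec b (a_of b s)" "E < f n" by auto
        then obtain j where j: "1 \<le> j" "j \<le> n" "\<bar>E - (2 * real j - 1) * bp\<bar> \<le> \<eta>" using near \<open>f n < _\<close> by force
        have "E = f j" using uniq[OF E(1) _ j(2)] f[OF j(1,2)] j(3) \<eta> by force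
        moreover have "j \<noteq> n" using calculation E(2) by auto
        ultimately show "E \<in> f ` {1..<n}" using j by auto
      next
        fix E assume "E \<in> f ` {1..<n}"
        thus "E \<in> {E' \<in> hspec b (a_of b s). E' < f n}" using f f_mono by auto
      qed
      moreover have "inj_on f {1..<n}"
        by (rule inj_onI) (metis atLeastLessThan_iff f_mono less_irrefl less_imp_le nat_neq_iff)
      ultimately have "card {E' \<in> hspec b (a_of b s). E' < f n} = n - 1" by (simp add: card_image)
      hence band: "band b n (a_of b s) = f n" using f[of n] n by (intro band_eqI) auto
      show "band b n (a_of b s) \<in> hspec b (a_of b s) \<and> \<bar>band b n (a_of b s) - (2 * real n - 1) * bp\<bar> \<le> \<eta> \<and>
        (\<forall>E\<in>hspec b (a_of b s). \<bar>E - (2 * real n - 1) * bp\<bar> \<le> \<eta>1 \<longrightarrow> E = band b n (a_of b s))"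
      proof (intro conjI ballI impI)
        fix E assume "E \<in> hspec b (a_of b s)" "\<bar>E - (2 * real n - 1) * bp\<bar> \<le> \<eta>1"
        thus "E = band b n (a_of b s)" unfolding band using uniq[of E "f n" n] f[of n] n \<eta> by auto
      qed (use f[of n] n band in auto)
    qed
  qed
qed

end

lemma integral_dec_tendsto:
  assumes "\<forall>\<^sub>F x in F. continuous_on UNIV (f x) \<and> dec 1 (r x) (\<lambda>y. f x y - g y)"
    and g: "continuous_on UNIV g" "dec 1 C g" and r: "(r \<longlongrightarrow> 0) F"
  shows "((\<lambda>x. LBINT y. f x y) \<longlongrightarrow> (LBINT y. g y)) F"
proof -
  have ev: "\<forall>\<^sub>F x in F. norm ((LBINT y. f x y) - (LBINT y. g y)) \<le> 7 * r x"
    using assms(1)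
  proof eventually_elim
    case (elim x)
    have c: "continuous_on UNIV (\<lambda>y. f x y - g y)" using elim g by (intro continuous_intros) auto
    have i: "integrable lborel (\<lambda>y. f x y - g y)" using integrable_dec[OF c] elim by auto
    have ig: "integrable lborel g" using integrable_dec[OF g] by auto
    have "(LBINT y. f x y) = (LBINT y. (f x y - g y) + g y)" by simp
    also have "\<dots> = (LBINT y. f x y - g y) + (LBINT y. g y)" by (rule Bochner_Integration.integral_add[OF i ig])
    finally have "(LBINT y. f x y) - (LBINT y. g y) = (LBINT y. f x y - g y)" by simp
    moreover have "\<bar>LBINT y. f x y - g y\<bar> \<le> 7 * r x"
      by (rule integral_dec_le[OF c conjunct2[OF elim]]) simp
    ultimately show ?case by simp
  qed
  have "((\<lambda>x. 7 * r x) \<longlongrightarrow> 0) F" by (rule tendsto_mult_right_zero[OF r])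
  from Lim_null_comparison[OF ev this] show ?thesis by (rule LIM_zero_cancel)
qed

context field_profile
begin

lemma pot_diff: "pot s \<kappa> y - pot s \<kappa>0 y = (\<kappa> - \<kappa>0) * (\<kappa> + \<kappa>0 - 2 * A s y)"
  by (simp add: pot_def power2_eq_square algebra_simps)

lemma pot_diff_dec:
  assumes "\<bar>\<kappa>\<bar> \<le> 1" "\<bar>\<kappa>0\<bar> \<le> 1"
  shows "dec (-1) (2 + 2 * bp) (\<lambda>y. \<kappa> + \<kappa>0 - 2 * A s y)"
    and "dec (-1) (\<bar>\<kappa> - \<kappa>0\<bar> * (2 + 2 * bp)) (\<lambda>y. pot s \<kappa> y - pot s \<kappa>0 y)"
proof -
  have "dec (-1) 2 (\<lambda>y. \<kappa> + \<kappa>0)"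
    by (rule dec_mono[OF dec_const]) (use assms in auto)
  moreover have "dec (-1) (\<bar>2\<bar> * bp) (\<lambda>y. 2 * A s y)" by (rule dec_cmult[OF A_dec])
  ultimately show *: "dec (-1) (2 + 2 * bp) (\<lambda>y. \<kappa> + \<kappa>0 - 2 * A s y)" using dec_diff by force
  show "dec (-1) (\<bar>\<kappa> - \<kappa>0\<bar> * (2 + 2 * bp)) (\<lambda>y. pot s \<kappa> y - pot s \<kappa>0 y)"
    unfolding pot_diff by (rule dec_cmult[OF *])
qed

end

context field_limit
begin

text \<open>Perturbing k moves the eigenvalue at k to some nearby eigenvalue of the new operator;
  this one still lies in the fixed window of \<open>band_char\<close>, hence is the band
  again.\<close>

lemma band_regular:
  assumes n: "1 \<le> n" and \<eta>: "0 < \<eta>"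
  shows "\<exists>K. \<forall>k\<ge>K. band b n k \<in> hspec b k \<and> \<bar>band b n k - (2 * real n - 1) * bp\<bar> \<le> \<eta> \<and> isCont (band b n) k"
proof -
  define L where "L = (2 * real n - 1) * bp"
  have L: "0 \<le> L" using n bp_pos by (simp add: L_def)
  obtain \<eta>1 where \<eta>1: "0 < \<eta>1" and char: "\<And>\<eta>. 0 < \<eta> \<Longrightarrow> \<eta> \<le> \<eta>1 \<Longrightarrow> \<exists>S. \<forall>s\<ge>S.
     band b n (a_of b s) \<in> hspec b (a_of b s) \<and> \<bar>band b n (a_of b s) - L\<bar> \<le> \<eta> \<and>
     (\<forall>E\<in>hspec b (a_of b s). \<bar>E - L\<bar> \<le> \<eta>1 \<longrightarrow> E = band b n (a_of b s))"
    by (rule band_char[OF n, folded L_def], erule that, assumption)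
  define \<eta>' where "\<eta>' = min \<eta> (\<eta>1 / 2)"
  have \<eta>': "0 < \<eta>'" "\<eta>' \<le> \<eta>1" "\<eta>' \<le> \<eta>1 / 2" "\<eta>' \<le> \<eta>" using \<eta> \<eta>1 by (auto simp: \<eta>'_def)
  obtain S where S: "\<And>s. S \<le> s \<Longrightarrow> band b n (a_of b s) \<in> hspec b (a_of b s) \<and> \<bar>band b n (a_of b s) - L\<bar> \<le> \<eta>' \<and>
     (\<forall>E\<in>hspec b (a_of b s). \<bar>E - L\<bar> \<le> \<eta>1 \<longrightarrow> E = band b n (a_of b s))"
    using char[OF \<eta>'(1,2)] by blast
  have K: "band b n k \<in> hspec b k \<and> \<bar>band b n k - L\<bar> \<le> \<eta>' \<and> (\<forall>E\<in>hspec b k. \<bar>E - L\<bar> \<le> \<eta>1 \<longrightarrow> E = band b n k)"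
    if "a_of b S \<le> k" for k
  proof -
    have "S \<le> xk b k" using that a_mono[of "xk b k" S] by (auto simp: not_less[symmetric])
    from S[OF this] show ?thesis by simp
  qed
  define \<mu> where "\<mu> = bm\<^sup>2 / 2"
  define M where "M = 2 * bp\<^sup>2 + 2 + (L + \<eta>1)"
  have \<mu>: "0 < \<mu>" using bm_pos by (simp add: \<mu>_def)
  have M: "0 \<le> M" using L \<eta>1 by (simp add: M_def add_nonneg_nonneg)
  obtain \<eta>X where \<eta>X: "0 < \<eta>X" "\<And>\<eta>. 0 < \<eta> \<Longrightarrow> \<eta> \<le> \<eta>X \<Longrightarrow> \<exists>\<delta>>0. \<forall>p0 p \<psi> \<psi>'. adm \<mu> M p0 \<longrightarrow> adm \<mu> M p \<longrightarrow>
     bound p0 \<psi> \<psi>' \<longrightarrow> dec (-1) \<delta> (\<lambda>y. p y - p0 y) \<longrightarrow> (\<exists>e u v. \<bar>e\<bar> \<le> \<eta> \<and> bound (\<lambda>y. p y - e) u v)"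
    by (rule eigenvalue_stability[OF \<mu> M], erule that, assumption)
  have cont: "isCont (band b n) k" if k: "a_of b S + 1 \<le> k" for k
    unfolding continuous_at_eps_delta dist_real_def
  proof (intro allI impI)
    fix \<epsilon> :: real assume \<epsilon>: "0 < \<epsilon>"
    define \<eta>2 where "\<eta>2 = min \<eta>X (min (\<eta>1 / 2) (\<epsilon> / 2))"
    have \<eta>2: "0 < \<eta>2" "\<eta>2 \<le> \<eta>X" "\<eta>2 \<le> \<eta>1 / 2" "\<eta>2 < \<epsilon>" using \<eta>X(1) \<eta>1 \<epsilon> by (auto simp: \<eta>2_def)
    obtain \<delta> where \<delta>: "0 < \<delta>" and X: "\<And>p0 p \<psi> \<psi>'. adm \<mu> M p0 \<Longrightarrow> adm \<mu> M p \<Longrightarrow>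
       bound p0 \<psi> \<psi>' \<Longrightarrow> dec (-1) \<delta> (\<lambda>y. p y - p0 y) \<Longrightarrow> \<exists>e u v. \<bar>e\<bar> \<le> \<eta>2 \<and> bound (\<lambda>y. p y - e) u v"
      using \<eta>X(2)[OF \<eta>2(1,2)] by blast
    define s where "s = xk b k"
    define e0 where "e0 = band b n k"
    have as: "a_of b s = k" by (simp add: s_def)
    have e0: "e0 \<in> hspec b k" "\<bar>e0 - L\<bar> \<le> \<eta>'" using K[of k] k by (auto simp: e0_def)
    then obtain u v where u: "bound (\<lambda>y. pot s 0 y - e0) u v" using hspec_iff[of e0 s 0] as by auto
    have e0M: "\<bar>e0\<bar> \<le> L + \<eta>1" using e0(2) L \<eta>' by (simp add: abs_le_iff)
    show "\<exists>d>0. \<forall>k'. \<bar>k' - k\<bar> < d \<longrightarrow> \<bar>band b n k' - band b n k\<bar> < \<epsilon>"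
    proof (rule exI[of _ "min 1 (\<delta> / (2 + 2 * bp))"], intro conjI allI impI)
      show "0 < min 1 (\<delta> / (2 + 2 * bp))" using \<delta> bp_pos by simp
      fix k' assume k': "\<bar>k' - k\<bar> < min 1 (\<delta> / (2 + 2 * bp))"
      define \<kappa> where "\<kappa> = k' - k"
      have \<kappa>: "\<bar>\<kappa>\<bar> \<le> 1" "\<bar>\<kappa>\<bar> * (2 + 2 * bp) \<le> \<delta>" using k' bp_pos by (auto simp: \<kappa>_def field_simps)
      have ad: "adm \<mu> M (\<lambda>y. pot s 0 y - e0)" "adm \<mu> M (\<lambda>y. pot s \<kappa> y - e0)"
        unfolding \<mu>_def M_def using pot_adm e0M \<kappa> by auto
      have "dec (-1) \<delta> (\<lambda>y. pot s \<kappa> y - pot s 0 y)"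
        using pot_diff_dec(2)[of \<kappa> 0 s] \<kappa> by (auto intro: dec_mono)
      hence "dec (-1) \<delta> (\<lambda>y. (pot s \<kappa> y - e0) - (pot s 0 y - e0))" by simp
      from X[OF ad u this] obtain e u v where e: "\<bar>e\<bar> \<le> \<eta>2" "bound (\<lambda>y. (pot s \<kappa> y - e0) - e) u v" by blast
      have "(\<lambda>y. (pot s \<kappa> y - e0) - e) = (\<lambda>y. pot s \<kappa> y - (e0 + e))" by auto
      hence "e0 + e \<in> hspec b (k + \<kappa>)" using e(2) hspec_iff[of "e0 + e" s \<kappa>] as by auto
      hence "e0 + e \<in> hspec b k'" by (simp add: \<kappa>_def)
      moreover have "\<bar>e0 + e - L\<bar> \<le> \<eta>1" using e0(2) e(1) \<eta>' \<eta>2 by linarith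
      moreover have "a_of b S \<le> k'" using k k' by linarith
      ultimately have "e0 + e = band b n k'" using K[of k'] by blast
      thus "\<bar>band b n k' - band b n k\<bar> < \<epsilon>" using e(1) \<eta>2 by (auto simp: e0_def)
    qed
  qed
  show ?thesis
  proof (intro exI[of _ "a_of b S + 1"] allI impI)
    fix k assume "a_of b S + 1 \<le> k"
    thus "band b n k \<in> hspec b k \<and> \<bar>band b n k - (2 * real n - 1) * bp\<bar> \<le> \<eta> \<and> isCont (band b n) k"
      using K[of k] cont[of k] \<eta>' by (auto simp: L_def)
  qed
qed

end

section \<open>Derivatives of an eigenvalue branch\<close>

text \<open>A continuous branch of eigenvalues as the momentum varies around a(s), abstracted from
  its label. Continuity is the input and two derivatives at \<kappa> = 0 are the output.\<close>

locale band_family = field_profile +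
  fixes s M0 :: real and e :: "real \<Rightarrow> real"
  assumes e_spec: "\<And>\<kappa>. \<bar>\<kappa>\<bar> < 1 \<Longrightarrow> e \<kappa> \<in> hspec b (a_of b s + \<kappa>)"
    and e_le: "\<And>\<kappa>. \<bar>\<kappa>\<bar> < 1 \<Longrightarrow> \<bar>e \<kappa>\<bar> \<le> M0"
    and e_cont: "\<And>\<kappa>. \<bar>\<kappa>\<bar> < 1 \<Longrightarrow> isCont e \<kappa>"
begin

definition P :: "real \<Rightarrow> real \<Rightarrow> real" where "P \<kappa> y = pot s \<kappa> y - e \<kappa>"
definition \<mu> :: real where "\<mu> = bm\<^sup>2 / 2"
definition M :: real where "M = 2 * bp\<^sup>2 + 2 + M0"
text \<open>The choice leaves the sign arbitrary for each \<kappa> separately, so continuity in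
  \<kappa> holds only after correction by signs.\<close>

definition U :: "real \<Rightarrow> real \<Rightarrow> real" where "U \<kappa> = (SOME u. \<exists>v. bound (P \<kappa>) u v)"
definition V :: "real \<Rightarrow> real \<Rightarrow> real" where "V \<kappa> = (SOME v. bound (P \<kappa>) (U \<kappa>) v)"
definition N :: "real \<Rightarrow> real" where "N \<kappa> = (LBINT y. (U \<kappa> y)\<^sup>2)"
text \<open>The Feynman-Hellmann quotient: 2 (\<kappa> - A) is the derivative of (A - \<kappa>)^2 in
  \<kappa>.\<close>

definition G :: "real \<Rightarrow> real" where "G \<kappa> = (LBINT y. 2 * (\<kappa> - A s y) * (U \<kappa> y)\<^sup>2) / N \<kappa>"

lemma mu_pos: "0 < \<mu>" using bm_pos by (simp add: \<mu>_def)

lemma M_nonneg: "0 \<le> M"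
  using e_le[of 0] unfolding M_def by (simp add: add_nonneg_nonneg)

lemma bound_U: "\<bar>\<kappa>\<bar> < 1 \<Longrightarrow> bound (P \<kappa>) (U \<kappa>) (V \<kappa>)"
proof -
  assume "\<bar>\<kappa>\<bar> < 1"
  hence "\<exists>u v. bound (P \<kappa>) u v" using e_spec[of \<kappa>] unfolding hspec_iff P_def[abs_def] by auto
  hence "\<exists>v. bound (P \<kappa>) (U \<kappa>) v" unfolding U_def by (rule someI_ex)
  thus ?thesis unfolding V_def by (rule someI_ex)
qed

lemma P_adm: "\<bar>\<kappa>\<bar> < 1 \<Longrightarrow> adm \<mu> M (P \<kappa>)"
proof -
  assume "\<bar>\<kappa>\<bar> < 1"
  hence "adm (bm\<^sup>2 / 2) (2 * bp\<^sup>2 + 2 + M0) (\<lambda>y. pot s \<kappa> y - e \<kappa>)"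
    by (intro pot_adm e_le less_imp_le)
  thus ?thesis by (simp add: P_def[abs_def] \<mu>_def M_def)
qed

lemma P_diff: "P \<kappa> y - P \<kappa>0 y = (\<kappa> - \<kappa>0) * (\<kappa> + \<kappa>0 - 2 * A s y) - (e \<kappa> - e \<kappa>0)"
  using pot_diff[of s \<kappa> y \<kappa>0] unfolding P_def by linarith

lemma P_diff_dec:
  assumes "\<bar>\<kappa>\<bar> < 1" "\<bar>\<kappa>0\<bar> < 1"
  shows "dec (-1) (\<bar>\<kappa> - \<kappa>0\<bar> * (2 + 2 * bp) + \<bar>e \<kappa> - e \<kappa>0\<bar>) (\<lambda>y. P \<kappa> y - P \<kappa>0 y)"
proof -
  have "dec (-1) \<bar>e \<kappa> - e \<kappa>0\<bar> (\<lambda>y. e \<kappa> - e \<kappa>0)" by (rule dec_mono[OF dec_const]) auto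
  from dec_diff[OF pot_diff_dec(2)[of \<kappa> \<kappa>0 s] this] assms show ?thesis
    by (simp add: P_def algebra_simps)
qed

lemma N_pos: "\<bar>\<kappa>\<bar> < 1 \<Longrightarrow> 0 < N \<kappa>"
proof -
  assume k: "\<bar>\<kappa>\<bar> < 1"
  obtain c where "0 < c" "\<And>p u v. adm \<mu> M p \<Longrightarrow> bound p u v \<Longrightarrow> c \<le> (LBINT y. (u y)\<^sup>2)"
    using bound_norm_lower[OF mu_pos M_nonneg] by metis
  thus ?thesis using P_adm[OF k] bound_U[OF k] unfolding N_def by force
qed

lemma U_cont: "\<bar>\<kappa>\<bar> < 1 \<Longrightarrow> continuous_on UNIV (U \<kappa>)" "\<bar>\<kappa>\<bar> < 1 \<Longrightarrow> continuous_on UNIV (V \<kappa>)"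
  by (rule sol_cont[OF boundD(1)[OF bound_U]], assumption)+

lemma close_family:
  assumes k0: "\<bar>\<kappa>0\<bar> < 1"
  obtains C \<sigma> where "1 \<le> C" "\<And>\<kappa>. \<bar>\<kappa>\<bar> < 1 \<Longrightarrow> \<sigma> \<kappa> \<in> {1, -1::real}"
    "\<And>\<kappa>. \<bar>\<kappa>\<bar> < 1 \<Longrightarrow> dec 4 (C * (\<bar>\<kappa> - \<kappa>0\<bar> * (2 + 2 * bp) + \<bar>e \<kappa> - e \<kappa>0\<bar>)) (\<lambda>y. U \<kappa> y - \<sigma> \<kappa> * U \<kappa>0 y)"
    "\<And>\<kappa>. \<bar>\<kappa>\<bar> < 1 \<Longrightarrow> \<bar>V \<kappa> 0 - \<sigma> \<kappa> * V \<kappa>0 0\<bar> \<le> C * (\<bar>\<kappa> - \<kappa>0\<bar> * (2 + 2 * bp) + \<bar>e \<kappa> - e \<kappa>0\<bar>)"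
proof -
  have four: "(0::real) \<le> 4" by simp
  obtain C where C: "1 \<le> C" and close:
    "\<And>p1 u1 v1 p2 u2 v2 d. adm \<mu> M p1 \<Longrightarrow> adm \<mu> M p2 \<Longrightarrow> bound p1 u1 v1 \<Longrightarrow> bound p2 u2 v2 \<Longrightarrow>
      dec (-1) d (\<lambda>y. p1 y - p2 y) \<Longrightarrow>
      \<exists>s\<in>{1, -1}. dec 4 (C * d) (\<lambda>y. u1 y - s * u2 y) \<and> \<bar>v1 0 - s * v2 0\<bar> \<le> C * d"
    by (rule bound_close[OF mu_pos M_nonneg four], erule that, assumption)
  define d where "d = (\<lambda>\<kappa>. \<bar>\<kappa> - \<kappa>0\<bar> * (2 + 2 * bp) + \<bar>e \<kappa> - e \<kappa>0\<bar>)"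
  have "\<exists>\<sigma>. \<bar>\<kappa>\<bar> < 1 \<longrightarrow> \<sigma> \<in> {1, -1} \<and> dec 4 (C * d \<kappa>) (\<lambda>y. U \<kappa> y - \<sigma> * U \<kappa>0 y) \<and> \<bar>V \<kappa> 0 - \<sigma> * V \<kappa>0 0\<bar> \<le> C * d \<kappa>" for \<kappa>
    using close[OF P_adm P_adm[OF k0] bound_U bound_U[OF k0], of \<kappa> "d \<kappa>"] P_diff_dec[OF _ k0, of \<kappa>] unfolding d_def
    by blast
  then obtain \<sigma> where "\<And>\<kappa>. \<bar>\<kappa>\<bar> < 1 \<longrightarrow> \<sigma> \<kappa> \<in> {1, -1} \<and> dec 4 (C * d \<kappa>) (\<lambda>y. U \<kappa> y - \<sigma> \<kappa> * U \<kappa>0 y) \<and> \<bar>V \<kappa> 0 - \<sigma> \<kappa> * V \<kappa>0 0\<bar> \<le> C * d \<kappa>"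
    by metis
  thus thesis using that[OF C, of \<sigma>] unfolding d_def by blast
qed

lemma U_dec:
  obtains K where "1 \<le> K" "\<And>\<kappa>. \<bar>\<kappa>\<bar> < 1 \<Longrightarrow> dec 4 K (U \<kappa>)" "\<And>\<kappa>. \<bar>\<kappa>\<bar> < 1 \<Longrightarrow> dec 4 K (V \<kappa>)"
proof -
  have four: "(0::real) \<le> 4" by simp
  obtain K where "1 \<le> K" "\<And>p u v. adm \<mu> M p \<Longrightarrow> bound p u v \<Longrightarrow> dec 4 K u \<and> dec 4 K v"
    by (rule bound_dec[OF mu_pos M_nonneg four], erule that, assumption)
  thus thesis using that[of K] P_adm bound_U by blast
qed

lemma near_tendsto:
  assumes k0: "\<bar>\<kappa>0\<bar> < 1"
  shows "((\<lambda>\<kappa>. \<bar>\<kappa> - \<kappa>0\<bar> * (2 + 2 * bp) + \<bar>e \<kappa> - e \<kappa>0\<bar>) \<longlongrightarrow> 0) (at \<kappa>0)"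
    and "\<forall>\<^sub>F \<kappa> in at \<kappa>0. \<bar>\<kappa>\<bar> < 1"
proof -
  have "(e \<longlongrightarrow> e \<kappa>0) (at \<kappa>0)" using e_cont[OF k0] by (simp add: isCont_def)
  hence "((\<lambda>\<kappa>. \<bar>\<kappa> - \<kappa>0\<bar> * (2 + 2 * bp) + \<bar>e \<kappa> - e \<kappa>0\<bar>) \<longlongrightarrow> \<bar>\<kappa>0 - \<kappa>0\<bar> * (2 + 2 * bp) + \<bar>e \<kappa>0 - e \<kappa>0\<bar>) (at \<kappa>0)"
    by (intro tendsto_intros)
  thus "((\<lambda>\<kappa>. \<bar>\<kappa> - \<kappa>0\<bar> * (2 + 2 * bp) + \<bar>e \<kappa> - e \<kappa>0\<bar>) \<longlongrightarrow> 0) (at \<kappa>0)" by simp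
  have "((\<lambda>\<kappa>. \<bar>\<kappa>\<bar>) \<longlongrightarrow> \<bar>\<kappa>0\<bar>) (at \<kappa>0)" by (intro tendsto_intros)
  thus "\<forall>\<^sub>F \<kappa> in at \<kappa>0. \<bar>\<kappa>\<bar> < 1" using k0 by (rule order_tendstoD)
qed

text \<open>Orthogonality of the Wronskian type turns the difference quotient of \<open>e\<close> into a quotient of
  integrals, so only continuity of the eigenfunction in \<open>\<kappa>\<close> is needed here.\<close>

lemma e_deriv:
  assumes k0: "\<bar>\<kappa>0\<bar> < 1"
  shows "(e has_real_derivative G \<kappa>0) (at \<kappa>0)"
proof -
  obtain C \<sigma> where C: "1 \<le> C" and \<sigma>: "\<And>\<kappa>. \<bar>\<kappa>\<bar> < 1 \<Longrightarrow> \<sigma> \<kappa> \<in> {1, -1::real}"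
    and cl: "\<And>\<kappa>. \<bar>\<kappa>\<bar> < 1 \<Longrightarrow> dec 4 (C * (\<bar>\<kappa> - \<kappa>0\<bar> * (2 + 2 * bp) + \<bar>e \<kappa> - e \<kappa>0\<bar>)) (\<lambda>y. U \<kappa> y - \<sigma> \<kappa> * U \<kappa>0 y)"
    by (rule close_family[OF k0], erule that, assumption+)
  obtain K where K: "1 \<le> K" "\<And>\<kappa>. \<bar>\<kappa>\<bar> < 1 \<Longrightarrow> dec 4 K (U \<kappa>)" by (rule U_dec, erule that, assumption)
  define d where "d = (\<lambda>\<kappa>. \<bar>\<kappa> - \<kappa>0\<bar> * (2 + 2 * bp) + \<bar>e \<kappa> - e \<kappa>0\<bar>)"
  have d: "(d \<longlongrightarrow> 0) (at \<kappa>0)" unfolding d_def by (rule near_tendsto(1)[OF k0])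
  have d0: "0 \<le> d \<kappa>" for \<kappa> using bp_pos by (simp add: d_def)
  define u where "u = U \<kappa>0"
  have cu: "continuous_on UNIV u" and du: "dec 4 K u" using U_cont k0 K by (auto simp: u_def)
  \<comment> \<open>With its sign corrected, the eigenfunction converges to u in the weighted
    sense.\<close>
  define T where "T = (\<lambda>\<kappa> y. \<sigma> \<kappa> * U \<kappa> y)"
  have cT: "continuous_on UNIV (T \<kappa>)" if "\<bar>\<kappa>\<bar> < 1" for \<kappa>
    unfolding T_def using U_cont that by (intro continuous_intros)
  have Tu: "dec 4 (C * d \<kappa>) (\<lambda>y. T \<kappa> y - u y)" if k: "\<bar>\<kappa>\<bar> < 1" for \<kappa>
  proof -
    have "T \<kappa> y - u y = \<sigma> \<kappa> * (U \<kappa> y - \<sigma> \<kappa> * U \<kappa>0 y)" for y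
      using \<sigma>[OF k] by (auto simp: T_def u_def algebra_simps)
    moreover have "dec 4 (\<bar>\<sigma> \<kappa>\<bar> * (C * d \<kappa>)) (\<lambda>y. \<sigma> \<kappa> * (U \<kappa> y - \<sigma> \<kappa> * U \<kappa>0 y))"
      unfolding d_def by (rule dec_cmult[OF cl[OF k]])
    ultimately show ?thesis using \<sigma>[OF k] by auto
  qed
  define J where "J = (\<lambda>\<kappa>. LBINT y. T \<kappa> y * u y)"
  define L where "L = (\<lambda>\<kappa>. LBINT y. (\<kappa> + \<kappa>0 - 2 * A s y) * (T \<kappa> y * u y))"
  have J: "(J \<longlongrightarrow> (LBINT y. u y * u y)) (at \<kappa>0)"
    unfolding J_def
  proof (rule integral_dec_tendsto)
    show "\<forall>\<^sub>F \<kappa> in at \<kappa>0. continuous_on UNIV (\<lambda>y. T \<kappa> y * u y) \<and> dec 1 (C * d \<kappa> * K) (\<lambda>y. T \<kappa> y * u y - u y * u y)"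
      using near_tendsto(2)[OF k0]
    proof eventually_elim
      case (elim \<kappa>)
      have "dec 1 (C * d \<kappa> * K) (\<lambda>y. (T \<kappa> y - u y) * u y)"
        by (rule dec_mono[OF dec_mult[OF Tu[OF elim] du]]) auto
      thus ?case using cT[OF elim] cu by (auto intro!: continuous_intros simp: algebra_simps)
    qed
    have "((\<lambda>\<kappa>. C * d \<kappa> * K) \<longlongrightarrow> C * 0 * K) (at \<kappa>0)" by (intro tendsto_intros d)
    thus "((\<lambda>\<kappa>. C * d \<kappa> * K) \<longlongrightarrow> 0) (at \<kappa>0)" by simp
    show "dec 1 (K * K) (\<lambda>y. u y * u y)" by (rule dec_mono[OF dec_mult[OF du du]]) auto
  qed (intro continuous_intros cu)
  have JN: "(LBINT y. u y * u y) = N \<kappa>0" by (simp add: N_def u_def power2_eq_square)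
  have L: "(L \<longlongrightarrow> (LBINT y. (\<kappa>0 + \<kappa>0 - 2 * A s y) * (u y * u y))) (at \<kappa>0)"
    unfolding L_def
  proof (rule integral_dec_tendsto)
    show "\<forall>\<^sub>F \<kappa> in at \<kappa>0. continuous_on UNIV (\<lambda>y. (\<kappa> + \<kappa>0 - 2 * A s y) * (T \<kappa> y * u y)) \<and>
      dec 1 ((2 + 2 * bp) * (C * d \<kappa> * K) + \<bar>\<kappa> - \<kappa>0\<bar> * (K * K))
       (\<lambda>y. (\<kappa> + \<kappa>0 - 2 * A s y) * (T \<kappa> y * u y) - (\<kappa>0 + \<kappa>0 - 2 * A s y) * (u y * u y))"
      using near_tendsto(2)[OF k0]
    proof eventually_elim
      case (elim \<kappa>)
      have 1: "dec 1 ((2 + 2 * bp) * (C * d \<kappa> * K)) (\<lambda>y. (\<kappa> + \<kappa>0 - 2 * A s y) * ((T \<kappa> y - u y) * u y))"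
        by (rule dec_mono[OF dec_mult[OF pot_diff_dec(1) dec_mult[OF Tu[OF elim] du]]]) (use elim k0 in auto)
      have 2: "dec 1 (\<bar>\<kappa> - \<kappa>0\<bar> * (K * K)) (\<lambda>y. (\<kappa> - \<kappa>0) * (u y * u y))"
        by (rule dec_mono[OF dec_cmult[OF dec_mult[OF du du]]]) auto
      from dec_add[OF 1 2] show ?case
        using cT[OF elim] cu by (auto intro!: continuous_intros A_cont simp: algebra_simps)
    qed
    have "((\<lambda>\<kappa>. (2 + 2 * bp) * (C * d \<kappa> * K) + \<bar>\<kappa> - \<kappa>0\<bar> * (K * K)) \<longlongrightarrow>
        (2 + 2 * bp) * (C * 0 * K) + \<bar>\<kappa>0 - \<kappa>0\<bar> * (K * K)) (at \<kappa>0)" by (intro tendsto_intros d)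
    thus "((\<lambda>\<kappa>. (2 + 2 * bp) * (C * d \<kappa> * K) + \<bar>\<kappa> - \<kappa>0\<bar> * (K * K)) \<longlongrightarrow> 0) (at \<kappa>0)" by simp
    show "dec 1 ((2 + 2 * bp) * (K * K)) (\<lambda>y. (\<kappa>0 + \<kappa>0 - 2 * A s y) * (u y * u y))"
      by (rule dec_mono[OF dec_mult[OF pot_diff_dec(1) dec_mult[OF du du]]]) (use k0 in auto)
  qed (intro continuous_intros cu A_cont)
  have LG: "(LBINT y. (\<kappa>0 + \<kappa>0 - 2 * A s y) * (u y * u y)) / N \<kappa>0 = G \<kappa>0"
    unfolding G_def u_def by (simp add: power2_eq_square algebra_simps)
  have "((\<lambda>\<kappa>. L \<kappa> / J \<kappa>) \<longlongrightarrow> G \<kappa>0) (at \<kappa>0)"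
    using tendsto_divide[OF L J[unfolded JN]] N_pos[OF k0] unfolding LG by simp
  moreover have "\<forall>\<^sub>F \<kappa> in at \<kappa>0. L \<kappa> / J \<kappa> = (e \<kappa> - e \<kappa>0) / (\<kappa> - \<kappa>0)"
  proof -
    have "\<forall>\<^sub>F \<kappa> in at \<kappa>0. 0 < J \<kappa>" using J N_pos[OF k0] unfolding JN by (rule order_tendstoD)
    moreover have "\<forall>\<^sub>F \<kappa> in at \<kappa>0. \<kappa> \<noteq> \<kappa>0" by (simp add: eventually_at_filter)
    ultimately show ?thesis using near_tendsto(2)[OF k0]
    proof eventually_elim
      case (elim \<kappa>)
      have i1: "integrable lborel (\<lambda>y. (\<kappa> + \<kappa>0 - 2 * A s y) * (u y * U \<kappa> y))"
        by (rule integrable_dec[OF _ dec_mult[OF pot_diff_dec(1) dec_mult[OF du K(2)]]])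
          (use elim k0 in \<open>auto intro!: continuous_intros A_cont cu U_cont\<close>)
      have i2: "integrable lborel (\<lambda>y. u y * U \<kappa> y)"
        by (rule integrable_dec[OF _ dec_mult[OF du K(2)]]) (use elim in \<open>auto intro!: continuous_intros cu U_cont\<close>)
      have "0 = (LBINT y. (P \<kappa> y - P \<kappa>0 y) * (U \<kappa>0 y * U \<kappa> y))"
        using bound_orthogonal[OF P_adm[OF k0] P_adm[OF elim(3)] mu_pos bound_U[OF k0] bound_U[OF elim(3)]] by simp
      also have "\<dots> = (LBINT y. (\<kappa> - \<kappa>0) * ((\<kappa> + \<kappa>0 - 2 * A s y) * (u y * U \<kappa> y)) - (e \<kappa> - e \<kappa>0) * (u y * U \<kappa> y))"
        unfolding P_diff u_def by (intro Bochner_Integration.integral_cong) (auto simp: algebra_simps)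
      also have "\<dots> = (\<kappa> - \<kappa>0) * (LBINT y. (\<kappa> + \<kappa>0 - 2 * A s y) * (u y * U \<kappa> y)) - (e \<kappa> - e \<kappa>0) * (LBINT y. u y * U \<kappa> y)"
        using i1 i2 by (subst Bochner_Integration.integral_diff) auto
      finally have eq: "0 = (\<kappa> - \<kappa>0) * (LBINT y. (\<kappa> + \<kappa>0 - 2 * A s y) * (u y * U \<kappa> y)) - (e \<kappa> - e \<kappa>0) * (LBINT y. u y * U \<kappa> y)" .
      have "b * (c * Y) = a * (c * X)" if "0 = a * X - b * Y" for a b c X Y :: real using that by (simp add: algebra_simps)
      from this[OF eq] have "(e \<kappa> - e \<kappa>0) * (\<sigma> \<kappa> * (LBINT y. u y * U \<kappa> y)) = (\<kappa> - \<kappa>0) * (\<sigma> \<kappa> * (LBINT y. (\<kappa> + \<kappa>0 - 2 * A s y) * (u y * U \<kappa> y)))" .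
      moreover have "J \<kappa> = \<sigma> \<kappa> * (LBINT y. u y * U \<kappa> y)"
        unfolding J_def T_def Bochner_Integration.integral_mult_right_zero[symmetric] by (intro Bochner_Integration.integral_cong) auto
      moreover have "L \<kappa> = \<sigma> \<kappa> * (LBINT y. (\<kappa> + \<kappa>0 - 2 * A s y) * (u y * U \<kappa> y))"
        unfolding L_def T_def Bochner_Integration.integral_mult_right_zero[symmetric] by (intro Bochner_Integration.integral_cong) auto
      ultimately have "(e \<kappa> - e \<kappa>0) * J \<kappa> = (\<kappa> - \<kappa>0) * L \<kappa>" by simp
      thus ?case using elim by (simp add: field_simps)
    qed
  qed
  ultimately show ?thesis unfolding has_field_derivative_iff by (rule Lim_transform_eventually)
qed

end

section \<open>Differentiability of eigenfunctions in the momentum\<close>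

lemma convergent_of_rate:
  fixes x r :: "nat \<Rightarrow> real"
  assumes x: "\<And>m n. \<bar>x m - x n\<bar> \<le> c * (r m + r n)" and r: "r \<longlonglongrightarrow> 0" and c: "0 \<le> c"
  shows "convergent x"
proof -
  have "Cauchy x"
  proof (rule metric_CauchyI)
    fix \<epsilon> :: real assume \<epsilon>: "0 < \<epsilon>"
    have "0 < \<epsilon> / (2 * (c + 1))" using \<epsilon> c by simp
    then obtain M where M: "\<And>m. M \<le> m \<Longrightarrow> \<bar>r m\<bar> < \<epsilon> / (2 * (c + 1))"
      using LIMSEQ_D[OF r] by (metis diff_zero real_norm_def)
    show "\<exists>M. \<forall>m\<ge>M. \<forall>n\<ge>M. dist (x m) (x n) < \<epsilon>"
    proof (intro exI[of _ M] allI impI)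
      fix m n assume "M \<le> m" "M \<le> n"
      hence "r m + r n \<le> \<epsilon> / (2 * (c + 1)) + \<epsilon> / (2 * (c + 1))" using M[of m] M[of n] by linarith
      also have "\<dots> = \<epsilon> / (c + 1)" using c by (simp add: field_simps add_divide_distrib[symmetric])
      finally have "r m + r n \<le> \<epsilon> / (c + 1)" .
      hence "c * (r m + r n) \<le> c * (\<epsilon> / (c + 1))" using c by (rule mult_left_mono)
      also have "\<dots> < \<epsilon>" using c \<epsilon> by (simp add: field_simps)
      finally show "dist (x m) (x n) < \<epsilon>" using x[of m n] by (simp add: dist_real_def)
    qed
  qed
  thus ?thesis by (simp add: Cauchy_convergent_iff)
qed

context band_family
begin

text \<open>Dividing by this cosine repairs the arbitrary sign and removes the component of the
  increment along \<open>U 0\<close>: the data of the difference quotients become orthogonal to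
  those of \<open>U 0\<close>, as \<open>fredholm_estimate\<close> demands.\<close>

definition t :: "real \<Rightarrow> real" where "t \<kappa> = U \<kappa> 0 * U 0 0 + V \<kappa> 0 * V 0 0"
definition q :: "real \<Rightarrow> real" where "q \<kappa> = (e \<kappa> - e 0) / \<kappa>"
definition uh :: "real \<Rightarrow> real \<Rightarrow> real" where "uh \<kappa> y = U \<kappa> y / t \<kappa>"
definition vh :: "real \<Rightarrow> real \<Rightarrow> real" where "vh \<kappa> y = V \<kappa> y / t \<kappa>"
definition Dq :: "real \<Rightarrow> real \<Rightarrow> real" where "Dq \<kappa> y = (uh \<kappa> y - U 0 y) / \<kappa>"
definition Eq :: "real \<Rightarrow> real \<Rightarrow> real" where "Eq \<kappa> y = (vh \<kappa> y - V 0 y) / \<kappa>"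
definition fq :: "real \<Rightarrow> real \<Rightarrow> real" where "fq \<kappa> y = (2 * A s y - \<kappa> + q \<kappa>) * uh \<kappa> y"
definition f0 :: "real \<Rightarrow> real" where "f0 y = (2 * A s y + G 0) * U 0 y"

lemma q_tendsto: "(q \<longlongrightarrow> G 0) (at 0)"
  using e_deriv[of 0] by (simp add: has_field_derivative_iff q_def[abs_def])

lemma uh_0: "uh 0 = U 0"
  using boundD(2)[OF bound_U[of 0]] by (auto simp: uh_def t_def power2_eq_square)

lemma quotient_sol:
  assumes "\<bar>\<kappa>\<bar> < 1" "\<kappa> \<noteq> 0"
  shows "sol (P 0) (fq \<kappa>) (Dq \<kappa>) (Eq \<kappa>)"
  unfolding sol_def
proof (intro allI conjI)
  fix y
  have zz: "\<bar>0::real\<bar> < 1" by simp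
  note d = solD[OF boundD(1)[OF bound_U[OF assms(1)]]] and d0 = solD[OF boundD(1)[OF bound_U[OF zz]]]
  show "(Dq \<kappa> has_real_derivative Eq \<kappa> y) (at y)"
    unfolding Dq_def[abs_def] Eq_def uh_def vh_def by (intro DERIV_cdivide DERIV_diff d(1) d0(1))
  have *: "(Eq \<kappa> has_real_derivative (((P \<kappa> y * U \<kappa> y - 0) / t \<kappa> - (P 0 y * U 0 y - 0)) / \<kappa>)) (at y)"
    unfolding Eq_def[abs_def] vh_def by (intro DERIV_cdivide DERIV_diff d(2) d0(2))
  have "\<kappa> * q \<kappa> = e \<kappa> - e 0" using assms(2) by (simp add: q_def)
  hence P\<kappa>: "P \<kappa> y = P 0 y - \<kappa> * (2 * A s y - \<kappa> + q \<kappa>)"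
    using P_diff[of \<kappa> y 0] by (simp add: algebra_simps)
  have gen: "((p - \<kappa> * c) * x - p * w) / \<kappa> = p * ((x - w) / \<kappa>) - c * x" for p c x w
    using assms(2) by (simp add: field_simps)
  have "((P \<kappa> y * U \<kappa> y - 0) / t \<kappa> - (P 0 y * U 0 y - 0)) / \<kappa> = (P \<kappa> y * uh \<kappa> y - P 0 y * U 0 y) / \<kappa>"
    by (simp add: uh_def)
  also have "\<dots> = P 0 y * Dq \<kappa> y - fq \<kappa> y"
    unfolding P\<kappa> gen Dq_def fq_def ..
  finally have "((P \<kappa> y * U \<kappa> y - 0) / t \<kappa> - (P 0 y * U 0 y - 0)) / \<kappa> = P 0 y * Dq \<kappa> y - fq \<kappa> y" .
  thus "(Eq \<kappa> has_real_derivative P 0 y * Dq \<kappa> y - fq \<kappa> y) (at y)" using * by simp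
qed

text \<open>The Fredholm estimate is used twice: at rate 3 it bounds the difference quotients, which
  makes their sources converge; at rate 2 it turns convergence of the sources into a Cauchy estimate
  for the quotients. Each factor \<open>A s\<close> costs one unit, hence the descent from rate 4 to
  rate 1.\<close>

lemma quotient_estimates:
  obtains \<rho> K B F r where "0 < \<rho>" "\<rho> \<le> 1" "0 \<le> K" "0 \<le> F" "(r \<longlongrightarrow> 0) (at 0)"
    "dec 4 K (U 0)"
    "\<And>\<kappa>. \<bar>\<kappa>\<bar> < \<rho> \<Longrightarrow> t \<kappa> \<noteq> 0 \<and> dec 4 (2 * K) (uh \<kappa>)"
    "\<And>\<kappa>. \<bar>\<kappa>\<bar> < \<rho> \<Longrightarrow> \<kappa> \<noteq> 0 \<Longrightarrow> dec 3 B (Dq \<kappa>)"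
    "\<And>\<kappa>. \<bar>\<kappa>\<bar> < \<rho> \<Longrightarrow> \<kappa> \<noteq> 0 \<Longrightarrow> dec 2 (r \<kappa>) (\<lambda>y. fq \<kappa> y - f0 y)"
    "\<And>\<kappa> \<kappa>'. \<bar>\<kappa>\<bar> < \<rho> \<Longrightarrow> \<kappa> \<noteq> 0 \<Longrightarrow> \<bar>\<kappa>'\<bar> < \<rho> \<Longrightarrow> \<kappa>' \<noteq> 0 \<Longrightarrow>
       dec 2 (F * (r \<kappa> + r \<kappa>')) (\<lambda>y. Dq \<kappa> y - Dq \<kappa>' y) \<and> dec 1 (F * (r \<kappa> + r \<kappa>')) (\<lambda>y. Eq \<kappa> y - Eq \<kappa>' y)"
proof -
  have zz: "\<bar>0::real\<bar> < 1" by simp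
  obtain C \<sigma> where C: "1 \<le> C" and \<sigma>: "\<And>\<kappa>. \<bar>\<kappa>\<bar> < 1 \<Longrightarrow> \<sigma> \<kappa> \<in> {1, -1::real}"
    and cl: "\<And>\<kappa>. \<bar>\<kappa>\<bar> < 1 \<Longrightarrow> dec 4 (C * (\<bar>\<kappa> - 0\<bar> * (2 + 2 * bp) + \<bar>e \<kappa> - e 0\<bar>)) (\<lambda>y. U \<kappa> y - \<sigma> \<kappa> * U 0 y)"
      "\<And>\<kappa>. \<bar>\<kappa>\<bar> < 1 \<Longrightarrow> \<bar>V \<kappa> 0 - \<sigma> \<kappa> * V 0 0\<bar> \<le> C * (\<bar>\<kappa> - 0\<bar> * (2 + 2 * bp) + \<bar>e \<kappa> - e 0\<bar>)"
    by (rule close_family[OF zz], erule that, assumption+)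
  define d where "d = (\<lambda>\<kappa>. \<bar>\<kappa> - 0\<bar> * (2 + 2 * bp) + \<bar>e \<kappa> - e 0\<bar>)"
  have d: "(d \<longlongrightarrow> 0) (at 0)" unfolding d_def by (rule near_tendsto(1)[OF zz])
  obtain K where K: "1 \<le> K" "\<And>\<kappa>. \<bar>\<kappa>\<bar> < 1 \<Longrightarrow> dec 4 K (U \<kappa>)" "\<And>\<kappa>. \<bar>\<kappa>\<bar> < 1 \<Longrightarrow> dec 4 K (V \<kappa>)"
    by (rule U_dec, erule that, assumption+)
  have l3: "(1::real) \<le> 3" and l2: "(1::real) \<le> 2" by auto
  obtain F3 where F3: "1 \<le> F3" "\<And>p u v f D E B C0. adm \<mu> M p \<Longrightarrow> bound p u v \<Longrightarrow> sol p f D E \<Longrightarrow> dec 3 B f \<Longrightarrow> dec 1 C0 D \<Longrightarrow> dec 0 C0 E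
       \<Longrightarrow> D 0 * u 0 + E 0 * v 0 = 0 \<Longrightarrow> dec 3 (F3 * B) D"
    by (rule fredholm_estimate[OF mu_pos M_nonneg l3], erule that, assumption)
  obtain F2 where F2: "1 \<le> F2" "\<And>p u v f D E B C0. adm \<mu> M p \<Longrightarrow> bound p u v \<Longrightarrow> sol p f D E \<Longrightarrow> dec 2 B f \<Longrightarrow> dec 1 C0 D \<Longrightarrow> dec 0 C0 E
       \<Longrightarrow> D 0 * u 0 + E 0 * v 0 = 0 \<Longrightarrow> dec 2 (F2 * B) D"
    by (rule fredholm_estimate[OF mu_pos M_nonneg l2], erule that, assumption)
  have "((\<lambda>\<kappa>. 2 * (C * d \<kappa>)) \<longlongrightarrow> 2 * (C * 0)) (at 0)" by (intro tendsto_intros d)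
  hence "\<forall>\<^sub>F \<kappa> in at 0. 2 * (C * d \<kappa>) < 1 / 2" by (rule order_tendstoD) simp
  moreover have "\<forall>\<^sub>F \<kappa> in at 0. dist (q \<kappa>) (G 0) < 1" using q_tendsto by (simp add: tendsto_iff)
  ultimately have "\<forall>\<^sub>F \<kappa> in at 0. \<bar>\<kappa>\<bar> < 1 \<and> 2 * (C * d \<kappa>) < 1 / 2 \<and> dist (q \<kappa>) (G 0) < 1"
    using near_tendsto(2)[OF zz] by eventually_elim auto
  then obtain \<rho>0 where \<rho>0: "0 < \<rho>0" "\<And>\<kappa>. \<kappa> \<noteq> 0 \<Longrightarrow> \<bar>\<kappa>\<bar> < \<rho>0 \<Longrightarrow> \<bar>\<kappa>\<bar> < 1 \<and> 2 * (C * d \<kappa>) < 1 / 2 \<and> \<bar>q \<kappa> - G 0\<bar> < 1"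
    by (auto simp: eventually_at dist_real_def)
  define \<rho> where "\<rho> = min 1 \<rho>0"
  have \<rho>: "0 < \<rho>" "\<rho> \<le> 1" using \<rho>0 by (auto simp: \<rho>_def)
  have good: "\<bar>\<kappa>\<bar> < 1" "2 * (C * d \<kappa>) < 1 / 2" "\<bar>q \<kappa> - G 0\<bar> < 1" if "\<bar>\<kappa>\<bar> < \<rho>" "\<kappa> \<noteq> 0" for \<kappa>
    using \<rho>0(2)[OF that(2)] that(1) by (auto simp: \<rho>_def)
  note b0 = bound_U[OF zz]
  have t: "1 / 2 \<le> \<bar>t \<kappa>\<bar>" if \<kappa>: "\<bar>\<kappa>\<bar> < \<rho>" for \<kappa>
  proof (cases "\<kappa> = 0")
    case True thus ?thesis using boundD(2)[OF b0] by (simp add: t_def power2_eq_square)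
  next
    case False
    note g = good[OF \<kappa> False]
    have "t \<kappa> - \<sigma> \<kappa> = t \<kappa> - \<sigma> \<kappa> * ((U 0 0)\<^sup>2 + (V 0 0)\<^sup>2)" using boundD(2)[OF b0] by simp
    also have "\<dots> = (U \<kappa> 0 - \<sigma> \<kappa> * U 0 0) * U 0 0 + (V \<kappa> 0 - \<sigma> \<kappa> * V 0 0) * V 0 0"
      unfolding t_def by (simp add: algebra_simps power2_eq_square)
    finally have "\<bar>t \<kappa> - \<sigma> \<kappa>\<bar> \<le> \<bar>U \<kappa> 0 - \<sigma> \<kappa> * U 0 0\<bar> * \<bar>U 0 0\<bar> + \<bar>V \<kappa> 0 - \<sigma> \<kappa> * V 0 0\<bar> * \<bar>V 0 0\<bar>"
      by (metis abs_mult abs_triangle_ineq)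
    also have "\<dots> \<le> (C * d \<kappa>) * 1 + (C * d \<kappa>) * 1"
    proof -
      have "0 \<le> C * d \<kappa>" using C bp_pos by (simp add: d_def)
      thus ?thesis
        using decD[OF cl(1)[OF g(1)], of 0] cl(2)[OF g(1)] boundD(3,4)[OF b0]
        by (intro add_mono mult_mono) (auto simp: d_def)
    qed
    finally have "\<bar>t \<kappa> - \<sigma> \<kappa>\<bar> \<le> 1 / 2" using g(2) by simp
    moreover have "\<bar>\<sigma> \<kappa>\<bar> = 1" using \<sigma>[OF g(1)] by auto
    ultimately show ?thesis by linarith
  qed
  have div_dec: "dec 4 (2 * K) (\<lambda>y. g y / t \<kappa>)" if "\<bar>\<kappa>\<bar> < \<rho>" "dec 4 K g" for g \<kappa>
  proof -
    have "dec 4 (\<bar>1 / t \<kappa>\<bar> * K) (\<lambda>y. (1 / t \<kappa>) * g y)" by (rule dec_cmult[OF that(2)])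
    moreover have "\<bar>1 / t \<kappa>\<bar> \<le> 2" using t[OF that(1)] by (simp add: abs_divide field_simps)
    hence "\<bar>1 / t \<kappa>\<bar> * K \<le> 2 * K" using K(1) by (intro mult_right_mono) auto
    ultimately have "dec 4 (2 * K) (\<lambda>y. (1 / t \<kappa>) * g y)" by (rule dec_mono[OF _ order_refl])
    thus ?thesis by simp
  qed
  have uhd: "dec 4 (2 * K) (uh \<kappa>)" "dec 4 (2 * K) (vh \<kappa>)" if "\<bar>\<kappa>\<bar> < \<rho>" for \<kappa>
    unfolding uh_def[abs_def] vh_def[abs_def] using div_dec[OF that] K(2,3)[of \<kappa>] that \<rho> by auto
  define c0 where "c0 = 2 * bp + (\<bar>G 0\<bar> + 2)"
  have c0: "0 \<le> c0" using bp_pos by (simp add: c0_def)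
  have coef: "dec (-1) c0 (\<lambda>y. 2 * A s y - \<kappa> + q \<kappa>)" if "\<bar>\<kappa>\<bar> < \<rho>" "\<kappa> \<noteq> 0" for \<kappa>
  proof -
    note g = good[OF that]
    have "\<bar>q \<kappa> - \<kappa>\<bar> \<le> \<bar>G 0\<bar> + 2" using g by linarith
    hence "dec (-1) (\<bar>G 0\<bar> + 2) (\<lambda>_. q \<kappa> - \<kappa>)" by (intro dec_mono[OF dec_const]) auto
    moreover have "dec (-1) (\<bar>2\<bar> * bp) (\<lambda>y. 2 * A s y)" by (rule dec_cmult[OF A_dec])
    ultimately have "dec (-1) (\<bar>2\<bar> * bp + (\<bar>G 0\<bar> + 2)) (\<lambda>y. 2 * A s y + (q \<kappa> - \<kappa>))" by (intro dec_add)
    moreover have "(\<lambda>y. 2 * A s y - \<kappa> + q \<kappa>) = (\<lambda>y. 2 * A s y + (q \<kappa> - \<kappa>))" by auto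
    ultimately show ?thesis by (simp add: c0_def)
  qed
  define B0 where "B0 = c0 * (2 * K)"
  have fqd: "dec 3 B0 (fq \<kappa>)" if "\<bar>\<kappa>\<bar> < \<rho>" "\<kappa> \<noteq> 0" for \<kappa>
    unfolding fq_def[abs_def] B0_def by (rule dec_mono[OF dec_mult[OF coef[OF that] uhd(1)[OF that(1)]]]) auto
  have perp: "Dq \<kappa> 0 * U 0 0 + Eq \<kappa> 0 * V 0 0 = 0" if "\<bar>\<kappa>\<bar> < \<rho>" "\<kappa> \<noteq> 0" for \<kappa>
  proof -
    have "t \<kappa> \<noteq> 0" using t[OF that(1)] by auto
    have "Dq \<kappa> 0 * U 0 0 + Eq \<kappa> 0 * V 0 0 = ((U \<kappa> 0 * U 0 0 + V \<kappa> 0 * V 0 0) / t \<kappa> - ((U 0 0)\<^sup>2 + (V 0 0)\<^sup>2)) / \<kappa>"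
      unfolding Dq_def Eq_def uh_def vh_def
      by (simp add: algebra_simps add_divide_distrib diff_divide_distrib power2_eq_square)
    thus ?thesis using \<open>t \<kappa> \<noteq> 0\<close> boundD(2)[OF b0] by (simp add: t_def[symmetric])
  qed
  have qual: "dec 1 (\<bar>1 / \<kappa>\<bar> * (2 * K + K)) (Dq \<kappa>)" "dec 0 (\<bar>1 / \<kappa>\<bar> * (2 * K + K)) (Eq \<kappa>)"
    if "\<bar>\<kappa>\<bar> < \<rho>" "\<kappa> \<noteq> 0" for \<kappa>
  proof -
    have "dec 4 (\<bar>1 / \<kappa>\<bar> * (2 * K + K)) (\<lambda>y. (1 / \<kappa>) * (uh \<kappa> y - U 0 y))"
      by (intro dec_cmult dec_diff uhd[OF that(1)] K zz)
    hence "dec 4 (\<bar>1 / \<kappa>\<bar> * (2 * K + K)) (Dq \<kappa>)" by (simp add: Dq_def[abs_def])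
    thus "dec 1 (\<bar>1 / \<kappa>\<bar> * (2 * K + K)) (Dq \<kappa>)" by (rule dec_mono) auto
    have "dec 4 (\<bar>1 / \<kappa>\<bar> * (2 * K + K)) (\<lambda>y. (1 / \<kappa>) * (vh \<kappa> y - V 0 y))"
      by (intro dec_cmult dec_diff uhd[OF that(1)] K zz)
    hence "dec 4 (\<bar>1 / \<kappa>\<bar> * (2 * K + K)) (Eq \<kappa>)" by (simp add: Eq_def[abs_def])
    thus "dec 0 (\<bar>1 / \<kappa>\<bar> * (2 * K + K)) (Eq \<kappa>)" by (rule dec_mono) auto
  qed
  define B where "B = F3 * B0"
  have DB: "dec 3 B (Dq \<kappa>)" if "\<bar>\<kappa>\<bar> < \<rho>" "\<kappa> \<noteq> 0" for \<kappa>
    unfolding B_def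
    by (rule F3(2)[OF P_adm[OF zz] b0 quotient_sol fqd qual perp]) (use that good[OF that] in auto)
  define r where "r = (\<lambda>\<kappa>. c0 * (\<bar>\<kappa>\<bar> * B) + (\<bar>q \<kappa> - G 0\<bar> + \<bar>\<kappa>\<bar>) * K)"
  have r: "(r \<longlongrightarrow> 0) (at 0)"
  proof -
    have "(r \<longlongrightarrow> c0 * (\<bar>0\<bar> * B) + (\<bar>G 0 - G 0\<bar> + \<bar>0\<bar>) * K) (at 0)"
      unfolding r_def by (intro tendsto_intros q_tendsto)
    thus ?thesis by simp
  qed
  have fr: "dec 2 (r \<kappa>) (\<lambda>y. fq \<kappa> y - f0 y)" if "\<bar>\<kappa>\<bar> < \<rho>" "\<kappa> \<noteq> 0" for \<kappa>
  proof -
    have "dec 3 (\<bar>\<kappa>\<bar> * B) (\<lambda>y. \<kappa> * Dq \<kappa> y)" by (rule dec_cmult[OF DB[OF that]])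
    hence "dec 3 (\<bar>\<kappa>\<bar> * B) (\<lambda>y. uh \<kappa> y - U 0 y)" using that(2) by (simp add: Dq_def)
    hence 1: "dec 2 (c0 * (\<bar>\<kappa>\<bar> * B)) (\<lambda>y. (2 * A s y - \<kappa> + q \<kappa>) * (uh \<kappa> y - U 0 y))"
      by (intro dec_mono[OF dec_mult[OF coef[OF that]]]) auto
    have 3: "dec 4 (\<bar>q \<kappa> - G 0 - \<kappa>\<bar> * K) (\<lambda>y. (q \<kappa> - G 0 - \<kappa>) * U 0 y)" by (intro dec_cmult K zz)
    have "\<bar>q \<kappa> - G 0 - \<kappa>\<bar> * K \<le> (\<bar>q \<kappa> - G 0\<bar> + \<bar>\<kappa>\<bar>) * K" using K(1) by (intro mult_right_mono) auto
    with 3 have 2: "dec 2 ((\<bar>q \<kappa> - G 0\<bar> + \<bar>\<kappa>\<bar>) * K) (\<lambda>y. (q \<kappa> - G 0 - \<kappa>) * U 0 y)" by (intro dec_mono[OF 3]) auto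
    have "(\<lambda>y. fq \<kappa> y - f0 y) = (\<lambda>y. (2 * A s y - \<kappa> + q \<kappa>) * (uh \<kappa> y - U 0 y) + (q \<kappa> - G 0 - \<kappa>) * U 0 y)"
      by (auto simp: fq_def f0_def algebra_simps)
    thus ?thesis using dec_add[OF 1 2] by (simp add: r_def)
  qed
  define F where "F = (2 + 2 * M) * F2 + 1"
  have F: "F2 \<le> F" "0 \<le> F"
  proof -
    have "1 * F2 \<le> (2 + 2 * M) * F2" using F2 M_nonneg by (intro mult_right_mono) auto
    thus "F2 \<le> F" "0 \<le> F" using F2(1) unfolding F_def by linarith+
  qed
  have diff: "dec 2 (F * (r \<kappa> + r \<kappa>')) (\<lambda>y. Dq \<kappa> y - Dq \<kappa>' y) \<and> dec 1 (F * (r \<kappa> + r \<kappa>')) (\<lambda>y. Eq \<kappa> y - Eq \<kappa>' y)"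
    if k: "\<bar>\<kappa>\<bar> < \<rho>" "\<kappa> \<noteq> 0" "\<bar>\<kappa>'\<bar> < \<rho>" "\<kappa>' \<noteq> 0" for \<kappa> \<kappa>'
  proof -
    have R: "0 \<le> r \<kappa> + r \<kappa>'" using dec_nonneg[OF fr[OF k(1,2)]] dec_nonneg[OF fr[OF k(3,4)]] by simp
    have so: "sol (P 0) (\<lambda>y. fq \<kappa> y - fq \<kappa>' y) (\<lambda>y. Dq \<kappa> y - Dq \<kappa>' y) (\<lambda>y. Eq \<kappa> y - Eq \<kappa>' y)"
      using sol_lincomb[OF quotient_sol quotient_sol, of \<kappa> \<kappa>' 1 "-1"] k good(1)[OF k(1,2)] good(1)[OF k(3,4)] by simp
    have f: "dec 2 (r \<kappa> + r \<kappa>') (\<lambda>y. fq \<kappa> y - fq \<kappa>' y)"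
      using dec_diff[OF fr[OF k(1,2)] fr[OF k(3,4)]] by simp
    have D: "dec 2 (F2 * (r \<kappa> + r \<kappa>')) (\<lambda>y. Dq \<kappa> y - Dq \<kappa>' y)"
    proof (rule F2(2)[OF P_adm[OF zz] b0 so f])
      define Z where "Z = \<bar>1 / \<kappa>\<bar> * (2 * K + K) + \<bar>1 / \<kappa>'\<bar> * (2 * K + K)"
      show "dec 1 Z (\<lambda>y. Dq \<kappa> y - Dq \<kappa>' y)" "dec 0 Z (\<lambda>y. Eq \<kappa> y - Eq \<kappa>' y)"
        unfolding Z_def by (intro dec_diff qual k)+
      show "(Dq \<kappa> 0 - Dq \<kappa>' 0) * U 0 0 + (Eq \<kappa> 0 - Eq \<kappa>' 0) * V 0 0 = 0"
        using perp[OF k(1,2)] perp[OF k(3,4)] by (simp add: algebra_simps)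
    qed
    have "dec (2 - 1) ((2 + 2 * M) * (F2 * (r \<kappa> + r \<kappa>')) + (r \<kappa> + r \<kappa>')) (\<lambda>y. Eq \<kappa> y - Eq \<kappa>' y)"
      by (rule dec_deriv[OF P_adm[OF zz] mu_pos so D f]) simp
    hence "dec 1 (F * (r \<kappa> + r \<kappa>')) (\<lambda>y. Eq \<kappa> y - Eq \<kappa>' y)" by (simp add: F_def algebra_simps)
    moreover have "dec 2 (F * (r \<kappa> + r \<kappa>')) (\<lambda>y. Dq \<kappa> y - Dq \<kappa>' y)"
      by (rule dec_mono[OF D]) (use F R in \<open>auto intro: mult_right_mono\<close>)
    ultimately show ?thesis by simp
  qed
  show thesis
  proof (rule that[of \<rho> K F r B])
    show "t \<kappa> \<noteq> 0 \<and> dec 4 (2 * K) (uh \<kappa>)" if "\<bar>\<kappa>\<bar> < \<rho>" for \<kappa> using t[OF that] uhd[OF that] by auto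
  qed (use \<rho> K F r DB fr diff zz in auto)
qed

text \<open>Only the Cauchy data need a limit along a sequence: D is then defined by the initial
  value problem with those data and source \<open>f0\<close>, and the Cauchy estimate carries
  weighted convergence to all small \<kappa>.\<close>

lemma parameter_derivative:
  assumes \<rho>: "0 < \<rho>" "\<rho> \<le> 1" and F: "0 \<le> F" and r: "(r \<longlongrightarrow> 0) (at 0)" and K: "dec 4 K (U 0)"
    and DB: "\<And>\<kappa>. \<bar>\<kappa>\<bar> < \<rho> \<Longrightarrow> \<kappa> \<noteq> 0 \<Longrightarrow> dec 3 B (Dq \<kappa>)"
    and fr: "\<And>\<kappa>. \<bar>\<kappa>\<bar> < \<rho> \<Longrightarrow> \<kappa> \<noteq> 0 \<Longrightarrow> dec 2 (r \<kappa>) (\<lambda>y. fq \<kappa> y - f0 y)"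
    and diff: "\<And>\<kappa> \<kappa>'. \<bar>\<kappa>\<bar> < \<rho> \<Longrightarrow> \<kappa> \<noteq> 0 \<Longrightarrow> \<bar>\<kappa>'\<bar> < \<rho> \<Longrightarrow> \<kappa>' \<noteq> 0 \<Longrightarrow>
       dec 2 (F * (r \<kappa> + r \<kappa>')) (\<lambda>y. Dq \<kappa> y - Dq \<kappa>' y) \<and> dec 1 (F * (r \<kappa> + r \<kappa>')) (\<lambda>y. Eq \<kappa> y - Eq \<kappa>' y)"
  obtains D E B' where "sol (P 0) f0 D E" "dec 2 B' D" "\<And>\<kappa>. \<bar>\<kappa>\<bar> < \<rho> \<Longrightarrow> \<kappa> \<noteq> 0 \<Longrightarrow> dec 2 (F * r \<kappa>) (\<lambda>y. Dq \<kappa> y - D y)"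
proof -
  have zz: "\<bar>0::real\<bar> < 1" by simp
  \<comment> \<open>The shift by 2 keeps every term strictly inside the interval of radius \<rho>,
    and nonzero.\<close>
  define k where "k = (\<lambda>m::nat. \<rho> / real (m + 2))"
  have k: "\<bar>k m\<bar> < \<rho>" "k m \<noteq> 0" "\<bar>k m\<bar> < 1" for m
  proof -
    have "\<rho> * 1 < \<rho> * real (m + 2)" using \<rho> by (intro mult_strict_left_mono) auto
    thus "\<bar>k m\<bar> < \<rho>" using \<rho> by (simp add: k_def field_simps)
    thus "\<bar>k m\<bar> < 1" using \<rho> by linarith
    show "k m \<noteq> 0" using \<rho> by (simp add: k_def)
  qed
  have "k \<longlonglongrightarrow> 0" unfolding k_def
    by (rule LIMSEQ_ignore_initial_segment[OF lim_const_over_n])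
  hence "filterlim k (at 0) sequentially" using k by (simp add: filterlim_at)
  hence rk: "(\<lambda>m. r (k m)) \<longlonglongrightarrow> 0" using r by (rule filterlim_compose[rotated])
  have r0: "0 \<le> r \<kappa>" if "\<bar>\<kappa>\<bar> < \<rho>" "\<kappa> \<noteq> 0" for \<kappa> using dec_nonneg[OF fr[OF that]] .
  have "\<bar>Dq (k m) 0 - Dq (k n) 0\<bar> \<le> F * (r (k m) + r (k n))" "\<bar>Eq (k m) 0 - Eq (k n) 0\<bar> \<le> F * (r (k m) + r (k n))" for m n
    using diff[OF k(1,2)[of m] k(1,2)[of n]] by (auto dest: decD[of _ _ _ 0])
  from this[THEN convergent_of_rate[OF _ rk F]] obtain D0 E0
    where D0: "(\<lambda>m. Dq (k m) 0) \<longlonglongrightarrow> D0" and E0: "(\<lambda>m. Eq (k m) 0) \<longlonglongrightarrow> E0"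
    unfolding convergent_def by blast
  have cP: "continuous_on UNIV (P 0)" by (rule admD(1)[OF P_adm[OF zz]])
  have cf0: "continuous_on UNIV f0" unfolding f0_def[abs_def] by (intro continuous_intros A_cont U_cont zz)
  obtain D E where DE: "sol (P 0) f0 D E" "D 0 = D0" "E 0 = E0" using ivp_exists[OF cP cf0] by metis
  have conv: "(\<lambda>m. Dq (k m) y) \<longlonglongrightarrow> D y" for y
  proof -
    obtain L where L: "1 \<le> L" "\<And>z. \<bar>z\<bar> \<le> \<bar>y\<bar> \<Longrightarrow> \<bar>P 0 z\<bar> \<le> L" using cont_bounded_on[OF cP] by blast
    define R where "R = (\<lambda>m. gron L \<bar>y\<bar> * ((\<bar>Dq (k m) 0 - D0\<bar> + \<bar>Eq (k m) 0 - E0\<bar>) + r (k m)))"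
    have bd: "norm (Dq (k m) y - D y) \<le> R m" for m
    proof -
      have so: "sol (P 0) (\<lambda>y. fq (k m) y - f0 y) (\<lambda>y. Dq (k m) y - D y) (\<lambda>y. Eq (k m) y - E y)"
        using sol_lincomb[OF quotient_sol[OF k(3)[of m] k(2)] DE(1), where c = 1 and d = "-1"] by simp
      have "\<bar>Dq (k m) y - D y\<bar> \<le> gron L \<bar>y\<bar> * ((\<bar>Dq (k m) 0 - D0\<bar> + \<bar>Eq (k m) 0 - E0\<bar>) + r (k m))"
      proof (rule gronwall_abs(1)[OF so])
        fix z :: real assume z: "\<bar>z\<bar> \<le> \<bar>y\<bar>"
        show "\<bar>P 0 z\<bar> \<le> L" by (rule L(2)[OF z])
        have "\<bar>fq (k m) z - f0 z\<bar> \<le> r (k m) * wt 2 z" by (rule decD[OF fr[OF k(1,2)]])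
        also have "\<dots> \<le> r (k m) * wt 0 z" using r0[OF k(1,2)] by (intro mult_left_mono wt_mono) auto
        finally show "\<bar>fq (k m) z - f0 z\<bar> \<le> r (k m)" by simp
      qed (auto simp: DE)
      thus ?thesis by (simp add: R_def)
    qed
    have "R \<longlonglongrightarrow> gron L \<bar>y\<bar> * ((\<bar>D0 - D0\<bar> + \<bar>E0 - E0\<bar>) + 0)" unfolding R_def by (intro tendsto_intros D0 E0 rk)
    hence "R \<longlonglongrightarrow> 0" by simp
    from Lim_null_comparison[OF always_eventually[OF allI[OF bd]] this] show ?thesis by (rule LIM_zero_cancel)
  qed
  have near: "dec 2 (F * r \<kappa>) (\<lambda>y. Dq \<kappa> y - D y)" if \<kappa>: "\<bar>\<kappa>\<bar> < \<rho>" "\<kappa> \<noteq> 0" for \<kappa>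
    unfolding dec_def
  proof
    fix y
    have "(\<lambda>m. \<bar>Dq \<kappa> y - Dq (k m) y\<bar>) \<longlonglongrightarrow> \<bar>Dq \<kappa> y - D y\<bar>" by (intro tendsto_intros conv)
    moreover have "(\<lambda>m. F * (r \<kappa> + r (k m)) * wt 2 y) \<longlonglongrightarrow> F * (r \<kappa> + 0) * wt 2 y" by (intro tendsto_intros rk)
    moreover have "\<bar>Dq \<kappa> y - Dq (k m) y\<bar> \<le> F * (r \<kappa> + r (k m)) * wt 2 y" for m
      using diff[OF \<kappa> k(1,2)[of m]] decD by blast
    ultimately show "\<bar>Dq \<kappa> y - D y\<bar> \<le> F * r \<kappa> * wt 2 y" using LIMSEQ_le[of _ _ _ "F * (r \<kappa> + 0) * wt 2 y"] by auto
  qed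
  have "dec 2 B (Dq (k 0))" by (rule dec_mono[OF DB[OF k(1,2)]]) auto
  from dec_diff[OF this near[OF k(1,2)[of 0]]] have "dec 2 (B + F * r (k 0)) D" by simp
  thus thesis using that DE(1) near by blast
qed

text \<open>The quotient rule for G with \<open>uh\<close> in place of \<open>U\<close>. Both
  numerator and norm are differentiable because uh^2 - U(0)^2 factors into \<kappa> times the
  difference quotient and the sum of the two functions.\<close>

lemma G_deriv:
  obtains D E B' where "sol (P 0) f0 D E" "dec 2 B' D"
    "(G has_real_derivative 2 - 4 / N 0 * (LBINT y. A s y * (U 0 y * D y)) - 2 * G 0 / N 0 * (LBINT y. U 0 y * D y)) (at 0)"
proof -
  have zz: "\<bar>0::real\<bar> < 1" by simp
  obtain \<rho> K B F r where \<rho>: "0 < \<rho>" "\<rho> \<le> 1" and K: "0 \<le> K" and F: "0 \<le> F" and r: "(r \<longlongrightarrow> 0) (at 0)"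
    and Kd: "dec 4 K (U 0)"
    and uh: "\<And>\<kappa>. \<bar>\<kappa>\<bar> < \<rho> \<Longrightarrow> t \<kappa> \<noteq> 0 \<and> dec 4 (2 * K) (uh \<kappa>)"
    and DB: "\<And>\<kappa>. \<bar>\<kappa>\<bar> < \<rho> \<Longrightarrow> \<kappa> \<noteq> 0 \<Longrightarrow> dec 3 B (Dq \<kappa>)"
    and fr: "\<And>\<kappa>. \<bar>\<kappa>\<bar> < \<rho> \<Longrightarrow> \<kappa> \<noteq> 0 \<Longrightarrow> dec 2 (r \<kappa>) (\<lambda>y. fq \<kappa> y - f0 y)"
    and diff: "\<And>\<kappa> \<kappa>'. \<bar>\<kappa>\<bar> < \<rho> \<Longrightarrow> \<kappa> \<noteq> 0 \<Longrightarrow> \<bar>\<kappa>'\<bar> < \<rho> \<Longrightarrow> \<kappa>' \<noteq> 0 \<Longrightarrow>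
       dec 2 (F * (r \<kappa> + r \<kappa>')) (\<lambda>y. Dq \<kappa> y - Dq \<kappa>' y) \<and> dec 1 (F * (r \<kappa> + r \<kappa>')) (\<lambda>y. Eq \<kappa> y - Eq \<kappa>' y)"
    by (rule quotient_estimates, erule that, assumption+)
  obtain D E B' where sD: "sol (P 0) f0 D E" and D: "dec 2 B' D"
    and near: "\<And>\<kappa>. \<bar>\<kappa>\<bar> < \<rho> \<Longrightarrow> \<kappa> \<noteq> 0 \<Longrightarrow> dec 2 (F * r \<kappa>) (\<lambda>y. Dq \<kappa> y - D y)"
    by (rule parameter_derivative[OF \<rho> F r Kd DB fr diff], assumption+, erule that, assumption+)
  have ev: "\<forall>\<^sub>F \<kappa> in at 0. \<bar>\<kappa>\<bar> < \<rho> \<and> \<kappa> \<noteq> 0" using \<rho> by (auto simp: eventually_at dist_real_def)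
  have cD: "continuous_on UNIV D" by (rule sol_cont(1)[OF sD])
  have cU: "continuous_on UNIV (U 0)" by (rule U_cont(1)[OF zz])
  have cuh: "continuous_on UNIV (uh \<kappa>)" if "\<bar>\<kappa>\<bar> < \<rho>" for \<kappa>
    unfolding uh_def[abs_def] using that \<rho> uh[OF that] by (intro continuous_intros U_cont) auto
  have cDq: "continuous_on UNIV (Dq \<kappa>)" if "\<bar>\<kappa>\<bar> < \<rho>" "\<kappa> \<noteq> 0" for \<kappa>
    unfolding Dq_def[abs_def] using that by (intro continuous_intros cuh cU) auto
  have step: "uh \<kappa> y = U 0 y + \<kappa> * Dq \<kappa> y" if "\<kappa> \<noteq> 0" for \<kappa> y using that by (simp add: Dq_def)
  have du: "dec 3 (\<bar>\<kappa>\<bar> * B) (\<lambda>y. uh \<kappa> y - U 0 y)" if "\<bar>\<kappa>\<bar> < \<rho>" "\<kappa> \<noteq> 0" for \<kappa>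
    using dec_cmult[OF DB[OF that], of \<kappa>] step[OF that(2)] by simp
  have su: "dec 4 (2 * K + K) (\<lambda>y. uh \<kappa> y + U 0 y)" if "\<bar>\<kappa>\<bar> < \<rho>" for \<kappa>
    using dec_add[of 4 "2 * K" "uh \<kappa>" K "U 0"] uh[OF that] Kd by simp
  define J where "J = (\<lambda>\<kappa>. LBINT y. Dq \<kappa> y * (uh \<kappa> y + U 0 y))"
  define H where "H = (\<lambda>\<kappa>. LBINT y. 2 * (uh \<kappa> y * uh \<kappa> y) - 2 * (A s y * (Dq \<kappa> y * (uh \<kappa> y + U 0 y))))"
  have dDs: "dec 4 (F * r \<kappa> * (2 * K + K) + B' * (\<bar>\<kappa>\<bar> * B)) (\<lambda>y. Dq \<kappa> y * (uh \<kappa> y + U 0 y) - D y * (U 0 y + U 0 y))"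
    if k: "\<bar>\<kappa>\<bar> < \<rho>" "\<kappa> \<noteq> 0" for \<kappa>
  proof -
    have 1: "dec 4 (F * r \<kappa> * (2 * K + K)) (\<lambda>y. (Dq \<kappa> y - D y) * (uh \<kappa> y + U 0 y))"
      by (rule dec_mono[OF dec_mult[OF near[OF k] su[OF k(1)]]]) auto
    have 2: "dec 4 (B' * (\<bar>\<kappa>\<bar> * B)) (\<lambda>y. D y * (uh \<kappa> y - U 0 y))"
      by (rule dec_mono[OF dec_mult[OF D du[OF k]]]) auto
    have "(\<lambda>y. Dq \<kappa> y * (uh \<kappa> y + U 0 y) - D y * (U 0 y + U 0 y)) =
      (\<lambda>y. (Dq \<kappa> y - D y) * (uh \<kappa> y + U 0 y) + D y * (uh \<kappa> y - U 0 y))" by (auto simp: algebra_simps)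
    thus ?thesis using dec_add[OF 1 2] by simp
  qed
  have J: "(J \<longlongrightarrow> (LBINT y. D y * (U 0 y + U 0 y))) (at 0)"
    unfolding J_def
  proof (rule integral_dec_tendsto)
    show "\<forall>\<^sub>F \<kappa> in at 0. continuous_on UNIV (\<lambda>y. Dq \<kappa> y * (uh \<kappa> y + U 0 y)) \<and>
      dec 1 (F * r \<kappa> * (2 * K + K) + B' * (\<bar>\<kappa>\<bar> * B)) (\<lambda>y. Dq \<kappa> y * (uh \<kappa> y + U 0 y) - D y * (U 0 y + U 0 y))"
      using ev
    proof eventually_elim
      case (elim \<kappa>)
      have "dec 1 (F * r \<kappa> * (2 * K + K) + B' * (\<bar>\<kappa>\<bar> * B)) (\<lambda>y. Dq \<kappa> y * (uh \<kappa> y + U 0 y) - D y * (U 0 y + U 0 y))"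
        by (rule dec_mono[OF dDs]) (use elim in auto)
      thus ?case using elim cDq cuh cU by (auto intro!: continuous_intros)
    qed
    have "((\<lambda>\<kappa>. F * r \<kappa> * (2 * K + K) + B' * (\<bar>\<kappa>\<bar> * B)) \<longlongrightarrow> F * 0 * (2 * K + K) + B' * (\<bar>0\<bar> * B)) (at 0)" by (intro tendsto_intros r)
    thus "((\<lambda>\<kappa>. F * r \<kappa> * (2 * K + K) + B' * (\<bar>\<kappa>\<bar> * B)) \<longlongrightarrow> 0) (at 0)" by simp
    show "dec 1 (B' * (K + K)) (\<lambda>y. D y * (U 0 y + U 0 y))"
      by (rule dec_mono[OF dec_mult[OF D dec_add[OF Kd Kd]]]) auto
  qed (intro continuous_intros cD cU)
  have H: "(H \<longlongrightarrow> (LBINT y. 2 * (U 0 y * U 0 y) - 2 * (A s y * (D y * (U 0 y + U 0 y))))) (at 0)"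
    unfolding H_def
  proof (rule integral_dec_tendsto)
    show "\<forall>\<^sub>F \<kappa> in at 0. continuous_on UNIV (\<lambda>y. 2 * (uh \<kappa> y * uh \<kappa> y) - 2 * (A s y * (Dq \<kappa> y * (uh \<kappa> y + U 0 y)))) \<and>
      dec 1 (\<bar>2\<bar> * (\<bar>\<kappa>\<bar> * B * (2 * K + K)) + \<bar>2\<bar> * (bp * (F * r \<kappa> * (2 * K + K) + B' * (\<bar>\<kappa>\<bar> * B))))
       (\<lambda>y. (2 * (uh \<kappa> y * uh \<kappa> y) - 2 * (A s y * (Dq \<kappa> y * (uh \<kappa> y + U 0 y))))
          - (2 * (U 0 y * U 0 y) - 2 * (A s y * (D y * (U 0 y + U 0 y)))))"
      using ev
    proof eventually_elim
      case (elim \<kappa>)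
      hence k: "\<bar>\<kappa>\<bar> < \<rho>" "\<kappa> \<noteq> 0" by auto
      have 1: "dec 1 (\<bar>2\<bar> * (\<bar>\<kappa>\<bar> * B * (2 * K + K))) (\<lambda>y. 2 * ((uh \<kappa> y - U 0 y) * (uh \<kappa> y + U 0 y)))"
        by (rule dec_mono[OF dec_cmult[OF dec_mult[OF du[OF k] su[OF k(1)]]]]) auto
      have 2: "dec 1 (\<bar>2\<bar> * (bp * (F * r \<kappa> * (2 * K + K) + B' * (\<bar>\<kappa>\<bar> * B))))
          (\<lambda>y. 2 * (A s y * (Dq \<kappa> y * (uh \<kappa> y + U 0 y) - D y * (U 0 y + U 0 y))))"
        by (rule dec_mono[OF dec_cmult[OF dec_mult[OF A_dec dDs[OF k]]]]) auto
      have "(\<lambda>y. (2 * (uh \<kappa> y * uh \<kappa> y) - 2 * (A s y * (Dq \<kappa> y * (uh \<kappa> y + U 0 y))))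
          - (2 * (U 0 y * U 0 y) - 2 * (A s y * (D y * (U 0 y + U 0 y))))) =
        (\<lambda>y. 2 * ((uh \<kappa> y - U 0 y) * (uh \<kappa> y + U 0 y)) - 2 * (A s y * (Dq \<kappa> y * (uh \<kappa> y + U 0 y) - D y * (U 0 y + U 0 y))))"
        by (auto simp: algebra_simps)
      with dec_diff[OF 1 2] show ?case using k cDq cuh cU A_cont by (auto intro!: continuous_intros)
    qed
    have "((\<lambda>\<kappa>. \<bar>2\<bar> * (\<bar>\<kappa>\<bar> * B * (2 * K + K)) + \<bar>2\<bar> * (bp * (F * r \<kappa> * (2 * K + K) + B' * (\<bar>\<kappa>\<bar> * B)))) \<longlongrightarrow>
      \<bar>2\<bar> * (\<bar>0\<bar> * B * (2 * K + K)) + \<bar>2\<bar> * (bp * (F * 0 * (2 * K + K) + B' * (\<bar>0\<bar> * B)))) (at 0)" by (intro tendsto_intros r)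
    thus "((\<lambda>\<kappa>. \<bar>2\<bar> * (\<bar>\<kappa>\<bar> * B * (2 * K + K)) + \<bar>2\<bar> * (bp * (F * r \<kappa> * (2 * K + K) + B' * (\<bar>\<kappa>\<bar> * B)))) \<longlongrightarrow> 0) (at 0)" by simp
    have "dec 1 (\<bar>2\<bar> * (K * K)) (\<lambda>y. 2 * (U 0 y * U 0 y))" by (rule dec_mono[OF dec_cmult[OF dec_mult[OF Kd Kd]]]) auto
    moreover have "dec 1 (\<bar>2\<bar> * (bp * (B' * (K + K)))) (\<lambda>y. 2 * (A s y * (D y * (U 0 y + U 0 y))))"
      by (rule dec_mono[OF dec_cmult[OF dec_mult[OF A_dec dec_mult[OF D dec_add[OF Kd Kd]]]]]) auto
    ultimately show "dec 1 (\<bar>2\<bar> * (K * K) + \<bar>2\<bar> * (bp * (B' * (K + K)))) (\<lambda>y. 2 * (U 0 y * U 0 y) - 2 * (A s y * (D y * (U 0 y + U 0 y))))"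
      by (rule dec_diff)
  qed (intro continuous_intros cD cU A_cont)
  define Nt where "Nt = (\<lambda>\<kappa>. LBINT y. uh \<kappa> y * uh \<kappa> y)"
  define nt where "nt = (\<lambda>\<kappa>. LBINT y. (\<kappa> + \<kappa> - 2 * A s y) * (uh \<kappa> y * uh \<kappa> y))"
  have iN: "integrable lborel (\<lambda>y. uh \<kappa> y * uh \<kappa> y)" if "\<bar>\<kappa>\<bar> < \<rho>" for \<kappa>
    using uh[OF that] cuh[OF that] by (intro integrable_dec[OF _ dec_mult]) (auto intro!: continuous_intros)
  have inn: "integrable lborel (\<lambda>y. (\<kappa> + \<kappa> - 2 * A s y) * (uh \<kappa> y * uh \<kappa> y))" if "\<bar>\<kappa>\<bar> < \<rho>" for \<kappa>
    by (rule integrable_dec[OF _ dec_mult[OF pot_diff_dec(1) dec_mult[OF conjunct2[OF uh[OF that]] conjunct2[OF uh[OF that]]]]])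
      (use that \<rho> cuh[OF that] A_cont in \<open>auto intro!: continuous_intros\<close>)
  have dN: "(Nt has_real_derivative (LBINT y. D y * (U 0 y + U 0 y))) (at 0)"
    unfolding has_field_derivative_iff
  proof (rule Lim_transform_eventually[OF J])
    show "\<forall>\<^sub>F \<kappa> in at 0. J \<kappa> = (Nt \<kappa> - Nt 0) / (\<kappa> - 0)"
      using ev
    proof eventually_elim
      case (elim \<kappa>)
      have "Nt \<kappa> - Nt 0 = (LBINT y. uh \<kappa> y * uh \<kappa> y - uh 0 y * uh 0 y)"
        unfolding Nt_def using elim \<rho> by (intro Bochner_Integration.integral_diff[symmetric] iN) auto
      also have "\<dots> = (LBINT y. \<kappa> * (Dq \<kappa> y * (uh \<kappa> y + U 0 y)))"
        unfolding uh_0 using elim step by (intro Bochner_Integration.integral_cong) (auto simp: algebra_simps)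
      also have "\<dots> = \<kappa> * J \<kappa>" by (simp add: J_def)
      finally show ?case using elim by simp
    qed
  qed
  have dn: "(nt has_real_derivative (LBINT y. 2 * (U 0 y * U 0 y) - 2 * (A s y * (D y * (U 0 y + U 0 y))))) (at 0)"
    unfolding has_field_derivative_iff
  proof (rule Lim_transform_eventually[OF H])
    show "\<forall>\<^sub>F \<kappa> in at 0. H \<kappa> = (nt \<kappa> - nt 0) / (\<kappa> - 0)"
      using ev
    proof eventually_elim
      case (elim \<kappa>)
      have "nt \<kappa> - nt 0 = (LBINT y. (\<kappa> + \<kappa> - 2 * A s y) * (uh \<kappa> y * uh \<kappa> y) - (0 + 0 - 2 * A s y) * (uh 0 y * uh 0 y))"
        unfolding nt_def using elim \<rho> by (intro Bochner_Integration.integral_diff[symmetric] inn) auto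
      also have "\<dots> = (LBINT y. \<kappa> * (2 * (uh \<kappa> y * uh \<kappa> y) - 2 * (A s y * (Dq \<kappa> y * (uh \<kappa> y + U 0 y)))))"
        unfolding uh_0 using elim step by (intro Bochner_Integration.integral_cong) (auto simp: algebra_simps)
      also have "\<dots> = \<kappa> * H \<kappa>" by (simp only: H_def Bochner_Integration.integral_mult_right_zero)
      finally show ?case using elim by simp
    qed
  qed
  have N0: "Nt 0 = N 0" by (simp add: Nt_def uh_0 N_def power2_eq_square)
  \<comment> \<open>The square of \<open>t \<kappa>\<close> cancels between numerator and norm, so
    the renormalisation does not change G.\<close>
  have Gq: "nt \<kappa> / Nt \<kappa> = G \<kappa>" if k: "\<bar>\<kappa>\<bar> < \<rho>" for \<kappa>
  proof -
    have t0: "t \<kappa> \<noteq> 0" using uh[OF k] by simp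
    have "nt \<kappa> = (LBINT y. (1 / (t \<kappa> * t \<kappa>)) * (2 * (\<kappa> - A s y) * (U \<kappa> y)\<^sup>2))"
      unfolding nt_def uh_def by (intro Bochner_Integration.integral_cong) (auto simp: field_simps power2_eq_square)
    hence 1: "nt \<kappa> = (1 / (t \<kappa> * t \<kappa>)) * (LBINT y. 2 * (\<kappa> - A s y) * (U \<kappa> y)\<^sup>2)"
      by (simp only: Bochner_Integration.integral_mult_right_zero)
    have "Nt \<kappa> = (LBINT y. (1 / (t \<kappa> * t \<kappa>)) * (U \<kappa> y)\<^sup>2)"
      unfolding Nt_def uh_def by (intro Bochner_Integration.integral_cong) (auto simp: field_simps power2_eq_square)
    hence 2: "Nt \<kappa> = (1 / (t \<kappa> * t \<kappa>)) * N \<kappa>" by (simp only: N_def Bochner_Integration.integral_mult_right_zero)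
    show ?thesis unfolding 1 2 G_def using t0 by simp
  qed
  define I1 where "I1 = (LBINT y. A s y * (U 0 y * D y))"
  define I0 where "I0 = (LBINT y. U 0 y * D y)"
  have i0: "integrable lborel (\<lambda>y. U 0 y * D y)"
    by (rule integrable_dec[OF _ dec_mult[OF Kd D]]) (auto intro!: continuous_intros cU cD)
  have i1: "integrable lborel (\<lambda>y. A s y * (U 0 y * D y))"
    by (rule integrable_dec[OF _ dec_mult[OF A_dec dec_mult[OF Kd D]]]) (auto intro!: continuous_intros cU cD A_cont)
  have iu: "integrable lborel (\<lambda>y. U 0 y * U 0 y)"
    by (rule integrable_dec[OF _ dec_mult[OF Kd Kd]]) (auto intro!: continuous_intros cU)
  have N': "(LBINT y. D y * (U 0 y + U 0 y)) = 2 * I0"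
    unfolding I0_def Bochner_Integration.integral_mult_right_zero[symmetric]
    by (intro Bochner_Integration.integral_cong) (auto simp: algebra_simps)
  have "(LBINT y. 2 * (U 0 y * U 0 y) - 2 * (A s y * (D y * (U 0 y + U 0 y)))) = (LBINT y. 2 * (U 0 y * U 0 y) - 4 * (A s y * (U 0 y * D y)))"
    by (intro Bochner_Integration.integral_cong) (auto simp: algebra_simps)
  also have "\<dots> = 2 * N 0 - 4 * I1"
    using iu i1 unfolding I1_def N_def by (subst Bochner_Integration.integral_diff) (auto simp: power2_eq_square)
  finally have n': "(LBINT y. 2 * (U 0 y * U 0 y) - 2 * (A s y * (D y * (U 0 y + U 0 y)))) = 2 * N 0 - 4 * I1" .
  have Np: "0 < N 0" by (rule N_pos[OF zz])
  have G0: "nt 0 = G 0 * N 0" using Gq[of 0] \<rho> N0 Np by (simp add: field_simps)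
  have "((\<lambda>\<kappa>. nt \<kappa> / Nt \<kappa>) has_real_derivative ((2 * N 0 - 4 * I1) * Nt 0 - nt 0 * (2 * I0)) / (Nt 0 * Nt 0)) (at 0)"
    using DERIV_divide[OF dn dN] N0 Np unfolding n' N' by simp
  hence "((\<lambda>\<kappa>. nt \<kappa> / Nt \<kappa>) has_real_derivative 2 - 4 / N 0 * I1 - 2 * G 0 / N 0 * I0) (at 0)"
    unfolding N0 G0 by (rule back_subst) (use Np in \<open>simp add: field_simps\<close>)
  hence "(G has_real_derivative 2 - 4 / N 0 * I1 - 2 * G 0 / N 0 * I0) (at 0)"
    by (rule has_field_derivative_transform_within_open[where S = "{-\<rho><..<\<rho>}"]) (use \<rho> Gq in auto)
  thus thesis using that sD D unfolding I1_def I0_def by blast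
qed

end

section \<open>Slowly varying fields\<close>

text \<open>The functions g^2 e^{-2 \<delta> t} and g^2 e^{2 \<delta> t} are monotone in opposite
  directions; squaring avoids a case distinction on the sign of g.\<close>

lemma slowly_varying:
  fixes g g' :: "real \<Rightarrow> real"
  assumes d: "\<And>x. (g has_real_derivative g' x) (at x)" and le: "\<And>x. X \<le> x \<Longrightarrow> \<bar>g' x\<bar> \<le> \<delta> * \<bar>g x\<bar>"
    and x: "X \<le> x" "X \<le> z"
  shows "\<bar>g z\<bar> \<le> \<bar>g x\<bar> * exp (\<delta> * \<bar>z - x\<bar>)"
proof -
  have gg: "\<bar>g t * g' t\<bar> \<le> \<delta> * (g t)\<^sup>2" if "X \<le> t" for t
  proof -
    have "\<bar>g t * g' t\<bar> \<le> \<bar>g t\<bar> * (\<delta> * \<bar>g t\<bar>)" unfolding abs_mult using le[OF that] by (intro mult_left_mono) auto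
    also have "\<dots> = \<delta> * (\<bar>g t\<bar> * \<bar>g t\<bar>)" by simp
    finally show ?thesis unfolding abs_mult_self_eq power2_eq_square .
  qed
  have up: "(g t)\<^sup>2 * exp (- 2 * \<delta> * t) \<le> (g r)\<^sup>2 * exp (- 2 * \<delta> * r)" if "X \<le> r" "r \<le> t" for r t
  proof (rule DERIV_nonpos_imp_nonincreasing[OF that(2)])
    fix y assume "r \<le> y" "y \<le> t"
    hence "2 * (g y * g' y) - 2 * \<delta> * (g y)\<^sup>2 \<le> 0" using gg[of y] that by (simp add: abs_le_iff)
    hence "exp (- 2 * \<delta> * y) * (2 * (g y * g' y) - 2 * \<delta> * (g y)\<^sup>2) \<le> 0" by (intro mult_nonneg_nonpos) auto
    moreover have "((\<lambda>t. (g t)\<^sup>2 * exp (- 2 * \<delta> * t)) has_real_derivative exp (- 2 * \<delta> * y) * (2 * (g y * g' y) - 2 * \<delta> * (g y)\<^sup>2)) (at y)"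
      by (auto intro!: derivative_eq_intros d simp: algebra_simps)
    ultimately show "\<exists>d. ((\<lambda>t. (g t)\<^sup>2 * exp (- 2 * \<delta> * t)) has_real_derivative d) (at y) \<and> d \<le> 0" by blast
  qed
  have down: "(g r)\<^sup>2 * exp (2 * \<delta> * r) \<le> (g t)\<^sup>2 * exp (2 * \<delta> * t)" if "X \<le> r" "r \<le> t" for r t
  proof (rule DERIV_nonneg_imp_nondecreasing[OF that(2)])
    fix y assume "r \<le> y" "y \<le> t"
    hence "0 \<le> 2 * (g y * g' y) + 2 * \<delta> * (g y)\<^sup>2" using gg[of y] that by (simp add: abs_le_iff)
    hence "0 \<le> exp (2 * \<delta> * y) * (2 * (g y * g' y) + 2 * \<delta> * (g y)\<^sup>2)" by (intro mult_nonneg_nonneg) auto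
    moreover have "((\<lambda>t. (g t)\<^sup>2 * exp (2 * \<delta> * t)) has_real_derivative exp (2 * \<delta> * y) * (2 * (g y * g' y) + 2 * \<delta> * (g y)\<^sup>2)) (at y)"
      by (auto intro!: derivative_eq_intros d simp: algebra_simps)
    ultimately show "\<exists>d. ((\<lambda>t. (g t)\<^sup>2 * exp (2 * \<delta> * t)) has_real_derivative d) (at y) \<and> 0 \<le> d" by blast
  qed
  have "(g z)\<^sup>2 \<le> (g x)\<^sup>2 * exp (2 * (\<delta> * \<bar>z - x\<bar>))"
  proof (cases "x \<le> z")
    case True
    have "(g z)\<^sup>2 * exp (- 2 * \<delta> * z) * exp (2 * \<delta> * z) \<le> (g x)\<^sup>2 * exp (- 2 * \<delta> * x) * exp (2 * \<delta> * z)"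
      by (rule mult_right_mono[OF up[OF x(1) True]]) simp
    thus ?thesis using True by (simp add: mult.assoc exp_add[symmetric] algebra_simps)
  next
    case False
    hence "z \<le> x" by simp
    have "(g z)\<^sup>2 * exp (2 * \<delta> * z) * exp (- 2 * \<delta> * z) \<le> (g x)\<^sup>2 * exp (2 * \<delta> * x) * exp (- 2 * \<delta> * z)"
      by (rule mult_right_mono[OF down[OF x(2) \<open>z \<le> x\<close>]]) simp
    thus ?thesis using False by (simp add: mult.assoc exp_add[symmetric] algebra_simps)
  qed
  also have "\<dots> = (\<bar>g x\<bar> * exp (\<delta> * \<bar>z - x\<bar>))\<^sup>2" by (simp add: power_mult_distrib exp_double[symmetric])
  finally have "\<bar>g z\<bar>\<^sup>2 \<le> (\<bar>g x\<bar> * exp (\<delta> * \<bar>z - x\<bar>))\<^sup>2" by simp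
  thus ?thesis by (rule power2_le_imp_le) simp
qed

text \<open>A localised form of \<open>deriv_bound_exp\<close>: the bound is required only on the
  segment between 0 and y, encoded by \<open>0 \<le> z * y\<close>, because the derivatives are
  controlled on one side of a threshold only.\<close>

lemma taylor_step:
  fixes G g :: "real \<Rightarrow> real"
  assumes d: "\<And>z. (G has_real_derivative g z) (at z)"
    and g: "\<And>z. \<bar>z\<bar> \<le> \<bar>y\<bar> \<Longrightarrow> 0 \<le> z * y \<Longrightarrow> \<bar>g z\<bar> \<le> B * exp (K * \<bar>z\<bar>)" and "G 0 = 0" "0 < K"
  shows "\<bar>G y\<bar> \<le> B / K * exp (K * \<bar>y\<bar>)"
proof (cases "0 \<le> y")
  case True
  have "\<bar>G y\<bar> \<le> B / K * exp (K * y)"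
  proof (rule deriv_bound_exp[of y G g B K y])
    show "\<bar>g z\<bar> \<le> B * exp (K * z)" if "0 \<le> z" "z \<le> y" for z
      using g[of z] that True by simp
  qed (use assms True in auto)
  thus ?thesis using True by simp
next
  case False
  have "\<bar>G (- (- y))\<bar> \<le> B / K * exp (K * (- y))"
  proof (rule deriv_bound_exp[of "-y" "\<lambda>y. G (- y)" "\<lambda>y. - g (- y)" B K "-y"])
    show "((\<lambda>y. G (- y)) has_real_derivative - g (- z)) (at z)" for z
      using d[of "-z"] by (simp add: DERIV_mirror)
    show "\<bar>- g (- z)\<bar> \<le> B * exp (K * z)" if "0 \<le> z" "z \<le> - y" for z
      using g[of "-z"] that False by (simp add: mult_nonneg_nonpos)
  qed (use assms False in auto)
  thus ?thesis using False by simp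
qed

locale smooth_profile = field_limit +
  assumes smooth: "\<And>p x. ((deriv ^^ p) b) differentiable (at x)"
    and nonzero: "\<exists>x0. \<forall>p. \<forall>x\<ge>x0. (deriv ^^ p) b x \<noteq> 0"
    and flat1: "deriv b \<in> o[at_top](\<lambda>x. bp - b x)"
    and flat2: "\<And>p. 1 \<le> p \<Longrightarrow> (deriv ^^ (Suc p)) b \<in> o[at_top]((deriv ^^ p) b)"
begin

definition bd :: "nat \<Rightarrow> real \<Rightarrow> real" where "bd p = (deriv ^^ p) b"

lemma bd_0 [simp]: "bd 0 = b" and bd_1: "bd 1 = deriv b"
  by (simp_all add: bd_def)

lemma bd_deriv: "(bd p has_real_derivative bd (Suc p) x) (at x)"
  using smooth[of p x] by (simp add: bd_def DERIV_deriv_iff_real_differentiable)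

lemma bd_shift_deriv: "((\<lambda>y. bd p (s + y)) has_real_derivative bd (Suc p) (s + y)) (at y)"
  using DERIV_shift[of "bd p" "bd (Suc p) (s + y)" y s] bd_deriv[of p "s + y"] by (simp add: add.commute)

lemma bd1_tendsto: "(bd 1 \<longlongrightarrow> 0) at_top"
proof -
  have "((\<lambda>x. bp - b x) \<longlongrightarrow> bp - bp) at_top" by (intro tendsto_intros b_lim)
  hence "((\<lambda>x. bp - b x) \<longlongrightarrow> 0) at_top" by simp
  moreover have "eventually (\<lambda>x. norm (bd 1 x) \<le> 1 * norm (bp - b x)) at_top"
    using landau_o.smallD[OF flat1, of 1] by (simp add: bd_def)
  ultimately show ?thesis
    by (intro Lim_null_comparison[where f = "bd 1" and g = "\<lambda>x. \<bar>bp - b x\<bar>"]) (auto intro: tendsto_rabs_zero)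
qed

text \<open>Through \<open>slowly_varying\<close> the ratio 1/4 becomes the growth rate of the
  Taylor errors; it is small enough that such an error times a linear factor still fits into the
  weight of rate -1.\<close>

lemma eventually_flat:
  obtains X where "\<And>x. X \<le> x \<Longrightarrow> \<bar>bd 1 x\<bar> \<le> 1" "\<And>x. X \<le> x \<Longrightarrow> bd 1 x \<noteq> 0" "\<And>x. X \<le> x \<Longrightarrow> bd 3 x \<noteq> 0"
    "\<And>p x. p \<in> {1, 2, 3} \<Longrightarrow> X \<le> x \<Longrightarrow> \<bar>bd (Suc p) x\<bar> \<le> 1/4 * \<bar>bd p x\<bar>"
proof -
  have *: "eventually (\<lambda>x. \<bar>bd (Suc p) x\<bar> \<le> 1/4 * \<bar>bd p x\<bar>) at_top" if "1 \<le> p" for p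
    using landau_o.smallD[OF flat2[OF that], of "1/4"] by (simp add: bd_def)
  have "eventually (\<lambda>x. dist (bd 1 x) 0 < 1) at_top" using bd1_tendsto by (simp add: tendsto_iff)
  hence 1: "eventually (\<lambda>x. \<bar>bd 1 x\<bar> \<le> 1) at_top" by eventually_elim simp
  have 2: "eventually (\<lambda>x. \<forall>p. bd p x \<noteq> 0) at_top"
    using nonzero by (auto simp: eventually_at_top_linorder bd_def)
  have s: "eventually (\<lambda>x. \<bar>bd (Suc 1) x\<bar> \<le> 1/4 * \<bar>bd 1 x\<bar>) at_top"
    "eventually (\<lambda>x. \<bar>bd (Suc 2) x\<bar> \<le> 1/4 * \<bar>bd 2 x\<bar>) at_top" "eventually (\<lambda>x. \<bar>bd (Suc 3) x\<bar> \<le> 1/4 * \<bar>bd 3 x\<bar>) at_top"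
    by (rule *, simp)+
  have "eventually (\<lambda>x. \<bar>bd 1 x\<bar> \<le> 1 \<and> (\<forall>p. bd p x \<noteq> 0) \<and> (\<forall>p\<in>{1,2,3}. \<bar>bd (Suc p) x\<bar> \<le> 1/4 * \<bar>bd p x\<bar>)) at_top"
    using 1 2 s by eventually_elim auto
  then obtain X where "\<And>x. X \<le> x \<Longrightarrow> \<bar>bd 1 x\<bar> \<le> 1 \<and> (\<forall>p. bd p x \<noteq> 0) \<and> (\<forall>p\<in>{1,2,3}. \<bar>bd (Suc p) x\<bar> \<le> 1/4 * \<bar>bd p x\<bar>)"
    by (auto simp: eventually_at_top_linorder)
  thus thesis using that by blast
qed

text \<open>To the right of X repeated integration of slowly varying derivatives gives the error. To
  the left of X only crude bounds are available, but slow variation between X and s shows that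
  |b'(s)| and |b'''(s)| cannot be smaller than a multiple of e^{-|y|/4}, so these bounds are also
  proportional to them in the weighted sense.\<close>

lemma taylor_bounds:
  obtains X C where "0 \<le> C" "\<And>s. X \<le> s \<Longrightarrow> \<bar>bd 1 s\<bar> \<le> 1" "\<And>s. X \<le> s \<Longrightarrow> \<bar>bd 2 s\<bar> \<le> \<bar>bd 1 s\<bar>"
    "\<And>s. X \<le> s \<Longrightarrow> \<bar>bd 3 s\<bar> \<le> \<bar>bd 1 s\<bar>"
    "\<And>s. X \<le> s \<Longrightarrow> dec (-1/4) (C * \<bar>bd 1 s\<bar>) (\<lambda>y. b (s + y) - b s)"
    "\<And>s. X \<le> s \<Longrightarrow> dec (-2) (C * \<bar>bd 3 s\<bar>) (\<lambda>y. b (s + y) - b s - bd 1 s * y - bd 2 s / 2 * y\<^sup>2)"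
proof -
  obtain X where X: "\<And>x. X \<le> x \<Longrightarrow> \<bar>bd 1 x\<bar> \<le> 1" "bd 1 X \<noteq> 0" "bd 3 X \<noteq> 0"
    "\<And>p x. p \<in> {1, 2, 3} \<Longrightarrow> X \<le> x \<Longrightarrow> \<bar>bd (Suc p) x\<bar> \<le> 1/4 * \<bar>bd p x\<bar>"
    using eventually_flat by (metis order_refl)
  have b2: "\<bar>bd 2 x\<bar> \<le> \<bar>bd 1 x\<bar>" "\<bar>bd 3 x\<bar> \<le> \<bar>bd 1 x\<bar>" if "X \<le> x" for x
    using X(4)[of 1 x] X(4)[of 2 x] that by (simp_all add: eval_nat_numeral)
  have sv: "\<bar>bd p z\<bar> \<le> \<bar>bd p x\<bar> * exp (1/4 * \<bar>z - x\<bar>)" if "p \<in> {1, 3}" "X \<le> x" "X \<le> z" for p x z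
    by (rule slowly_varying[OF bd_deriv _ that(2,3)]) (use X(4)[of p] that(1) in auto)
  \<comment> \<open>4^3 comes from up to three integrations at rate 1/4; the other two summands pay
    for the region to the left of X.\<close>
  define C where "C = 4 * 4 * 4 + (bp + 2) * 4 / \<bar>bd 3 X\<bar> + bp / \<bar>bd 1 X\<bar>"
  have C: "4 \<le> C" "64 \<le> C" "bp / \<bar>bd 1 X\<bar> \<le> C" "(bp + 2) * 4 / \<bar>bd 3 X\<bar> \<le> C"
    using bp_pos by (auto simp: C_def)
  \<comment> \<open>Slow variation read backwards: when s + y lies left of X, the distance from s to
    X is below |y|, so |y| controls how small the derivative at s can be.\<close>
  have low: "1 \<le> \<bar>bd p s\<bar> / \<bar>bd p X\<bar> * exp (1/4 * \<bar>y\<bar>)" if p: "p \<in> {1, 3}" and s: "X \<le> s" "s + y < X" for p s y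
  proof -
    have "\<bar>bd p X\<bar> \<le> \<bar>bd p s\<bar> * exp (1/4 * \<bar>X - s\<bar>)" by (rule sv[OF p s(1)]) simp
    also have "\<dots> \<le> \<bar>bd p s\<bar> * exp (1/4 * \<bar>y\<bar>)" using s by (intro mult_left_mono) auto
    finally show ?thesis using p X by (auto simp: field_simps)
  qed
  have ge: "X \<le> s + z" if "X \<le> s" "X \<le> s + y" "\<bar>z\<bar> \<le> \<bar>y\<bar>" "0 \<le> z * y" for s y z
    using that by (cases "0 \<le> y"; cases "0 \<le> z") (auto simp: zero_le_mult_iff)
  have T1: "dec (-1/4) (C * \<bar>bd 1 s\<bar>) (\<lambda>y. b (s + y) - b s)" if s: "X \<le> s" for s
    unfolding dec_def
  proof
    fix y
    have w: "wt (-1/4) y = exp (1/4 * \<bar>y\<bar>)" by (simp add: wt_def)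
    show "\<bar>b (s + y) - b s\<bar> \<le> C * \<bar>bd 1 s\<bar> * wt (-1/4) y"
    proof (cases "X \<le> s + y")
      case True
      have "\<bar>b (s + y) - b s\<bar> \<le> \<bar>bd 1 s\<bar> / (1/4) * exp (1/4 * \<bar>y\<bar>)"
      proof (rule taylor_step[where G = "\<lambda>y. b (s + y) - b s"])
        show "((\<lambda>y. b (s + y) - b s) has_real_derivative bd 1 (s + z)) (at z)" for z
          using bd_shift_deriv[of 0 s z] by (auto intro!: derivative_eq_intros)
        show "\<bar>bd 1 (s + z)\<bar> \<le> \<bar>bd 1 s\<bar> * exp (1 / 4 * \<bar>z\<bar>)" if "\<bar>z\<bar> \<le> \<bar>y\<bar>" "0 \<le> z * y" for z
          using sv[of 1 s "s + z"] s ge[OF s True that] by simp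
      qed auto
      also have "\<dots> = 4 * \<bar>bd 1 s\<bar> * exp (1/4 * \<bar>y\<bar>)" by simp
      also have "\<dots> \<le> C * \<bar>bd 1 s\<bar> * exp (1/4 * \<bar>y\<bar>)" using C by (intro mult_right_mono) auto
      finally show ?thesis unfolding w .
    next
      case False
      have "\<bar>b (s + y) - b s\<bar> \<le> bp * 1" using b_lower[of s] b_upper[of s] b_lower[of "s + y"] b_upper[of "s + y"] bm_pos by (simp add: abs_le_iff)
      also have "\<dots> \<le> bp * (\<bar>bd 1 s\<bar> / \<bar>bd 1 X\<bar> * exp (1/4 * \<bar>y\<bar>))"
        using low[of 1 s y] s False bp_pos by (intro mult_left_mono) auto
      also have "\<dots> = bp / \<bar>bd 1 X\<bar> * (\<bar>bd 1 s\<bar> * exp (1/4 * \<bar>y\<bar>))" by simp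
      also have "\<dots> \<le> C * (\<bar>bd 1 s\<bar> * exp (1/4 * \<bar>y\<bar>))" using C by (intro mult_right_mono) auto
      finally show ?thesis unfolding w mult.assoc .
    qed
  qed
  have T2: "dec (-2) (C * \<bar>bd 3 s\<bar>) (\<lambda>y. b (s + y) - b s - bd 1 s * y - bd 2 s / 2 * y\<^sup>2)" if s: "X \<le> s" for s
    unfolding dec_def
  proof
    fix y
    have w: "exp (1/4 * \<bar>y\<bar>) \<le> wt (-2) y" "wt (-2) y = exp \<bar>y\<bar> * exp \<bar>y\<bar>"
      by (auto simp: wt_def exp_add[symmetric])
    show "\<bar>b (s + y) - b s - bd 1 s * y - bd 2 s / 2 * y\<^sup>2\<bar> \<le> C * \<bar>bd 3 s\<bar> * wt (-2) y"
    proof (cases "X \<le> s + y")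
      case True
      have h2: "\<bar>bd 2 (s + z) - bd 2 s\<bar> \<le> \<bar>bd 3 s\<bar> / (1/4) * exp (1/4 * \<bar>z\<bar>)" if z: "\<bar>z\<bar> \<le> \<bar>y\<bar>" "0 \<le> z * y" for z
      proof (rule taylor_step[where G = "\<lambda>y. bd 2 (s + y) - bd 2 s"])
        show "((\<lambda>y. bd 2 (s + y) - bd 2 s) has_real_derivative bd 3 (s + x)) (at x)" for x
          using bd_shift_deriv[of 2 s x] by (auto intro!: derivative_eq_intros simp: eval_nat_numeral)
        show "\<bar>bd 3 (s + x)\<bar> \<le> \<bar>bd 3 s\<bar> * exp (1 / 4 * \<bar>x\<bar>)" if "\<bar>x\<bar> \<le> \<bar>z\<bar>" "0 \<le> x * z" for x
          using sv[of 3 s "s + x"] s ge[OF s ge[OF s True z] that] by simp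
      qed auto
      have h1: "\<bar>bd 1 (s + z) - bd 1 s - bd 2 s * z\<bar> \<le> \<bar>bd 3 s\<bar> / (1/4) / (1/4) * exp (1/4 * \<bar>z\<bar>)"
        if z: "\<bar>z\<bar> \<le> \<bar>y\<bar>" "0 \<le> z * y" for z
      proof (rule taylor_step[where G = "\<lambda>y. bd 1 (s + y) - bd 1 s - bd 2 s * y"])
        show "((\<lambda>y. bd 1 (s + y) - bd 1 s - bd 2 s * y) has_real_derivative bd 2 (s + x) - bd 2 s) (at x)" for x
          using bd_shift_deriv[of 1 s x] by (auto intro!: derivative_eq_intros simp: eval_nat_numeral)
        show "\<bar>bd 2 (s + x) - bd 2 s\<bar> \<le> \<bar>bd 3 s\<bar> / (1 / 4) * exp (1 / 4 * \<bar>x\<bar>)" if "\<bar>x\<bar> \<le> \<bar>z\<bar>" "0 \<le> x * z" for x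
        proof (rule h2)
          show "\<bar>x\<bar> \<le> \<bar>y\<bar>" using that z by simp
          show "0 \<le> x * y" using that z by (cases "z = 0"; auto simp: zero_le_mult_iff; linarith?)
        qed
      qed auto
      have "\<bar>b (s + y) - b s - bd 1 s * y - bd 2 s / 2 * y\<^sup>2\<bar> \<le> \<bar>bd 3 s\<bar> / (1/4) / (1/4) / (1/4) * exp (1/4 * \<bar>y\<bar>)"
      proof (rule taylor_step[where G = "\<lambda>y. b (s + y) - b s - bd 1 s * y - bd 2 s / 2 * y\<^sup>2"])
        show "((\<lambda>y. b (s + y) - b s - bd 1 s * y - bd 2 s / 2 * y\<^sup>2) has_real_derivative bd 1 (s + x) - bd 1 s - bd 2 s * x) (at x)" for x
          using bd_shift_deriv[of 0 s x] by (auto intro!: derivative_eq_intros simp: eval_nat_numeral)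
      qed (use h1 in auto)
      also have "\<dots> = 64 * (\<bar>bd 3 s\<bar> * exp (1/4 * \<bar>y\<bar>))" by simp
      also have "\<dots> \<le> C * (\<bar>bd 3 s\<bar> * wt (-2) y)"
        using C w(1) by (intro mult_mono mult_left_mono) auto
      finally show ?thesis by (simp add: mult.assoc)
    next
      case False
      have y2: "1 + y\<^sup>2 \<le> 2 * exp \<bar>y\<bar>" using exp_abs_ge[of y] by (simp add: wt_def)
      have y1: "\<bar>y\<bar> \<le> 1 + y\<^sup>2" using sum_squares_bound[of 1 "\<bar>y\<bar>"] by (simp add: power2_eq_square)
      have 0: "\<bar>b (s + y) - b s\<bar> \<le> bp" using b_lower[of s] b_upper[of s] b_lower[of "s + y"] b_upper[of "s + y"] bm_pos by (simp add: abs_le_iff)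
      have 1: "\<bar>bd 1 s * y\<bar> \<le> 1 * (1 + y\<^sup>2)" unfolding abs_mult using X(1)[OF s] y1 by (intro mult_mono) auto
      have 2: "\<bar>bd 2 s / 2 * y\<^sup>2\<bar> \<le> 1 * (1 + y\<^sup>2)" unfolding abs_mult using X(1)[OF s] b2[OF s] by (intro mult_mono) auto
      have "bp * 1 \<le> bp * (1 + y\<^sup>2)" using bp_pos by (intro mult_left_mono) auto
      hence "\<bar>b (s + y) - b s\<bar> \<le> bp * (1 + y\<^sup>2)" using 0 by (simp only: mult_1_right)
      from add_mono[OF add_mono[OF this 1] 2]
      have "\<bar>b (s + y) - b s\<bar> + \<bar>bd 1 s * y\<bar> + \<bar>bd 2 s / 2 * y\<^sup>2\<bar> \<le> (bp + 2) * (1 + y\<^sup>2)"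
        by (simp add: algebra_simps)
      hence "\<bar>b (s + y) - b s - bd 1 s * y - bd 2 s / 2 * y\<^sup>2\<bar> \<le> (bp + 2) * (1 + y\<^sup>2)"
        by linarith
      also have "\<dots> \<le> (bp + 2) * (2 * exp \<bar>y\<bar>)" using y2 bp_pos by (intro mult_left_mono) auto
      also have "\<dots> * 1 \<le> (bp + 2) * (2 * exp \<bar>y\<bar>) * (\<bar>bd 3 s\<bar> / \<bar>bd 3 X\<bar> * exp (1/4 * \<bar>y\<bar>))"
        using low[of 3 s y] s False bp_pos by (intro mult_left_mono) auto
      also have "\<dots> = ((bp + 2) * 2 / \<bar>bd 3 X\<bar>) * \<bar>bd 3 s\<bar> * (exp \<bar>y\<bar> * exp (1/4 * \<bar>y\<bar>))" by simp
      also have "\<dots> \<le> C * \<bar>bd 3 s\<bar> * (exp \<bar>y\<bar> * exp \<bar>y\<bar>)"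
      proof (intro mult_mono mult_right_mono)
        have "(bp + 2) * 2 / \<bar>bd 3 X\<bar> \<le> (bp + 2) * 4 / \<bar>bd 3 X\<bar>" using bp_pos by (intro divide_right_mono) auto
        thus "(bp + 2) * 2 / \<bar>bd 3 X\<bar> \<le> C" using C(4) by linarith
      qed (use C in auto)
      finally show ?thesis by (simp add: w(2))
    qed
  qed
  show thesis
    by (rule that[of C X]) (use C X(1) b2 T1 T2 in auto)
qed

end

text \<open>A Landau symbol with values in a weighted space: the constant is uniform in y and the
  bound holds for large s. Rates and gauges can thus be tracked separately through products and
  integrals.\<close>

definition decO :: "real \<Rightarrow> (real \<Rightarrow> real) \<Rightarrow> (real \<Rightarrow> real \<Rightarrow> real) \<Rightarrow> bool" where
  "decO l g F \<longleftrightarrow> (\<exists>C\<ge>0. \<forall>\<^sub>F s in at_top. dec l (C * g s) (F s))"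

lemma decOI: "0 \<le> C \<Longrightarrow> (\<And>s. X \<le> s \<Longrightarrow> dec l (C * g s) (F s)) \<Longrightarrow> decO l g F"
  unfolding decO_def by (auto simp: eventually_at_top_linorder)

lemma decO_add:
  assumes "decO l g F" "decO l g F'"
  shows "decO l g (\<lambda>s y. F s y + F' s y)"
proof -
  obtain C C' where "0 \<le> C" "0 \<le> C'" and ev: "\<forall>\<^sub>F s in at_top. dec l (C * g s) (F s)" "\<forall>\<^sub>F s in at_top. dec l (C' * g s) (F' s)"
    using assms unfolding decO_def by blast
  moreover have "\<forall>\<^sub>F s in at_top. dec l ((C + C') * g s) (\<lambda>y. F s y + F' s y)"
    using ev by eventually_elim (simp add: distrib_right dec_add)
  ultimately show ?thesis unfolding decO_def by (intro exI[of _ "C + C'"]) auto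
qed

lemma decO_uminus: "decO l g F \<Longrightarrow> decO l g (\<lambda>s y. - F s y)"
  unfolding decO_def by (simp add: dec_def)

lemma decO_diff: "decO l g F \<Longrightarrow> decO l g F' \<Longrightarrow> decO l g (\<lambda>s y. F s y - F' s y)"
  using decO_add[of l g F "\<lambda>s y. - F' s y"] decO_uminus[of l g F'] by simp

lemma decO_mult:
  assumes "decO l g F" "decO l' g' F'"
  shows "decO (l + l') (\<lambda>s. g s * g' s) (\<lambda>s y. F s y * F' s y)"
proof -
  obtain C C' where C: "0 \<le> C" "0 \<le> C'" and ev: "\<forall>\<^sub>F s in at_top. dec l (C * g s) (F s)" "\<forall>\<^sub>F s in at_top. dec l' (C' * g' s) (F' s)"
    using assms unfolding decO_def by blast
  have "\<forall>\<^sub>F s in at_top. dec (l + l') (C * C' * (g s * g' s)) (\<lambda>y. F s y * F' s y)"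
    using ev
  proof eventually_elim
    case (elim s)
    from dec_mult[OF elim] show ?case by (simp add: mult_ac)
  qed
  thus ?thesis unfolding decO_def using C by (intro exI[of _ "C * C'"]) auto
qed

lemma decO_mono:
  assumes F: "decO l g F" and "l' \<le> l" and g: "g \<in> O[at_top](g')" "\<forall>\<^sub>F s in at_top. 0 \<le> g' s"
  shows "decO l' g' F"
proof -
  obtain C where C: "0 \<le> C" "\<forall>\<^sub>F s in at_top. dec l (C * g s) (F s)" using F unfolding decO_def by blast
  obtain c where c: "0 < c" "\<forall>\<^sub>F s in at_top. norm (g s) \<le> c * norm (g' s)" using g(1) by (rule landau_o.bigE)
  have "\<forall>\<^sub>F s in at_top. dec l' (C * c * g' s) (F s)"
    using C(2) c(2) g(2)
  proof eventually_elim
    case (elim s)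
    have "g s \<le> c * g' s" using elim(2,3) by simp
    hence "C * g s \<le> C * c * g' s" using C(1) by (simp add: mult.assoc mult_left_mono)
    thus ?case using dec_mono[OF elim(1) assms(2)] by simp
  qed
  thus ?thesis unfolding decO_def using C c by (intro exI[of _ "C * c"]) auto
qed

lemma decO_scalar:
  assumes "a \<in> O[at_top](g)" "\<forall>\<^sub>F s in at_top. 0 \<le> g s"
  shows "decO 0 g (\<lambda>s y. a s)"
proof -
  obtain c where c: "0 < c" "\<forall>\<^sub>F s in at_top. norm (a s) \<le> c * norm (g s)" using assms(1) by (rule landau_o.bigE)
  have "\<forall>\<^sub>F s in at_top. dec 0 (c * g s) (\<lambda>y. a s)"
    using c(2) assms(2) by eventually_elim (simp add: dec_def)
  thus ?thesis unfolding decO_def using c by (intro exI[of _ c]) auto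
qed

lemma decO_const: "decO 0 (\<lambda>_. 1) (\<lambda>s y. c)"
  by (rule decO_scalar) auto

lemma decO_power: "decO (- real k) (\<lambda>_. 1) (\<lambda>s y. y ^ k)"
proof (rule decOI[of 1])
  fix s :: real
  have "dec (0 - real k) 1 (\<lambda>y. y ^ k * 1)" by (rule dec_poly) (auto simp: dec_def)
  thus "dec (- real k) (1 * 1) (\<lambda>y. y ^ k)" by simp
qed simp

lemma decO_integral:
  assumes F: "decO l g F" and l: "1 \<le> l" and c: "\<forall>\<^sub>F s in at_top. continuous_on UNIV (F s)"
  shows "(\<lambda>s. LBINT y. F s y) \<in> O[at_top](g)" "\<forall>\<^sub>F s in at_top. integrable lborel (F s)"
proof -
  obtain C where C: "0 \<le> C" and ev: "\<forall>\<^sub>F s in at_top. dec l (C * g s) (F s)" using F unfolding decO_def by blast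
  have "\<forall>\<^sub>F s in at_top. norm (LBINT y. F s y) \<le> 7 * C * norm (g s)"
    using ev c
  proof eventually_elim
    case (elim s)
    have "\<bar>LBINT y. F s y\<bar> \<le> 7 * (C * g s)" by (rule integral_dec_le[OF elim(2,1) l])
    also have "\<dots> \<le> 7 * C * \<bar>g s\<bar>" using C by (simp add: mult_left_mono)
    finally show ?case by simp
  qed
  thus "(\<lambda>s. LBINT y. F s y) \<in> O[at_top](g)" by (rule bigoI)
  show "\<forall>\<^sub>F s in at_top. integrable lborel (F s)"
    using ev c by eventually_elim (rule integrable_dec[OF _ _ l])
qed

context field_profile
begin

text \<open>A linear function also fits into half a unit of rate, at the price of a factor 2; this
  leaves room for a Taylor error of rate -1/4 in the same product.\<close>

lemma A_dec_half: "dec (-1/2) (2 * bp) (A s)" "dec (-1/2) 2 (\<lambda>y. y)"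
proof -
  have y: "\<bar>y\<bar> \<le> 2 * wt (-1/2) y" for y :: real
  proof -
    have "\<bar>y\<bar> \<le> 2 * exp (\<bar>y\<bar> / 2)" using exp_ge_add_one_self[of "\<bar>y\<bar> / 2"] by linarith
    thus ?thesis by (simp add: wt_def)
  qed
  thus "dec (-1/2) 2 (\<lambda>y. y)" by (simp add: dec_def)
  show "dec (-1/2) (2 * bp) (A s)"
    unfolding dec_def
  proof
    fix z
    have "bp * \<bar>z\<bar> \<le> bp * (2 * wt (-1/2) z)" using y bp_pos by (intro mult_left_mono) auto
    thus "\<bar>A s z\<bar> \<le> 2 * bp * wt (-1/2) z" using A_upper[of s z] by simp
  qed
qed

end

context smooth_profile
begin

definition g1 :: "real \<Rightarrow> real" where "g1 s = \<bar>bd 1 s\<bar>"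
text \<open>The gauge of all final errors: it bounds products of two quantities of size b' as well
  as third-order Taylor remainders.\<close>

definition ge :: "real \<Rightarrow> real" where "ge s = (bd 1 s)\<^sup>2 + \<bar>bd 3 s\<bar>"

lemma g_nonneg: "\<forall>\<^sub>F s in at_top. 0 \<le> g1 s" "\<forall>\<^sub>F s in at_top. 0 \<le> ge s"
  by (auto simp: g1_def ge_def)

lemma g1_tendsto: "(g1 \<longlongrightarrow> 0) at_top"
  using tendsto_rabs_zero[OF bd1_tendsto] by (simp add: g1_def[abs_def])

lemma g_bigo: "g1 \<in> O[at_top](\<lambda>_. 1)" "(\<lambda>s. g1 s * g1 s) \<in> O[at_top](ge)" "ge \<in> O[at_top](g1)"
    "bd 1 \<in> O[at_top](g1)" "bd 2 \<in> O[at_top](g1)" "(\<lambda>s. \<bar>bd 3 s\<bar>) \<in> O[at_top](ge)"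
    "b \<in> O[at_top](\<lambda>_. 1)" "(\<lambda>s. 1 / b s) \<in> O[at_top](\<lambda>_. 1)"
proof -
  obtain X C where X: "\<And>s. X \<le> s \<Longrightarrow> \<bar>bd 1 s\<bar> \<le> 1" "\<And>s. X \<le> s \<Longrightarrow> \<bar>bd 2 s\<bar> \<le> \<bar>bd 1 s\<bar>"
    "\<And>s. X \<le> s \<Longrightarrow> \<bar>bd 3 s\<bar> \<le> \<bar>bd 1 s\<bar>" by (rule taylor_bounds, erule that, assumption+)
  have ev: "\<forall>\<^sub>F s in at_top. X \<le> s" by (rule eventually_ge_at_top)
  show "g1 \<in> O[at_top](\<lambda>_. 1)" by (rule bigoI[of _ 1], rule eventually_mono[OF ev]) (use X in \<open>auto simp: g1_def\<close>)
  show "(\<lambda>s. g1 s * g1 s) \<in> O[at_top](ge)" by (rule bigoI[of _ 1]) (auto simp: g1_def ge_def power2_eq_square)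
  show "ge \<in> O[at_top](g1)"
  proof (rule bigoI[of _ 2], rule eventually_mono[OF ev])
    fix s assume s: "X \<le> s"
    have "(bd 1 s)\<^sup>2 = \<bar>bd 1 s\<bar> * \<bar>bd 1 s\<bar>" by (simp add: power2_eq_square)
    also have "\<dots> \<le> 1 * \<bar>bd 1 s\<bar>" using X(1)[OF s] by (intro mult_right_mono) auto
    finally show "norm (ge s) \<le> 2 * norm (g1 s)" using X(3)[OF s] by (simp add: ge_def g1_def)
  qed
  show "bd 1 \<in> O[at_top](g1)" by (rule bigoI[of _ 1]) (auto simp: g1_def)
  show "bd 2 \<in> O[at_top](g1)" by (rule bigoI[of _ 1], rule eventually_mono[OF ev]) (use X in \<open>auto simp: g1_def\<close>)
  show "(\<lambda>s. \<bar>bd 3 s\<bar>) \<in> O[at_top](ge)" by (rule bigoI[of _ 1]) (auto simp: ge_def)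
  have b: "\<bar>b s\<bar> \<le> bp" "\<bar>1 / b s\<bar> \<le> 1 / bm" for s
    using b_lower[of s] b_upper[of s] bm_pos by (auto simp: frac_le)
  show "b \<in> O[at_top](\<lambda>_. 1)" by (rule bigoI[of _ bp]) (use b in auto)
  show "(\<lambda>s. 1 / b s) \<in> O[at_top](\<lambda>_. 1)" by (rule bigoI[of _ "1 / bm"]) (use b in auto)
qed

lemma decO_b: "decO (-1/4) g1 (\<lambda>s y. b (s + y) - b s)"
    "decO (-2) ge (\<lambda>s y. b (s + y) - b s - bd 1 s * y - bd 2 s / 2 * y\<^sup>2)"
  and decO_A: "decO (-1/4) g1 (\<lambda>s y. A s y - b s * y)"
    "decO (-2) ge (\<lambda>s y. A s y - b s * y - bd 1 s / 2 * y\<^sup>2 - bd 2 s / 6 * y ^ 3)"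
    "decO (-1) (\<lambda>_. 1) A" "decO (-1/2) (\<lambda>_. 1) A" "decO (-1/2) (\<lambda>_. 1) (\<lambda>s y. b s * y)" "decO (-1) (\<lambda>_. 1) (\<lambda>s y. b s * y)"
    "decO 0 (\<lambda>_. 1) (\<lambda>s y. b (s + y))"
proof -
  obtain X C where C: "0 \<le> C"
    and T: "\<And>s. X \<le> s \<Longrightarrow> dec (-1/4) (C * \<bar>bd 1 s\<bar>) (\<lambda>y. b (s + y) - b s)"
    "\<And>s. X \<le> s \<Longrightarrow> dec (-2) (C * \<bar>bd 3 s\<bar>) (\<lambda>y. b (s + y) - b s - bd 1 s * y - bd 2 s / 2 * y\<^sup>2)"
    by (rule taylor_bounds, erule that, assumption+)
  show "decO (-1/4) g1 (\<lambda>s y. b (s + y) - b s)" by (rule decOI[OF C, of X]) (use T in \<open>simp add: g1_def\<close>)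
  have le: "C * \<bar>bd 3 s\<bar> \<le> C * ge s" for s using C by (intro mult_left_mono) (auto simp: ge_def)
  show "decO (-2) ge (\<lambda>s y. b (s + y) - b s - bd 1 s * y - bd 2 s / 2 * y\<^sup>2)"
    by (rule decOI[OF C, of X], rule dec_mono[OF T(2)]) (use le in auto)
  have T3: "dec (-1/4) (4 * C * \<bar>bd 1 s\<bar>) (\<lambda>y. A s y - b s * y)" if s: "X \<le> s" for s
    unfolding dec_def
  proof
    fix y
    have "\<bar>A s y - b s * y\<bar> \<le> C * \<bar>bd 1 s\<bar> / (1/4) * exp (1/4 * \<bar>y\<bar>)"
    proof (rule taylor_step[where G = "\<lambda>y. A s y - b s * y"])
      show "((\<lambda>y. A s y - b s * y) has_real_derivative b (s + z) - b s) (at z)" for z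
        by (auto intro!: derivative_eq_intros A_deriv)
      show "\<bar>b (s + z) - b s\<bar> \<le> C * \<bar>bd 1 s\<bar> * exp (1/4 * \<bar>z\<bar>)" for z
        using decD[OF T(1)[OF s], of z] by (simp add: wt_def)
    qed auto
    thus "\<bar>A s y - b s * y\<bar> \<le> 4 * C * \<bar>bd 1 s\<bar> * wt (-1/4) y" by (simp add: wt_def)
  qed
  show "decO (-1/4) g1 (\<lambda>s y. A s y - b s * y)"
    by (rule decOI[of "4 * C" X]) (use T3 C in \<open>simp_all add: g1_def\<close>)
  have T4: "dec (-2) (C * \<bar>bd 3 s\<bar>) (\<lambda>y. A s y - b s * y - bd 1 s / 2 * y\<^sup>2 - bd 2 s / 6 * y ^ 3)" if s: "X \<le> s" for s
    unfolding dec_def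
  proof
    fix y
    have "\<bar>A s y - b s * y - bd 1 s / 2 * y\<^sup>2 - bd 2 s / 6 * y ^ 3\<bar> \<le> C * \<bar>bd 3 s\<bar> / 2 * exp (2 * \<bar>y\<bar>)"
    proof (rule taylor_step[where G = "\<lambda>y. A s y - b s * y - bd 1 s / 2 * y\<^sup>2 - bd 2 s / 6 * y ^ 3"])
      show "((\<lambda>y. A s y - b s * y - bd 1 s / 2 * y\<^sup>2 - bd 2 s / 6 * y ^ 3) has_real_derivative b (s + z) - b s - bd 1 s * z - bd 2 s / 2 * z\<^sup>2) (at z)" for z
        by (auto intro!: derivative_eq_intros A_deriv simp: power2_eq_square)
      show "\<bar>b (s + z) - b s - bd 1 s * z - bd 2 s / 2 * z\<^sup>2\<bar> \<le> C * \<bar>bd 3 s\<bar> * exp (2 * \<bar>z\<bar>)" for z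
        using decD[OF T(2)[OF s], of z] by (simp add: wt_def)
    qed auto
    also have "\<dots> \<le> C * \<bar>bd 3 s\<bar> * exp (2 * \<bar>y\<bar>)" using C by (intro mult_right_mono) auto
    finally show "\<bar>A s y - b s * y - bd 1 s / 2 * y\<^sup>2 - bd 2 s / 6 * y ^ 3\<bar> \<le> C * \<bar>bd 3 s\<bar> * wt (-2) y" by (simp add: wt_def)
  qed
  show "decO (-2) ge (\<lambda>s y. A s y - b s * y - bd 1 s / 2 * y\<^sup>2 - bd 2 s / 6 * y ^ 3)"
    by (rule decOI[OF C, of X], rule dec_mono[OF T4]) (use le in auto)
  show "decO (-1) (\<lambda>_. 1) A" by (rule decOI[of bp]) (use A_dec bp_pos in auto)
  show "decO (-1/2) (\<lambda>_. 1) A" by (rule decOI[of "2 * bp"]) (use A_dec_half bp_pos in auto)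
  have b: "\<bar>b s\<bar> \<le> bp" for s using b_lower[of s] b_upper[of s] bm_pos by auto
  show "decO (-1/2) (\<lambda>_. 1) (\<lambda>s y. b s * y)"
    by (rule decOI[of "bp * 2"], use bp_pos in simp, rule dec_mono[OF dec_cmult[OF A_dec_half(2)]]) (use b in \<open>auto intro: mult_right_mono\<close>)
  show "decO (-1) (\<lambda>_. 1) (\<lambda>s y. b s * y)"
    by (rule decOI[of "bp * 1"], use bp_pos in simp, rule dec_mono[OF dec_cmult[OF dec_y]]) (use b in \<open>auto intro: mult_right_mono\<close>)
  show "decO 0 (\<lambda>_. 1) (\<lambda>s y. b (s + y))" by (rule decOI[of bp]) (use b bp_pos in \<open>auto simp: dec_def\<close>)
qed

end

section \<open>Asymptotics of the band functions\<close>

lemma choice2: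
  assumes "\<And>s. \<exists>f g. Q s f g"
  shows "\<exists>F G. \<forall>s. Q s (F s) (G s)"
proof -
  have "\<forall>s. \<exists>q. Q s (fst q) (snd q)" using assms by simp
  from choice[OF this] obtain q where "\<forall>s. Q s (fst (q s)) (snd (q s))" ..
  thus ?thesis by (intro exI[of _ "\<lambda>s. fst (q s)"] exI[of _ "\<lambda>s. snd (q s)"])
qed

locale band_asymptotics = smooth_profile +
  fixes n :: nat and u v :: "real \<Rightarrow> real \<Rightarrow> real"
  assumes n: "1 \<le> n"
    and ev_bound: "\<forall>\<^sub>F s in at_top. bound (\<lambda>y. pot s 0 y - band b n (a_of b s)) (u s) (v s)"
begin

definition En :: "real \<Rightarrow> real" where "En s = band b n (a_of b s)"
definition \<Lambda> :: real where "\<Lambda> = 2 * real n - 1"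
definition M0 :: real where "M0 = \<Lambda> * bp + 1"
definition \<mu> :: real where "\<mu> = bm\<^sup>2 / 2"
definition M :: real where "M = 2 * bp\<^sup>2 + 2 + M0"

lemma constants: "1 \<le> \<Lambda>" "1 \<le> M0" "0 < \<mu>" "0 \<le> M" "M0 \<le> M"
proof -
  show \<Lambda>: "1 \<le> \<Lambda>" using n by (simp add: \<Lambda>_def)
  show "1 \<le> M0" using \<Lambda> bp_pos by (simp add: M0_def)
  thus "0 \<le> M" "M0 \<le> M" by (auto simp: M_def add_nonneg_nonneg)
  show "0 < \<mu>" using bm_pos by (simp add: \<mu>_def)
qed

lemma at_top_a: "(\<forall>\<^sub>F k in at_top. P k) \<Longrightarrow> (\<forall>\<^sub>F s in at_top. P (a_of b s))"
proof -
  assume "\<forall>\<^sub>F k in at_top. P k"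
  then obtain K where K: "\<And>k. K \<le> k \<Longrightarrow> P k" by (auto simp: eventually_at_top_linorder)
  have "K \<le> a_of b s" if "xk b K \<le> s" for s
    using that a_mono[of "xk b K" s] by (cases "xk b K = s") auto
  thus ?thesis using K by (auto simp: eventually_at_top_linorder)
qed

lemma En_near:
  assumes "0 < \<eta>"
  shows "\<forall>\<^sub>F s in at_top. \<bar>En s - \<Lambda> * bp\<bar> \<le> \<eta>"
proof -
  obtain K where "\<forall>k\<ge>K. band b n k \<in> hspec b k \<and> \<bar>band b n k - (2 * real n - 1) * bp\<bar> \<le> \<eta> \<and> isCont (band b n) k"
    using band_regular[OF n assms] by blast
  hence "\<forall>\<^sub>F k in at_top. \<bar>band b n k - (2 * real n - 1) * bp\<bar> \<le> \<eta>"
    unfolding eventually_at_top_linorder by (intro exI[of _ K]) simp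
  from at_top_a[OF this] show ?thesis unfolding En_def \<Lambda>_def .
qed

lemma En_tendsto: "(En \<longlongrightarrow> \<Lambda> * bp) at_top"
  unfolding tendsto_iff dist_real_def
proof (intro allI impI)
  fix \<epsilon> :: real assume "0 < \<epsilon>"
  hence "0 < \<epsilon> / 2" by simp
  from En_near[OF this] show "\<forall>\<^sub>F s in at_top. \<bar>En s - \<Lambda> * bp\<bar> < \<epsilon>"
    by eventually_elim (use \<open>0 < \<epsilon>\<close> in auto)
qed

lemma ev_good: "\<forall>\<^sub>F s in at_top. bound (\<lambda>y. pot s 0 y - En s) (u s) (v s) \<and> adm \<mu> M (\<lambda>y. pot s 0 y - En s)"
  using ev_bound[folded En_def] En_near[OF zero_less_one]
proof eventually_elim
  case (elim s)
  have "0 \<le> \<Lambda> * bp" using constants bp_pos by simp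
  hence "\<bar>En s\<bar> \<le> M0" using elim(2) by (simp add: M0_def abs_le_iff)
  thus ?case using elim(1) pot_adm[of 0 "En s" M0 s] by (simp add: \<mu>_def M_def)
qed

lemma ho_good: "adm \<mu> M (ho (b s) (\<Lambda> * b s))"
proof (rule ho_adm[OF constants(3)])
  have b: "bm \<le> b s" "b s \<le> bp" "0 < b s" using b_lower[of s] b_upper[of s] bm_pos by auto
  have "bm\<^sup>2 \<le> (b s)\<^sup>2" "(b s)\<^sup>2 \<le> bp\<^sup>2" using b bm_pos by (auto intro!: power_mono)
  moreover have "0 \<le> bm\<^sup>2" "0 \<le> bp\<^sup>2" by auto
  ultimately show "\<mu> \<le> (b s)\<^sup>2" "(b s)\<^sup>2 \<le> M" using constants(2) unfolding \<mu>_def M_def by linarith+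
  have "\<bar>\<Lambda> * b s\<bar> = \<Lambda> * b s" using constants(1) b by simp
  also have "\<dots> \<le> \<Lambda> * bp" using constants(1) b by (intro mult_left_mono) auto
  finally show "\<bar>\<Lambda> * b s\<bar> \<le> M" using constants unfolding M0_def by linarith
qed

lemma ho_exists: "\<exists>w w'. bound (ho (b s) (\<Lambda> * b s)) w w'"
proof -
  have "0 < b s" using b_lower[of s] bm_pos by linarith
  from ho_spec[OF this, of "\<Lambda> * b s"] n show ?thesis unfolding \<Lambda>_def by blast
qed

lemma A_sq_diff: "decO (-1) g1 (\<lambda>s y. (A s y)\<^sup>2 - (b s)\<^sup>2 * y\<^sup>2)"
proof -
  have "decO (-1/2) (\<lambda>_. 1) (\<lambda>s y. A s y + b s * y)" by (rule decO_add[OF decO_A(4,5)])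
  from decO_mult[OF decO_A(1) this] have "decO (-1/4 + -1/2) (\<lambda>s. g1 s * 1) (\<lambda>s y. (A s y - b s * y) * (A s y + b s * y))" .
  hence "decO (-1) g1 (\<lambda>s y. (A s y - b s * y) * (A s y + b s * y))"
    by (rule decO_mono) (auto simp: g_nonneg)
  moreover have "(A s y - b s * y) * (A s y + b s * y) = (A s y)\<^sup>2 - (b s)\<^sup>2 * y\<^sup>2" for s y
    by (simp add: algebra_simps power2_eq_square)
  ultimately show ?thesis by simp
qed

text \<open>First the oscillator state \<open>\<phi>\<close> is close to \<open>u\<close> by \<open>o(1)\<close>, which keeps \<open>\<integral>u\<phi>\<close> away from 0;
  then orthogonality bounds the eigenvalue defect by \<open>b'\<close>, and the closeness improves to \<open>O(b')\<close>.\<close>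

lemma close_oscillator:
  obtains \<phi> \<phi>' where "\<forall>\<^sub>F s in at_top. bound (ho (b s) (\<Lambda> * b s)) (\<phi> s) (\<phi>' s)"
    "decO 8 g1 (\<lambda>s y. u s y - \<phi> s y)" "(\<lambda>s. En s - \<Lambda> * b s) \<in> O[at_top](g1)"
proof -
  have e8: "(0::real) \<le> 8" by simp
  obtain CQ where CQ: "1 \<le> CQ" and close:
    "\<And>p1 u1 v1 p2 u2 v2 d. adm \<mu> M p1 \<Longrightarrow> adm \<mu> M p2 \<Longrightarrow> bound p1 u1 v1 \<Longrightarrow> bound p2 u2 v2 \<Longrightarrow>
      dec (-1) d (\<lambda>y. p1 y - p2 y) \<Longrightarrow>
      \<exists>s\<in>{1, -1}. dec 8 (CQ * d) (\<lambda>y. u1 y - s * u2 y) \<and> \<bar>v1 0 - s * v2 0\<bar> \<le> CQ * d"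
    by (rule bound_close[OF constants(3,4) e8], erule that, assumption)
  obtain K where K: "1 \<le> K" "\<And>p u v. adm \<mu> M p \<Longrightarrow> bound p u v \<Longrightarrow> dec 8 K u \<and> dec 8 K v"
    by (rule bound_dec[OF constants(3,4) e8], erule that, assumption)
  obtain \<kappa> where \<kappa>: "0 < \<kappa>" "\<And>p u v. adm \<mu> M p \<Longrightarrow> bound p u v \<Longrightarrow> \<kappa> \<le> (LBINT y. (u y)\<^sup>2)"
    by (rule bound_norm_lower[OF constants(3,4)], erule that, assumption)
  obtain C where C: "0 \<le> C" "\<forall>\<^sub>F s in at_top. dec (-1) (C * g1 s) (\<lambda>y. (A s y)\<^sup>2 - (b s)\<^sup>2 * y\<^sup>2)"
    using A_sq_diff unfolding decO_def by blast
  \<comment> \<open>At this stage \<open>d\<close> is only known to tend to 0, by convergence of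
    energy and field; the rate is obtained at the end.\<close>
  define d where "d = (\<lambda>s. C * g1 s + \<bar>En s - \<Lambda> * b s\<bar>)"
  have d0: "(d \<longlongrightarrow> 0) at_top"
  proof -
    have "(d \<longlongrightarrow> C * 0 + \<bar>\<Lambda> * bp - \<Lambda> * bp\<bar>) at_top" unfolding d_def by (intro tendsto_intros g1_tendsto En_tendsto b_lim)
    thus ?thesis by simp
  qed
  have dd: "dec (-1) (d s) (\<lambda>y. (pot s 0 y - En s) - ho (b s) (\<Lambda> * b s) y)"
    if "dec (-1) (C * g1 s) (\<lambda>y. (A s y)\<^sup>2 - (b s)\<^sup>2 * y\<^sup>2)" for s
  proof -
    have "dec (-1) \<bar>En s - \<Lambda> * b s\<bar> (\<lambda>_. En s - \<Lambda> * b s)" by (rule dec_mono[OF dec_const]) auto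
    from dec_diff[OF that this] show ?thesis by (simp add: d_def pot_def ho_def algebra_simps)
  qed
  have ex: "\<exists>f g. bound (\<lambda>y. pot s 0 y - En s) (u s) (v s) \<and> adm \<mu> M (\<lambda>y. pot s 0 y - En s) \<and>
      dec (-1) (C * g1 s) (\<lambda>y. (A s y)\<^sup>2 - (b s)\<^sup>2 * y\<^sup>2) \<longrightarrow>
      bound (ho (b s) (\<Lambda> * b s)) f g \<and> dec 8 (CQ * d s) (\<lambda>y. u s y - f y)" for s
  proof -
    obtain w w' where w: "bound (ho (b s) (\<Lambda> * b s)) w w'" using ho_exists by blast
    show ?thesis
    proof (cases "bound (\<lambda>y. pot s 0 y - En s) (u s) (v s) \<and> adm \<mu> M (\<lambda>y. pot s 0 y - En s) \<and>
      dec (-1) (C * g1 s) (\<lambda>y. (A s y)\<^sup>2 - (b s)\<^sup>2 * y\<^sup>2)")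
      case True
      then obtain \<sigma> where \<sigma>: "\<sigma> \<in> {1, -1::real}" "dec 8 (CQ * d s) (\<lambda>y. u s y - \<sigma> * w y)"
        using close[OF _ ho_good _ w dd] by blast
      have "sol (ho (b s) (\<Lambda> * b s)) (\<lambda>_. 0) (\<lambda>y. \<sigma> * w y) (\<lambda>y. \<sigma> * w' y)"
        using sol_lincomb[OF boundD(1)[OF w] boundD(1)[OF w], of \<sigma> 0] by simp
      hence "bound (ho (b s) (\<Lambda> * b s)) (\<lambda>y. \<sigma> * w y) (\<lambda>y. \<sigma> * w' y)"
        using w \<sigma>(1) by (auto simp: bound_def power_mult_distrib)
      thus ?thesis using \<sigma>(2) by blast
    qed blast
  qed
  obtain \<phi> \<phi>' where \<phi>: "\<And>s. bound (\<lambda>y. pot s 0 y - En s) (u s) (v s) \<and> adm \<mu> M (\<lambda>y. pot s 0 y - En s) \<and>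
      dec (-1) (C * g1 s) (\<lambda>y. (A s y)\<^sup>2 - (b s)\<^sup>2 * y\<^sup>2) \<longrightarrow>
      bound (ho (b s) (\<Lambda> * b s)) (\<phi> s) (\<phi>' s) \<and> dec 8 (CQ * d s) (\<lambda>y. u s y - \<phi> s y)"
    using choice2[of "\<lambda>s f g. bound (\<lambda>y. pot s 0 y - En s) (u s) (v s) \<and> adm \<mu> M (\<lambda>y. pot s 0 y - En s) \<and>
      dec (-1) (C * g1 s) (\<lambda>y. (A s y)\<^sup>2 - (b s)\<^sup>2 * y\<^sup>2) \<longrightarrow>
      bound (ho (b s) (\<Lambda> * b s)) f g \<and> dec 8 (CQ * d s) (\<lambda>y. u s y - f y)", OF ex] by blast
  have "((\<lambda>s. 7 * (CQ * d s * K)) \<longlongrightarrow> 7 * (CQ * 0 * K)) at_top" by (intro tendsto_intros d0)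
  hence small: "\<forall>\<^sub>F s in at_top. 7 * (CQ * d s * K) < \<kappa> / 2"
    by (rule order_tendstoD) (use \<kappa> in simp)
  define C3 where "C3 = 2 / \<kappa> * (7 * (C * (K * K)))"
  have C3: "0 \<le> C3" using C \<kappa> K by (simp add: C3_def)
  have all: "\<forall>\<^sub>F s in at_top. bound (ho (b s) (\<Lambda> * b s)) (\<phi> s) (\<phi>' s) \<and> dec 8 (CQ * d s) (\<lambda>y. u s y - \<phi> s y) \<and>
      \<bar>En s - \<Lambda> * b s\<bar> \<le> C3 * g1 s"
    using ev_good C(2) small
  proof eventually_elim
    case (elim s)
    have bu: "bound (\<lambda>y. pot s 0 y - En s) (u s) (v s)" and au: "adm \<mu> M (\<lambda>y. pot s 0 y - En s)" using elim(1) by auto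
    have b\<phi>: "bound (ho (b s) (\<Lambda> * b s)) (\<phi> s) (\<phi>' s)" and c\<phi>: "dec 8 (CQ * d s) (\<lambda>y. u s y - \<phi> s y)"
      using \<phi>[of s] elim by auto
    have Ku: "dec 8 K (u s)" and K\<phi>: "dec 8 K (\<phi> s)" using K(2)[OF au bu] K(2)[OF ho_good b\<phi>] by auto
    have cu: "continuous_on UNIV (u s)" "continuous_on UNIV (\<phi> s)"
      using sol_cont(1)[OF boundD(1)[OF bu]] sol_cont(1)[OF boundD(1)[OF b\<phi>]] .
    define J where "J = (LBINT y. u s y * \<phi> s y)"
    have iu\<phi>: "integrable lborel (\<lambda>y. u s y * \<phi> s y)"
      by (rule integrable_dec[OF _ dec_mult[OF Ku K\<phi>]]) (auto intro!: continuous_intros cu)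
    \<comment> \<open>The overlap differs from the squared norm of \<phi> by an integral of size
      \<open>d\<close>, so it can be divided out of the orthogonality relation.\<close>
    have J: "\<kappa> / 2 \<le> J"
    proof -
      have i1: "integrable lborel (\<lambda>y. (u s y - \<phi> s y) * \<phi> s y)"
        by (rule integrable_dec[OF _ dec_mult[OF c\<phi> K\<phi>]]) (auto intro!: continuous_intros cu)
      have i2: "integrable lborel (\<lambda>y. (\<phi> s y)\<^sup>2)" by (rule boundD(5)[OF b\<phi>])
      have "J = (LBINT y. (u s y - \<phi> s y) * \<phi> s y + (\<phi> s y)\<^sup>2)"
        unfolding J_def by (intro Bochner_Integration.integral_cong) (auto simp: algebra_simps power2_eq_square)
      also have "\<dots> = (LBINT y. (u s y - \<phi> s y) * \<phi> s y) + (LBINT y. (\<phi> s y)\<^sup>2)"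
        by (rule Bochner_Integration.integral_add[OF i1 i2])
      finally have "J = (LBINT y. (u s y - \<phi> s y) * \<phi> s y) + (LBINT y. (\<phi> s y)\<^sup>2)" .
      moreover have "\<bar>LBINT y. (u s y - \<phi> s y) * \<phi> s y\<bar> \<le> 7 * (CQ * d s * K)"
        by (rule integral_dec_le[OF _ dec_mult[OF c\<phi> K\<phi>]]) (auto intro!: continuous_intros cu)
      ultimately show ?thesis using \<kappa>(2)[OF ho_good b\<phi>] elim(3) by linarith
    qed
    have iA: "integrable lborel (\<lambda>y. ((A s y)\<^sup>2 - (b s)\<^sup>2 * y\<^sup>2) * (u s y * \<phi> s y))"
      by (rule integrable_dec[OF _ dec_mult[OF elim(2) dec_mult[OF Ku K\<phi>]]]) (auto intro!: continuous_intros cu A_cont)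
    have "0 = (LBINT y. ((pot s 0 y - En s) - ho (b s) (\<Lambda> * b s) y) * (\<phi> s y * u s y))"
      using bound_orthogonal[OF ho_good au constants(3) b\<phi> bu] by simp
    also have "\<dots> = (LBINT y. ((A s y)\<^sup>2 - (b s)\<^sup>2 * y\<^sup>2) * (u s y * \<phi> s y) - (En s - \<Lambda> * b s) * (u s y * \<phi> s y))"
      by (intro Bochner_Integration.integral_cong) (auto simp: pot_def ho_def algebra_simps)
    also have "\<dots> = (LBINT y. ((A s y)\<^sup>2 - (b s)\<^sup>2 * y\<^sup>2) * (u s y * \<phi> s y)) - (En s - \<Lambda> * b s) * J"
      unfolding J_def using iA iu\<phi> by (subst Bochner_Integration.integral_diff) auto
    finally have eq: "(En s - \<Lambda> * b s) * J = (LBINT y. ((A s y)\<^sup>2 - (b s)\<^sup>2 * y\<^sup>2) * (u s y * \<phi> s y))" by simp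
    have "\<bar>LBINT y. ((A s y)\<^sup>2 - (b s)\<^sup>2 * y\<^sup>2) * (u s y * \<phi> s y)\<bar> \<le> 7 * (C * g1 s * (K * K))"
      by (rule integral_dec_le[OF _ dec_mult[OF elim(2) dec_mult[OF Ku K\<phi>]]]) (auto intro!: continuous_intros cu A_cont)
    hence "\<bar>En s - \<Lambda> * b s\<bar> * \<bar>J\<bar> \<le> 7 * (C * g1 s * (K * K))" unfolding eq[symmetric] abs_mult .
    moreover have "\<bar>En s - \<Lambda> * b s\<bar> * (\<kappa> / 2) \<le> \<bar>En s - \<Lambda> * b s\<bar> * \<bar>J\<bar>" using J by (intro mult_left_mono) auto
    ultimately have "\<bar>En s - \<Lambda> * b s\<bar> * (\<kappa> / 2) \<le> 7 * (C * g1 s * (K * K))" by linarith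
    hence "\<bar>En s - \<Lambda> * b s\<bar> \<le> C3 * g1 s" using \<kappa>(1) unfolding C3_def by (simp add: field_simps)
    thus ?case using b\<phi> c\<phi> by blast
  qed
  show thesis
  proof (rule that[of \<phi> \<phi>'])
    show "\<forall>\<^sub>F s in at_top. bound (ho (b s) (\<Lambda> * b s)) (\<phi> s) (\<phi>' s)" using all by eventually_elim auto
    show "(\<lambda>s. En s - \<Lambda> * b s) \<in> O[at_top](g1)"
      by (rule bigoI[of _ C3], rule eventually_mono[OF all]) (auto simp: g1_def)
    have "\<forall>\<^sub>F s in at_top. dec 8 (CQ * (C + C3) * g1 s) (\<lambda>y. u s y - \<phi> s y)"
      using all
    proof eventually_elim
      case (elim s)
      have "d s \<le> (C + C3) * g1 s" unfolding d_def using elim by (simp add: distrib_right)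
      hence "CQ * d s \<le> CQ * ((C + C3) * g1 s)" using CQ by (intro mult_left_mono) auto
            with dec_mono[of 8 "CQ * d s" "\<lambda>y. u s y - \<phi> s y" 8] elim show ?case by (simp add: mult.assoc)
    qed
    thus "decO 8 g1 (\<lambda>s y. u s y - \<phi> s y)"
      unfolding decO_def using C C3 CQ by (intro exI[of _ "CQ * (C + C3)"]) auto
  qed
qed

lemma decO_bound:
  assumes ev: "\<forall>\<^sub>F s in at_top. bound (p s) (f s) (g s) \<and> adm \<mu> M (p s)"
  shows "decO 8 (\<lambda>_. 1) f" "decO 8 (\<lambda>_. 1) g"
    "\<forall>\<^sub>F s in at_top. continuous_on UNIV (f s) \<and> continuous_on UNIV (g s)"
    "(\<lambda>s. 1 / (LBINT y. (f s y)\<^sup>2)) \<in> O[at_top](\<lambda>_. 1)" "\<forall>\<^sub>F s in at_top. 0 < (LBINT y. (f s y)\<^sup>2)"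
proof -
  have e8: "(0::real) \<le> 8" by simp
  obtain K where K: "1 \<le> K" "\<And>p u v. adm \<mu> M p \<Longrightarrow> bound p u v \<Longrightarrow> dec 8 K u \<and> dec 8 K v"
    by (rule bound_dec[OF constants(3,4) e8], erule that, assumption)
  obtain \<kappa> where \<kappa>: "0 < \<kappa>" "\<And>p u v. adm \<mu> M p \<Longrightarrow> bound p u v \<Longrightarrow> \<kappa> \<le> (LBINT y. (u y)\<^sup>2)"
    by (rule bound_norm_lower[OF constants(3,4)], erule that, assumption)
  have "\<forall>\<^sub>F s in at_top. dec 8 (K * 1) (f s) \<and> dec 8 (K * 1) (g s)"
    using ev by eventually_elim (use K in auto)
  hence "\<forall>\<^sub>F s in at_top. dec 8 (K * 1) (f s)" "\<forall>\<^sub>F s in at_top. dec 8 (K * 1) (g s)"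
    by (auto elim: eventually_mono)
  thus "decO 8 (\<lambda>_. 1) f" "decO 8 (\<lambda>_. 1) g" unfolding decO_def using K(1) by (auto intro!: exI[of _ K])
  show "\<forall>\<^sub>F s in at_top. continuous_on UNIV (f s) \<and> continuous_on UNIV (g s)"
    using ev by eventually_elim (use sol_cont boundD(1) in blast)
  have ev2: "\<forall>\<^sub>F s in at_top. \<kappa> \<le> (LBINT y. (f s y)\<^sup>2)" using ev by eventually_elim (use \<kappa> in blast)
  show "\<forall>\<^sub>F s in at_top. 0 < (LBINT y. (f s y)\<^sup>2)" using ev2 by eventually_elim (use \<kappa> in linarith)
  show "(\<lambda>s. 1 / (LBINT y. (f s y)\<^sup>2)) \<in> O[at_top](\<lambda>_. 1)"
  proof (rule bigoI[of _ "1 / \<kappa>"], rule eventually_mono[OF ev2])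
    fix s assume "\<kappa> \<le> (LBINT y. (f s y)\<^sup>2)"
    thus "norm (1 / (LBINT y. (f s y)\<^sup>2)) \<le> 1 / \<kappa> * norm (1::real)" using \<kappa>(1) by (simp add: frac_le)
  qed
qed

end

section \<open>Exact integral identities for eigenstates\<close>

lemma state_dec:
  assumes u: "dec 8 K u" "dec 8 K v"
  shows "dec (16 - real i) (K * K) (\<lambda>y. y ^ i * (u y)\<^sup>2)" "dec (16 - real i) (K * K) (\<lambda>y. y ^ i * (u y * v y))"
proof -
  have K: "0 \<le> K" using u(1) by (rule dec_nonneg)
  show "dec (16 - real i) (K * K) (\<lambda>y. y ^ i * (u y)\<^sup>2)"
    using dec_poly[OF dec_mult[OF u(1) u(1)], of i] K by (simp add: power2_eq_square)
  show "dec (16 - real i) (K * K) (\<lambda>y. y ^ i * (u y * v y))"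
    using dec_poly[OF dec_mult[OF u(1) u(2)], of i] K by simp
qed

lemma state_ibp:
  assumes s: "sol p (\<lambda>_. 0) u v" and u: "dec 8 K u" "dec 8 K v" and j: "j \<le> 6"
  shows "2 * (LBINT y. y ^ Suc j * (u y * v y)) = - (real (Suc j) * (LBINT y. y ^ j * (u y)\<^sup>2))"
proof -
  note c = sol_cont[OF s] and d = state_dec[OF u]
  have i: "integrable lborel (\<lambda>y. y ^ j * (u y)\<^sup>2)"
    by (rule integrable_dec[OF _ d(1)]) (use j in \<open>auto intro!: continuous_intros c\<close>)
  have i': "integrable lborel (\<lambda>y. y ^ Suc j * (u y * v y))"
    by (rule integrable_dec[OF _ d(2)]) (use j in \<open>auto intro!: continuous_intros c\<close>)
  have "(LBINT y. real (Suc j) * (y ^ j * (u y)\<^sup>2) + 2 * (y ^ Suc j * (u y * v y))) = 0"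
  proof (rule integral_deriv_zero[OF _ _ d(1)[of "Suc j"]])
    show "((\<lambda>y. y ^ Suc j * (u y)\<^sup>2) has_real_derivative real (Suc j) * (y ^ j * (u y)\<^sup>2) + 2 * (y ^ Suc j * (u y * v y))) (at y)" for y
      by (auto intro!: derivative_eq_intros solD(1)[OF s] simp: algebra_simps power2_eq_square simp del: of_nat_Suc power_Suc)
    show "continuous_on UNIV (\<lambda>y. real (Suc j) * (y ^ j * (u y)\<^sup>2) + 2 * (y ^ Suc j * (u y * v y)))"
      by (intro continuous_intros c)
    have l: "16 - real (Suc j) \<le> 16 - real j" by simp
    show "dec (16 - real (Suc j)) (\<bar>real (Suc j)\<bar> * (K * K) + \<bar>2\<bar> * (K * K))
       (\<lambda>y. real (Suc j) * (y ^ j * (u y)\<^sup>2) + 2 * (y ^ Suc j * (u y * v y)))"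
      by (rule dec_add[OF dec_mono[OF dec_cmult[OF d(1)] l order_refl] dec_cmult[OF d(2)]])
  qed (use j in auto)
  also have "(LBINT y. real (Suc j) * (y ^ j * (u y)\<^sup>2) + 2 * (y ^ Suc j * (u y * v y)))
     = (LBINT y. real (Suc j) * (y ^ j * (u y)\<^sup>2)) + (LBINT y. 2 * (y ^ Suc j * (u y * v y)))"
    by (rule Bochner_Integration.integral_add) (use i i' in auto)
  finally show ?thesis by (simp del: of_nat_Suc power_Suc)
qed

context field_profile
begin

lemma b_shift: "continuous_on UNIV (\<lambda>y. b (s + y))" "dec 0 bp (\<lambda>y. b (s + y))"
proof -
  show "continuous_on UNIV (\<lambda>y. b (s + y))"
    by (rule continuous_on_compose2[OF b_cont]) (auto intro!: continuous_intros)
  have "\<bar>b x\<bar> \<le> bp" for x using b_lower[of x] b_upper[of x] bm_pos by auto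
  thus "dec 0 bp (\<lambda>y. b (s + y))" by (simp add: dec_def)
qed

lemma pot_dec: "dec (-2) (bp * bp + \<bar>E\<bar>) (\<lambda>y. pot s 0 y - E)"
proof -
  have "dec (-2) \<bar>E\<bar> (\<lambda>_. E)" by (rule dec_mono[OF dec_const]) auto
  moreover have "dec (-2) (bp * bp) (\<lambda>y. pot s 0 y)"
    using dec_mult[OF A_dec A_dec, of s s] by (simp add: pot_def power2_eq_square)
  ultimately show ?thesis by (rule dec_diff[rotated])
qed

lemma pot_cont: "continuous_on UNIV (\<lambda>y. pot s 0 y - E)"
  unfolding pot_def by (intro continuous_intros A_cont)

text \<open>The derivative of v^2 - p u^2 is -p' u^2, and p' = 2 A b(s + y).\<close>

lemma state_virial:
  assumes s: "sol (\<lambda>y. pot s 0 y - E) (\<lambda>_. 0) u v" and u: "dec 8 K u" "dec 8 K v"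
  shows "(LBINT y. A s y * (b (s + y) * (u y)\<^sup>2)) = 0"
proof -
  note c = sol_cont[OF s]
  have K: "0 \<le> K" using u(1) by (rule dec_nonneg)
  let ?p = "\<lambda>y. pot s 0 y - E"
  have uu: "dec 16 (K * K) (\<lambda>y. (u y)\<^sup>2)" "dec 16 (K * K) (\<lambda>y. (v y)\<^sup>2)"
    using dec_mult[OF u(1) u(1)] dec_mult[OF u(2) u(2)] by (simp_all add: power2_eq_square)
  have "(LBINT y. - 2 * (A s y * (b (s + y) * (u y)\<^sup>2))) = 0"
  proof (rule integral_deriv_zero)
    show "((\<lambda>y. (v y)\<^sup>2 - ?p y * (u y)\<^sup>2) has_real_derivative - 2 * (A s y * (b (s + y) * (u y)\<^sup>2))) (at y)" for y
      by (auto intro!: derivative_eq_intros solD[OF s] A_deriv simp: pot_def algebra_simps power2_eq_square)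
    show "continuous_on UNIV (\<lambda>y. - 2 * (A s y * (b (s + y) * (u y)\<^sup>2)))" by (intro continuous_intros c A_cont b_shift)
    have "dec 14 ((bp * bp + \<bar>E\<bar>) * (K * K)) (\<lambda>y. ?p y * (u y)\<^sup>2)" using dec_mult[OF pot_dec uu(1)] by simp
    from dec_diff[OF dec_mono[OF uu(2) _ order_refl] this]
    show "dec 14 (K * K + (bp * bp + \<bar>E\<bar>) * (K * K)) (\<lambda>y. (v y)\<^sup>2 - ?p y * (u y)\<^sup>2)" by simp
    show "dec 15 (\<bar>- 2\<bar> * (bp * (bp * (K * K)))) (\<lambda>y. - 2 * (A s y * (b (s + y) * (u y)\<^sup>2)))"
      using dec_cmult[OF dec_mult[OF A_dec dec_mult[OF b_shift(2) uu(1)]], of "-2" s s] by simp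
  qed auto
  thus ?thesis by simp
qed

text \<open>Differentiating the eigenvalue equation in y shows that v solves it with source -p' u.
  In D + v/b(s) the large parts of the two sources cancel and the source \<open>f\<close>, of size
  b', remains; subtracting a multiple of u gives w. Eliminating D in favour of w leaves explicit
  integrals and the product of f with w, which is quadratic in b'.\<close>

lemma second_derivative_identity:
  fixes s E :: real and u v D DE :: "real \<Rightarrow> real"
  defines "N \<equiv> LBINT y. (u y)\<^sup>2" and "G \<equiv> (LBINT y. 2 * (0 - A s y) * (u y)\<^sup>2) / (LBINT y. (u y)\<^sup>2)"
  defines "f \<equiv> \<lambda>y. (G - 2 / b s * (A s y * (b (s + y) - b s))) * u y"
  assumes b: "bound (\<lambda>y. pot s 0 y - E) u v" and a: "adm \<mu> M (\<lambda>y. pot s 0 y - E)" "0 < \<mu>"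
    and u: "dec 8 K u" "dec 8 K v" and N: "N \<noteq> 0"
    and D: "sol (\<lambda>y. pot s 0 y - E) (\<lambda>y. (2 * A s y + G) * u y) D DE" "dec 2 B D"
  obtains w w' B' where "sol (\<lambda>y. pot s 0 y - E) f w w'" "dec 1 B' w" "dec 0 B' w'" "w 0 * u 0 + w' 0 * v 0 = 0"
    "2 - 4 / N * (LBINT y. A s y * (u y * D y)) - 2 * G / N * (LBINT y. u y * D y)
      = - (2 / (b s * N)) * (LBINT y. (b (s + y) - b s) * (u y)\<^sup>2) - 2 / N * (LBINT y. f y * w y)
        + 2 / (b s * N) * (LBINT y. f y * v y)"
proof -
  define p where "p = (\<lambda>y. pot s 0 y - E)"
  define r where "r = 1 / b s"
  define Q where "Q = (\<lambda>y. A s y * (b (s + y) - b s))"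
  have bs: "b s \<noteq> 0" using b_lower[of s] bm_pos by simp
  hence r: "r * b s = 1" by (simp add: r_def)
  have K: "0 \<le> K" using u(1) by (rule dec_nonneg)
  note sb = boundD(1)[OF b, folded p_def] and sD = D(1)[folded p_def]
  note cu = sol_cont[OF sb] and cD = sol_cont[OF sD]
  have dp: "dec (-2) (bp * bp + \<bar>E\<bar>) p" unfolding p_def by (rule pot_dec)
  have cp: "continuous_on UNIV p" unfolding p_def by (rule pot_cont)
  \<comment> \<open>The component of the data of D + v/b(s) along those of u; removing it makes the
    Fredholm estimate applicable to w.\<close>
  define \<tau> where "\<tau> = (D 0 + r * v 0) * u 0 + (DE 0 + r * (p 0 * u 0)) * v 0"
  define w where "w = (\<lambda>y. D y + r * v y - \<tau> * u y)"
  define w' where "w' = (\<lambda>y. DE y + r * (p y * u y) - \<tau> * v y)"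
  have pd: "(p has_real_derivative 2 * A s y * b (s + y)) (at y)" for y
    unfolding p_def pot_def by (auto intro!: derivative_eq_intros A_deriv)
  have sw: "sol p f w w'"
    unfolding sol_def
  proof (intro allI conjI)
    fix y
    show "(w has_real_derivative w' y) (at y)"
      unfolding w_def w'_def by (auto intro!: derivative_eq_intros solD[OF sb] solD[OF sD])
    have "f y = (2 * A s y + G) * u y - 2 * r * (A s y * (b (s + y) * u y))"
      unfolding f_def using bs by (simp add: r_def field_simps)
    hence "p y * w y - f y = (p y * D y - (2 * A s y + G) * u y) + r * (2 * A s y * b (s + y) * u y + v y * p y) - \<tau> * (p y * u y)"
      unfolding w_def by (simp add: algebra_simps)
    moreover have "(w' has_real_derivative (p y * D y - (2 * A s y + G) * u y) + r * (2 * A s y * b (s + y) * u y + v y * p y) - \<tau> * (p y * u y)) (at y)"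
      unfolding w'_def by (auto intro!: derivative_eq_intros solD[OF sb] solD[OF sD] pd)
    ultimately show "(w' has_real_derivative p y * w y - f y) (at y)" by simp
  qed
  have dA: "dec (-1) bp (A s)" by (rule A_dec)
  have db: "dec 0 bp (\<lambda>y. b (s + y))" by (rule b_shift)
  have dcb: "dec 0 (bp + \<bar>b s\<bar>) (\<lambda>y. b (s + y) - b s)" by (rule dec_diff[OF db dec_const])
  have dQ: "dec (-1) (bp * (bp + \<bar>b s\<bar>)) Q" unfolding Q_def using dec_mult[OF dA dcb] by simp
  have dG: "dec (-1) \<bar>G\<bar> (\<lambda>_. G)" by (rule dec_mono[OF dec_const]) auto
  define q0 where "q0 = (\<lambda>y. 2 * A s y + G)"
  obtain Cq where dq0: "dec (-1) Cq q0" unfolding q0_def using dec_add[OF dec_cmult[OF dA] dG] by blast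
  obtain Cf where df: "dec 7 Cf f"
    using dec_mult[OF dec_diff[OF dG dec_cmult[OF dQ]] u(1), of "2 / b s"] by (auto simp: f_def Q_def)
  obtain C0 where df0: "dec 7 C0 (\<lambda>y. q0 y * u y)" using dec_mult[OF dq0 u(1)] by auto
  have cf: "continuous_on UNIV f" unfolding f_def by (intro continuous_intros A_cont b_shift cu)
  have cq0: "continuous_on UNIV q0" unfolding q0_def by (intro continuous_intros A_cont)
  have sw_cont: "continuous_on UNIV w" "continuous_on UNIV w'" using sol_cont[OF sw] .
  obtain Cw where dw: "dec 2 Cw w"
    unfolding w_def using dec_diff[OF dec_add[OF D(2) dec_mono[OF dec_cmult[OF u(2)] _ order_refl]] dec_mono[OF dec_cmult[OF u(1)] _ order_refl], of r \<tau>] by auto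
  obtain Cw' where dw': "dec 1 Cw' w'"
    using dec_deriv[OF a(1)[folded p_def] a(2) sw dw dec_mono[OF df _ order_refl]] by auto
  have Cww: "0 \<le> Cw" "0 \<le> Cw'" using dw dw' by (auto dest: dec_nonneg)
  have uu: "dec 16 (K * K) (\<lambda>y. (u y)\<^sup>2)" using dec_mult[OF u(1) u(1)] by (simp add: power2_eq_square)
  \<comment> \<open>The derivative of q0 u^2/2, since q0' = 2 b(s + y). Its vanishing integral
    trades q0 u v for -b(s + y) u^2.\<close>
  define c1 where "c1 = (\<lambda>y. b (s + y) * (u y)\<^sup>2 + q0 y * u y * v y)"
  have I1: "(LBINT y. c1 y) = 0" and i1: "integrable lborel c1"
  proof -
    obtain C1 where C1: "dec 15 C1 (\<lambda>y. q0 y * u y * v y)" using dec_mult[OF df0 u(2)] by auto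
    have dc1: "dec 15 (bp * (K * K) + C1) c1" unfolding c1_def using dec_mult[OF db uu] by (intro dec_add[OF dec_mono[OF _ _ order_refl] C1]) auto
    have cc1: "continuous_on UNIV c1" unfolding c1_def by (intro continuous_intros b_shift cu cq0)
    show "integrable lborel c1" by (rule integrable_dec[OF cc1 dc1]) simp
    show "(LBINT y. c1 y) = 0"
    proof (rule integral_deriv_zero[OF _ cc1 _ _ dc1])
      show "((\<lambda>y. (1/2 * q0 y) * (u y)\<^sup>2) has_real_derivative c1 y) (at y)" for y
        unfolding c1_def q0_def by (auto intro!: derivative_eq_intros A_deriv solD[OF sb] simp: algebra_simps power2_eq_square)
      show "dec 15 (\<bar>1/2\<bar> * (Cq * (K * K))) (\<lambda>y. (1/2 * q0 y) * (u y)\<^sup>2)"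
        using dec_cmult[OF dec_mult[OF dq0 uu], of "1/2"] by (simp add: mult.assoc)
    qed auto
  qed
  \<comment> \<open>The derivative of the Wronskian of v = u' with w. Its vanishing integral
    replaces the large term 2 A b(s + y) u w by -f v.\<close>
  define c2 where "c2 = (\<lambda>y. f y * v y + 2 * A s y * b (s + y) * u y * w y)"
  have cc2: "continuous_on UNIV c2" unfolding c2_def by (intro continuous_intros b_shift cu cf A_cont sw_cont)
  obtain C2 where dc2: "dec 9 C2 c2"
  proof -
    obtain Ca where "dec 9 Ca (\<lambda>y. 2 * A s y * b (s + y) * u y * w y)"
      using dec_mult[OF dec_mult[OF dec_mult[OF dec_cmult[OF dA] db] u(1)] dw, of 2] by auto
    moreover obtain Cb where "dec 9 Cb (\<lambda>y. f y * v y)" using dec_mono[OF dec_mult[OF df u(2)] _ order_refl, of 9] by auto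
    ultimately show thesis using that dec_add unfolding c2_def by blast
  qed
  have i2: "integrable lborel c2" by (rule integrable_dec[OF cc2 dc2]) simp
  have I2: "(LBINT y. c2 y) = 0"
  proof (rule integral_deriv_zero[OF _ cc2 _ _ dc2])
    show "((\<lambda>y. p y * u y * w y - v y * w' y) has_real_derivative c2 y) (at y)" for y
      unfolding c2_def by (auto intro!: derivative_eq_intros solD[OF sb] solD[OF sw] pd simp: algebra_simps)
    show "dec 8 ((bp * bp + \<bar>E\<bar>) * K * Cw + K * Cw') (\<lambda>y. p y * u y * w y - v y * w' y)"
      using dec_diff[OF _ dec_mono[OF dec_mult[OF u(2) dw'], of 8]] dec_mult[OF dec_mult[OF dp u(1)] dw] by simp
  qed auto
  have iA: "integrable lborel (\<lambda>y. 2 * (0 - A s y) * (u y)\<^sup>2)"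
  proof (rule integrable_dec)
    show "dec 15 (\<bar>-2\<bar> * (bp * (K * K))) (\<lambda>y. 2 * (0 - A s y) * (u y)\<^sup>2)"
      using dec_cmult[OF dec_mult[OF dA uu], of "-2"] by (simp add: mult.assoc)
  qed (auto intro!: continuous_intros A_cont cu)
  have iu: "integrable lborel (\<lambda>y. (u y)\<^sup>2)" by (rule boundD(5)[OF b])
  have i3: "integrable lborel (\<lambda>y. q0 y * (u y)\<^sup>2)"
    by (rule integrable_dec[OF _ dec_mult[OF dq0 uu]]) (auto intro!: continuous_intros cq0 cu)
  \<comment> \<open>This is the definition of G, and it makes the choice of \<tau> irrelevant to the
    value of the integral.\<close>
  have I3: "(LBINT y. q0 y * (u y)\<^sup>2) = 0"
  proof -
    have "(LBINT y. q0 y * (u y)\<^sup>2) = (LBINT y. G * (u y)\<^sup>2 - 2 * (0 - A s y) * (u y)\<^sup>2)"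
      by (intro Bochner_Integration.integral_cong) (auto simp: q0_def algebra_simps)
    also have "\<dots> = G * N - (LBINT y. 2 * (0 - A s y) * (u y)\<^sup>2)"
      using iA iu unfolding N_def by (subst Bochner_Integration.integral_diff) auto
    also have "\<dots> = 0" using N unfolding G_def N_def by simp
    finally show ?thesis .
  qed
  have ifw: "integrable lborel (\<lambda>y. f y * w y)"
    by (rule integrable_dec[OF _ dec_mult[OF df dw]]) (auto intro!: continuous_intros cf sw_cont)
  have ifv: "integrable lborel (\<lambda>y. f y * v y)"
    by (rule integrable_dec[OF _ dec_mult[OF df u(2)]]) (auto intro!: continuous_intros cf cu)
  have ic: "integrable lborel (\<lambda>y. (b (s + y) - b s) * (u y)\<^sup>2)"
    by (rule integrable_dec[OF _ dec_mult[OF dcb uu]]) (auto intro!: continuous_intros b_shift cu)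
  have pw: "q0 y * (u y * D y) = f y * w y - r * (f y * v y) + r * c2 y - r * c1 y + r * ((b (s + y) - b s) * (u y)\<^sup>2) + (u y)\<^sup>2
      + \<tau> * (q0 y * (u y)\<^sup>2)" for y
  proof -
    have D: "D y = w y - r * v y + \<tau> * u y" by (simp add: w_def)
    have f: "f y = q0 y * u y - 2 * r * (A s y * (b (s + y) * u y))"
      unfolding f_def q0_def using bs by (simp add: r_def field_simps)
    have rb: "b s * r = 1" using r by (simp add: mult.commute)
    have "f y * w y - r * (f y * v y) + r * c2 y - r * c1 y + r * ((b (s + y) - b s) * (u y)\<^sup>2) + (u y)\<^sup>2 + \<tau> * (q0 y * (u y)\<^sup>2)
      = q0 y * (u y * D y) + (1 - b s * r) * (u y)\<^sup>2"
      unfolding c1_def c2_def D f by (simp add: algebra_simps power2_eq_square)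
    thus ?thesis using rb by simp
  qed
  have "(LBINT y. q0 y * (u y * D y)) = (LBINT y. f y * w y) - r * (LBINT y. f y * v y) + r * (LBINT y. c2 y) - r * (LBINT y. c1 y)
      + r * (LBINT y. (b (s + y) - b s) * (u y)\<^sup>2) + N + \<tau> * (LBINT y. q0 y * (u y)\<^sup>2)"
    unfolding pw N_def using ifw ifv ic i1 i2 i3 iu by simp
  hence main: "(LBINT y. q0 y * (u y * D y)) = (LBINT y. f y * w y) - r * (LBINT y. f y * v y) + r * (LBINT y. (b (s + y) - b s) * (u y)\<^sup>2) + N"
    by (simp add: I1 I2 I3)
  have iuD: "integrable lborel (\<lambda>y. u y * D y)"
    by (rule integrable_dec[OF _ dec_mult[OF u(1) D(2)]]) (auto intro!: continuous_intros cu cD)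
  have iAD: "integrable lborel (\<lambda>y. A s y * (u y * D y))"
    by (rule integrable_dec[OF _ dec_mult[OF dA dec_mult[OF u(1) D(2)]]]) (auto intro!: continuous_intros cu cD A_cont)
  have "(LBINT y. q0 y * (u y * D y)) = (LBINT y. 2 * (A s y * (u y * D y)) + G * (u y * D y))"
    unfolding q0_def by (intro Bochner_Integration.integral_cong) (auto simp: algebra_simps)
  also have "\<dots> = 2 * (LBINT y. A s y * (u y * D y)) + G * (LBINT y. u y * D y)"
    using iuD iAD by simp
  finally have split: "2 * (LBINT y. A s y * (u y * D y)) + G * (LBINT y. u y * D y) =
      (LBINT y. f y * w y) - r * (LBINT y. f y * v y) + r * (LBINT y. (b (s + y) - b s) * (u y)\<^sup>2) + N"
    unfolding main by simp
  \<comment> \<open>The norm N produced by the c1 term cancels the leading 2, so that E'' has no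
    contribution of order one.\<close>
  have fin: "2 - 4 / N * X - 2 * G / N * Y = - (2 / (b s * N)) * c - 2 / N * fw + 2 / (b s * N) * fv"
    if "2 * X + G * Y = fw - r * fv + r * c + N" for X Y fw fv c
  proof -
    have "2 - 4 / N * X - 2 * G / N * Y = 2 - 2 / N * (2 * X + G * Y)" by (simp add: algebra_simps add_divide_distrib)
    also have "\<dots> = - (2 / (b s * N)) * c - 2 / N * fw + 2 / (b s * N) * fv"
      unfolding that r_def using N bs by (simp add: field_simps)
    finally show ?thesis .
  qed
  show thesis
  proof (rule that[of w w' "max Cw Cw'"])
    show "sol (\<lambda>y. pot s 0 y - E) f w w'" using sw unfolding p_def .
    show "dec 1 (max Cw Cw') w" by (rule dec_mono[OF dw]) auto
    show "dec 0 (max Cw Cw') w'" by (rule dec_mono[OF dw']) auto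
    have "w 0 * u 0 + w' 0 * v 0 = \<tau> - \<tau> * ((u 0)\<^sup>2 + (v 0)\<^sup>2)"
      unfolding w_def w'_def \<tau>_def by (simp add: algebra_simps power2_eq_square)
    thus "w 0 * u 0 + w' 0 * v 0 = 0" using boundD(2)[OF b] by simp
    show "2 - 4 / N * (LBINT y. A s y * (u y * D y)) - 2 * G / N * (LBINT y. u y * D y)
      = - (2 / (b s * N)) * (LBINT y. (b (s + y) - b s) * (u y)\<^sup>2) - 2 / N * (LBINT y. f y * w y)
        + 2 / (b s * N) * (LBINT y. f y * v y)" by (rule fin[OF split])
  qed
qed

end

section \<open>Moment estimates and the three expansions\<close>

definition mom :: "nat \<Rightarrow> (real \<Rightarrow> real) \<Rightarrow> real" where "mom j f = (LBINT y. y ^ j * f y)"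

lemma mom_0: "mom 0 f = (LBINT y. f y)" by (simp add: mom_def)

lemma mom_diff:
  assumes "integrable lborel (\<lambda>y. y ^ j * f y)" "integrable lborel (\<lambda>y. y ^ j * g y)"
  shows "mom j f - mom j g = mom j (\<lambda>y. f y - g y)"
  using Bochner_Integration.integral_diff[OF assms] unfolding mom_def right_diff_distrib by (rule sym)

lemma decO_le:
  assumes "decO l g F" "l' \<le> l"
  shows "decO l' g F"
proof -
  obtain C where C: "0 \<le> C" "\<forall>\<^sub>F s in at_top. dec l (C * g s) (F s)" using assms(1) unfolding decO_def by blast
  have "\<forall>\<^sub>F s in at_top. dec l' (C * g s) (F s)"
    using C(2) by eventually_elim (rule dec_mono[OF _ assms(2) order_refl])
  thus ?thesis using C(1) unfolding decO_def by blast
qed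

lemma decO_mult_1:
  assumes "decO l1 g F" "decO l2 (\<lambda>_. 1) H" "l \<le> l1 + l2"
  shows "decO l g (\<lambda>s y. F s y * H s y)"
  using decO_le[OF decO_mult[OF assms(1,2)] assms(3)] by simp

lemma decO_1_mult:
  assumes "decO l1 (\<lambda>_. 1) F" "decO l2 g H" "l \<le> l1 + l2"
  shows "decO l g (\<lambda>s y. F s y * H s y)"
  using decO_le[OF decO_mult[OF assms(1,2)] assms(3)] by simp

lemma bigo_1_mult:
  fixes a f :: "real \<Rightarrow> real"
  assumes "a \<in> O[at_top](\<lambda>_. 1)" "f \<in> O[at_top](g)"
  shows "(\<lambda>s. a s * f s) \<in> O[at_top](g)"
  using landau_o.big.mult[OF assms] by simp

lemma bigo_cmult:
  fixes f :: "real \<Rightarrow> real"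
  shows "f \<in> O[at_top](g) \<Longrightarrow> (\<lambda>s. c * f s) \<in> O[at_top](g)"
  by simp

lemma
  assumes F: "decO 8 g F" and H: "decO 8 (\<lambda>_. 1) H" and j: "j \<le> 8"
    and c: "\<forall>\<^sub>F s in at_top. continuous_on UNIV (F s)" "\<forall>\<^sub>F s in at_top. continuous_on UNIV (H s)"
  shows mom_bigo: "(\<lambda>s. mom j (\<lambda>y. F s y * H s y)) \<in> O[at_top](g)"
    and mom_integrable: "\<forall>\<^sub>F s in at_top. integrable lborel (\<lambda>y. y ^ j * (F s y * H s y))"
proof -
  have d: "decO 1 g (\<lambda>s y. y ^ j * (F s y * H s y))"
    by (rule decO_1_mult[OF decO_power decO_mult_1[OF F H order_refl]]) (use j in simp)
  have e: "\<forall>\<^sub>F s in at_top. continuous_on UNIV (\<lambda>y. y ^ j * (F s y * H s y))"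
    using c by eventually_elim (intro continuous_intros)
  show "(\<lambda>s. mom j (\<lambda>y. F s y * H s y)) \<in> O[at_top](g)"
    unfolding mom_def by (rule decO_integral(1)[OF d order_refl e])
  show "\<forall>\<^sub>F s in at_top. integrable lborel (\<lambda>y. y ^ j * (F s y * H s y))"
    by (rule decO_integral(2)[OF d order_refl e])
qed

lemma state_ibp_0:
  assumes s: "sol p (\<lambda>_. 0) u v" and u: "dec 8 K u" "dec 8 K v"
  shows "(LBINT y. u y * v y) = 0"
proof -
  note c = sol_cont[OF s]
  have "(LBINT y. 2 * (u y * v y)) = 0"
  proof (rule integral_deriv_zero)
    show "((\<lambda>y. u y * u y) has_real_derivative 2 * (u y * v y)) (at y)" for y
      by (auto intro!: derivative_eq_intros solD(1)[OF s])
    show "dec (8 + 8) (\<bar>2\<bar> * (K * K)) (\<lambda>y. 2 * (u y * v y))" by (rule dec_cmult[OF dec_mult[OF u]])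
    show "dec (8 + 8) (K * K) (\<lambda>y. u y * u y)" by (rule dec_mult[OF u(1) u(1)])
  qed (auto intro!: continuous_intros c)
  thus ?thesis by simp
qed

context band_asymptotics
begin

lemma bs_pos: "0 < b s" using b_lower[of s] bm_pos by linarith

lemma g1_mult:
  fixes f h :: "real \<Rightarrow> real"
  assumes "f \<in> O[at_top](g1)" "h \<in> O[at_top](g1)"
  shows "(\<lambda>s. f s * h s) \<in> O[at_top](ge)"
  by (rule landau_o.big_trans[OF landau_o.big.mult[OF assms] g_bigo(2)])

lemma decO_u: "decO 8 (\<lambda>_. 1) u" "decO 8 (\<lambda>_. 1) v"
  and cont_uv: "\<forall>\<^sub>F s in at_top. continuous_on UNIV (u s)" "\<forall>\<^sub>F s in at_top. continuous_on UNIV (v s)"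
  and norm_u: "(\<lambda>s. 1 / mom 0 (\<lambda>y. (u s y)\<^sup>2)) \<in> O[at_top](\<lambda>_. 1)" "\<forall>\<^sub>F s in at_top. 0 < mom 0 (\<lambda>y. (u s y)\<^sup>2)"
proof -
  note d = decO_bound[OF ev_good, folded mom_0]
  show "decO 8 (\<lambda>_. 1) u" "decO 8 (\<lambda>_. 1) v" "(\<lambda>s. 1 / mom 0 (\<lambda>y. (u s y)\<^sup>2)) \<in> O[at_top](\<lambda>_. 1)"
    "\<forall>\<^sub>F s in at_top. 0 < mom 0 (\<lambda>y. (u s y)\<^sup>2)" by (fact d)+
  show "\<forall>\<^sub>F s in at_top. continuous_on UNIV (u s)" "\<forall>\<^sub>F s in at_top. continuous_on UNIV (v s)"
    using d(3) by (auto elim: eventually_mono)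
qed

text \<open>At energy \<Lambda> b the general moments reduce to \<Lambda>/(2b) and 3 (1 +
  \<Lambda>^2)/(8 b^2) times the norm. The last clause is the orthogonality relation, an exact
  equation for the energy defect.\<close>

lemma oscillator:
  obtains \<phi> where "decO 8 (\<lambda>_. 1) \<phi>" "decO 8 g1 (\<lambda>s y. u s y - \<phi> s y)" "\<forall>\<^sub>F s in at_top. continuous_on UNIV (\<phi> s)"
    "(\<lambda>s. 1 / mom 0 (\<lambda>y. (\<phi> s y)\<^sup>2)) \<in> O[at_top](\<lambda>_. 1)" "\<forall>\<^sub>F s in at_top. 0 < mom 0 (\<lambda>y. (\<phi> s y)\<^sup>2)"
    "\<forall>\<^sub>F s in at_top. mom 1 (\<lambda>y. (\<phi> s y)\<^sup>2) = 0 \<and> mom 2 (\<lambda>y. (\<phi> s y)\<^sup>2) = \<Lambda> / (2 * b s) * mom 0 (\<lambda>y. (\<phi> s y)\<^sup>2) \<and>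
       mom 3 (\<lambda>y. (\<phi> s y)\<^sup>2) = 0 \<and> mom 4 (\<lambda>y. (\<phi> s y)\<^sup>2) = 3 / (8 * (b s)\<^sup>2) * (1 + \<Lambda>\<^sup>2) * mom 0 (\<lambda>y. (\<phi> s y)\<^sup>2)"
    "(\<lambda>s. En s - \<Lambda> * b s) \<in> O[at_top](g1)"
    "\<forall>\<^sub>F s in at_top. (En s - \<Lambda> * b s) * mom 0 (\<lambda>y. u s y * \<phi> s y) = (LBINT y. ((A s y)\<^sup>2 - (b s)\<^sup>2 * y\<^sup>2) * (u s y * \<phi> s y))"
proof -
  obtain \<phi> \<phi>' where ev: "\<forall>\<^sub>F s in at_top. bound (ho (b s) (\<Lambda> * b s)) (\<phi> s) (\<phi>' s)"
    and close: "decO 8 g1 (\<lambda>s y. u s y - \<phi> s y)" and E: "(\<lambda>s. En s - \<Lambda> * b s) \<in> O[at_top](g1)"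
    by (rule close_oscillator)
  have "\<forall>\<^sub>F s in at_top. bound (ho (b s) (\<Lambda> * b s)) (\<phi> s) (\<phi>' s) \<and> adm \<mu> M (ho (b s) (\<Lambda> * b s))"
    using ev by eventually_elim (simp add: ho_good)
  note d = decO_bound[OF this, folded mom_0]
  have c: "\<forall>\<^sub>F s in at_top. continuous_on UNIV (\<phi> s)" using d(3) by (auto elim: eventually_mono)
  have "decO 1 g1 (\<lambda>s y. ((A s y)\<^sup>2 - (b s)\<^sup>2 * y\<^sup>2) * (u s y * \<phi> s y))"
    by (rule decO_mult_1[OF A_sq_diff decO_mult_1[OF decO_u(1) d(1) order_refl]]) simp
  moreover have "\<forall>\<^sub>F s in at_top. continuous_on UNIV (\<lambda>y. ((A s y)\<^sup>2 - (b s)\<^sup>2 * y\<^sup>2) * (u s y * \<phi> s y))"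
    using cont_uv(1) c by eventually_elim (intro continuous_intros A_cont)
  ultimately have iA: "\<forall>\<^sub>F s in at_top. integrable lborel (\<lambda>y. ((A s y)\<^sup>2 - (b s)\<^sup>2 * y\<^sup>2) * (u s y * \<phi> s y))"
    by (intro decO_integral(2)[OF _ order_refl])
  have i0: "\<forall>\<^sub>F s in at_top. integrable lborel (\<lambda>y. y ^ 0 * (u s y * \<phi> s y))"
    by (rule mom_integrable[OF decO_u(1) d(1) _ cont_uv(1) c]) simp
  show thesis
  proof (rule that[OF d(1) close c d(4,5) _ E])
    show "\<forall>\<^sub>F s in at_top. mom 1 (\<lambda>y. (\<phi> s y)\<^sup>2) = 0 \<and> mom 2 (\<lambda>y. (\<phi> s y)\<^sup>2) = \<Lambda> / (2 * b s) * mom 0 (\<lambda>y. (\<phi> s y)\<^sup>2) \<and>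
       mom 3 (\<lambda>y. (\<phi> s y)\<^sup>2) = 0 \<and> mom 4 (\<lambda>y. (\<phi> s y)\<^sup>2) = 3 / (8 * (b s)\<^sup>2) * (1 + \<Lambda>\<^sup>2) * mom 0 (\<lambda>y. (\<phi> s y)\<^sup>2)"
      using ev
    proof eventually_elim
      case (elim s)
      have "\<Lambda> * b s / (2 * (b s)\<^sup>2) = \<Lambda> / (2 * b s)" "\<Lambda> * b s / b s = \<Lambda>"
        using bs_pos[of s] by (simp_all add: power2_eq_square)
      with ho_moments[OF bs_pos elim] show ?case unfolding mom_def by simp
    qed
    show "\<forall>\<^sub>F s in at_top. (En s - \<Lambda> * b s) * mom 0 (\<lambda>y. u s y * \<phi> s y) = (LBINT y. ((A s y)\<^sup>2 - (b s)\<^sup>2 * y\<^sup>2) * (u s y * \<phi> s y))"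
      using ev_good ev iA i0
    proof eventually_elim
      case (elim s)
      have "0 = (LBINT y. ((pot s 0 y - En s) - ho (b s) (\<Lambda> * b s) y) * (\<phi> s y * u s y))"
        using bound_orthogonal[OF ho_good _ constants(3) elim(2), of "\<lambda>y. pot s 0 y - En s" "u s" "v s"] elim(1) by simp
      also have "\<dots> = (LBINT y. ((A s y)\<^sup>2 - (b s)\<^sup>2 * y\<^sup>2) * (u s y * \<phi> s y) - (En s - \<Lambda> * b s) * (u s y * \<phi> s y))"
        by (intro Bochner_Integration.integral_cong) (auto simp: pot_def ho_def algebra_simps)
      also have "\<dots> = (LBINT y. ((A s y)\<^sup>2 - (b s)\<^sup>2 * y\<^sup>2) * (u s y * \<phi> s y)) - (En s - \<Lambda> * b s) * mom 0 (\<lambda>y. u s y * \<phi> s y)"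
        unfolding mom_0 using elim(3,4) by (subst Bochner_Integration.integral_diff) auto
      finally show ?case by simp
    qed
  qed
qed

text \<open>In the exact equation for the defect every mixed moment of u \<phi> is replaced by that
  of \<phi>^2 at the cost O(b'). Each such replacement is multiplied by b', b'' or the defect
  itself, all of size O(b'), so it falls into the error.\<close>

lemma energy: "(\<lambda>s. En s - (\<Lambda> * b s + (1 + \<Lambda>\<^sup>2) / 8 * bd 2 s / b s)) \<in> O[at_top](ge)"
proof -
  obtain \<phi> where d\<phi>: "decO 8 (\<lambda>_. 1) \<phi>" and close: "decO 8 g1 (\<lambda>s y. u s y - \<phi> s y)"
    and c: "\<forall>\<^sub>F s in at_top. continuous_on UNIV (\<phi> s)"
    and N: "(\<lambda>s. 1 / mom 0 (\<lambda>y. (\<phi> s y)\<^sup>2)) \<in> O[at_top](\<lambda>_. 1)" "\<forall>\<^sub>F s in at_top. 0 < mom 0 (\<lambda>y. (\<phi> s y)\<^sup>2)"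
    and ev: "\<forall>\<^sub>F s in at_top. mom 1 (\<lambda>y. (\<phi> s y)\<^sup>2) = 0 \<and> mom 2 (\<lambda>y. (\<phi> s y)\<^sup>2) = \<Lambda> / (2 * b s) * mom 0 (\<lambda>y. (\<phi> s y)\<^sup>2) \<and>
       mom 3 (\<lambda>y. (\<phi> s y)\<^sup>2) = 0 \<and> mom 4 (\<lambda>y. (\<phi> s y)\<^sup>2) = 3 / (8 * (b s)\<^sup>2) * (1 + \<Lambda>\<^sup>2) * mom 0 (\<lambda>y. (\<phi> s y)\<^sup>2)"
    and E: "(\<lambda>s. En s - \<Lambda> * b s) \<in> O[at_top](g1)"
    and orth: "\<forall>\<^sub>F s in at_top. (En s - \<Lambda> * b s) * mom 0 (\<lambda>y. u s y * \<phi> s y) = (LBINT y. ((A s y)\<^sup>2 - (b s)\<^sup>2 * y\<^sup>2) * (u s y * \<phi> s y))"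
    by (rule oscillator)
  define J where "J = (\<lambda>j s. mom j (\<lambda>y. u s y * \<phi> s y))"
  define m where "m = (\<lambda>j s. mom j (\<lambda>y. (\<phi> s y)\<^sup>2))"
  have cd: "\<forall>\<^sub>F s in at_top. continuous_on UNIV (\<lambda>y. u s y - \<phi> s y)"
    using cont_uv(1) c by eventually_elim (intro continuous_intros)
  have iJ: "\<forall>\<^sub>F s in at_top. integrable lborel (\<lambda>y. y ^ j * (u s y * \<phi> s y))" if "j \<le> 8" for j
    by (rule mom_integrable[OF decO_u(1) d\<phi> that cont_uv(1) c])
  have Jm: "(\<lambda>s. J j s - m j s) \<in> O[at_top](g1)" if j: "j \<le> 8" for j
  proof -
    have eq: "\<forall>\<^sub>F s in at_top. J j s - m j s = mom j (\<lambda>y. (u s y - \<phi> s y) * \<phi> s y)"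
      using iJ[OF j] mom_integrable[OF d\<phi> d\<phi> j c c]
      unfolding J_def m_def power2_eq_square left_diff_distrib by eventually_elim (rule mom_diff)
    show ?thesis unfolding landau_o.big.in_cong[OF eq] by (rule mom_bigo[OF close d\<phi> j cd c])
  qed
  \<comment> \<open>The square of b y + b' y^2/2 + b'' y^3/6 has leading terms b^2 y^2, b b' y^3 and
    (b b''/3) y^4; the other quartic term carries b'^2 and belongs to the remainder.\<close>
  define \<rho> where "\<rho> = (\<lambda>s y. (A s y)\<^sup>2 - (b s)\<^sup>2 * y\<^sup>2 - b s * bd 1 s * y ^ 3 - b s * bd 2 s / 3 * y ^ 4)"
  have d\<rho>: "decO (-3) ge \<rho>"
  proof -
    have 1: "decO (-3) ge (\<lambda>s y. (A s y - b s * y) * (A s y - b s * y))"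
      by (rule decO_mono[OF decO_mult[OF decO_A(1) decO_A(1)] _ g_bigo(2) g_nonneg(2)]) simp
    have 2: "decO (-3) ge (\<lambda>s y. 2 * (b s * y * (A s y - b s * y - bd 1 s / 2 * y\<^sup>2 - bd 2 s / 6 * y ^ 3)))"
      by (rule decO_1_mult[OF decO_const decO_1_mult[OF decO_A(6) decO_A(2) order_refl]]) simp
    have "\<rho> = (\<lambda>s y. (A s y - b s * y) * (A s y - b s * y) + 2 * (b s * y * (A s y - b s * y - bd 1 s / 2 * y\<^sup>2 - bd 2 s / 6 * y ^ 3)))"
      unfolding \<rho>_def by (intro ext) (simp add: algebra_simps power2_eq_square power3_eq_cube power4_eq_xxxx)
    thus ?thesis using decO_add[OF 1 2] by simp
  qed
  have d\<rho>': "decO 1 ge (\<lambda>s y. \<rho> s y * (u s y * \<phi> s y))"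
    by (rule decO_mult_1[OF d\<rho> decO_mult_1[OF decO_u(1) d\<phi> order_refl]]) simp
  have c\<rho>: "\<forall>\<^sub>F s in at_top. continuous_on UNIV (\<lambda>y. \<rho> s y * (u s y * \<phi> s y))"
    using cont_uv(1) c unfolding \<rho>_def by eventually_elim (intro continuous_intros A_cont)
  define I where "I = (\<lambda>s. LBINT y. \<rho> s y * (u s y * \<phi> s y))"
  have I: "I \<in> O[at_top](ge)" "\<forall>\<^sub>F s in at_top. integrable lborel (\<lambda>y. \<rho> s y * (u s y * \<phi> s y))"
    unfolding I_def by (rule decO_integral[OF d\<rho>' order_refl c\<rho>])+
  have j34: "3 \<le> (8::nat)" "4 \<le> (8::nat)" by simp_all
  \<comment> \<open>The third moment of \<phi> vanishes, which eliminates the term linear in b'; the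
    fourth moment turns b b''/3 into (1 + \<Lambda>^2) b''/(8b).\<close>
  have eq: "\<forall>\<^sub>F s in at_top. En s - (\<Lambda> * b s + (1 + \<Lambda>\<^sup>2) / 8 * bd 2 s / b s) =
     1 / m 0 s * (b s * (bd 1 s * (J 3 s - m 3 s)) + 1/3 * (b s * (bd 2 s * (J 4 s - m 4 s))) + I s - (En s - \<Lambda> * b s) * (J 0 s - m 0 s))"
    using orth ev N(2) I(2) iJ[OF j34(1)] iJ[OF j34(2)]
  proof eventually_elim
    case (elim s)
    let ?f = "\<lambda>y. u s y * \<phi> s y"
    have "(En s - \<Lambda> * b s) * J 0 s = (LBINT y. b s * bd 1 s * (y ^ 3 * ?f y) + b s * bd 2 s / 3 * (y ^ 4 * ?f y) + \<rho> s y * ?f y)"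
      unfolding J_def elim(1) by (intro Bochner_Integration.integral_cong) (auto simp: \<rho>_def algebra_simps)
    also have "\<dots> = b s * bd 1 s * J 3 s + b s * bd 2 s / 3 * J 4 s + I s"
      unfolding J_def mom_def I_def using elim(4-6) by simp
    finally have eq: "(En s - \<Lambda> * b s) * J 0 s = b s * bd 1 s * J 3 s + b s * bd 2 s / 3 * J 4 s + I s" .
    have m34: "m 3 s = 0" "b s * bd 2 s / 3 * m 4 s = (1 + \<Lambda>\<^sup>2) / 8 * bd 2 s / b s * m 0 s"
    proof -
      show "m 3 s = 0" using elim(2) by (simp add: m_def)
      have m4: "m 4 s = 3 / (8 * (b s)\<^sup>2) * (1 + \<Lambda>\<^sup>2) * m 0 s" using elim(2) by (simp add: m_def)
      show "b s * bd 2 s / 3 * m 4 s = (1 + \<Lambda>\<^sup>2) / 8 * bd 2 s / b s * m 0 s"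
        unfolding m4 using bs_pos[of s] by (simp add: field_simps power2_eq_square)
    qed
    have "b s * (bd 1 s * (J 3 s - m 3 s)) + 1/3 * (b s * (bd 2 s * (J 4 s - m 4 s))) + I s - (En s - \<Lambda> * b s) * (J 0 s - m 0 s)
       = b s * bd 1 s * J 3 s + b s * bd 2 s / 3 * J 4 s + I s - b s * bd 2 s / 3 * m 4 s - (En s - \<Lambda> * b s) * J 0 s + (En s - \<Lambda> * b s) * m 0 s"
      unfolding m34(1) by (simp add: algebra_simps)
    also have "\<dots> = (En s - (\<Lambda> * b s + (1 + \<Lambda>\<^sup>2) / 8 * bd 2 s / b s)) * m 0 s"
      unfolding m34(2) eq by (simp add: algebra_simps)
    finally show ?case using elim(3) by (simp add: m_def)
  qed
  have t: "(\<lambda>s. b s * (bd 1 s * (J 3 s - m 3 s))) \<in> O[at_top](ge)" "(\<lambda>s. b s * (bd 2 s * (J 4 s - m 4 s))) \<in> O[at_top](ge)"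
    "(\<lambda>s. (En s - \<Lambda> * b s) * (J 0 s - m 0 s)) \<in> O[at_top](ge)"
    by (rule bigo_1_mult[OF g_bigo(7) g1_mult[OF g_bigo(4) Jm]] bigo_1_mult[OF g_bigo(7) g1_mult[OF g_bigo(5) Jm]] g1_mult[OF E Jm], simp)+
  have N1: "(\<lambda>s. 1 / m 0 s) \<in> O[at_top](\<lambda>_. 1)" using N(1) unfolding m_def .
  show ?thesis
    unfolding landau_o.big.in_cong[OF eq]
    by (rule bigo_1_mult[OF N1 sum_in_bigo(2)[OF sum_in_bigo(1)[OF sum_in_bigo(1)[OF t(1) bigo_cmult[OF t(2)]] I(1)] t(3)]])
qed

text \<open>u^2 - \<phi>^2 factors into (u - \<phi>)(u + \<phi>), so each moment of u differs from
  that of \<phi> by O(b'); the odd ones of \<phi> are 0.\<close>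

lemma u_moments: "(\<lambda>s. mom 1 (\<lambda>y. (u s y)\<^sup>2)) \<in> O[at_top](g1)" "(\<lambda>s. mom 3 (\<lambda>y. (u s y)\<^sup>2)) \<in> O[at_top](g1)"
    "(\<lambda>s. mom 2 (\<lambda>y. (u s y)\<^sup>2) - \<Lambda> / (2 * b s) * mom 0 (\<lambda>y. (u s y)\<^sup>2)) \<in> O[at_top](g1)"
proof -
  obtain \<phi> where d\<phi>: "decO 8 (\<lambda>_. 1) \<phi>" and close: "decO 8 g1 (\<lambda>s y. u s y - \<phi> s y)"
    and c: "\<forall>\<^sub>F s in at_top. continuous_on UNIV (\<phi> s)"
    and ev: "\<forall>\<^sub>F s in at_top. mom 1 (\<lambda>y. (\<phi> s y)\<^sup>2) = 0 \<and> mom 2 (\<lambda>y. (\<phi> s y)\<^sup>2) = \<Lambda> / (2 * b s) * mom 0 (\<lambda>y. (\<phi> s y)\<^sup>2) \<and>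
       mom 3 (\<lambda>y. (\<phi> s y)\<^sup>2) = 0 \<and> mom 4 (\<lambda>y. (\<phi> s y)\<^sup>2) = 3 / (8 * (b s)\<^sup>2) * (1 + \<Lambda>\<^sup>2) * mom 0 (\<lambda>y. (\<phi> s y)\<^sup>2)"
    by (rule oscillator)
  define m where "m = (\<lambda>j s. mom j (\<lambda>y. (\<phi> s y)\<^sup>2))"
  define m' where "m' = (\<lambda>j s. mom j (\<lambda>y. (u s y)\<^sup>2))"
  have cd: "\<forall>\<^sub>F s in at_top. continuous_on UNIV (\<lambda>y. u s y - \<phi> s y)" "\<forall>\<^sub>F s in at_top. continuous_on UNIV (\<lambda>y. u s y + \<phi> s y)"
    using eventually_conj[OF cont_uv(1) c] by (auto elim!: eventually_mono intro!: continuous_intros)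
  have mm: "(\<lambda>s. m' j s - m j s) \<in> O[at_top](g1)" if j: "j \<le> 8" for j
  proof -
    have eq: "\<forall>\<^sub>F s in at_top. m' j s - m j s = mom j (\<lambda>y. (u s y - \<phi> s y) * (u s y + \<phi> s y))"
      using mom_integrable[OF decO_u(1) decO_u(1) j cont_uv(1) cont_uv(1)] mom_integrable[OF d\<phi> d\<phi> j c c]
    proof eventually_elim
      case (elim s)
      have "(u s y - \<phi> s y) * (u s y + \<phi> s y) = u s y * u s y - \<phi> s y * \<phi> s y" for y by (simp add: algebra_simps)
      thus ?case unfolding m'_def m_def power2_eq_square using mom_diff[OF elim] by simp
    qed
    show ?thesis unfolding landau_o.big.in_cong[OF eq] by (rule mom_bigo[OF close decO_add[OF decO_u(1) d\<phi>] j cd])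
  qed
  have b2: "(\<lambda>s. \<Lambda> / 2 * (1 / b s)) \<in> O[at_top](\<lambda>_. 1)" by (rule bigo_cmult[OF g_bigo(8)])
  have "\<forall>\<^sub>F s in at_top. m' 1 s = m' 1 s - m 1 s" "\<forall>\<^sub>F s in at_top. m' 3 s = m' 3 s - m 3 s"
    "\<forall>\<^sub>F s in at_top. m' 2 s - \<Lambda> / (2 * b s) * m' 0 s = (m' 2 s - m 2 s) - \<Lambda> / 2 * (1 / b s) * (m' 0 s - m 0 s)"
    using ev by (auto elim!: eventually_mono simp: m_def algebra_simps)
  note eq = this[THEN landau_o.big.in_cong]
  show "(\<lambda>s. mom 1 (\<lambda>y. (u s y)\<^sup>2)) \<in> O[at_top](g1)" using eq(1) mm[of 1] by (simp add: m'_def)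
  show "(\<lambda>s. mom 3 (\<lambda>y. (u s y)\<^sup>2)) \<in> O[at_top](g1)" using eq(2) mm[of 3] by (simp add: m'_def)
  have "(\<lambda>s. m' 2 s - \<Lambda> / (2 * b s) * m' 0 s) \<in> O[at_top](g1)"
    unfolding eq(3) by (intro sum_in_bigo mm bigo_1_mult[OF b2]) simp_all
  thus "(\<lambda>s. mom 2 (\<lambda>y. (u s y)\<^sup>2) - \<Lambda> / (2 * b s) * mom 0 (\<lambda>y. (u s y)\<^sup>2)) \<in> O[at_top](g1)"
    unfolding m'_def .
qed

definition Gd :: "real \<Rightarrow> real" where "Gd s = (LBINT y. 2 * (0 - A s y) * (u s y)\<^sup>2) / (LBINT y. (u s y)\<^sup>2)"
definition R :: "real \<Rightarrow> real \<Rightarrow> real" where "R s y = b (s + y) - b s - bd 1 s * y - bd 2 s / 2 * y\<^sup>2"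
text \<open>Remainder of A (b(s + y) - b(s)) after the product of b y with b' y + b'' y^2/2; the
  neglected part of A already carries a second factor b'.\<close>

definition S :: "real \<Rightarrow> real \<Rightarrow> real" where
  "S s y = A s y * (b (s + y) - b s) - b s * bd 1 s * y\<^sup>2 - b s * bd 2 s / 2 * y ^ 3"

lemma decO_R: "decO (-3) ge R"
  using decO_le[OF decO_b(2), of "-3"] unfolding R_def by simp

lemma decO_S: "decO (-3) ge S"
proof -
  have 1: "decO (-3) ge (\<lambda>s y. (A s y - b s * y) * (b (s + y) - b s))"
    by (rule decO_mono[OF decO_mult[OF decO_A(1) decO_b(1)] _ g_bigo(2) g_nonneg(2)]) simp
  have 2: "decO (-3) ge (\<lambda>s y. b s * y * (b (s + y) - b s - bd 1 s * y - bd 2 s / 2 * y\<^sup>2))"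
    by (rule decO_1_mult[OF decO_A(6) decO_b(2)]) simp
  have "S = (\<lambda>s y. (A s y - b s * y) * (b (s + y) - b s) + b s * y * (b (s + y) - b s - bd 1 s * y - bd 2 s / 2 * y\<^sup>2))"
    unfolding S_def by (intro ext) (simp add: algebra_simps power2_eq_square power3_eq_cube)
  thus ?thesis using decO_add[OF 1 2] by simp
qed

lemma RS_cont: "continuous_on UNIV (R s)" "continuous_on UNIV (S s)"
  unfolding R_def S_def by (intro continuous_intros b_shift A_cont)+

lemma
  assumes F: "decO (-3) ge F" and cF: "\<And>s. continuous_on UNIV (F s)" and H: "decO 8 (\<lambda>_. 1) H" and cH: "\<forall>\<^sub>F s in at_top. continuous_on UNIV (H s)"
  shows remainder_bigo: "(\<lambda>s. LBINT y. F s y * (u s y * H s y)) \<in> O[at_top](ge)"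
    and remainder_integrable: "\<forall>\<^sub>F s in at_top. integrable lborel (\<lambda>y. F s y * (u s y * H s y))"
proof -
  have d: "decO 1 ge (\<lambda>s y. F s y * (u s y * H s y))"
    by (rule decO_mult_1[OF F decO_mult_1[OF decO_u(1) H order_refl]]) simp
  have c: "\<forall>\<^sub>F s in at_top. continuous_on UNIV (\<lambda>y. F s y * (u s y * H s y))"
    using cont_uv(1) cH by eventually_elim (intro continuous_intros cF)
  show "(\<lambda>s. LBINT y. F s y * (u s y * H s y)) \<in> O[at_top](ge)" by (rule decO_integral(1)[OF d order_refl c])
  show "\<forall>\<^sub>F s in at_top. integrable lborel (\<lambda>y. F s y * (u s y * H s y))" by (rule decO_integral(2)[OF d order_refl c])
qed

lemma state_uniform:
  obtains K where "\<forall>\<^sub>F s in at_top. bound (\<lambda>y. pot s 0 y - En s) (u s) (v s) \<and> adm \<mu> M (\<lambda>y. pot s 0 y - En s) \<and>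
    dec 8 K (u s) \<and> dec 8 K (v s) \<and> mom 0 (\<lambda>y. (u s y)\<^sup>2) \<noteq> 0"
proof -
  have e8: "(0::real) \<le> 8" by simp
  obtain K where K: "1 \<le> K" "\<And>p u v. adm \<mu> M p \<Longrightarrow> bound p u v \<Longrightarrow> dec 8 K u \<and> dec 8 K v"
    by (rule bound_dec[OF constants(3,4) e8], erule that, assumption)
  have "\<forall>\<^sub>F s in at_top. bound (\<lambda>y. pot s 0 y - En s) (u s) (v s) \<and> adm \<mu> M (\<lambda>y. pot s 0 y - En s) \<and>
    dec 8 K (u s) \<and> dec 8 K (v s) \<and> mom 0 (\<lambda>y. (u s y)\<^sup>2) \<noteq> 0"
    using ev_good norm_u(2)
  proof eventually_elim
    case (elim s)
    with K(2)[of "\<lambda>y. pot s 0 y - En s" "u s" "v s"] show ?case by simp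
  qed
  thus thesis by (rule that)
qed

text \<open>The virial identity trades A, of order one, for A (b(s + y) - b(s)), of order b'. The
  second moment \<Lambda>/(2b) then gives the coefficient, and the third moment, itself O(b'), meets
  only b''.\<close>

lemma first_derivative: "(\<lambda>s. Gd s - \<Lambda> * bd 1 s / b s) \<in> O[at_top](ge)"
proof -
  obtain K where st: "\<forall>\<^sub>F s in at_top. bound (\<lambda>y. pot s 0 y - En s) (u s) (v s) \<and> adm \<mu> M (\<lambda>y. pot s 0 y - En s) \<and>
    dec 8 K (u s) \<and> dec 8 K (v s) \<and> mom 0 (\<lambda>y. (u s y)\<^sup>2) \<noteq> 0" by (rule state_uniform)
  define m where "m = (\<lambda>j s. mom j (\<lambda>y. (u s y)\<^sup>2))"
  define I where "I = (\<lambda>s. LBINT y. S s y * (u s y)\<^sup>2)"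
  have j: "2 \<le> (8::nat)" "3 \<le> (8::nat)" by simp_all
  have eq: "\<forall>\<^sub>F s in at_top. Gd s - \<Lambda> * bd 1 s / b s
     = 1 / m 0 s * (2 * (bd 1 s * (m 2 s - \<Lambda> / (2 * b s) * m 0 s)) + bd 2 s * m 3 s + 2 * (1 / b s * I s))"
    using st remainder_integrable[OF decO_S RS_cont(2) decO_u(1) cont_uv(1)]
      mom_integrable[OF decO_u(1) decO_u(1) j(1) cont_uv(1) cont_uv(1)] mom_integrable[OF decO_u(1) decO_u(1) j(2) cont_uv(1) cont_uv(1)]
  proof eventually_elim
    case (elim s)
    have bu: "bound (\<lambda>y. pot s 0 y - En s) (u s) (v s)" and d: "dec 8 K (u s)" "dec 8 K (v s)" and m0: "m 0 s \<noteq> 0"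
      using elim(1) by (auto simp: m_def)
    note cu = sol_cont(1)[OF boundD(1)[OF bu]]
    have uu: "dec 16 (K * K) (\<lambda>y. (u s y)\<^sup>2)" using dec_mult[OF d(1) d(1)] by (simp add: power2_eq_square)
    have i1: "integrable lborel (\<lambda>y. A s y * (u s y)\<^sup>2)"
      by (rule integrable_dec[OF _ dec_mult[OF A_dec uu]]) (auto intro!: continuous_intros A_cont cu)
    have i2: "integrable lborel (\<lambda>y. A s y * (b (s + y) * (u s y)\<^sup>2))"
      by (rule integrable_dec[OF _ dec_mult[OF A_dec dec_mult[OF b_shift(2) uu]]]) (auto intro!: continuous_intros A_cont cu b_shift)
    \<comment> \<open>The leading 0 stands for the virial integral of A b(s + y) u^2.\<close>
    have "0 - b s * (LBINT y. A s y * (u s y)\<^sup>2) = (LBINT y. A s y * (b (s + y) * (u s y)\<^sup>2) - b s * (A s y * (u s y)\<^sup>2))"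
      using i1 i2 state_virial[OF boundD(1)[OF bu] d] by simp
    also have "\<dots> = (LBINT y. b s * bd 1 s * (y ^ 2 * (u s y)\<^sup>2) + b s * bd 2 s / 2 * (y ^ 3 * (u s y)\<^sup>2) + S s y * (u s y)\<^sup>2)"
      by (intro Bochner_Integration.integral_cong) (auto simp: S_def algebra_simps)
    also have "\<dots> = b s * bd 1 s * m 2 s + b s * bd 2 s / 2 * m 3 s + I s"
      using elim(2-4) unfolding m_def mom_def I_def power2_eq_square[symmetric] by simp
    finally have X: "b s * (LBINT y. A s y * (u s y)\<^sup>2) = - (b s * bd 1 s * m 2 s + b s * bd 2 s / 2 * m 3 s + I s)" by simp
    have "(LBINT y. 2 * (0 - A s y) * (u s y)\<^sup>2) = (LBINT y. - 2 * (A s y * (u s y)\<^sup>2))"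
      by (intro Bochner_Integration.integral_cong) auto
    hence "Gd s = - 2 * (LBINT y. A s y * (u s y)\<^sup>2) / m 0 s" unfolding Gd_def m_def mom_0 by simp
    also have "\<dots> = - 2 / (b s * m 0 s) * (b s * (LBINT y. A s y * (u s y)\<^sup>2))" using bs_pos[of s] by simp
    finally show ?case unfolding X using bs_pos[of s] m0 by (simp add: field_simps)
  qed
  have N: "(\<lambda>s. 1 / m 0 s) \<in> O[at_top](\<lambda>_. 1)" using norm_u(1) unfolding m_def .
  have I: "I \<in> O[at_top](ge)"
    using remainder_bigo[OF decO_S RS_cont(2) decO_u(1) cont_uv(1)] unfolding I_def power2_eq_square .
  have mo: "(\<lambda>s. m 2 s - \<Lambda> / (2 * b s) * m 0 s) \<in> O[at_top](g1)" "(\<lambda>s. m 3 s) \<in> O[at_top](g1)" using u_moments(3,2) unfolding m_def .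
  show ?thesis
    unfolding landau_o.big.in_cong[OF eq]
    by (rule bigo_1_mult[OF N sum_in_bigo(1)[OF sum_in_bigo(1)[OF bigo_cmult[OF g1_mult[OF g_bigo(4) mo(1)]] g1_mult[OF g_bigo(5) mo(2)]]
      bigo_cmult[OF bigo_1_mult[OF g_bigo(8) I]]]])
qed

lemma Gd_bigo: "Gd \<in> O[at_top](g1)"
proof -
  have "(\<lambda>s. (Gd s - \<Lambda> * bd 1 s / b s) + \<Lambda> * (1 / b s * bd 1 s)) \<in> O[at_top](g1)"
    by (rule sum_in_bigo(1)[OF landau_o.big_trans[OF first_derivative g_bigo(3)] bigo_cmult[OF bigo_1_mult[OF g_bigo(8,4)]]])
  thus ?thesis by simp
qed

definition ff :: "real \<Rightarrow> real \<Rightarrow> real" where "ff s y = (Gd s - 2 / b s * (A s y * (b (s + y) - b s))) * u s y"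

lemma decO_ff: "decO 2 g1 ff"
proof -
  have "decO 0 (\<lambda>_. 1) (\<lambda>s y. 2 * (1 / b s))" by (rule decO_scalar[OF bigo_cmult[OF g_bigo(8)]]) simp
  from decO_1_mult[OF this decO_1_mult[OF decO_A(3) decO_b(1) order_refl], of "-2"]
  have 1: "decO (-2) g1 (\<lambda>s y. 2 / b s * (A s y * (b (s + y) - b s)))" by simp
  have 2: "decO (-2) g1 (\<lambda>s y. Gd s)" by (rule decO_le[OF decO_scalar[OF Gd_bigo g_nonneg(1)]]) simp
  show ?thesis unfolding ff_def by (rule decO_mult_1[OF decO_diff[OF 2 1] decO_u(1)]) simp
qed

text \<open>The slope drops out because u v integrates to 0; integration by parts turns the moments
  of u v of order 2 and 3 into -1 and -3/2 times those of u^2 of order 1 and 2.\<close>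

lemma ff_v: "\<forall>\<^sub>F s in at_top. (LBINT y. ff s y * v s y) = 2 * bd 1 s * mom 1 (\<lambda>y. (u s y)\<^sup>2) + 3 / 2 * bd 2 s * mom 2 (\<lambda>y. (u s y)\<^sup>2)
    - 2 / b s * (LBINT y. S s y * (u s y * v s y))"
proof -
  obtain K where st: "\<forall>\<^sub>F s in at_top. bound (\<lambda>y. pot s 0 y - En s) (u s) (v s) \<and> adm \<mu> M (\<lambda>y. pot s 0 y - En s) \<and>
    dec 8 K (u s) \<and> dec 8 K (v s) \<and> mom 0 (\<lambda>y. (u s y)\<^sup>2) \<noteq> 0" by (rule state_uniform)
  have j: "0 \<le> (8::nat)" "2 \<le> (8::nat)" "3 \<le> (8::nat)" by simp_all
  note im = mom_integrable[OF decO_u(1) decO_u(2) _ cont_uv]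
  show ?thesis
    using st remainder_integrable[OF decO_S RS_cont(2) decO_u(2) cont_uv(2)] im[OF j(1)] im[OF j(2)] im[OF j(3)]
  proof eventually_elim
    case (elim s)
    have bu: "bound (\<lambda>y. pot s 0 y - En s) (u s) (v s)" and d: "dec 8 K (u s)" "dec 8 K (v s)"
      using elim(1) by auto
    note s = boundD(1)[OF bu]
    have m1: "(LBINT y. y ^ 2 * (u s y * v s y)) = - mom 1 (\<lambda>y. (u s y)\<^sup>2)"
      using state_ibp[OF s d, of 1] by (simp add: mom_def power2_eq_square)
    have m2: "(LBINT y. y ^ 3 * (u s y * v s y)) = - 3 / 2 * mom 2 (\<lambda>y. (u s y)\<^sup>2)"
      using state_ibp[OF s d, of 2] by (simp add: mom_def)
    have m0: "(LBINT y. y ^ 0 * (u s y * v s y)) = 0" using state_ibp_0[OF s d] by simp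
    have "(LBINT y. ff s y * v s y) = (LBINT y. Gd s * (y ^ 0 * (u s y * v s y)) - 2 * bd 1 s * (y ^ 2 * (u s y * v s y))
        - bd 2 s * (y ^ 3 * (u s y * v s y)) - 2 / b s * (S s y * (u s y * v s y)))"
    proof (intro Bochner_Integration.integral_cong refl)
      fix y
      have 1: "A s y * (b (s + y) - b s) = S s y + b s * (bd 1 s * y\<^sup>2 + bd 2 s / 2 * y ^ 3)"
        by (simp add: S_def algebra_simps)
      have 2: "2 / b s * (x + b s * z) = 2 / b s * x + 2 * z" for x z using bs_pos[of s] by (simp add: distrib_left)
      show "ff s y * v s y = Gd s * (y ^ 0 * (u s y * v s y)) - 2 * bd 1 s * (y ^ 2 * (u s y * v s y))
        - bd 2 s * (y ^ 3 * (u s y * v s y)) - 2 / b s * (S s y * (u s y * v s y))"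
        unfolding ff_def 1 2 by (simp add: algebra_simps)
    qed
    also have "\<dots> = Gd s * (LBINT y. y ^ 0 * (u s y * v s y)) - 2 * bd 1 s * (LBINT y. y ^ 2 * (u s y * v s y))
        - bd 2 s * (LBINT y. y ^ 3 * (u s y * v s y)) - 2 / b s * (LBINT y. S s y * (u s y * v s y))"
      using elim(2-5) by (simp del: power_0)
    finally show ?case unfolding m0 m1 m2 by simp
  qed
qed

text \<open>Differentiating the eigenvalue equation, \<open>D\<close> plus \<open>u'/b\<close> equals a multiple of \<open>u\<close> up to \<open>O(b')\<close>, since \<open>u\<close> is
  nearly translated along with \<open>x\<^sub>k\<close>; the identity for \<open>E''\<close> is quadratic in that small remainder.\<close>

lemma second_derivative:
  assumes ev: "\<forall>\<^sub>F s in at_top. sol (\<lambda>y. pot s 0 y - En s) (\<lambda>y. (2 * A s y + Gd s) * u s y) (D s) (DE s) \<and> (\<exists>B. dec 2 B (D s))"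
  shows "(\<lambda>s. 2 - 4 / (LBINT y. (u s y)\<^sup>2) * (LBINT y. A s y * (u s y * D s y)) - 2 * Gd s / (LBINT y. (u s y)\<^sup>2) * (LBINT y. u s y * D s y)
     - \<Lambda> * bd 2 s / (b s)\<^sup>2) \<in> O[at_top](ge)" (is "(\<lambda>s. ?X s - _) \<in> _")
proof -
  define m where "m = (\<lambda>j s. mom j (\<lambda>y. (u s y)\<^sup>2))"
  define X where "X = (\<lambda>s. ?X s)"
  define Ic where "Ic = (\<lambda>s. LBINT y. (b (s + y) - b s) * (u s y)\<^sup>2)"
  define Iv where "Iv = (\<lambda>s. LBINT y. ff s y * v s y)"
  define IR where "IR = (\<lambda>s. LBINT y. R s y * (u s y)\<^sup>2)"
  define IS where "IS = (\<lambda>s. LBINT y. S s y * (u s y * v s y))"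
  \<comment> \<open>Norm times what is left of the curvature after the two explicit integrals; by
    the identity it is -2 times the integral of the source against the remainder w.\<close>
  define W where "W = (\<lambda>s. m 0 s * (X s + 2 / (b s * m 0 s) * Ic s - 2 / (b s * m 0 s) * Iv s))"
  obtain K where st: "\<forall>\<^sub>F s in at_top. bound (\<lambda>y. pot s 0 y - En s) (u s) (v s) \<and> adm \<mu> M (\<lambda>y. pot s 0 y - En s) \<and>
    dec 8 K (u s) \<and> dec 8 K (v s) \<and> mom 0 (\<lambda>y. (u s y)\<^sup>2) \<noteq> 0" by (rule state_uniform)
  have e2: "(1::real) \<le> 2" by simp
  obtain C where C: "1 \<le> C" and fred: "\<And>p u v f D E B C0. adm \<mu> M p \<Longrightarrow> bound p u v \<Longrightarrow> sol p f D E \<Longrightarrow> dec 2 B f \<Longrightarrow> dec 1 C0 D \<Longrightarrow> dec 0 C0 E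
       \<Longrightarrow> D 0 * u 0 + E 0 * v 0 = 0 \<Longrightarrow> dec 2 (C * B) D"
    by (rule fredholm_estimate[OF constants(3,4) e2], erule that, assumption)
  obtain Cf where Cf: "0 \<le> Cf" "\<forall>\<^sub>F s in at_top. dec 2 (Cf * g1 s) (ff s)" using decO_ff unfolding decO_def by blast
  have "\<forall>\<^sub>F s in at_top. norm (W s) \<le> 14 * (Cf * (C * Cf)) * norm (g1 s * g1 s)"
    using st ev Cf(2)
  proof eventually_elim
    case (elim s)
    have bu: "bound (\<lambda>y. pot s 0 y - En s) (u s) (v s)" and au: "adm \<mu> M (\<lambda>y. pot s 0 y - En s)"
      and d: "dec 8 K (u s)" "dec 8 K (v s)" and N: "(LBINT y. (u s y)\<^sup>2) \<noteq> 0"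
      using elim(1) by (auto simp: mom_0)
    from elim(2) obtain B where sD: "sol (\<lambda>y. pot s 0 y - En s) (\<lambda>y. (2 * A s y + Gd s) * u s y) (D s) (DE s)" and dD: "dec 2 B (D s)" by blast
    obtain w w' B' where w: "sol (\<lambda>y. pot s 0 y - En s) (ff s) w w'" "dec 1 B' w" "dec 0 B' w'" "w 0 * u s 0 + w' 0 * v s 0 = 0"
      and Xw: "?X s = - (2 / (b s * (LBINT y. (u s y)\<^sup>2))) * (LBINT y. (b (s + y) - b s) * (u s y)\<^sup>2) - 2 / (LBINT y. (u s y)\<^sup>2) * (LBINT y. ff s y * w y)
        + 2 / (b s * (LBINT y. (u s y)\<^sup>2)) * (LBINT y. ff s y * v s y)"
      by (rule second_derivative_identity[OF bu au constants(3) d N sD[unfolded Gd_def] dD, folded Gd_def, folded ff_def])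
    \<comment> \<open>The identity supplies w with qualitative bounds only; the Fredholm estimate
      improves them to the size of the source, which makes the integral quadratic in b'.\<close>
    have dw: "dec 2 (C * (Cf * g1 s)) w" by (rule fred[OF au bu w(1) elim(3) w(2-4)])
    have cf: "continuous_on UNIV (ff s)"
      unfolding ff_def by (intro continuous_intros A_cont b_shift sol_cont(1)[OF boundD(1)[OF bu]])
    have I: "\<bar>LBINT y. ff s y * w y\<bar> \<le> 7 * (Cf * g1 s * (C * (Cf * g1 s)))"
      by (rule integral_dec_le[OF _ dec_mult[OF elim(3) dw]]) (auto intro!: continuous_intros cf sol_cont(1)[OF w(1)])
    have "X s = - (2 / (b s * m 0 s)) * Ic s - 2 / m 0 s * (LBINT y. ff s y * w y) + 2 / (b s * m 0 s) * Iv s"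
      unfolding X_def Ic_def Iv_def m_def mom_0 by (rule Xw)
    hence "W s = - 2 * (LBINT y. ff s y * w y)" using N unfolding W_def m_def mom_0 by (simp add: right_diff_distrib)
    hence "\<bar>W s\<bar> = 2 * \<bar>LBINT y. ff s y * w y\<bar>" by (simp add: abs_mult)
    also have "\<dots> \<le> 14 * (Cf * (C * Cf)) * (g1 s * g1 s)" using I by (simp add: algebra_simps)
    finally show ?case by (simp add: g1_def)
  qed
  hence "W \<in> O[at_top](\<lambda>s. g1 s * g1 s)" by (rule bigoI)
  hence W: "W \<in> O[at_top](ge)" using g_bigo(2) by (rule landau_o.big_trans)
  have j: "1 \<le> (8::nat)" "2 \<le> (8::nat)" by simp_all
  note im = mom_integrable[OF decO_u(1) decO_u(1) _ cont_uv(1) cont_uv(1)]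
  \<comment> \<open>The two explicit integrals contribute -1 and +3 times b'' m_2/b; the sum 2 b''
    m_2/b equals \<Lambda> b''/b^2 times the norm once m_2 is replaced by its leading part \<Lambda>
    m_0/(2b).\<close>
  have eq: "\<forall>\<^sub>F s in at_top. ?X s - \<Lambda> * bd 2 s / (b s)\<^sup>2 = 1 / m 0 s * (W s + 2 * (1 / b s * (bd 1 s * m 1 s))
      + 2 * (1 / b s * (bd 2 s * (m 2 s - \<Lambda> / (2 * b s) * m 0 s))) - 2 * (1 / b s * IR s) - 4 * (1 / b s * (1 / b s * IS s)))"
    using st ff_v im[OF j(1)] im[OF j(2)] remainder_integrable[OF decO_R RS_cont(1) decO_u(1) cont_uv(1)]
  proof eventually_elim
    case (elim s)
    have m0: "m 0 s \<noteq> 0" using elim(1) by (simp add: m_def)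
    have b0: "b s \<noteq> 0" using bs_pos[of s] by simp
    have Iv: "Iv s = 2 * bd 1 s * m 1 s + 3 / 2 * bd 2 s * m 2 s - 2 / b s * IS s"
      using elim(2) unfolding Iv_def m_def IS_def .
    have "Ic s = (LBINT y. bd 1 s * (y ^ 1 * (u s y)\<^sup>2) + bd 2 s / 2 * (y ^ 2 * (u s y)\<^sup>2) + R s y * (u s y)\<^sup>2)"
      unfolding Ic_def by (intro Bochner_Integration.integral_cong) (auto simp: R_def algebra_simps)
    also have "\<dots> = bd 1 s * m 1 s + bd 2 s / 2 * m 2 s + IR s"
      using elim(3-5) unfolding m_def mom_def IR_def power2_eq_square[symmetric] by (simp del: power_one_right)
    finally have Ic: "Ic s = bd 1 s * m 1 s + bd 2 s / 2 * m 2 s + IR s" .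
    have Xs: "X s = 1 / m 0 s * (W s - 2 / b s * Ic s + 2 / b s * Iv s)"
      unfolding W_def using m0 by (simp add: algebra_simps)
    have "X s - \<Lambda> * bd 2 s / (b s)\<^sup>2 = 1 / m 0 s * (W s + 2 * (1 / b s * (bd 1 s * m 1 s))
      + 2 * (1 / b s * (bd 2 s * (m 2 s - \<Lambda> / (2 * b s) * m 0 s))) - 2 * (1 / b s * IR s) - 4 * (1 / b s * (1 / b s * IS s)))"
    proof -
      have id: "q * (W s - 2 * r * (x + y / 2 + p) + 2 * r * (2 * x + 3 / 2 * y - 2 * r * z)) - \<Lambda> * B * r\<^sup>2
        = q * (W s + 2 * (r * x) + 2 * (r * (y - B * (\<Lambda> / 2 * r * m 0 s))) - 2 * (r * p) - 4 * (r * (r * z))) + \<Lambda> * B * r\<^sup>2 * (q * m 0 s - 1)"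
        for q r x y z p B by (simp add: algebra_simps power2_eq_square)
      have "1 / m 0 s * m 0 s - 1 = 0" using m0 by simp
      with id[of "1 / m 0 s" "1 / b s" "bd 1 s * m 1 s" "bd 2 s * m 2 s" "IR s" "IS s" "bd 2 s"]
      show ?thesis unfolding Xs Ic Iv by (simp add: right_diff_distrib mult.assoc power_divide)
    qed
    thus ?case unfolding X_def .
  qed
  have N: "(\<lambda>s. 1 / m 0 s) \<in> O[at_top](\<lambda>_. 1)" using norm_u(1) unfolding m_def .
  have IR: "IR \<in> O[at_top](ge)"
    using remainder_bigo[OF decO_R RS_cont(1) decO_u(1) cont_uv(1)] unfolding IR_def power2_eq_square .
  have IS: "IS \<in> O[at_top](ge)"
    using remainder_bigo[OF decO_S RS_cont(2) decO_u(2) cont_uv(2)] unfolding IS_def .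
  have mo: "(\<lambda>s. m 1 s) \<in> O[at_top](g1)" "(\<lambda>s. m 2 s - \<Lambda> / (2 * b s) * m 0 s) \<in> O[at_top](g1)" using u_moments(1,3) unfolding m_def .
  note b1 = bigo_1_mult[OF g_bigo(8)]
  have t1: "(\<lambda>s. 2 * (1 / b s * (bd 1 s * m 1 s))) \<in> O[at_top](ge)"
    by (rule bigo_cmult, rule b1, rule g1_mult[OF g_bigo(4) mo(1)])
  have t2: "(\<lambda>s. 2 * (1 / b s * (bd 2 s * (m 2 s - \<Lambda> / (2 * b s) * m 0 s)))) \<in> O[at_top](ge)"
    by (rule bigo_cmult, rule b1, rule g1_mult[OF g_bigo(5) mo(2)])
  have t3: "(\<lambda>s. 2 * (1 / b s * IR s)) \<in> O[at_top](ge)" by (rule bigo_cmult, rule b1, rule IR)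
  have t4: "(\<lambda>s. 4 * (1 / b s * (1 / b s * IS s))) \<in> O[at_top](ge)" by (rule bigo_cmult, rule b1, rule b1, rule IS)
  show ?thesis
    unfolding landau_o.big.in_cong[OF eq]
    by (rule bigo_1_mult[OF N], rule sum_in_bigo(2), rule sum_in_bigo(2), rule sum_in_bigo(1), rule sum_in_bigo(1), rule W, rule t1, rule t2, rule t3, rule t4)
qed

end

section \<open>From eigenstates back to the band functions\<close>

lemma deriv_shift: "deriv (\<lambda>x. f (z + x)) = (\<lambda>x::real. deriv f (z + x))"
  \<comment> \<open>Both sides choose from the same set of candidate derivatives, so no
    differentiability is required.\<close>
  using DERIV_shift[of f _ _ z] by (simp add: deriv_def add.commute fun_eq_iff)

definition slope :: "(real \<Rightarrow> real) \<Rightarrow> (real \<Rightarrow> real) \<Rightarrow> real" where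
  "slope a u = (LBINT y. 2 * (0 - a y) * (u y)\<^sup>2) / (LBINT y. (u y)\<^sup>2)"

definition curvature :: "(real \<Rightarrow> real) \<Rightarrow> (real \<Rightarrow> real) \<Rightarrow> (real \<Rightarrow> real) \<Rightarrow> real" where
  "curvature a u D = 2 - 4 / (LBINT y. (u y)\<^sup>2) * (LBINT y. a y * (u y * D y)) - 2 * slope a u / (LBINT y. (u y)\<^sup>2) * (LBINT y. u y * D y)"

lemma (in band_family) e_derivatives:
  "\<exists>u v D DE. bound (\<lambda>y. pot s 0 y - e 0) u v \<and> deriv e 0 = slope (A s) u \<and>
     (sol (\<lambda>y. pot s 0 y - e 0) (\<lambda>y. (2 * A s y + slope (A s) u) * u y) D DE \<and> (\<exists>B. dec 2 B D)) \<and>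
     deriv (deriv e) 0 = curvature (A s) u D"
proof -
  have 0: "\<bar>0::real\<bar> < 1" by simp
  have P0: "P 0 = (\<lambda>y. pot s 0 y - e 0)" by (simp add: P_def fun_eq_iff)
  have G0: "G 0 = slope (A s) (U 0)" unfolding G_def N_def slope_def ..
  obtain D E B' where D: "sol (P 0) f0 D E" "dec 2 B' D"
    and G: "(G has_real_derivative 2 - 4 / N 0 * (LBINT y. A s y * (U 0 y * D y)) - 2 * G 0 / N 0 * (LBINT y. U 0 y * D y)) (at 0)"
    by (rule G_deriv)
  have f0: "f0 = (\<lambda>y. (2 * A s y + slope (A s) (U 0)) * U 0 y)" by (simp add: f0_def G0 fun_eq_iff)
  have e: "deriv e \<kappa> = G \<kappa>" if "\<bar>\<kappa>\<bar> < 1" for \<kappa> by (rule DERIV_imp_deriv[OF e_deriv[OF that]])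
  have "(deriv e has_real_derivative 2 - 4 / N 0 * (LBINT y. A s y * (U 0 y * D y)) - 2 * G 0 / N 0 * (LBINT y. U 0 y * D y)) (at 0)"
    by (rule has_field_derivative_transform_within_open[OF G, of "{-1<..<1}"]) (auto simp: e)
  hence "deriv (deriv e) 0 = curvature (A s) (U 0) D" unfolding G0 N_def curvature_def by (rule DERIV_imp_deriv)
  thus ?thesis using bound_U[OF 0] D e[OF 0] unfolding P0 f0 G0 by blast
qed

text \<open>The implication permits a choice for every s although the data exist only for large
  s.\<close>

lemma choice4: "\<exists>U V D E. \<forall>s. (\<exists>u v d e. Q s u v d e) \<longrightarrow> Q s (U s) (V s) (D s) (E s)"
proof -
  have "\<exists>q. (\<exists>u v d e. Q s u v d e) \<longrightarrow> Q s (fst q) (fst (snd q)) (fst (snd (snd q))) (snd (snd (snd q)))" for s by auto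
  then obtain q where "\<And>s. (\<exists>u v d e. Q s u v d e) \<longrightarrow> Q s (fst (q s)) (fst (snd (q s))) (fst (snd (snd (q s)))) (snd (snd (snd (q s))))"
    using choice[of "\<lambda>s q. (\<exists>u v d e. Q s u v d e) \<longrightarrow> Q s (fst q) (fst (snd q)) (fst (snd (snd q))) (snd (snd (snd q)))"] by blast
  thus ?thesis
    by (intro exI[of _ "\<lambda>s. fst (q s)"] exI[of _ "\<lambda>s. fst (snd (q s))"] exI[of _ "\<lambda>s. fst (snd (snd (q s)))"] exI[of _ "\<lambda>s. snd (snd (snd (q s)))"]) blast
qed

context smooth_profile
begin

text \<open>For each large s the branch \<kappa> \<mapsto> E_n(a(s) + \<kappa>) is an instance of
  \<open>band_family\<close>; translation identifies its derivatives at 0 with those of the band at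
  a(s).\<close>

lemma band_data:
  assumes n: "1 \<le> n"
  shows "\<forall>\<^sub>F s in at_top. \<exists>u v D DE. bound (\<lambda>y. pot s 0 y - band b n (a_of b s)) u v \<and> deriv (band b n) (a_of b s) = slope (A s) u \<and>
     (sol (\<lambda>y. pot s 0 y - band b n (a_of b s)) (\<lambda>y. (2 * A s y + slope (A s) u) * u y) D DE \<and> (\<exists>B. dec 2 B D)) \<and>
     deriv (deriv (band b n)) (a_of b s) = curvature (A s) u D"
proof -
  obtain K where K: "\<forall>k\<ge>K. band b n k \<in> hspec b k \<and> \<bar>band b n k - (2 * real n - 1) * bp\<bar> \<le> 1 \<and> isCont (band b n) k"
    using band_regular[OF n zero_less_one] by blast
  \<comment> \<open>The \<open>+ 1\<close> leaves room for all |\<kappa>| < 1 inside the range where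
    the band is regular.\<close>
  have "\<forall>\<^sub>F s in at_top. xk b (K + 1) \<le> s" by (rule eventually_ge_at_top)
  thus ?thesis
  proof eventually_elim
    case (elim s)
    have "K + 1 \<le> a_of b s" using a_mono[of "xk b (K + 1)" s] elim by (cases "xk b (K + 1) = s") auto
    hence good: "K \<le> a_of b s + \<kappa>" if "\<bar>\<kappa>\<bar> < 1" for \<kappa> using that by linarith
    define e where "e = (\<lambda>\<kappa>. band b n (a_of b s + \<kappa>))"
    interpret F: band_family b bm bp s "\<bar>(2 * real n - 1) * bp\<bar> + 1" e
    proof
      fix \<kappa> :: real assume "\<bar>\<kappa>\<bar> < 1"
      from K[rule_format, OF good[OF this]] have k: "band b n (a_of b s + \<kappa>) \<in> hspec b (a_of b s + \<kappa>)"
        "\<bar>band b n (a_of b s + \<kappa>) - (2 * real n - 1) * bp\<bar> \<le> 1" "isCont (band b n) (a_of b s + \<kappa>)" by auto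
      show "e \<kappa> \<in> hspec b (a_of b s + \<kappa>)" using k(1) by (simp add: e_def)
      show "\<bar>e \<kappa>\<bar> \<le> \<bar>(2 * real n - 1) * bp\<bar> + 1" using k(2) unfolding e_def by linarith
      show "isCont e \<kappa>" unfolding e_def by (rule isCont_o2[of \<kappa> "\<lambda>\<kappa>. a_of b s + \<kappa>", OF _ k(3)]) simp
    qed
    have e0: "e 0 = band b n (a_of b s)" "deriv e 0 = deriv (band b n) (a_of b s)" "deriv (deriv e) 0 = deriv (deriv (band b n)) (a_of b s)"
      by (simp_all add: e_def deriv_shift)
    show ?case using F.e_derivatives unfolding e0 .
  qed
qed

lemma band_asymptotics_at_center:
  assumes n: "1 \<le> n"
  shows "(\<lambda>s. band b n (a_of b s) - ((2 * real n - 1) * b s + (1 + (2 * real n - 1)\<^sup>2) / 8 * bd 2 s / b s)) \<in> O[at_top](ge)"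
    "(\<lambda>s. deriv (band b n) (a_of b s) - (2 * real n - 1) * bd 1 s / b s) \<in> O[at_top](ge)"
    "(\<lambda>s. deriv (deriv (band b n)) (a_of b s) - (2 * real n - 1) * bd 2 s / (b s)\<^sup>2) \<in> O[at_top](ge)"
proof -
  obtain u v D DE where uv: "\<forall>s. (\<exists>u v D DE. bound (\<lambda>y. pot s 0 y - band b n (a_of b s)) u v \<and> deriv (band b n) (a_of b s) = slope (A s) u \<and>
     (sol (\<lambda>y. pot s 0 y - band b n (a_of b s)) (\<lambda>y. (2 * A s y + slope (A s) u) * u y) D DE \<and> (\<exists>B. dec 2 B D)) \<and>
     deriv (deriv (band b n)) (a_of b s) = curvature (A s) u D) \<longrightarrow>
     bound (\<lambda>y. pot s 0 y - band b n (a_of b s)) (u s) (v s) \<and> deriv (band b n) (a_of b s) = slope (A s) (u s) \<and>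
     (sol (\<lambda>y. pot s 0 y - band b n (a_of b s)) (\<lambda>y. (2 * A s y + slope (A s) (u s)) * u s y) (D s) (DE s) \<and> (\<exists>B. dec 2 B (D s))) \<and>
     deriv (deriv (band b n)) (a_of b s) = curvature (A s) (u s) (D s)"
    using choice4[of "\<lambda>s u v D DE. bound (\<lambda>y. pot s 0 y - band b n (a_of b s)) u v \<and> deriv (band b n) (a_of b s) = slope (A s) u \<and>
     (sol (\<lambda>y. pot s 0 y - band b n (a_of b s)) (\<lambda>y. (2 * A s y + slope (A s) u) * u y) D DE \<and> (\<exists>B. dec 2 B D)) \<and>
     deriv (deriv (band b n)) (a_of b s) = curvature (A s) u D"] by (elim exE) (rule that)
  have ev: "\<forall>\<^sub>F s in at_top. bound (\<lambda>y. pot s 0 y - band b n (a_of b s)) (u s) (v s) \<and> deriv (band b n) (a_of b s) = slope (A s) (u s) \<and>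
     (sol (\<lambda>y. pot s 0 y - band b n (a_of b s)) (\<lambda>y. (2 * A s y + slope (A s) (u s)) * u s y) (D s) (DE s) \<and> (\<exists>B. dec 2 B (D s))) \<and>
     deriv (deriv (band b n)) (a_of b s) = curvature (A s) (u s) (D s)"
    by (rule eventually_mono[OF band_data[OF n] uv[rule_format]])
  interpret B: band_asymptotics b bm bp n u v
    by unfold_locales (rule n, rule eventually_mono[OF ev], erule conjunct1)
  have G: "B.Gd s = slope (A s) (u s)" for s unfolding B.Gd_def slope_def ..
  have E: "B.En s = band b n (a_of b s)" for s unfolding B.En_def ..
  show "(\<lambda>s. band b n (a_of b s) - ((2 * real n - 1) * b s + (1 + (2 * real n - 1)\<^sup>2) / 8 * bd 2 s / b s)) \<in> O[at_top](ge)"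
    using B.energy unfolding E B.\<Lambda>_def .
  have ev1: "\<forall>\<^sub>F s in at_top. deriv (band b n) (a_of b s) = slope (A s) (u s)"
    by (rule eventually_mono[OF ev]) (drule conjunct2, erule conjunct1)
  have ev2: "\<forall>\<^sub>F s in at_top. deriv (deriv (band b n)) (a_of b s) = curvature (A s) (u s) (D s)"
    by (rule eventually_mono[OF ev]) (drule conjunct2, drule conjunct2, erule conjunct2)
  have e1: "\<forall>\<^sub>F s in at_top. deriv (band b n) (a_of b s) - (2 * real n - 1) * bd 1 s / b s = slope (A s) (u s) - (2 * real n - 1) * bd 1 s / b s"
    using ev1 by eventually_elim simp
  show "(\<lambda>s. deriv (band b n) (a_of b s) - (2 * real n - 1) * bd 1 s / b s) \<in> O[at_top](ge)"
    unfolding landau_o.big.in_cong[OF e1] using B.first_derivative unfolding G B.\<Lambda>_def .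
  have e2: "\<forall>\<^sub>F s in at_top. deriv (deriv (band b n)) (a_of b s) - (2 * real n - 1) * bd 2 s / (b s)\<^sup>2
      = curvature (A s) (u s) (D s) - (2 * real n - 1) * bd 2 s / (b s)\<^sup>2"
    using ev2 by eventually_elim simp
  have "\<forall>\<^sub>F s in at_top. sol (\<lambda>y. pot s 0 y - B.En s) (\<lambda>y. (2 * A s y + B.Gd s) * u s y) (D s) (DE s) \<and> (\<exists>B. dec 2 B (D s))"
    unfolding E G by (rule eventually_mono[OF ev]) (drule conjunct2, drule conjunct2, erule conjunct1)
  from B.second_derivative[OF this]
  show "(\<lambda>s. deriv (deriv (band b n)) (a_of b s) - (2 * real n - 1) * bd 2 s / (b s)\<^sup>2) \<in> O[at_top](ge)"
    unfolding landau_o.big.in_cong[OF e2] unfolding G B.\<Lambda>_def curvature_def .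
qed

lemma xk_at_top: "filterlim (xk b) at_top at_top"
  unfolding filterlim_at_top
proof
  fix Z
  have "Z \<le> xk b k" if "a_of b Z \<le> k" for k
    using that a_mono[of "xk b k" Z] by (cases "Z \<le> xk b k") auto
  thus "\<forall>\<^sub>F k in at_top. Z \<le> xk b k" unfolding eventually_at_top_linorder by blast
qed

text \<open>From k = a(x_k) \<le> bp x_k the point x_k lies beyond k/bp; halving the constant puts
  it strictly inside the open half-line of the supremum, so the supremum dominates
  |b'''(x_k)|.\<close>

lemma eps_lower: "(\<lambda>k. ge (xk b k)) \<in> O[at_top](eps b (1 / (2 * bp)) \<tau>)"
proof -
  obtain X where X: "\<And>s. X \<le> s \<Longrightarrow> \<bar>bd 1 s\<bar> \<le> 1" "\<And>s. X \<le> s \<Longrightarrow> \<bar>bd 2 s\<bar> \<le> \<bar>bd 1 s\<bar>"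
    "\<And>s. X \<le> s \<Longrightarrow> \<bar>bd 3 s\<bar> \<le> \<bar>bd 1 s\<bar>" by (rule taylor_bounds, erule that, assumption+)
  define h where "h = (\<lambda>x. \<bar>deriv b x * (deriv ^^ 2) b x\<bar> + \<bar>(deriv ^^ 3) b x\<bar>)"
  have h: "h x = \<bar>bd 1 x * bd 2 x\<bar> + \<bar>bd 3 x\<bar>" for x unfolding h_def bd_1 unfolding bd_def ..
  have hb: "h x \<le> 2" if "X \<le> x" for x
  proof -
    have "\<bar>bd 2 x\<bar> \<le> 1" "\<bar>bd 3 x\<bar> \<le> 1" using X[OF that] by linarith+
    moreover have "\<bar>bd 1 x\<bar> * \<bar>bd 2 x\<bar> \<le> 1 * 1" using X(1)[OF that] \<open>\<bar>bd 2 x\<bar> \<le> 1\<close> by (intro mult_mono) auto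
    ultimately show ?thesis unfolding h abs_mult by linarith
  qed
  have "ge (xk b k) \<le> eps b (1 / (2 * bp)) \<tau> k" if k: "max 1 (2 * bp * X) \<le> k" for k
  proof -
    let ?s = "xk b k"
    have k1: "1 \<le> k" "2 * bp * X \<le> k" using k by auto
    have "?s > 0"
    proof (rule ccontr)
      assume "\<not> 0 < ?s"
      hence "a_of b ?s \<le> a_of b 0" using a_mono[of ?s 0] by (cases "?s = 0") auto
      thus False using k1 by simp
    qed
    hence "k \<le> bp * ?s" using A_upper[of 0 ?s] by (simp add: A_def)
    hence sk: "1 / (2 * bp) * k < ?s" using k1 bp_pos by (simp add: field_simps)
    have Xk: "X \<le> 1 / (2 * bp) * k" using k1 bp_pos by (simp add: field_simps)
    have "h ?s \<le> Sup (h ` {1 / (2 * bp) * k<..})"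
      \<comment> \<open>\<open>Sup\<close> is informative only for sets bounded above; the bound 2
        from \<open>hb\<close> applies because the half-line starts to the right of X for large
        k.\<close>
      by (rule cSup_upper) (use sk Xk hb in \<open>auto intro!: bdd_aboveI[of _ 2]\<close>)
    moreover have "\<bar>bd 3 ?s\<bar> \<le> h ?s" unfolding h by simp
    moreover have "0 \<le> exp (- \<tau> * k\<^sup>2)" by simp
    ultimately show ?thesis unfolding eps_def ge_def bd_1 h_def by linarith
  qed
  hence "\<forall>\<^sub>F k in at_top. ge (xk b k) \<le> eps b (1 / (2 * bp)) \<tau> k" unfolding eventually_at_top_linorder by blast
  hence "\<forall>\<^sub>F k in at_top. norm (ge (xk b k)) \<le> 1 * norm (eps b (1 / (2 * bp)) \<tau> k)"
  proof eventually_elim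
    case (elim k)
    have "0 \<le> ge (xk b k)" by (simp add: ge_def)
    thus ?case using elim by simp
  qed
  thus ?thesis by (rule bigoI)
qed

end

theorem theorem2p1:
  fixes b :: "real \<Rightarrow> real" and bm bp :: real
  assumes smooth: "\<forall>p x. ((deriv ^^ p) b) differentiable (at x)"
    and incr: "mono b"
    and lim_bot: "(b \<longlongrightarrow> bm) at_bot"
    and lim_top: "(b \<longlongrightarrow> bp) at_top"
    and pos: "0 < bm" and gap: "bm < bp"
    and hyp_a: "\<exists>x0. \<forall>p. \<forall>x\<ge>x0. (deriv ^^ p) b x \<noteq> 0"
    and hyp_b1: "deriv b \<in> o[at_top](\<lambda>x. bp - b x)"
    and hyp_b2: "\<forall>p\<ge>1. (deriv ^^ (Suc p)) b \<in> o[at_top]((deriv ^^ p) b)"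
    and hyp_c: "(\<lambda>x. (deriv b x)^2) \<in> o[at_top]((deriv ^^ 2) b)"
  shows "\<forall>n\<ge>1. \<exists>\<sigma>>0. \<exists>\<tau>>0.
      (\<lambda>k. band b n k - (b (xk b k) * (2 * real n - 1)
            + (2 * (real n)^2 - 2 * real n + 1) / 4 * (deriv ^^ 2) b (xk b k) / b (xk b k)))
        \<in> O[at_top](eps b \<sigma> \<tau>) \<and>
      (\<lambda>k. deriv (band b n) k - (2 * real n - 1) * deriv b (xk b k) / b (xk b k))
        \<in> O[at_top](eps b \<sigma> \<tau>) \<and>
      (\<lambda>k. deriv (deriv (band b n)) k - (2 * real n - 1) * (deriv ^^ 2) b (xk b k) / (b (xk b k))^2)
        \<in> O[at_top](eps b \<sigma> \<tau>)"
proof -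
  have d: "b differentiable (at x)" for x using smooth[rule_format, of 0 x] by simp
  interpret smooth_profile b bm bp
  proof
    show "continuous_on UNIV b"
      using d by (auto simp: continuous_on_eq_continuous_at intro: differentiable_imp_continuous_within)
    show "bm \<le> b x" for x
      by (rule tendsto_upperbound[OF lim_bot eventually_mono[OF eventually_le_at_bot[of x]]]) (auto intro: monoD[OF incr])
    show "b x \<le> bp" for x
      by (rule tendsto_lowerbound[OF lim_top eventually_mono[OF eventually_ge_at_top[of x]]]) (auto intro: monoD[OF incr])
  qed (use assms in auto)
  show ?thesis
  proof (intro allI impI)
    fix n :: nat assume n: "1 \<le> n"
    have sig: "0 < 1 / (2 * bp)" using bp_pos by simp
    \<comment> \<open>Since x_k tends to infinity with k, an estimate in s composes to one in k, and
      its gauge is then dominated by \<open>eps\<close>.\<close>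
    have tr: "(\<lambda>k. f (xk b k)) \<in> O[at_top](eps b (1 / (2 * bp)) 1)" if "f \<in> O[at_top](ge)" for f
      by (rule landau_o.big_trans[OF landau_o.big.compose[OF that xk_at_top] eps_lower])
    \<comment> \<open>With \<Lambda> = 2n - 1 the oscillator constant (1 + \<Lambda>^2)/8 is exactly
      \<gamma>_n.\<close>
    have g: "(1 + (2 * real n - 1)\<^sup>2) / 8 = (2 * (real n)\<^sup>2 - 2 * real n + 1) / 4"
      by (simp add: power2_eq_square field_simps)
    have c: "b x * (2 * real n - 1) = (2 * real n - 1) * b x" for x by (rule mult.commute)
    note t = band_asymptotics_at_center[OF n, THEN tr, unfolded a_xk bd_1]
    show "\<exists>\<sigma>>0. \<exists>\<tau>>0.
      (\<lambda>k. band b n k - (b (xk b k) * (2 * real n - 1)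
            + (2 * (real n)^2 - 2 * real n + 1) / 4 * (deriv ^^ 2) b (xk b k) / b (xk b k)))
        \<in> O[at_top](eps b \<sigma> \<tau>) \<and>
      (\<lambda>k. deriv (band b n) k - (2 * real n - 1) * deriv b (xk b k) / b (xk b k))
        \<in> O[at_top](eps b \<sigma> \<tau>) \<and>
      (\<lambda>k. deriv (deriv (band b n)) k - (2 * real n - 1) * (deriv ^^ 2) b (xk b k) / (b (xk b k))^2)
        \<in> O[at_top](eps b \<sigma> \<tau>)"
    proof (rule exI[of _ "1 / (2 * bp)"], rule conjI[OF sig], rule exI[of _ 1], intro conjI)
      show "(\<lambda>k. band b n k - (b (xk b k) * (2 * real n - 1)
            + (2 * (real n)^2 - 2 * real n + 1) / 4 * (deriv ^^ 2) b (xk b k) / b (xk b k))) \<in> O[at_top](eps b (1 / (2 * bp)) 1)"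
        using t(1) unfolding g bd_def c .
      show "(\<lambda>k. deriv (band b n) k - (2 * real n - 1) * deriv b (xk b k) / b (xk b k)) \<in> O[at_top](eps b (1 / (2 * bp)) 1)"
        using t(2) .
      show "(\<lambda>k. deriv (deriv (band b n)) k - (2 * real n - 1) * (deriv ^^ 2) b (xk b k) / (b (xk b k))^2) \<in> O[at_top](eps b (1 / (2 * bp)) 1)"
        using t(3) unfolding bd_def .
    qed simp
  qed
qed

end
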